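(* Let $\phi$ be a Drinfeld $A[\underline{t}_s]$-module over $\mathbb{T}_s$ with $\phi_\theta=\theta + A_1\tau + \dots + A_r\tau^r$ such that (i) $A_r\in \mathbb{T}_s^{\times}$, and (ii) $\Lambda_{\phi}$ is a free and finitely generated $A[\underline{t}_s]$-module of rank $r$. Then the de Rham map \[ \mathrm{DR} \colon H_{\mathrm{DR}}^*(\phi) \to \operatorname{Hom}_{A[\underline{t}_s]}(\Lambda_{\phi},\mathbb{T}_s),\qquad \mathrm{DR}([\eta])=F_{\eta}|_{\Lambda_{\phi}}, \] is an isomorphism of left $\mathbb{T}_s$-modules.
   Context: Let $\mathbb{F}_q$ be a finite field with $q$ elements, and $\theta, t_1,\dots,t_s$ ($s\ge 1$) independent variables; $A=\mathbb{F}_q[\theta]$, $A[\underline{t}_s]=\mathbb{F}_q[\theta,t_1,\dots,t_s]$, $\mathbb{F}_q[\underline{t}_s]=\mathbb{F}_q[t_1,\dots,t_s]$. Let $\mathbb{C}_\infty$ be the completion of an algebraic closure of $\mathbb{F}_q((1/\theta))$ with absolute value $|\cdot|_\infty$, $|\theta|_\infty=q$. $\mathbb{T}_s$ is the Tate algebra of power series $\sum_\nu a_\nu t_1^{\nu_1}\cdots t_s^{\nu_s}$ with $a_\nu\in\mathbb{C}_\infty$, $|a_\nu|_\infty\to 0$ as $\nu_1+\dots+\nu_s\to\infty$, with Gauss norm $\|f\|_\infty=\sup_\nu|a_\nu|_\infty$. The automorphism $\tau$ of $\mathbb{T}_s$ raises each coefficient $a_\nu$ to its $q$-th power; $f^{(n)}=\tau^n(f)$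 for $n\in\mathbb{Z}$. $\mathbb{T}_s[\tau]$ (resp. $\mathbb{T}_s[[\tau]]$) is the twisted polynomial (power series) ring with $\tau f=f^{(1)}\tau$; $\sum a_i\tau^i$ acts on $f\in\mathbb{T}_s$ by $\sum a_i f^{(i)}$ whenever this converges. A Drinfeld $A[\underline{t}_s]$-module of rank $r$ is an $\mathbb{F}_q[\underline{t}_s]$-algebra homomorphism $\phi: A[\underline{t}_s]\to\mathbb{T}_s[\tau]$, $a\mapsto\phi_a$, with $\phi_\theta=\theta+A_1\tau+\dots+A_r\tau^r$, $A_i\in\mathbb{T}_s$, $A_r\neq0$. Its exponential is the unique $\exp_\phi=\sum_{i\ge0}\alpha_i\tau^i\in\mathbb{T}_s[[\tau]]$ with $\alpha_0=1$ and $\exp_\phi a=\phi_a\exp_\phi$ for all $a\in A[\underline{t}_s]$; the series $\sum\alpha_i f^{(i)}$ converges for all $f\in\mathbb{T}_s$, giving an $\mathbb{F}_q[\underline{t}_s]$-linear map $\exp_\phi:\mathbb{T}_s\to\mathbb{T}_s$, and $\Lambda_\phi=\ker\exp_\phi$ is an $A[\underline{t}_s]$-submodule of $\mathbb{T}_s$. A biderivation is an $\mathbb{F}_q[\underline{t}_s]$-linear map $\eta:A[\underline{t}_s]\to\tau\mathbb{T}_s[\tau]$ with $\eta_{ab}=a\eta_b+\eta_a\phi_b$ for all $a,b$; the set $\mathrm{Der}(\phi)$ of biderivations is a left $\mathbb{T}_s$-module via $(f\eta)_a=f\eta_a$. For $m\in\tau\mathbb{T}_s[\tau]$, the strictly inner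 biderivation $\eta^{\{m\}}$ is $\eta^{\{m\}}_a=m\phi_a-am$; these form a submodule $\mathrm{Der}_{si}(\phi)$, and $H^*_{\mathrm{DR}}(\phi)=\mathrm{Der}(\phi)/\mathrm{Der}_{si}(\phi)$. For $\eta\in\mathrm{Der}(\phi)$, the quasi-periodic operator $F_\eta$ is the unique element of $\tau\mathbb{T}_s[[\tau]]$ with $F_\eta\theta-\theta F_\eta=\eta_\theta\exp_\phi$; it converges on every element of $\mathbb{T}_s$, its restriction to $\Lambda_\phi$ is $A[\underline{t}_s]$-linear, and $\mathrm{DR}$ is a well-defined $\mathbb{T}_s$-linear map, where $\operatorname{Hom}_{A[\underline{t}_s]}(\Lambda_\phi,\mathbb{T}_s)$ is a left $\mathbb{T}_s$-module by $(f\Omega)(\lambda)=f\Omega(\lambda)$. *)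

theory Defs
  imports Complex_Main "HOL-Computational_Algebra.Polynomial" "HOL-Computational_Algebra.Primes"
begin

text \<open>Elements of the Tate algebra T_s are coefficient functions on multi-indices
  nu :: nat => nat (variable t_(i+1) corresponds to index i, valid indices have
  nu i = 0 for i >= s). Twisted power series are functions nat => Tate element
  (coefficient of tau^n).\<close>

type_synonym 'a tel = "(nat \<Rightarrow> nat) \<Rightarrow> 'a"
type_synonym 'a tser = "nat \<Rightarrow> 'a tel"

definition Fq :: "nat \<Rightarrow> 'a::field set" where
  "Fq q = {x. x ^ q = x}"

definition Atheta :: "nat \<Rightarrow> 'a::field \<Rightarrow> 'a set" where
  "Atheta q \<theta> = {poly P \<theta> | P. \<forall>i. coeff P i \<in> Fq q}"

text \<open>Closure of F_q(theta), i.e. F_q((1/theta)).\<close>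
definition Kinf :: "nat \<Rightarrow> 'a::field \<Rightarrow> ('a \<Rightarrow> real) \<Rightarrow> 'a set" where
  "Kinf q \<theta> av = {x. \<forall>\<epsilon>>0. \<exists>a\<in>Atheta q \<theta>. \<exists>b\<in>Atheta q \<theta>. b \<noteq> 0 \<and> av (x - a / b) < \<epsilon>}"

definition alg_over :: "'a::field set \<Rightarrow> 'a \<Rightarrow> bool" where
  "alg_over K y \<longleftrightarrow> (\<exists>P. P \<noteq> 0 \<and> (\<forall>i. coeff P i \<in> K) \<and> poly P y = 0)"

definition Cinf_field :: "nat \<Rightarrow> 'a::field \<Rightarrow> ('a \<Rightarrow> real) \<Rightarrow> bool" where
  "Cinf_field q \<theta> av \<longleftrightarrow>
    (\<exists>p e. prime (p::nat) \<and> e \<ge> 1 \<and> q = p ^ e \<and> of_nat p = (0::'a)) \<and>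
    (\<forall>x. 0 \<le> av x) \<and> (\<forall>x. av x = 0 \<longleftrightarrow> x = 0) \<and>
    (\<forall>x y. av (x * y) = av x * av y) \<and>
    (\<forall>x y. av (x + y) \<le> max (av x) (av y)) \<and>
    av \<theta> = real q \<and>
    (\<forall>X::nat \<Rightarrow> 'a. (\<forall>\<epsilon>>0. \<exists>N. \<forall>m\<ge>N. \<forall>n\<ge>N. av (X m - X n) < \<epsilon>)
        \<longrightarrow> (\<exists>L. (\<lambda>n. av (X n - L)) \<longlonglongrightarrow> 0)) \<and>
    (\<forall>P::'a poly. degree P \<ge> 1 \<longrightarrow> (\<exists>x. poly P x = 0)) \<and>
    (\<forall>x \<epsilon>. \<epsilon> > 0 \<longrightarrow> (\<exists>y. alg_over (Kinf q \<theta> av) y \<and> av (x - y) < \<epsilon>))"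

definition valid_idx :: "nat \<Rightarrow> (nat \<Rightarrow> nat) \<Rightarrow> bool" where
  "valid_idx s \<nu> \<longleftrightarrow> (\<forall>i\<ge>s. \<nu> i = 0)"

definition tate :: "nat \<Rightarrow> ('a::field \<Rightarrow> real) \<Rightarrow> 'a tel set" where
  "tate s av = {f. (\<forall>\<nu>. \<not> valid_idx s \<nu> \<longrightarrow> f \<nu> = 0) \<and>
                   (\<forall>\<epsilon>>0. finite {\<nu>. \<epsilon> \<le> av (f \<nu>)})}"

definition tzero :: "'a::field tel" where "tzero = (\<lambda>\<nu>. 0)"
definition tconst :: "'a::field \<Rightarrow> 'a tel" where
  "tconst c = (\<lambda>\<nu>. if \<nu> = (\<lambda>i. 0) then c else 0)"
definition tone :: "'a::field tel" where "tone = tconst 1"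
definition tadd :: "'a::field tel \<Rightarrow> 'a tel \<Rightarrow> 'a tel" where
  "tadd f g = (\<lambda>\<nu>. f \<nu> + g \<nu>)"
definition tsub :: "'a::field tel \<Rightarrow> 'a tel \<Rightarrow> 'a tel" where
  "tsub f g = (\<lambda>\<nu>. f \<nu> - g \<nu>)"
definition tmul :: "'a::field tel \<Rightarrow> 'a tel \<Rightarrow> 'a tel" where
  "tmul f g = (\<lambda>\<nu>. \<Sum>\<mu>\<in>{\<mu>. \<forall>i. \<mu> i \<le> \<nu> i}. f \<mu> * g (\<lambda>i. \<nu> i - \<mu> i))"

definition gauss :: "('a::field \<Rightarrow> real) \<Rightarrow> 'a tel \<Rightarrow> real" where
  "gauss av f = (SUP \<nu>. av (f \<nu>))"

definition frob :: "nat \<Rightarrow> 'a::field tel \<Rightarrow> 'a tel" where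
  "frob q f = (\<lambda>\<nu>. f \<nu> ^ q)"

definition Fqt :: "nat \<Rightarrow> nat \<Rightarrow> 'a::field tel set" where
  "Fqt q s = {f. (\<forall>\<nu>. \<not> valid_idx s \<nu> \<longrightarrow> f \<nu> = 0) \<and> finite {\<nu>. f \<nu> \<noteq> 0} \<and>
                 (\<forall>\<nu>. f \<nu> \<in> Fq q)}"

definition Aset :: "nat \<Rightarrow> nat \<Rightarrow> 'a::field \<Rightarrow> 'a tel set" where
  "Aset q s \<theta> = {f. (\<forall>\<nu>. \<not> valid_idx s \<nu> \<longrightarrow> f \<nu> = 0) \<and> finite {\<nu>. f \<nu> \<noteq> 0} \<and>
                 (\<forall>\<nu>. f \<nu> \<in> Atheta q \<theta>)}"

definition is_tser :: "nat \<Rightarrow> ('a::field \<Rightarrow> real) \<Rightarrow> 'a tser \<Rightarrow> bool" where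
  "is_tser s av a \<longleftrightarrow> (\<forall>n. a n \<in> tate s av)"

definition is_tpoly :: "nat \<Rightarrow> ('a::field \<Rightarrow> real) \<Rightarrow> 'a tser \<Rightarrow> bool" where
  "is_tpoly s av a \<longleftrightarrow> is_tser s av a \<and> finite {n. a n \<noteq> tzero}"

definition is_tau_tpoly :: "nat \<Rightarrow> ('a::field \<Rightarrow> real) \<Rightarrow> 'a tser \<Rightarrow> bool" where
  "is_tau_tpoly s av a \<longleftrightarrow> is_tpoly s av a \<and> a 0 = tzero"

definition szero :: "'a::field tser" where "szero = (\<lambda>n. tzero)"
definition sconst :: "'a::field tel \<Rightarrow> 'a tser" where
  "sconst c = (\<lambda>n. if n = 0 then c else tzero)"
definition sadd :: "'a::field tser \<Rightarrow> 'a tser \<Rightarrow> 'a tser" where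
  "sadd a b = (\<lambda>n. tadd (a n) (b n))"
definition ssub :: "'a::field tser \<Rightarrow> 'a tser \<Rightarrow> 'a tser" where
  "ssub a b = (\<lambda>n. tsub (a n) (b n))"

text \<open>product with tau f = f^(1) tau\<close>
definition smul :: "nat \<Rightarrow> 'a::field tser \<Rightarrow> 'a tser \<Rightarrow> 'a tser" where
  "smul q a b = (\<lambda>k. (\<lambda>\<nu>. \<Sum>i\<le>k. tmul (a i) ((frob q ^^ i) (b (k - i))) \<nu>))"

definition tconv :: "nat \<Rightarrow> ('a::field \<Rightarrow> real) \<Rightarrow> (nat \<Rightarrow> 'a tel) \<Rightarrow> 'a tel \<Rightarrow> bool" where
  "tconv s av S L \<longleftrightarrow> L \<in> tate s av \<and> (\<lambda>N. gauss av (tsub (S N) L)) \<longlonglongrightarrow> 0"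

definition sapp :: "nat \<Rightarrow> nat \<Rightarrow> ('a::field \<Rightarrow> real) \<Rightarrow> 'a tser \<Rightarrow> 'a tel \<Rightarrow> 'a tel" where
  "sapp q s av a f = (THE L. tconv s av (\<lambda>N. (\<lambda>\<nu>. \<Sum>n<N. tmul (a n) ((frob q ^^ n) f) \<nu>)) L)"

definition drinfeld ::
  "nat \<Rightarrow> nat \<Rightarrow> ('a::field \<Rightarrow> real) \<Rightarrow> 'a \<Rightarrow> ('a tel \<Rightarrow> 'a tser) \<Rightarrow> nat \<Rightarrow> bool" where
  "drinfeld q s av \<theta> \<phi> r \<longleftrightarrow>
    r \<ge> 1 \<and>
    (\<forall>a\<in>Aset q s \<theta>. is_tpoly s av (\<phi> a)) \<and>
    (\<forall>a\<in>Aset q s \<theta>. \<forall>b\<in>Aset q s \<theta>.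
        \<phi> (tadd a b) = sadd (\<phi> a) (\<phi> b) \<and> \<phi> (tmul a b) = smul q (\<phi> a) (\<phi> b)) \<and>
    (\<forall>c\<in>Fqt q s. \<phi> c = sconst c) \<and>
    \<phi> (tconst \<theta>) 0 = tconst \<theta> \<and>
    \<phi> (tconst \<theta>) r \<noteq> tzero \<and>
    (\<forall>n>r. \<phi> (tconst \<theta>) n = tzero)"

definition expo :: "nat \<Rightarrow> nat \<Rightarrow> ('a::field \<Rightarrow> real) \<Rightarrow> 'a \<Rightarrow> ('a tel \<Rightarrow> 'a tser) \<Rightarrow> 'a tser" where
  "expo q s av \<theta> \<phi> = (THE e. e 0 = tone \<and> is_tser s av e \<and>
      (\<forall>a\<in>Aset q s \<theta>. smul q e (sconst a) = smul q (\<phi> a) e))"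

definition Lam :: "nat \<Rightarrow> nat \<Rightarrow> ('a::field \<Rightarrow> real) \<Rightarrow> 'a \<Rightarrow> ('a tel \<Rightarrow> 'a tser) \<Rightarrow> 'a tel set" where
  "Lam q s av \<theta> \<phi> = {x \<in> tate s av. sapp q s av (expo q s av \<theta> \<phi>) x = tzero}"

definition Der :: "nat \<Rightarrow> nat \<Rightarrow> ('a::field \<Rightarrow> real) \<Rightarrow> 'a \<Rightarrow> ('a tel \<Rightarrow> 'a tser)
    \<Rightarrow> ('a tel \<Rightarrow> 'a tser) set" where
  "Der q s av \<theta> \<phi> = {\<eta>.
     (\<forall>a. a \<notin> Aset q s \<theta> \<longrightarrow> \<eta> a = szero) \<and>
     (\<forall>a\<in>Aset q s \<theta>. is_tau_tpoly s av (\<eta> a)) \<and>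
     (\<forall>a\<in>Aset q s \<theta>. \<forall>b\<in>Aset q s \<theta>. \<eta> (tadd a b) = sadd (\<eta> a) (\<eta> b)) \<and>
     (\<forall>c\<in>Fqt q s. \<forall>a\<in>Aset q s \<theta>. \<eta> (tmul c a) = smul q (sconst c) (\<eta> a)) \<and>
     (\<forall>a\<in>Aset q s \<theta>. \<forall>b\<in>Aset q s \<theta>.
        \<eta> (tmul a b) = sadd (smul q (sconst a) (\<eta> b)) (smul q (\<eta> a) (\<phi> b)))}"

definition badd :: "('a::field tel \<Rightarrow> 'a tser) \<Rightarrow> ('a tel \<Rightarrow> 'a tser) \<Rightarrow> ('a tel \<Rightarrow> 'a tser)" where
  "badd \<eta> \<eta>' = (\<lambda>a. sadd (\<eta> a) (\<eta>' a))"
definition bsub :: "('a::field tel \<Rightarrow> 'a tser) \<Rightarrow> ('a tel \<Rightarrow> 'a tser) \<Rightarrow> ('a tel \<Rightarrow> 'a tser)" where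
  "bsub \<eta> \<eta>' = (\<lambda>a. ssub (\<eta> a) (\<eta>' a))"
definition bsmul :: "'a::field tel \<Rightarrow> ('a tel \<Rightarrow> 'a tser) \<Rightarrow> ('a tel \<Rightarrow> 'a tser)" where
  "bsmul f \<eta> = (\<lambda>a. (\<lambda>k. tmul f (\<eta> a k)))"

definition Dsi :: "nat \<Rightarrow> nat \<Rightarrow> ('a::field \<Rightarrow> real) \<Rightarrow> 'a \<Rightarrow> ('a tel \<Rightarrow> 'a tser)
    \<Rightarrow> ('a tel \<Rightarrow> 'a tser) set" where
  "Dsi q s av \<theta> \<phi> = {\<eta>. \<exists>m. is_tau_tpoly s av m \<and>
     \<eta> = (\<lambda>a. if a \<in> Aset q s \<theta> then ssub (smul q m (\<phi> a)) (smul q (sconst a) m) else szero)}"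

definition DRrel :: "nat \<Rightarrow> nat \<Rightarrow> ('a::field \<Rightarrow> real) \<Rightarrow> 'a \<Rightarrow> ('a tel \<Rightarrow> 'a tser)
    \<Rightarrow> (('a tel \<Rightarrow> 'a tser) \<times> ('a tel \<Rightarrow> 'a tser)) set" where
  "DRrel q s av \<theta> \<phi> = {(\<eta>, \<eta>'). \<eta> \<in> Der q s av \<theta> \<phi> \<and> \<eta>' \<in> Der q s av \<theta> \<phi> \<and>
                        bsub \<eta> \<eta>' \<in> Dsi q s av \<theta> \<phi>}"

definition HDR :: "nat \<Rightarrow> nat \<Rightarrow> ('a::field \<Rightarrow> real) \<Rightarrow> 'a \<Rightarrow> ('a tel \<Rightarrow> 'a tser)
    \<Rightarrow> ('a tel \<Rightarrow> 'a tser) set set" where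
  "HDR q s av \<theta> \<phi> = Der q s av \<theta> \<phi> // DRrel q s av \<theta> \<phi>"

definition qper :: "nat \<Rightarrow> nat \<Rightarrow> ('a::field \<Rightarrow> real) \<Rightarrow> 'a \<Rightarrow> ('a tel \<Rightarrow> 'a tser)
    \<Rightarrow> ('a tel \<Rightarrow> 'a tser) \<Rightarrow> 'a tser" where
  "qper q s av \<theta> \<phi> \<eta> = (THE F. F 0 = tzero \<and> is_tser s av F \<and>
     ssub (smul q F (sconst (tconst \<theta>))) (smul q (sconst (tconst \<theta>)) F)
       = smul q (\<eta> (tconst \<theta>)) (expo q s av \<theta> \<phi>))"

definition HomL :: "nat \<Rightarrow> nat \<Rightarrow> ('a::field \<Rightarrow> real) \<Rightarrow> 'a \<Rightarrow> ('a tel \<Rightarrow> 'a tser)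
    \<Rightarrow> ('a tel \<Rightarrow> 'a tel) set" where
  "HomL q s av \<theta> \<phi> = {\<Omega>.
     (\<forall>x. x \<notin> Lam q s av \<theta> \<phi> \<longrightarrow> \<Omega> x = tzero) \<and>
     (\<forall>x\<in>Lam q s av \<theta> \<phi>. \<Omega> x \<in> tate s av) \<and>
     (\<forall>x\<in>Lam q s av \<theta> \<phi>. \<forall>y\<in>Lam q s av \<theta> \<phi>. \<Omega> (tadd x y) = tadd (\<Omega> x) (\<Omega> y)) \<and>
     (\<forall>a\<in>Aset q s \<theta>. \<forall>x\<in>Lam q s av \<theta> \<phi>. \<Omega> (tmul a x) = tmul a (\<Omega> x))}"

definition homadd :: "('a::field tel \<Rightarrow> 'a tel) \<Rightarrow> ('a tel \<Rightarrow> 'a tel) \<Rightarrow> ('a tel \<Rightarrow> 'a tel)" where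
  "homadd \<Omega> \<Omega>' = (\<lambda>x. tadd (\<Omega> x) (\<Omega>' x))"
definition homsmul :: "'a::field tel \<Rightarrow> ('a tel \<Rightarrow> 'a tel) \<Rightarrow> ('a tel \<Rightarrow> 'a tel)" where
  "homsmul f \<Omega> = (\<lambda>x. tmul f (\<Omega> x))"

definition DR :: "nat \<Rightarrow> nat \<Rightarrow> ('a::field \<Rightarrow> real) \<Rightarrow> 'a \<Rightarrow> ('a tel \<Rightarrow> 'a tser)
    \<Rightarrow> ('a tel \<Rightarrow> 'a tser) \<Rightarrow> ('a tel \<Rightarrow> 'a tel)" where
  "DR q s av \<theta> \<phi> \<eta> = (\<lambda>x. if x \<in> Lam q s av \<theta> \<phi> then sapp q s av (qper q s av \<theta> \<phi> \<eta>) x else tzero)"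

definition DRbar :: "nat \<Rightarrow> nat \<Rightarrow> ('a::field \<Rightarrow> real) \<Rightarrow> 'a \<Rightarrow> ('a tel \<Rightarrow> 'a tser)
    \<Rightarrow> ('a tel \<Rightarrow> 'a tser) set \<Rightarrow> ('a tel \<Rightarrow> 'a tel)" where
  "DRbar q s av \<theta> \<phi> X = DR q s av \<theta> \<phi> (SOME \<eta>. \<eta> \<in> X)"

end

theory Submission
  imports Defs "Jordan_Normal_Form.Determinant" "HOL-Computational_Algebra.Formal_Power_Series"
    "HOL-Library.Function_Algebras" "HOL-Library.Poly_Mapping"
begin

text \<open>Every biderivation is determined by its value at theta, which can be prescribed arbitrarily, and
  since the leading coefficient is a unit, every class contains a biderivation whose value at theta is a
  combination of the first r powers of tau. So the claim is that the matrix of the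
  values of the corresponding quasi-periodic functions on a basis of the period lattice is invertible.
  Adjoin a variable t. The Anderson generating functions of the periods are exactly the solutions of a
  tau-difference equation of order r over the larger Tate algebra, and the period matrix is the first Frobenius
  twist of their Moore matrix, evaluated at t = theta. The Moore determinant is a unit times a Frobenius-fixed
  element; because the generating functions of a basis generate the whole solution module, Frobenius descent
  (a closed Frobenius-stable subspace of a finite free module is controlled by its fixed vectors) shows that
  this element divides the adjugate, so the Moore matrix is invertible. Its inverse satisfies a difference
  equation too, hence can also be evaluated at t = theta after a Frobenius twist, and the period matrix is invertible.\<close>

text \<open>With s >= 1 the fixed ring of Frobenius is a polynomial ring in several variables, not a
  principal ideal domain, so elementary divisors cannot compare the solutions with the ambient
  module, and entries cannot be divided inside a Tate algebra. Descent over the ground field avoids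
  both: a vector over a Tate algebra is a null family of scalars, which can be scaled by a scalar
  and iterated. The m-th coefficient of a generating function has the size of theta^(-m), too large
  for convergence at t = theta; a twist by tau^j with j >= 1 makes it of order theta^(-m q^j). This
  is why tau, ..., tau^r appear and not 1, ..., tau^(r-1), in agreement with biderivations having
  values without constant term. The inverse matrix is obtained with coefficients tending to 0 at no
  known rate; in its own equation every unknown on the right stands under tau, and this turns plain
  convergence into fast decay. The unit A_r enters in the reduction to low powers of tau, in solving
  the difference equation for its top term, and in the bounds for the inverse.\<close>

abbreviation lookup :: "(nat \<Rightarrow>\<^sub>0 nat) \<Rightarrow> nat \<Rightarrow> nat" where
  "lookup \<equiv> Poly_Mapping.lookup"

abbreviation keys :: "(nat \<Rightarrow>\<^sub>0 nat) \<Rightarrow> nat set" where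
  "keys \<equiv> Poly_Mapping.keys"

section \<open>Power series in countably many variables\<close>

type_synonym midx = "nat \<Rightarrow>\<^sub>0 nat"

text \<open>Indices have finite support so that convolution is a finite sum and gives a ring; over
  arbitrary functions \<open>nat \<Rightarrow> nat\<close> the sum in \<open>tmul\<close> may range
  over an infinite set, where it is 0. The number of variables is not fixed, so that one more can be
  adjoined without a change of type.\<close>

typedef 'a mps = "UNIV :: (midx \<Rightarrow> 'a) set" morphisms cf Mps ..

lemma cf_Mps [simp]: "cf (Mps f) = f"
  by (simp add: Mps_inverse)

lemma Mps_cf [simp]: "Mps (cf f) = f"
  by (simp add: cf_inverse)

lemma mps_eqI: "(\<And>\<nu>. cf f \<nu> = cf g \<nu>) \<Longrightarrow> f = g"
  by (rule cf_inject[THEN iffD1], rule ext)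

lemma mps_eq_iff: "f = g \<longleftrightarrow> (\<forall>\<nu>. cf f \<nu> = cf g \<nu>)"
  by (auto intro: mps_eqI)

definition splits :: "midx \<Rightarrow> (midx \<times> midx) set" where
  "splits \<nu> = {(a, b). a + b = \<nu>}"

lemma finite_midx_le: "finite {\<mu>::midx. \<forall>i. lookup \<mu> i \<le> lookup (\<nu>::midx) i}"
proof -
  define M where "M = Max (insert 0 (lookup \<nu> ` keys \<nu>))"
  let ?S = "{f::nat\<Rightarrow>nat. \<forall>x. (x \<in> keys \<nu> \<longrightarrow> f x \<in> {..M}) \<and> (x \<notin> keys \<nu> \<longrightarrow> f x = 0)}"
  have fin: "finite ?S"
    by (rule finite_set_of_finite_funs) auto
  have "lookup ` {\<mu>::midx. \<forall>i. lookup \<mu> i \<le> lookup \<nu> i} \<subseteq> ?S"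
  proof clarify
    fix \<mu> :: midx and x
    assume le: "\<forall>i. lookup \<mu> i \<le> lookup \<nu> i"
    have "lookup \<mu> x \<le> M" if "x \<in> keys \<nu>"
    proof -
      have "lookup \<nu> x \<le> M" unfolding M_def using that by (intro Max_ge) auto
      then show ?thesis using le order_trans by blast
    qed
    moreover have "lookup \<mu> x = 0" if "x \<notin> keys \<nu>"
      using le[rule_format, of x] that by (simp add: in_keys_iff)
    ultimately show "(x \<in> keys \<nu> \<longrightarrow> lookup \<mu> x \<in> {..M}) \<and> (x \<notin> keys \<nu> \<longrightarrow> lookup \<mu> x = 0)"
      by blast
  qed
  then have "finite (lookup ` {\<mu>::midx. \<forall>i. lookup \<mu> i \<le> lookup \<nu> i})"
    using fin finite_subset by blast
  moreover have "inj_on lookup A" for A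
    by (rule inj_onI) (simp add: poly_mapping_eqI)
  ultimately show ?thesis
    by (rule finite_imageD)
qed

lemma splits_iff [simp]: "(a, b) \<in> splits \<nu> \<longleftrightarrow> a + b = \<nu>"
  by (simp add: splits_def)

lemma finite_splits [simp]: "finite (splits \<nu>)"
proof -
  have "splits \<nu> \<subseteq> {\<mu>. \<forall>i. lookup \<mu> i \<le> lookup \<nu> i} \<times> {\<mu>. \<forall>i. lookup \<mu> i \<le> lookup \<nu> i}"
    by (auto simp: splits_def lookup_add)
  then show ?thesis
    by (rule finite_subset) (intro finite_cartesian_product finite_midx_le)
qed

lemma midx_add_eq_0_iff: "a + b = 0 \<longleftrightarrow> a = 0 \<and> b = (0 :: midx)"
proof
  assume "a + b = 0"
  then have "lookup a i + lookup b i = 0" for i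
    by (metis lookup_add lookup_zero)
  then show "a = 0 \<and> b = 0"
    by (auto intro!: poly_mapping_eqI)
qed simp

instantiation mps :: (comm_ring_1) comm_ring_1
begin

definition zero_mps_def: "0 = Mps (\<lambda>\<nu>. 0)"
definition one_mps_def: "1 = Mps (\<lambda>\<nu>. if \<nu> = 0 then 1 else 0)"
definition plus_mps_def: "f + g = Mps (\<lambda>\<nu>. cf f \<nu> + cf g \<nu>)"
definition minus_mps_def: "f - g = Mps (\<lambda>\<nu>. cf f \<nu> - cf g \<nu>)"
definition uminus_mps_def: "- f = Mps (\<lambda>\<nu>. - cf f \<nu>)"
definition times_mps_def: "f * g = Mps (\<lambda>\<nu>. \<Sum>(a, b)\<in>splits \<nu>. cf f a * cf g b)"

instance
proof
  fix f g h :: "'a mps"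
  have comm: "x * y = y * x" for x y :: "'a mps"
  proof (rule mps_eqI)
    fix \<nu>
    show "cf (x * y) \<nu> = cf (y * x) \<nu>"
      unfolding times_mps_def cf_Mps
      by (rule sum.reindex_bij_witness[of _ prod.swap prod.swap])
        (auto simp: add.commute mult.commute)
  qed
  show "f * g = g * f" by (rule comm)
  show "f * g * h = f * (g * h)"
  proof (rule mps_eqI)
    fix \<nu>
    have "cf (f * g * h) \<nu> = (\<Sum>x\<in>splits \<nu>. \<Sum>y\<in>splits (fst x). cf f (fst y) * cf g (snd y) * cf h (snd x))"
      by (simp add: times_mps_def case_prod_unfold sum_distrib_right)
    also have "\<dots> = (\<Sum>z\<in>(SIGMA x:splits \<nu>. splits (fst x)). cf f (fst (snd z)) * cf g (snd (snd z)) * cf h (snd (fst z)))"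
      by (subst sum.Sigma) (auto simp: case_prod_unfold)
    also have "\<dots> = (\<Sum>z\<in>(SIGMA x:splits \<nu>. splits (snd x)). cf f (fst (fst z)) * (cf g (fst (snd z)) * cf h (snd (snd z))))"
      by (rule sum.reindex_bij_witness[of _
          "\<lambda>z. ((fst (fst z) + fst (snd z), snd (snd z)), (fst (fst z), fst (snd z)))"
          "\<lambda>z. ((fst (snd z), snd (snd z) + snd (fst z)), (snd (snd z), snd (fst z)))"])
        (auto simp: add.assoc mult.assoc)
    also have "\<dots> = (\<Sum>x\<in>splits \<nu>. \<Sum>y\<in>splits (snd x). cf f (fst x) * (cf g (fst y) * cf h (snd y)))"
      by (subst sum.Sigma) (auto simp: case_prod_unfold)
    also have "\<dots> = cf (f * (g * h)) \<nu>"
      by (simp add: times_mps_def case_prod_unfold sum_distrib_left)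
    finally show "cf (f * g * h) \<nu> = cf (f * (g * h)) \<nu>" .
  qed
  show "1 * f = f"
  proof (rule mps_eqI)
    fix \<nu>
    have "cf (1 * f) \<nu> = (\<Sum>x\<in>splits \<nu>. if x = (0, \<nu>) then cf f \<nu> else 0)"
      unfolding times_mps_def one_mps_def cf_Mps
      by (intro sum.cong) (auto simp: splits_def split: if_splits)
    also have "\<dots> = cf f \<nu>"
    proof -
      have "(0, \<nu>) \<in> splits \<nu>" by (simp add: splits_def)
      then show ?thesis by simp
    qed
    finally show "cf (1 * f) \<nu> = cf f \<nu>" .
  qed
  show "(0::'a mps) \<noteq> 1"
  proof
    assume "(0::'a mps) = 1"
    then have "cf (0::'a mps) 0 = cf 1 0" by (rule arg_cong)
    then show False unfolding zero_mps_def one_mps_def by simp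
  qed
qed (simp_all add: zero_mps_def plus_mps_def minus_mps_def uminus_mps_def times_mps_def case_prod_unfold
    distrib_right sum.distrib add_ac)

end

lemma cf_zero [simp]: "cf 0 \<nu> = 0"
  and cf_one: "cf 1 \<nu> = (if \<nu> = 0 then 1 else 0)"
  and cf_add [simp]: "cf (f + g) \<nu> = cf f \<nu> + cf g \<nu>"
  and cf_diff [simp]: "cf (f - g) \<nu> = cf f \<nu> - cf g \<nu>"
  and cf_uminus [simp]: "cf (- f) \<nu> = - cf f \<nu>"
  and cf_mult: "cf (f * g) \<nu> = (\<Sum>(a, b)\<in>splits \<nu>. cf f a * cf g b)"
  by (simp_all add: zero_mps_def one_mps_def plus_mps_def minus_mps_def uminus_mps_def times_mps_def)

lemma cf_sum: "cf (\<Sum>i\<in>I. f i) \<nu> = (\<Sum>i\<in>I. cf (f i) \<nu>)"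
  by (induction I rule: infinite_finite_induct) auto

definition monom_mps :: "midx \<Rightarrow> 'a \<Rightarrow> 'a::comm_ring_1 mps" where
  "monom_mps \<mu> c = Mps (\<lambda>\<nu>. if \<nu> = \<mu> then c else 0)"

definition const :: "'a \<Rightarrow> 'a::comm_ring_1 mps" where
  "const c = monom_mps 0 c"

lemma cf_monom: "cf (monom_mps \<mu> c) \<nu> = (if \<nu> = \<mu> then c else 0)"
  by (simp add: monom_mps_def)

lemma cf_const: "cf (const c) \<nu> = (if \<nu> = 0 then c else 0)"
  by (simp add: const_def cf_monom)

lemma cf_monom_mult_add [simp]: "cf (monom_mps \<mu> c * f) (\<mu> + \<nu>) = c * cf f \<nu>"
proof -
  have "cf (monom_mps \<mu> c * f) (\<mu> + \<nu>) = (\<Sum>x\<in>splits (\<mu> + \<nu>). if x = (\<mu>, \<nu>) then c * cf f \<nu> else 0)"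
    unfolding cf_mult by (intro sum.cong) (auto simp: splits_def cf_monom split: if_splits)
  moreover have "(\<mu>, \<nu>) \<in> splits (\<mu> + \<nu>)" by (simp add: splits_def)
  ultimately show ?thesis by simp
qed

lemma cf_monom_mult_eq_0:
  assumes "\<And>\<kappa>. \<nu> \<noteq> \<mu> + \<kappa>"
  shows "cf (monom_mps \<mu> c * f) \<nu> = 0"
  unfolding cf_mult using assms by (intro sum.neutral) (auto simp: splits_def cf_monom)

lemma cf_const_mult [simp]: "cf (const c * f) \<nu> = c * cf f \<nu>"
  using cf_monom_mult_add[of 0 c f \<nu>] by (simp add: const_def)

lemma const_0 [simp]: "const 0 = 0" and const_1 [simp]: "const 1 = 1"
  by (auto intro!: mps_eqI simp: cf_const cf_one)

lemma const_diff: "const (a - b) = const a - const b"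
  and const_mult: "const (a * b) = const a * const b"
  by (auto intro!: mps_eqI simp: cf_const)

lemma const_inverse: "c \<noteq> 0 \<Longrightarrow> const c * const (inverse c :: 'a::field) = 1"
  by (simp add: const_mult[symmetric])

section \<open>The valued field\<close>

locale cinf =
  fixes q :: nat and \<theta> :: "'a::field" and av :: "'a \<Rightarrow> real"
  assumes C: "Cinf_field q \<theta> av"
begin

lemma av_nonneg [simp]: "0 \<le> av x" and av_eq_0_iff [simp]: "av x = 0 \<longleftrightarrow> x = 0"
  and av_mult: "av (x * y) = av x * av y" and av_add: "av (x + y) \<le> max (av x) (av y)"
  and av_theta: "av \<theta> = real q"
  using C unfolding Cinf_field_def by blast+

lemma complete_K: "(\<And>\<epsilon>. \<epsilon> > 0 \<Longrightarrow> \<exists>N. \<forall>m\<ge>N. \<forall>n\<ge>N. av (X m - X n) < \<epsilon>) \<Longrightarrow> \<exists>L. (\<lambda>n. av (X n - L)) \<longlonglongrightarrow> 0"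
  using C unfolding Cinf_field_def by blast

lemma alg_closed: "degree (P::'a poly) \<ge> 1 \<Longrightarrow> \<exists>x. poly P x = 0"
  using C unfolding Cinf_field_def by blast

lemma q_prime_power: obtains p e where "prime p" "e \<ge> 1" "q = p ^ e" "of_nat p = (0::'a)"
  using C unfolding Cinf_field_def by blast

lemma q_ge_2: "q \<ge> 2"
proof -
  obtain p e where pe: "prime p" "e \<ge> 1" "q = p ^ e" using q_prime_power by blast
  have "p \<ge> 2" using pe by (simp add: prime_ge_2_nat)
  moreover have "p ^ 1 \<le> p ^ e" using pe calculation by (intro power_increasing) auto
  ultimately show ?thesis using pe by simp
qed

lemma q_pos [simp]: "q > 0" "q \<noteq> 0" using q_ge_2 by auto

lemma qpow_ge: "n \<ge> 1 \<Longrightarrow> q ^ n \<ge> 2"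
  using q_ge_2 self_le_power[of q n] by linarith

lemma av_0 [simp]: "av 0 = 0" by simp

lemma av_1 [simp]: "av 1 = 1"
  using av_mult[of 1 1] by (metis av_eq_0_iff mult_cancel_right1 mult_1 zero_neq_one)

lemma av_power: "av (x ^ n) = av x ^ n"
  by (induction n) (auto simp: av_mult)

lemma av_minus [simp]: "av (- x) = av x"
proof -
  have "av (-1) ^ 2 = 1" using av_power[of "-1" 2] by simp
  then have "av (-1) = 1" using av_nonneg[of "-1"] by (simp add: power2_eq_1_iff)
  then show ?thesis using av_mult[of "-1" x] by simp
qed

lemma av_diff: "av (x - y) \<le> max (av x) (av y)"
  using av_add[of x "- y"] by simp

lemma av_diff_commute: "av (x - y) = av (y - x)"
  using av_minus[of "x - y"] by simp

lemma av_add_le: "av x \<le> c \<Longrightarrow> av y \<le> c \<Longrightarrow> av (x + y) \<le> c"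
  using av_add[of x y] by linarith

lemma av_diff_le: "av x \<le> c \<Longrightarrow> av y \<le> c \<Longrightarrow> av (x - y) \<le> c"
  using av_diff[of x y] by linarith

lemma av_add_less: "av x < c \<Longrightarrow> av y < c \<Longrightarrow> av (x + y) < c"
  using av_add[of x y] by linarith

lemma av_diff_less: "av x < c \<Longrightarrow> av y < c \<Longrightarrow> av (x - y) < c"
  using av_diff[of x y] by linarith

lemma av_inverse: "av (inverse x) = inverse (av x)"
proof (cases "x = 0")
  case False
  then have "av x * av (inverse x) = 1" by (simp add: av_mult[symmetric])
  then show ?thesis by (metis inverse_unique)
qed simp

lemma av_sum_le: "(\<And>i. i \<in> I \<Longrightarrow> av (f i) \<le> c) \<Longrightarrow> 0 \<le> c \<Longrightarrow> av (\<Sum>i\<in>I. f i) \<le> c"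
  by (induction I rule: infinite_finite_induct) (auto intro!: av_add_le)

lemma av_sum_less: "(\<And>i. i \<in> I \<Longrightarrow> av (f i) < c) \<Longrightarrow> 0 < c \<Longrightarrow> av (\<Sum>i\<in>I. f i) < c"
  by (induction I rule: infinite_finite_induct) (auto intro!: av_add_less)

lemma av_add_eq: "av x < av y \<Longrightarrow> av (x + y) = av y"
  using av_add[of x y] av_diff[of "x + y" x] by auto

lemma theta_nz [simp]: "\<theta> \<noteq> 0" using av_theta by force

lemma frob_add_K: "(x + y :: 'a) ^ q = x ^ q + y ^ q"
proof -
  obtain p e where pe: "prime p" "q = p ^ e" "of_nat p = (0::'a)" using q_prime_power by blast
  have p0: "p > 0" using pe by (simp add: prime_gt_0_nat)
  have step: "(a + b :: 'a) ^ p = a ^ p + b ^ p" for a b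
  proof -
    have "(a + b) ^ p = (\<Sum>k\<le>p. of_nat (p choose k) * a ^ k * b ^ (p - k))"
      by (rule binomial_ring)
    also have "\<dots> = (\<Sum>k\<in>{0, p}. of_nat (p choose k) * a ^ k * b ^ (p - k))"
    proof (rule sum.mono_neutral_right)
      show "\<forall>i\<in>{..p} - {0, p}. of_nat (p choose i) * a ^ i * b ^ (p - i) = 0"
      proof
        fix i assume "i \<in> {..p} - {0, p}"
        then have "p dvd (p choose i)" using pe(1) by (intro dvd_choose_prime) auto
        then obtain m where "p choose i = p * m" by (elim dvdE)
        then show "of_nat (p choose i) * a ^ i * b ^ (p - i) = 0" using pe by simp
      qed
    qed auto
    also have "\<dots> = a ^ p + b ^ p" using p0 by (simp add: add.commute)
    finally show ?thesis .
  qed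
  have "(x + y) ^ (p ^ e) = x ^ (p ^ e) + y ^ (p ^ e)" for e
  proof (induction e)
    case (Suc e)
    have "(x + y) ^ (p ^ Suc e) = ((x + y) ^ (p ^ e)) ^ p"
      by (simp only: power_Suc2 power_mult)
    also have "\<dots> = (x ^ (p ^ e)) ^ p + (y ^ (p ^ e)) ^ p"
      by (simp only: Suc step)
    finally show ?case by (simp only: power_Suc2 power_mult)
  qed simp
  then show ?thesis using pe by simp
qed

lemma frob_uminus_K: "(- x :: 'a) ^ q = - (x ^ q)"
  using frob_add_K[of x "- x"] by (simp add: power_0_left eq_neg_iff_add_eq_0 add.commute)

lemma frob_diff_K: "(x - y :: 'a) ^ q = x ^ q - y ^ q"
  using frob_add_K[of x "- y"] frob_uminus_K[of y] by simp

lemma frob_sum_K: "(\<Sum>i\<in>I. f i :: 'a) ^ q = (\<Sum>i\<in>I. f i ^ q)"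
  by (induction I rule: infinite_finite_induct) (auto simp: frob_add_K power_0_left)

text \<open>The relation x^(q-1) = 1 forces absolute value 1. This discreteness of F_q has two
  consequences used later: a null family with entries in F_q has finite support, and a
  Frobenius-fixed power series of norm less than 1 is 0.\<close>

lemma av_Fq: "x \<in> Fq q \<Longrightarrow> x \<noteq> 0 \<Longrightarrow> av x = 1"
proof -
  assume x: "x \<in> Fq q" "x \<noteq> 0"
  have "av x ^ q = av x" using x av_power[of x q] by (simp add: Fq_def)
  moreover have "q = Suc (q - 1)" by (simp add: Suc_leI)
  ultimately have "av x ^ (q - 1) * av x = 1 * av x" by (metis mult_1 power_Suc2)
  then have "av x ^ (q - 1) = 1" using x by auto
  moreover have "q - 1 > 0" using q_ge_2 by simp
  ultimately show "av x = 1" by (metis av_nonneg power_eq_1_iff real_norm_def abs_of_nonneg gr_implies_not0)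
qed

text \<open>The power theta^(q^n) dominates theta. These differences are the denominators of the
  exponential and of the quasi-periodic operators; their size gives the exponential its rate of
  convergence.\<close>

lemma av_theta_power_diff:
  assumes "n \<ge> 1"
  shows "av (\<theta> ^ (q ^ n) - \<theta>) = real q ^ (q ^ n)"
proof -
  have "real q ^ 1 < real q ^ (q ^ n)"
    using qpow_ge[OF assms] q_ge_2 by (intro power_strict_increasing) auto
  then have "av (- \<theta>) < av (\<theta> ^ (q ^ n))" by (simp add: av_power av_theta)
  then show ?thesis using av_add_eq[of "- \<theta>" "\<theta> ^ (q ^ n)"] by (simp add: av_power av_theta)
qed

end

section \<open>Gauss norms and Tate algebras\<close>

context cinf
begin

text \<open>The space c_0(I). Two kinds of index set occur: multi-indices for single power series,
  and pairs of a component and a multi-index for vectors of power series.\<close>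

definition C0 :: "('i \<Rightarrow> 'a) set" where
  "C0 = {x. \<forall>\<epsilon>>0. finite {k. \<epsilon> \<le> av (x k)}}"

definition sup_norm :: "('i \<Rightarrow> 'a) \<Rightarrow> real" where
  "sup_norm x = (SUP k. av (x k))"

lemma C0_I: "(\<And>\<epsilon>. \<epsilon> > 0 \<Longrightarrow> finite {k. \<epsilon> \<le> av (x k)}) \<Longrightarrow> x \<in> C0"
  by (simp add: C0_def)

lemma C0_D: "x \<in> C0 \<Longrightarrow> \<epsilon> > 0 \<Longrightarrow> finite {k. \<epsilon> \<le> av (x k)}"
  by (simp add: C0_def)

lemma C0_bdd: 
  assumes "x \<in> C0"
  shows "\<exists>B. \<forall>k. av (x k) \<le> B"
proof -
  have fin: "finite {k. 1 \<le> av (x k)}" using C0_D[OF assms, of 1] by simp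
  have "av (x k) \<le> Max (insert 1 ((\<lambda>k. av (x k)) ` {k. 1 \<le> av (x k)}))" for k
  proof (cases "1 \<le> av (x k)")
    case True
    then show ?thesis using fin by (intro Max_ge) auto
  next
    case False
    have "1 \<le> Max (insert 1 ((\<lambda>k. av (x k)) ` {k. 1 \<le> av (x k)}))" using fin by (intro Max_ge) auto
    then show ?thesis using False by linarith
  qed
  then show ?thesis by blast
qed

lemma sup_norm_ge: "x \<in> C0 \<Longrightarrow> av (x k) \<le> sup_norm x"
  unfolding sup_norm_def using C0_bdd[of x] by (intro cSUP_upper) (auto simp: bdd_above_def)

lemma sup_norm_le: "(\<And>k. av (x k) \<le> c) \<Longrightarrow> sup_norm x \<le> c"
  unfolding sup_norm_def by (rule cSUP_least) auto

lemma sup_norm_nonneg: "x \<in> C0 \<Longrightarrow> 0 \<le> sup_norm x"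
  using sup_norm_ge[of x undefined] av_nonneg[of "x undefined"] by linarith

lemma sup_norm_attained:
  assumes x: "x \<in> C0" and k0: "x k0 \<noteq> 0"
  shows "\<exists>k. av (x k) = sup_norm x"
proof -
  let ?S = "{k. av (x k0) \<le> av (x k)}"
  have pos: "av (x k0) > 0" using k0 by (metis av_nonneg av_eq_0_iff less_eq_real_def)
  have fin: "finite ?S" using C0_D[OF x pos] .
  define m where "m = Max ((\<lambda>k. av (x k)) ` ?S)"
  have "m \<in> (\<lambda>k. av (x k)) ` ?S" unfolding m_def using fin by (intro Max_in) auto
  then obtain k where k: "m = av (x k)" by blast
  have k0m: "av (x k0) \<le> m" unfolding m_def using fin by (intro Max_ge) auto
  have "av (x j) \<le> m" for j
  proof (cases "j \<in> ?S")
    case True then show ?thesis unfolding m_def using fin by (intro Max_ge) auto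
  next
    case False then show ?thesis using k0m by simp
  qed
  then have "sup_norm x \<le> m" by (rule sup_norm_le)
  then show ?thesis using sup_norm_ge[OF x, of k] k by (intro exI[of _ k]) linarith
qed

text \<open>The supremum of a null family is attained, so a strict bound on all coordinates stays
  strict.\<close>

lemma sup_norm_less:
  assumes x: "x \<in> C0" and c: "0 < c" and l: "\<And>k. av (x k) < c"
  shows "sup_norm x < c"
proof (cases "\<exists>k. x k \<noteq> 0")
  case True
  then show ?thesis using sup_norm_attained[OF x] l by metis
next
  case False
  then have "sup_norm x \<le> 0" by (intro sup_norm_le) simp
  then show ?thesis using c by linarith
qed

lemma sup_norm_eq_0_iff: 
  assumes "x \<in> C0" shows "sup_norm x = 0 \<longleftrightarrow> (\<forall>k. x k = 0)"
proof
  assume "sup_norm x = 0"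
  then have "av (x k) \<le> 0" for k using sup_norm_ge[OF assms, of k] by simp
  then have "av (x k) = 0" for k using av_nonneg[of "x k"] by (intro antisym) auto
  then show "\<forall>k. x k = 0" by simp
next
  assume "\<forall>k. x k = 0"
  then have "sup_norm x \<le> 0" by (intro sup_norm_le) simp
  then show "sup_norm x = 0" using sup_norm_nonneg[OF assms] by simp
qed

lemma C0_max:
  assumes x: "x \<in> C0" and y: "y \<in> C0" and le: "\<And>k. av (z k) \<le> max (av (x k)) (av (y k))"
  shows "z \<in> C0"
proof (rule C0_I)
  fix \<epsilon> :: real assume e: "\<epsilon> > 0"
  have "{k. \<epsilon> \<le> av (z k)} \<subseteq> {k. \<epsilon> \<le> av (x k)} \<union> {k. \<epsilon> \<le> av (y k)}"
  proof
    fix k assume "k \<in> {k. \<epsilon> \<le> av (z k)}"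
    then show "k \<in> {k. \<epsilon> \<le> av (x k)} \<union> {k. \<epsilon> \<le> av (y k)}"
      using le[of k] by auto
  qed
  then show "finite {k. \<epsilon> \<le> av (z k)}"
    using C0_D[OF x e] C0_D[OF y e] by (meson finite_UnI finite_subset)
qed

lemma C0_add: "x \<in> C0 \<Longrightarrow> y \<in> C0 \<Longrightarrow> (\<lambda>k. x k + y k) \<in> C0"
  by (erule (1) C0_max) (rule av_add)

lemma C0_mono:
  assumes x: "x \<in> C0" and le: "\<And>k. av (z k) \<le> av (x k)"
  shows "z \<in> C0"
  using C0_max[OF x x, of z] le by simp

lemma C0_scale:
  assumes x: "x \<in> C0" shows "(\<lambda>k. c * x k) \<in> C0"
proof (cases "c = 0")
  case True
  then show ?thesis by (auto simp: C0_def not_le)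
next
  case False
  then have c: "av c > 0" by (metis av_nonneg av_eq_0_iff less_eq_real_def)
  show ?thesis
  proof (rule C0_I)
    fix \<epsilon> :: real assume "\<epsilon> > 0"
    then have "finite {k. \<epsilon> / av c \<le> av (x k)}" using c by (intro C0_D[OF x]) simp
    moreover have "{k. \<epsilon> \<le> av (c * x k)} \<subseteq> {k. \<epsilon> / av c \<le> av (x k)}"
      using c by (auto simp: av_mult field_simps)
    ultimately show "finite {k. \<epsilon> \<le> av (c * x k)}" by (rule rev_finite_subset)
  qed
qed

lemma C0_power:
  assumes x: "x \<in> C0" and n: "n \<ge> 1" shows "(\<lambda>k. x k ^ n) \<in> C0"
proof (rule C0_I)
  fix \<epsilon> :: real assume e: "\<epsilon> > 0"
  have "min 1 \<epsilon> \<le> av (x k)" if "\<epsilon> \<le> av (x k ^ n)" for k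
  proof (rule ccontr)
    assume "\<not> ?thesis"
    then have *: "av (x k) < 1" "av (x k) < \<epsilon>" by auto
    have "av (x k) ^ n \<le> av (x k) ^ 1" using * n by (intro power_decreasing) auto
    then show False using that * by (simp add: av_power)
  qed
  then have "{k. \<epsilon> \<le> av (x k ^ n)} \<subseteq> {k. min 1 \<epsilon> \<le> av (x k)}" by blast
  moreover have "finite {k. min 1 \<epsilon> \<le> av (x k)}" using e by (intro C0_D[OF x]) auto
  ultimately show "finite {k. \<epsilon> \<le> av (x k ^ n)}" by (rule finite_subset)
qed

lemma C0_finite_support: "finite {k. x k \<noteq> 0} \<Longrightarrow> x \<in> C0"
proof (rule C0_I)
  fix \<epsilon> :: real assume "finite {k. x k \<noteq> 0}" "\<epsilon> > 0"
  moreover have "{k. \<epsilon> \<le> av (x k)} \<subseteq> {k. x k \<noteq> 0}" using \<open>\<epsilon> > 0\<close> by auto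
  ultimately show "finite {k. \<epsilon> \<le> av (x k)}" using finite_subset by blast
qed

lemma C0_complete:
  fixes X :: "nat \<Rightarrow> 'i \<Rightarrow> 'a"
  assumes X: "\<And>n. X n \<in> C0"
    and cau: "\<And>\<epsilon>. \<epsilon> > 0 \<Longrightarrow> \<exists>N. \<forall>m\<ge>N. \<forall>n\<ge>N. \<forall>k. av (X m k - X n k) < \<epsilon>"
  shows "\<exists>L\<in>C0. \<forall>\<epsilon>>0. \<exists>N. \<forall>n\<ge>N. \<forall>k. av (X n k - L k) < \<epsilon>"
proof -
  have "\<exists>L. (\<lambda>n. av (X n k - L)) \<longlonglongrightarrow> 0" for k
    using cau by (intro complete_K) blast
  then obtain L where L: "\<And>k. (\<lambda>n. av (X n k - L k)) \<longlonglongrightarrow> 0" by metis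
  have conv: "\<exists>N. \<forall>n\<ge>N. \<forall>k. av (X n k - L k) < \<epsilon>" if e: "\<epsilon> > 0" for \<epsilon>
  proof -
    obtain N where N: "\<And>m n k. m \<ge> N \<Longrightarrow> n \<ge> N \<Longrightarrow> av (X m k - X n k) < \<epsilon>"
      using cau[OF e] by blast
    have "av (X n k - L k) < \<epsilon>" if n: "n \<ge> N" for n k
    proof -
      have "\<forall>\<^sub>F m in sequentially. av (X m k - L k) < \<epsilon>"
        using L[of k] e by (rule order_tendstoD)
      then obtain M where M: "\<And>m. m \<ge> M \<Longrightarrow> av (X m k - L k) < \<epsilon>"
        by (auto simp: eventually_sequentially)
      have "av ((X n k - X (max M N) k) + (X (max M N) k - L k)) < \<epsilon>"
        using N[OF n, of "max M N" k] M[of "max M N"] by (intro av_add_less) auto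
      then show ?thesis by simp
    qed
    then show ?thesis by blast
  qed
  have "L \<in> C0"
  proof (rule C0_I)
    fix \<epsilon> :: real assume e: "\<epsilon> > 0"
    obtain N where N: "\<And>k. av (X N k - L k) < \<epsilon>" using conv[OF e] by blast
    have "{k. \<epsilon> \<le> av (L k)} \<subseteq> {k. \<epsilon> \<le> av (X N k)}"
    proof clarify
      fix k assume *: "\<epsilon> \<le> av (L k)"
      show "\<epsilon> \<le> av (X N k)"
      proof (rule ccontr)
        assume "\<not> ?thesis"
        then have "av (X N k) < \<epsilon>" by simp
        then have "av (X N k - (X N k - L k)) < \<epsilon>" using N[of k] by (rule av_diff_less)
        then show False using * by simp
      qed
    qed
    then show "finite {k. \<epsilon> \<le> av (L k)}" using C0_D[OF X e] by (rule finite_subset)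
  qed
  then show ?thesis using conv by blast
qed

text \<open>By the ultrametric inequality it is enough that consecutive differences tend to 0. The
  bound \<open>e n\<close> is uniform in k, so the conclusion is the Cauchy property in the sup
  norm.\<close>

lemma telescoping_cauchy:
  assumes step: "\<And>n k. av (X (Suc n) k - X n k) \<le> e n" and e: "e \<longlonglongrightarrow> 0" and eps: "\<epsilon> > 0"
  shows "\<exists>N. \<forall>m\<ge>N. \<forall>n\<ge>N. \<forall>k. av (X m k - X n k) < \<epsilon>"
proof -
  have "\<forall>\<^sub>F n in sequentially. e n < \<epsilon>" using e eps by (rule order_tendstoD)
  then obtain N where N: "\<And>n. n \<ge> N \<Longrightarrow> e n < \<epsilon>" by (auto simp: eventually_sequentially)
  have *: "av (X (N + j) k - X N k) < \<epsilon>" for j k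
  proof (induction j)
    case 0 then show ?case using eps by simp
  next
    case (Suc j)
    have "av (X (Suc (N + j)) k - X (N + j) k) < \<epsilon>" using step[of "N + j" k] N[of "N + j"] by simp
    then have "av ((X (Suc (N + j)) k - X (N + j) k) + (X (N + j) k - X N k)) < \<epsilon>"
      using Suc by (rule av_add_less)
    then show ?case by simp
  qed
  have "av (X m k - X n k) < \<epsilon>" if "m \<ge> N" "n \<ge> N" for m n k
  proof -
    have "av (X m k - X N k) < \<epsilon>" "av (X n k - X N k) < \<epsilon>"
      using *[of "m - N" k] *[of "n - N" k] that by simp_all
    then have "av ((X m k - X N k) - (X n k - X N k)) < \<epsilon>" by (rule av_diff_less)
    then show ?thesis by simp
  qed
  then show ?thesis by blast
qed

section \<open>The Gauss norm and the Frobenius twist on power series\<close>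

definition CC :: "'a mps set" where
  "CC = {f. cf f \<in> C0}"

definition nrm :: "'a mps \<Rightarrow> real" where
  "nrm f = sup_norm (cf f)"

text \<open>Only finitely supported multi-indices occur here, but in arbitrarily many variables; this lets one
  adjoin a further variable t to the Tate algebra T s by passing to T (Suc s).\<close>

definition V :: "nat \<Rightarrow> 'a mps set" where
  "V s = {f. \<forall>\<nu>. \<not> valid_idx s (lookup \<nu>) \<longrightarrow> cf f \<nu> = 0}"

definition T :: "nat \<Rightarrow> 'a mps set" where
  "T s = CC \<inter> V s"

definition tau :: "'a mps \<Rightarrow> 'a mps" where
  "tau f = Mps (\<lambda>\<nu>. cf f \<nu> ^ q)"

lemma cf_tau [simp]: "cf (tau f) \<nu> = cf f \<nu> ^ q"
  by (simp add: tau_def)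

lemma cf_taun: "cf ((tau ^^ n) f) \<nu> = cf f \<nu> ^ (q ^ n)"
  by (induction n) (auto simp: power_mult[symmetric] mult.commute)

lemma tau_0 [simp]: "tau 0 = 0" and tau_1 [simp]: "tau 1 = 1"
  and tau_add: "tau (f + g) = tau f + tau g" and tau_diff: "tau (f - g) = tau f - tau g"
  and tau_uminus: "tau (- f) = - tau f" and tau_const: "tau (const c) = const (c ^ q)"
  by (rule mps_eqI; simp add: cf_one cf_const frob_add_K frob_diff_K frob_uminus_K power_0_left)+

lemma tau_mult: "tau (f * g) = tau f * tau g"
  by (rule mps_eqI) (simp add: cf_mult frob_sum_K case_prod_unfold power_mult_distrib)

lemma tau_sum: "tau (\<Sum>i\<in>I. f i) = (\<Sum>i\<in>I. tau (f i))"
  by (induction I rule: infinite_finite_induct) (auto simp: tau_add)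

lemma tau_inj: "tau f = 0 \<longleftrightarrow> f = 0"
  by (auto simp: mps_eq_iff)

lemma taun_0 [simp]: "(tau ^^ n) 0 = 0" and taun_1 [simp]: "(tau ^^ n) 1 = 1"
  and taun_add: "(tau ^^ n) (f + g) = (tau ^^ n) f + (tau ^^ n) g"
  and taun_diff: "(tau ^^ n) (f - g) = (tau ^^ n) f - (tau ^^ n) g"
  and taun_mult: "(tau ^^ n) (f * g) = (tau ^^ n) f * (tau ^^ n) g"
  by (induction n) (simp_all add: tau_add tau_diff tau_uminus tau_mult)

lemma taun_const: "(tau ^^ n) (const c) = const (c ^ (q ^ n))"
  by (rule mps_eqI) (simp add: cf_taun cf_const power_0_left)

lemma taun_sum: "(tau ^^ n) (\<Sum>i\<in>I. f i) = (\<Sum>i\<in>I. (tau ^^ n) (f i))"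
  by (induction I rule: infinite_finite_induct) (auto simp: taun_add)

lemma taun_taun: "(tau ^^ n) ((tau ^^ m) f) = (tau ^^ (n + m)) f"
  by (simp add: funpow_add)

lemma taun_fixed: "tau c = c \<Longrightarrow> (tau ^^ n) c = c"
  by (induction n) auto

lemma nrm_ge: "f \<in> CC \<Longrightarrow> av (cf f \<nu>) \<le> nrm f"
  unfolding nrm_def CC_def using sup_norm_ge by auto

lemma nrm_le: "(\<And>\<nu>. av (cf f \<nu>) \<le> c) \<Longrightarrow> nrm f \<le> c"
  unfolding nrm_def by (rule sup_norm_le)

lemma nrm_nonneg: "f \<in> CC \<Longrightarrow> 0 \<le> nrm f"
  unfolding nrm_def CC_def using sup_norm_nonneg by auto

lemma nrm_less: "f \<in> CC \<Longrightarrow> 0 < c \<Longrightarrow> (\<And>\<nu>. av (cf f \<nu>) < c) \<Longrightarrow> nrm f < c"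
  unfolding nrm_def CC_def by (intro sup_norm_less) auto

lemma nrm_eq_0_iff: "f \<in> CC \<Longrightarrow> nrm f = 0 \<longleftrightarrow> f = 0"
  unfolding nrm_def CC_def by (auto simp: sup_norm_eq_0_iff mps_eq_iff)

lemma nrm_pos: "f \<in> CC \<Longrightarrow> f \<noteq> 0 \<Longrightarrow> nrm f > 0"
  using nrm_nonneg[of f] nrm_eq_0_iff[of f] by linarith

lemma nrm_0 [simp]: "nrm 0 = 0"
  unfolding nrm_def sup_norm_def by simp

lemma nrm_attained: 
  assumes "f \<in> CC" "f \<noteq> 0" shows "\<exists>\<nu>. av (cf f \<nu>) = nrm f"
proof -
  obtain k where "cf f k \<noteq> 0" using assms(2) by (auto simp: mps_eq_iff)
  then show ?thesis using assms(1) sup_norm_attained[of "cf f" k] by (simp add: nrm_def CC_def)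
qed

lemma CC_0 [simp]: "0 \<in> CC" and CC_monom [simp]: "monom_mps \<mu> c \<in> CC"
  unfolding CC_def by (auto intro!: C0_finite_support simp: cf_monom)

lemma CC_const [simp]: "const c \<in> CC" and CC_1 [simp]: "1 \<in> CC"
  using CC_monom[of 0 c] CC_monom[of 0 1] by (simp_all add: const_def[symmetric])

lemma CC_add: "f \<in> CC \<Longrightarrow> g \<in> CC \<Longrightarrow> f + g \<in> CC"
  unfolding CC_def by (simp add: C0_max[of "cf f" "cf g"] av_add)

lemma CC_diff: "f \<in> CC \<Longrightarrow> g \<in> CC \<Longrightarrow> f - g \<in> CC"
  unfolding CC_def by (simp add: C0_max[of "cf f" "cf g"] av_diff)

lemma CC_uminus: "f \<in> CC \<Longrightarrow> - f \<in> CC"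
  unfolding CC_def by (auto intro: C0_mono)

lemma CC_tau: "f \<in> CC \<Longrightarrow> tau f \<in> CC"
  unfolding CC_def tau_def using C0_power[of "cf f" q] q_ge_2 by simp

lemma nrm_add: "f \<in> CC \<Longrightarrow> g \<in> CC \<Longrightarrow> nrm (f + g) \<le> max (nrm f) (nrm g)"
proof (rule nrm_le)
  fix \<nu> assume "f \<in> CC" "g \<in> CC"
  then show "av (cf (f + g) \<nu>) \<le> max (nrm f) (nrm g)"
    using av_add[of "cf f \<nu>" "cf g \<nu>"] nrm_ge[of f \<nu>] nrm_ge[of g \<nu>] by simp
qed

lemma nrm_uminus [simp]: "nrm (- f) = nrm f"
  by (simp add: nrm_def sup_norm_def)

lemma nrm_diff_commute: "nrm (f - g) = nrm (g - f)"
  using nrm_uminus[of "f - g"] by simp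

lemma nrm_diff: "f \<in> CC \<Longrightarrow> g \<in> CC \<Longrightarrow> nrm (f - g) \<le> max (nrm f) (nrm g)"
  using nrm_add[of f "- g"] CC_uminus[of g] by simp

lemma nrm_add_le: "f \<in> CC \<Longrightarrow> g \<in> CC \<Longrightarrow> nrm f \<le> c \<Longrightarrow> nrm g \<le> c \<Longrightarrow> nrm (f + g) \<le> c"
  using nrm_add[of f g] by linarith

lemma nrm_diff_le: "f \<in> CC \<Longrightarrow> g \<in> CC \<Longrightarrow> nrm f \<le> c \<Longrightarrow> nrm g \<le> c \<Longrightarrow> nrm (f - g) \<le> c"
  using nrm_diff[of f g] by linarith

lemma CC_sum: "(\<And>i. i \<in> I \<Longrightarrow> f i \<in> CC) \<Longrightarrow> (\<Sum>i\<in>I. f i) \<in> CC"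
  by (induction I rule: infinite_finite_induct) (auto intro: CC_add)

lemma nrm_sum_le: "(\<And>i. i \<in> I \<Longrightarrow> f i \<in> CC) \<Longrightarrow> (\<And>i. i \<in> I \<Longrightarrow> nrm (f i) \<le> c) \<Longrightarrow> 0 \<le> c
    \<Longrightarrow> nrm (\<Sum>i\<in>I. f i) \<le> c"
  by (induction I rule: infinite_finite_induct) (auto intro!: nrm_add_le CC_sum)

lemma nrm_const [simp]: "nrm (const c) = av c"
proof (rule antisym)
  show "nrm (const c) \<le> av c" by (rule nrm_le) (simp add: cf_const)
  show "av c \<le> nrm (const c)" using nrm_ge[of "const c" 0] by (simp add: cf_const)
qed

lemma nrm_1 [simp]: "nrm 1 = 1"
  using nrm_const[of 1] by simp

lemma nrm_tau:
  assumes f: "f \<in> CC" shows "nrm (tau f) = nrm f ^ q"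
proof (cases "f = 0")
  case True then show ?thesis by (simp add: power_0_left)
next
  case False
  show ?thesis
  proof (rule antisym)
    show "nrm (tau f) \<le> nrm f ^ q"
      using nrm_ge[OF f] by (intro nrm_le) (simp add: av_power power_mono)
    obtain \<nu> where "av (cf f \<nu>) = nrm f" using nrm_attained[OF f False] by blast
    then show "nrm f ^ q \<le> nrm (tau f)"
      using nrm_ge[OF CC_tau[OF f], of \<nu>] by (simp add: av_power)
  qed
qed

lemma CC_taun: "f \<in> CC \<Longrightarrow> (tau ^^ n) f \<in> CC"
  by (induction n) (auto intro: CC_tau)

lemma nrm_taun: "f \<in> CC \<Longrightarrow> nrm ((tau ^^ n) f) = nrm f ^ (q ^ n)"
  by (induction n) (auto simp: nrm_tau CC_taun power_mult[symmetric] mult.commute)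

text \<open>A coefficient of size at least \<epsilon> contains a product of that size. Each factor
  of this product is then bounded below, hence both indices come from finite sets.\<close>

lemma CC_mult:
  assumes f: "f \<in> CC" and g: "g \<in> CC"
  shows "f * g \<in> CC"
proof -
  define F where "F = nrm f + 1"
  define G where "G = nrm g + 1"
  have F: "F > 0" "\<And>a. av (cf f a) \<le> F" 
    using nrm_nonneg[OF f] nrm_ge[OF f] unfolding F_def by (auto intro: add_increasing2)
  have G: "G > 0" "\<And>a. av (cf g a) \<le> G" 
    using nrm_nonneg[OF g] nrm_ge[OF g] unfolding G_def by (auto intro: add_increasing2)
  have "cf (f * g) \<in> C0"
  proof (rule C0_I)
    fix \<epsilon> :: real assume e: "\<epsilon> > 0"
    have fin: "finite ({a. \<epsilon> / G \<le> av (cf f a)} \<times> {b. \<epsilon> / F \<le> av (cf g b)})"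
      using f g e F G unfolding CC_def by (intro finite_cartesian_product C0_D) auto
    have "{\<nu>. \<epsilon> \<le> av (cf (f * g) \<nu>)} \<subseteq> (\<lambda>(a, b). a + b) ` ({a. \<epsilon> / G \<le> av (cf f a)} \<times> {b. \<epsilon> / F \<le> av (cf g b)})"
    proof clarify
      fix \<nu> assume \<nu>: "\<epsilon> \<le> av (cf (f * g) \<nu>)"
      have "\<exists>x\<in>splits \<nu>. \<epsilon> \<le> av (cf f (fst x) * cf g (snd x))"
      proof (rule ccontr)
        assume "\<not> ?thesis"
        then have "av (cf (f * g) \<nu>) < \<epsilon>"
          unfolding cf_mult case_prod_unfold using e by (intro av_sum_less) auto
        then show False using \<nu> by simp
      qed
      then obtain a b where ab: "a + b = \<nu>" "\<epsilon> \<le> av (cf f a) * av (cf g b)"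
        by (auto simp: splits_def av_mult)
      have "\<epsilon> \<le> av (cf f a) * G" "\<epsilon> \<le> F * av (cf g b)"
        using ab(2) mult_left_mono[OF G(2)[of b], of "av (cf f a)"] mult_right_mono[OF F(2)[of a], of "av (cf g b)"]
        by auto
      then have "(a, b) \<in> {a. \<epsilon> / G \<le> av (cf f a)} \<times> {b. \<epsilon> / F \<le> av (cf g b)}"
        using F(1) G(1) by (auto simp: field_simps)
      then show "\<nu> \<in> (\<lambda>(a, b). a + b) ` ({a. \<epsilon> / G \<le> av (cf f a)} \<times> {b. \<epsilon> / F \<le> av (cf g b)})"
        using ab(1) by (intro image_eqI[of _ _ "(a, b)"]) auto
    qed
    then show "finite {\<nu>. \<epsilon> \<le> av (cf (f * g) \<nu>)}" using fin finite_surj by blast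
  qed
  then show ?thesis by (simp add: CC_def)
qed

text \<open>The largest index, in the linear order of multi-indices, at which the Gauss norm is
  attained. The order is compatible with addition, so this serves as a leading exponent.\<close>

definition lmon :: "'a mps \<Rightarrow> midx" where
  "lmon f = Max {a. av (cf f a) = nrm f}"

lemma lmon:
  assumes f: "f \<in> CC" "f \<noteq> 0"
  shows "av (cf f (lmon f)) = nrm f" "\<not> a \<le> lmon f \<Longrightarrow> av (cf f a) < nrm f"
proof -
  have "finite {a. nrm f \<le> av (cf f a)}"
    using f nrm_pos[OF f] unfolding CC_def by (intro C0_D) auto
  then have fin: "finite {a. av (cf f a) = nrm f}" by (rule rev_finite_subset) auto
  have "lmon f \<in> {a. av (cf f a) = nrm f}"
    unfolding lmon_def using fin nrm_attained[OF f] by (intro Max_in) auto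
  then show "av (cf f (lmon f)) = nrm f" by simp
  assume "\<not> a \<le> lmon f"
  then have "av (cf f a) \<noteq> nrm f" using Max_ge[OF fin, of a] unfolding lmon_def by blast
  then show "av (cf f a) < nrm f" using nrm_ge[OF f(1), of a] by linarith
qed

text \<open>Of all pairs of indices with sum \<open>lmon f + lmon g\<close>, every pair other than
  the two leading indices has a component beyond its leading index and so contributes a strictly
  smaller product. One dominant term remains, and multiplicativity of the Gauss norm
  follows.\<close>

lemma av_cf_lmon_mult:
  assumes f: "f \<in> CC" "f \<noteq> 0" and g: "g \<in> CC" "g \<noteq> 0"
  shows "av (cf (f * g) (lmon f + lmon g)) = nrm f * nrm g"
proof -
  let ?S = "splits (lmon f + lmon g)" and ?x = "(lmon f, lmon g)"
  have pos: "nrm f > 0" "nrm g > 0" using nrm_pos f g by auto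
  have top: "av (cf f (lmon f) * cf g (lmon g)) = nrm f * nrm g"
    using lmon(1)[OF f] lmon(1)[OF g] by (simp add: av_mult)
  have rest: "av (\<Sum>x\<in>?S - {?x}. cf f (fst x) * cf g (snd x)) < nrm f * nrm g"
  proof (rule av_sum_less)
    fix x assume x: "x \<in> ?S - {?x}"
    obtain a b where ab: "x = (a, b)" by (cases x)
    have eq: "a + b = lmon f + lmon g" and ne: "\<not> (a = lmon f \<and> b = lmon g)" using x ab by auto
    have "\<not> a \<le> lmon f \<or> \<not> b \<le> lmon g"
    proof (rule ccontr)
      assume "\<not> ?thesis"
      then have le: "a \<le> lmon f" "b \<le> lmon g" by auto
      then have "a < lmon f \<or> b < lmon g" using ne by auto
      then have "a + b < lmon f + lmon g" using le by (auto intro: add_less_le_mono add_le_less_mono)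
      then show False using eq by simp
    qed
    then have "av (cf f a) < nrm f \<or> av (cf g b) < nrm g" using lmon(2)[OF f] lmon(2)[OF g] by blast
    then have "av (cf f a) * av (cf g b) < nrm f * nrm g"
    proof
      assume "av (cf f a) < nrm f"
      have "av (cf f a) * av (cf g b) \<le> av (cf f a) * nrm g"
        using nrm_ge[OF g(1), of b] by (intro mult_left_mono) auto
      also have "\<dots> < nrm f * nrm g" using \<open>av (cf f a) < nrm f\<close> pos by simp
      finally show ?thesis .
    next
      assume "av (cf g b) < nrm g"
      have "av (cf f a) * av (cf g b) \<le> nrm f * av (cf g b)"
        using nrm_ge[OF f(1), of a] by (intro mult_right_mono) auto
      also have "\<dots> < nrm f * nrm g" using \<open>av (cf g b) < nrm g\<close> pos by simp
      finally show ?thesis .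
    qed
    then show "av (cf f (fst x) * cf g (snd x)) < nrm f * nrm g" using ab by (simp add: av_mult)
  qed (use pos in simp)
  have "cf (f * g) (lmon f + lmon g) = (\<Sum>x\<in>?S - {?x}. cf f (fst x) * cf g (snd x)) + cf f (lmon f) * cf g (lmon g)"
    unfolding cf_mult case_prod_unfold by (subst sum.remove[of _ ?x]) auto
  then show ?thesis using av_add_eq[of "\<Sum>x\<in>?S - {?x}. cf f (fst x) * cf g (snd x)" "cf f (lmon f) * cf g (lmon g)"] rest top
    by simp
qed

lemma nrm_mult:
  assumes f: "f \<in> CC" and g: "g \<in> CC"
  shows "nrm (f * g) = nrm f * nrm g"
proof (cases "f = 0 \<or> g = 0")
  case False
  show ?thesis
  proof (rule antisym)
    show "nrm f * nrm g \<le> nrm (f * g)"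
      using av_cf_lmon_mult[of f g] nrm_ge[OF CC_mult[OF f g], of "lmon f + lmon g"] False f g by simp
    show "nrm (f * g) \<le> nrm f * nrm g"
    proof (rule nrm_le)
      fix \<nu>
      show "av (cf (f * g) \<nu>) \<le> nrm f * nrm g"
        unfolding cf_mult case_prod_unfold using nrm_ge[OF f] nrm_ge[OF g] nrm_nonneg[OF f] nrm_nonneg[OF g]
        by (intro av_sum_le) (auto simp: av_mult intro!: mult_mono)
    qed
  qed
qed auto

lemma CC_mult_eq_0: "f \<in> CC \<Longrightarrow> g \<in> CC \<Longrightarrow> f * g = 0 \<Longrightarrow> f = 0 \<or> g = 0"
  using nrm_mult[of f g] nrm_eq_0_iff[of f] nrm_eq_0_iff[of g] by auto

lemma CC_mult_cancel: "f \<in> CC \<Longrightarrow> g \<in> CC \<Longrightarrow> h \<in> CC \<Longrightarrow> f \<noteq> 0 \<Longrightarrow> f * g = f * h \<Longrightarrow> g = h"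
  using CC_mult_eq_0[of f "g - h"] CC_diff[of g h] by (simp add: right_diff_distrib)

lemma midx_le_0: "\<nu> \<le> 0 \<Longrightarrow> \<nu> = (0 :: midx)"
proof (rule ccontr)
  assume "\<nu> \<le> 0" "\<nu> \<noteq> 0"
  then have "\<nu> < 0" by simp
  then show False by (simp add: less_poly_mapping.rep_eq less_fun_def)
qed

text \<open>The product has a nonzero coefficient at the sum of the leading indices. If the product
  is 1, this sum is 0, so both leading indices are 0 and the constant coefficient dominates
  strictly.\<close>

lemma unit_coeffs:
  assumes f: "f \<in> CC" and g: "g \<in> CC" and fg: "f * g = 1" and \<nu>: "\<nu> \<noteq> 0"
  shows "av (cf f \<nu>) < av (cf f 0)"
proof -
  have nz: "f \<noteq> 0" "g \<noteq> 0" using fg by auto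
  have "nrm f * nrm g > 0" using nrm_pos f g nz by simp
  then have "cf (f * g) (lmon f + lmon g) \<noteq> 0" using av_cf_lmon_mult[OF f nz(1) g nz(2)] by auto
  then have "lmon f + lmon g = 0" unfolding fg by (auto simp: cf_one split: if_splits)
  then have 0: "lmon f = 0" by (simp add: midx_add_eq_0_iff)
  then have "\<not> \<nu> \<le> lmon f" using midx_le_0 \<nu> by auto
  then show ?thesis using lmon(1)[OF f nz(1)] lmon(2)[OF f nz(1), of \<nu>] 0 by simp
qed

lemma valid_idx_add: "valid_idx s (lookup (a + b)) \<longleftrightarrow> valid_idx s (lookup a) \<and> valid_idx s (lookup b)"
  by (auto simp: valid_idx_def lookup_add)

lemma valid_idx_0 [simp]: "valid_idx s (lookup 0)"
  by (simp add: valid_idx_def)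

lemma V_mult:
  assumes f: "f \<in> V s" and g: "g \<in> V s"
  shows "f * g \<in> V s"
proof -
  have "cf (f * g) \<nu> = 0" if nv: "\<not> valid_idx s (lookup \<nu>)" for \<nu>
    unfolding cf_mult
  proof (intro sum.neutral ballI)
    fix x assume "x \<in> splits \<nu>"
    then obtain a b where ab: "x = (a, b)" "a + b = \<nu>" by (cases x) auto
    then have "\<not> valid_idx s (lookup a) \<or> \<not> valid_idx s (lookup b)" using nv valid_idx_add by blast
    then show "(case x of (a, b) \<Rightarrow> cf f a * cf g b) = 0" using f g ab by (auto simp: V_def)
  qed
  then show ?thesis by (simp add: V_def)
qed

lemma T_CC: "f \<in> T s \<Longrightarrow> f \<in> CC"
  by (simp add: T_def)

lemma V_arith: "0 \<in> V s" "const c \<in> V s" "1 \<in> V s" "f \<in> V s \<Longrightarrow> g \<in> V s \<Longrightarrow> f + g \<in> V s" "f \<in> V s \<Longrightarrow> g \<in> V s \<Longrightarrow> f - g \<in> V s"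
    "f \<in> V s \<Longrightarrow> - f \<in> V s" "f \<in> V s \<Longrightarrow> tau f \<in> V s"
  by (auto simp: V_def cf_const cf_one)

lemma T_0 [simp]: "0 \<in> T s" and T_1 [simp]: "1 \<in> T s" and T_const [simp]: "const c \<in> T s"
  and T_add: "f \<in> T s \<Longrightarrow> g \<in> T s \<Longrightarrow> f + g \<in> T s" and T_diff: "f \<in> T s \<Longrightarrow> g \<in> T s \<Longrightarrow> f - g \<in> T s"
  and T_uminus: "f \<in> T s \<Longrightarrow> - f \<in> T s" and T_mult: "f \<in> T s \<Longrightarrow> g \<in> T s \<Longrightarrow> f * g \<in> T s"
  and T_tau: "f \<in> T s \<Longrightarrow> tau f \<in> T s"
  by (auto simp: T_def intro: V_arith V_mult CC_add CC_diff CC_uminus CC_mult CC_tau)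

lemma T_sum: "(\<And>i. i \<in> I \<Longrightarrow> f i \<in> T s) \<Longrightarrow> (\<Sum>i\<in>I. f i) \<in> T s"
  by (induction I rule: infinite_finite_induct) (auto intro: T_add)

lemma T_prod: "(\<And>i. i \<in> I \<Longrightarrow> f i \<in> T s) \<Longrightarrow> (\<Prod>i\<in>I. f i) \<in> T s"
  by (induction I rule: infinite_finite_induct) (auto intro: T_mult)

lemma T_power: "f \<in> T s \<Longrightarrow> f ^ n \<in> T s"
  by (induction n) (auto intro: T_mult)

lemma T_taun: "f \<in> T s \<Longrightarrow> (tau ^^ n) f \<in> T s"
  by (induction n) (auto intro: T_tau)

lemma valid_idx_mono: "valid_idx s \<nu> \<Longrightarrow> s \<le> s' \<Longrightarrow> valid_idx s' \<nu>"
  by (simp add: valid_idx_def)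

lemma T_mono: "f \<in> T s \<Longrightarrow> s \<le> s' \<Longrightarrow> f \<in> T s'"
  by (auto simp: T_def V_def intro: valid_idx_mono)

lemma nrm_power: "f \<in> CC \<Longrightarrow> nrm (f ^ n) = nrm f ^ n"
proof (induction n)
  case (Suc n)
  have "f ^ n \<in> CC" using Suc(2) by (induction n) (auto intro: CC_mult)
  then show ?case using Suc by (simp add: nrm_mult)
qed simp

section \<open>Limits in the Gauss norm\<close>

definition nlim :: "(nat \<Rightarrow> 'a mps) \<Rightarrow> 'a mps \<Rightarrow> bool" where
  "nlim X L \<longleftrightarrow> (\<lambda>n. nrm (X n - L)) \<longlonglongrightarrow> 0"

lemma tendsto_0_le: "(\<And>n. (0::real) \<le> f n) \<Longrightarrow> (\<And>n. f n \<le> g n) \<Longrightarrow> g \<longlonglongrightarrow> 0 \<Longrightarrow> f \<longlonglongrightarrow> 0"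
  by (rule tendsto_sandwich[of "\<lambda>_. 0" f _ g]) auto

lemma T_complete:
  assumes X: "\<And>n. X n \<in> T s" and d: "(\<lambda>n. nrm (X (Suc n) - X n)) \<longlonglongrightarrow> 0"
  shows "\<exists>L\<in>T s. nlim X L"
proof -
  have C0: "cf (X n) \<in> C0" for n using X[of n] by (simp add: T_def CC_def)
  have step: "av (cf (X (Suc n)) k - cf (X n) k) \<le> nrm (X (Suc n) - X n)" for n k
    using nrm_ge[OF CC_diff[OF T_CC[OF X] T_CC[OF X]], of "Suc n" n k] by simp
  obtain L where L: "L \<in> C0" "\<And>\<epsilon>. \<epsilon> > 0 \<Longrightarrow> \<exists>N. \<forall>n\<ge>N. \<forall>k. av (cf (X n) k - L k) < \<epsilon>"
    using C0_complete[of "\<lambda>n. cf (X n)", OF C0 telescoping_cauchy[of "\<lambda>n. cf (X n)", OF step d]] by blast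
  have "valid_idx s (lookup \<nu>)" if nz: "L \<nu> \<noteq> 0" for \<nu>
  proof -
    have "av (L \<nu>) > 0" using nz by (metis av_nonneg av_eq_0_iff less_eq_real_def)
    then obtain N where N: "av (cf (X N) \<nu> - L \<nu>) < av (L \<nu>)" using L(2) by blast
    then have "cf (X N) \<nu> \<noteq> 0" by (metis av_minus diff_0 less_irrefl)
    then show ?thesis using X[of N] by (auto simp: T_def V_def)
  qed
  then have LT: "Mps L \<in> T s" using L(1) by (auto simp: T_def CC_def V_def)
  have "nlim X (Mps L)"
    unfolding nlim_def
  proof (rule LIMSEQ_I)
    fix r :: real assume r: "0 < r"
    obtain N where N: "\<And>n k. n \<ge> N \<Longrightarrow> av (cf (X n) k - L k) < r" using L(2)[OF r] by blast
    have "norm (nrm (X n - Mps L) - 0) < r" if "n \<ge> N" for n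
    proof -
      have m: "X n - Mps L \<in> CC" using CC_diff[OF T_CC[OF X] T_CC[OF LT]] .
      have "nrm (X n - Mps L) < r" using N[OF that] r by (intro nrm_less[OF m]) auto
      then show ?thesis using nrm_nonneg[OF m] by simp
    qed
    then show "\<exists>no. \<forall>n\<ge>no. norm (nrm (X n - Mps L) - 0) < r" by blast
  qed
  then show ?thesis using LT by blast
qed

lemma nlim_const [simp]: "nlim (\<lambda>n. L) L"
  by (simp add: nlim_def)

lemma nlim_unique:
  assumes X: "\<And>n. X n \<in> CC" and L: "L \<in> CC" "L' \<in> CC" and lim: "nlim X L" "nlim X L'"
  shows "L = L'"
proof -
  have "nrm (L - L') \<le> nrm (X n - L) + nrm (X n - L')" for n
  proof -
    have "nrm (L - L') = nrm ((X n - L') - (X n - L))" by simp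
    also have "\<dots> \<le> max (nrm (X n - L')) (nrm (X n - L))" by (intro nrm_diff CC_diff X L)
    also have "\<dots> \<le> nrm (X n - L) + nrm (X n - L')"
      using nrm_nonneg[OF CC_diff[OF X L(1)], of n] nrm_nonneg[OF CC_diff[OF X L(2)], of n] by auto
    finally show ?thesis .
  qed
  moreover have "(\<lambda>n. nrm (X n - L) + nrm (X n - L')) \<longlonglongrightarrow> 0"
    using tendsto_add[OF lim[unfolded nlim_def]] by simp
  ultimately have "nrm (L - L') \<le> 0" by (intro LIMSEQ_le_const) auto
  then show ?thesis using nrm_nonneg[OF CC_diff[OF L]] nrm_eq_0_iff[OF CC_diff[OF L]] by simp
qed

lemma nlim_add:
  assumes X: "\<And>n. X n \<in> CC" "\<And>n. Y n \<in> CC" and L: "L \<in> CC" "M \<in> CC" and lim: "nlim X L" "nlim Y M"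
  shows "nlim (\<lambda>n. X n + Y n) (L + M)"
  unfolding nlim_def
proof (rule tendsto_0_le)
  show "0 \<le> nrm (X n + Y n - (L + M))" for n by (intro nrm_nonneg CC_add CC_diff X L)
  show "nrm (X n + Y n - (L + M)) \<le> nrm (X n - L) + nrm (Y n - M)" for n
  proof -
    have "nrm (X n + Y n - (L + M)) = nrm ((X n - L) + (Y n - M))" by (simp add: algebra_simps)
    also have "\<dots> \<le> max (nrm (X n - L)) (nrm (Y n - M))" by (intro nrm_add CC_diff X L)
    also have "\<dots> \<le> nrm (X n - L) + nrm (Y n - M)"
      using nrm_nonneg[OF CC_diff[OF X(1) L(1)], of n] nrm_nonneg[OF CC_diff[OF X(2) L(2)], of n] by auto
    finally show ?thesis .
  qed
  show "(\<lambda>n. nrm (X n - L) + nrm (Y n - M)) \<longlonglongrightarrow> 0"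
    using tendsto_add[OF lim[unfolded nlim_def]] by simp
qed

lemma nlim_mult:
  assumes X: "\<And>n. X n \<in> CC" and L: "L \<in> CC" and c: "c \<in> CC" and lim: "nlim X L"
  shows "nlim (\<lambda>n. c * X n) (c * L)"
proof -
  have "nrm (c * X n - c * L) = nrm c * nrm (X n - L)" for n
    using nrm_mult[OF c CC_diff[OF X L], of n] by (simp add: right_diff_distrib)
  then show ?thesis using tendsto_mult_right_zero[OF lim[unfolded nlim_def]] by (simp add: nlim_def)
qed

lemma nlim_tau:
  assumes X: "\<And>n. X n \<in> CC" and L: "L \<in> CC" and lim: "nlim X L"
  shows "nlim (\<lambda>n. tau (X n)) (tau L)"
proof -
  have "nrm (tau (X n) - tau L) = nrm (X n - L) ^ q" for n
    using nrm_tau[OF CC_diff[OF X L], of n] by (simp add: tau_diff)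
  then show ?thesis using tendsto_power[OF lim[unfolded nlim_def], of q] by (simp add: nlim_def power_0_left)
qed

lemma nlim_taun:
  assumes X: "\<And>n. X n \<in> CC" and L: "L \<in> CC" and lim: "nlim X L"
  shows "nlim (\<lambda>n. (tau ^^ m) (X n)) ((tau ^^ m) L)"
  by (induction m) (auto intro!: nlim_tau lim CC_taun X L)

lemma nlim_sum:
  assumes "\<And>i n. i \<in> I \<Longrightarrow> X i n \<in> CC" "\<And>i. i \<in> I \<Longrightarrow> L i \<in> CC" "\<And>i. i \<in> I \<Longrightarrow> nlim (X i) (L i)"
  shows "nlim (\<lambda>n. \<Sum>i\<in>I. X i n) (\<Sum>i\<in>I. L i)"
  using assms by (induction I rule: infinite_finite_induct) (auto intro!: nlim_add CC_sum)

lemma nlim_le: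
  assumes X: "\<And>n. X n \<in> CC" and L: "L \<in> CC" and lim: "nlim X L" and le: "\<And>n. nrm (X n) \<le> c"
  shows "nrm L \<le> c"
proof (rule ccontr)
  assume "\<not> ?thesis"
  then have cl: "c < nrm L" by simp
  have c0: "0 \<le> c" using le[of 0] nrm_nonneg[OF X, of 0] by linarith
  have "\<forall>\<^sub>F n in sequentially. nrm (X n - L) < nrm L" 
    using cl c0 by (intro order_tendstoD(2)[OF lim[unfolded nlim_def]]) auto
  then obtain n where n: "nrm (X n - L) < nrm L" by (auto simp: eventually_sequentially)
  have "nrm (X n - (X n - L)) \<le> max (nrm (X n)) (nrm (X n - L))" by (intro nrm_diff CC_diff X L)
  then show False using n cl le[of n] by simp
qed

lemma nlim_Suc: "nlim X L \<Longrightarrow> nlim (\<lambda>n. X (Suc n)) L"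
  unfolding nlim_def by (rule LIMSEQ_Suc)

section \<open>Units of a Tate algebra and the equation tau y = k y\<close>

lemma geometric_inverse:
  assumes h: "h \<in> T s" and small: "nrm h < 1"
  shows "\<exists>g\<in>T s. (1 + h) * g = 1"
proof -
  define X where "X n = (\<Sum>i<n. (- h) ^ i)" for n
  have XT: "X n \<in> T s" for n unfolding X_def by (intro T_sum T_power T_uminus h)
  have pw: "(\<lambda>n. nrm ((- h) ^ n)) \<longlonglongrightarrow> 0"
    using small nrm_nonneg[OF T_CC[OF h]] by (simp add: nrm_power CC_uminus T_CC[OF h] LIMSEQ_realpow_zero)
  have "(\<lambda>n. nrm (X (Suc n) - X n)) \<longlonglongrightarrow> 0" using pw by (simp add: X_def)
  then obtain g where g: "g \<in> T s" "nlim X g" using T_complete[of X s] XT by blast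
  have tele: "(1 + h) * X n = 1 - (- h) ^ n" for n
    unfolding X_def by (induction n) (auto simp: algebra_simps)
  have "nlim (\<lambda>n. (1 + h) * X n) ((1 + h) * g)"
    using g h XT by (intro nlim_mult T_CC[of _ s] T_add T_1)
  moreover have "nlim (\<lambda>n. (1 + h) * X n) 1"
    using pw by (simp add: tele nlim_def)
  ultimately have "(1 + h) * g = 1"
    using g h XT by (intro nlim_unique[of "\<lambda>n. (1 + h) * X n"] T_CC[of _ s] T_mult T_add T_1)
  then show ?thesis using g by blast
qed

lemma power_q_tendsto_0:
  assumes "0 \<le> x" "x < (1::real)" shows "(\<lambda>n. x ^ (q ^ n)) \<longlonglongrightarrow> 0"
proof (rule tendsto_0_le)
  show "x ^ (q ^ n) \<le> x ^ n" for n
    using assms order_trans[OF less_imp_le[OF less_exp[of n]] power_mono[OF q_ge_2, of n]]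
    by (intro power_decreasing) auto
  show "(\<lambda>n. x ^ n) \<longlonglongrightarrow> 0" using assms by (rule LIMSEQ_realpow_zero)
qed (use assms in auto)

lemma root_qm1: assumes "c \<noteq> 0" obtains a :: 'a where "a \<noteq> 0" "a ^ q = c * a"
proof -
  have "degree (Polynomial.monom (1::'a) (q - 1) + [:- c:]) = q - 1"
    using q_ge_2 by (subst degree_add_eq_left) (auto simp: degree_monom_eq)
  then have "degree (Polynomial.monom (1::'a) (q - 1) + [:- c:]) \<ge> 1" using q_ge_2 by simp
  then obtain a where "poly (Polynomial.monom (1::'a) (q - 1) + [:- c:]) a = 0"
    using alg_closed by blast
  then have a: "a ^ (q - 1) = c" by (simp add: poly_monom)
  have "a ^ q = a ^ (q - 1) * a" using q_pos(1) by (metis Suc_diff_1 power_Suc2)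
  moreover have "a \<noteq> 0" using a assms q_ge_2 by (auto simp: power_0_left)
  ultimately show thesis using that a by simp
qed

text \<open>The constant coefficient of a unit strictly dominates all others. After division by it
  the remainder h has all coefficients below 1, hence norm below 1.\<close>

lemma unit_form:
  assumes k: "k \<in> T s" "k' \<in> T s" "k * k' = 1"
  obtains c h where "c \<noteq> 0" "h \<in> T s" "nrm h < 1" "k = const c * (1 + h)"
proof -
  define c where "c = cf k 0"
  have less: "\<nu> \<noteq> 0 \<Longrightarrow> av (cf k \<nu>) < av c" for \<nu>
    unfolding c_def using unit_coeffs[OF T_CC[OF k(1)] T_CC[OF k(2)] k(3)] by blast
  \<comment> \<open>Any nonzero index serves: the strict inequality at that index forces c to have
    positive absolute value.\<close>
  have "Poly_Mapping.single 0 1 \<noteq> (0 :: midx)" by (metis lookup_single_eq lookup_zero zero_neq_one)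
  then have "av c > 0" using less[of "Poly_Mapping.single 0 1"] av_nonneg[of "cf k (Poly_Mapping.single 0 1)"] by linarith
  then have c: "c \<noteq> 0" by auto
  define h where "h = const (inverse c) * k - 1"
  have hT: "h \<in> T s" unfolding h_def by (intro T_diff T_mult T_const T_1 k)
  have "nrm h < 1"
  proof (rule nrm_less[OF T_CC[OF hT]])
    fix \<nu>
    show "av (cf h \<nu>) < 1"
    proof (cases "\<nu> = 0")
      case True then show ?thesis using c by (simp add: h_def cf_one c_def)
    next
      case False
      have "cf h \<nu> = inverse c * cf k \<nu>" using False by (simp add: h_def cf_one)
      then have "av (cf h \<nu>) = av (cf k \<nu>) / av c" by (simp add: av_mult av_inverse divide_inverse mult.commute)
      then show ?thesis using less[OF False] \<open>av c > 0\<close> by simp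
    qed
  qed simp
  moreover have "k = const c * (1 + h)"
    unfolding h_def using const_inverse[OF c] by (simp add: mult.assoc[symmetric])
  ultimately show thesis using that c hT by blast
qed

text \<open>Write k = c (1 + h) with h small. The factor 1 + h is absorbed by the infinite product
  of the twists of its inverse g, and the constant c by a scalar a with a^q = c a, which exists
  because the field is algebraically closed.\<close>

lemma unit_frobenius_equation:
  assumes k: "k \<in> T s" "k' \<in> T s" "k * k' = 1"
  obtains y y' where "y \<in> T s" "y' \<in> T s" "y * y' = 1" "tau y = k * y"
proof -
  obtain c h where ch: "c \<noteq> 0" "h \<in> T s" "nrm h < 1" "k = const c * (1 + h)"
    using unit_form[OF k] by blast
  obtain g where g: "g \<in> T s" "(1 + h) * g = 1" using geometric_inverse[OF ch(2,3)] by blast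
  define e where "e = g - 1"
  have eT: "e \<in> T s" unfolding e_def using g by (intro T_diff T_1)
  have ng: "nrm g = 1"
  proof -
    have "nrm (1 + h) = 1"
    proof (rule antisym)
      show "nrm (1 + h) \<le> 1" using ch T_CC by (intro nrm_add_le) auto
      have "nrm ((1 + h) - h) \<le> max (nrm (1 + h)) (nrm h)"
        using ch T_CC by (intro nrm_diff CC_add) auto
      then show "1 \<le> nrm (1 + h)" using ch(3) by simp
    qed
    then show ?thesis using nrm_mult[of "1 + h" g] g ch by (simp add: T_CC CC_add)
  qed
  have ne: "nrm e < 1"
  proof -
    have "e = - (h * g)" using g(2) unfolding e_def by (simp add: algebra_simps eq_neg_iff_add_eq_0)
    then show ?thesis using nrm_mult[OF T_CC T_CC, OF ch(2) g(1)] ng ch(3) by simp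
  qed
  define z where "z n = (\<Prod>i<n. (tau ^^ i) g)" for n
  have zT: "z n \<in> T s" for n unfolding z_def by (intro T_prod T_taun g)
  have zn: "nrm (z n) \<le> 1" for n
  proof (induction n)
    case (Suc n)
    have "nrm (z (Suc n)) = nrm (z n) * nrm ((tau ^^ n) g)"
      using nrm_mult[OF T_CC[OF zT] T_CC[OF T_taun[OF g(1)]], of n n] by (simp add: z_def)
    then show ?case using Suc ng g by (simp add: nrm_taun T_CC)
  qed (simp add: z_def)
  have zd: "z (Suc n) - z n = z n * (tau ^^ n) e" for n
    unfolding z_def e_def by (simp add: taun_diff algebra_simps)
  have zd': "nrm (z (Suc n) - z n) \<le> nrm e ^ (q ^ n)" for n
  proof -
    have "nrm (z (Suc n) - z n) = nrm (z n) * nrm e ^ (q ^ n)"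
      unfolding zd nrm_mult[OF T_CC[OF zT] T_CC[OF T_taun[OF eT]]] nrm_taun[OF T_CC[OF eT]] ..
    also have "\<dots> \<le> nrm e ^ (q ^ n)"
      using zn[of n] nrm_nonneg[OF T_CC[OF eT]] nrm_nonneg[OF T_CC[OF zT], of n] by (intro mult_left_le_one_le) auto
    finally show ?thesis .
  qed
  have "(\<lambda>n. nrm (z (Suc n) - z n)) \<longlonglongrightarrow> 0"
    by (rule tendsto_0_le[OF _ zd' power_q_tendsto_0])
      (use ne nrm_nonneg[OF T_CC[OF eT]] nrm_nonneg[OF T_CC[OF T_diff[OF zT zT]]] in auto)
  then obtain y where y: "y \<in> T s" "nlim z y" using T_complete[of z s] zT by blast
  have rec: "g * tau (z n) = z (Suc n)" for n
    unfolding z_def by (induction n) (auto simp: tau_mult mult.assoc[symmetric])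
  have "g * tau y = y"
  proof (rule nlim_unique[of "\<lambda>n. z (Suc n)"])
    show "nlim (\<lambda>n. z (Suc n)) y" by (rule nlim_Suc[OF y(2)])
    show "nlim (\<lambda>n. z (Suc n)) (g * tau y)"
      unfolding rec[symmetric] using y g zT
      by (intro nlim_mult nlim_tau) (auto intro: T_CC CC_tau)
  qed (use zT y g in \<open>auto intro: T_CC CC_tau CC_mult\<close>)
  then have "(1 + h) * y = ((1 + h) * g) * tau y" by (simp only: mult.assoc)
  then have ty: "tau y = (1 + h) * y" using g(2) by simp
  \<comment> \<open>All partial products stay within \<open>nrm e\<close> < 1 of 1. The limit is
    therefore of the form 1 + small, which makes it a unit.\<close>
  have z1: "nrm (z n - 1) \<le> nrm e" for n
  proof (induction n)
    case 0 then show ?case using nrm_nonneg[OF T_CC[OF eT]] by (simp add: z_def)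
  next
    case (Suc n)
    have "nrm e ^ (q ^ n) \<le> nrm e ^ 1" using ne nrm_nonneg[OF T_CC[OF eT]] q_pos(1)
      by (intro power_decreasing) (auto simp: Suc_leI)
    then have "nrm ((z (Suc n) - z n) + (z n - 1)) \<le> nrm e" using zd'[of n] Suc
      by (intro nrm_add_le CC_diff T_CC[OF zT] CC_1) auto
    then show ?case by simp
  qed
  have "nlim (\<lambda>n. z n - 1) (y - 1)" using y(2) by (simp add: nlim_def)
  then have "nrm (y - 1) \<le> nrm e"
    by (rule nlim_le[OF CC_diff[OF T_CC[OF zT] CC_1] CC_diff[OF T_CC[OF y(1)] CC_1] _ z1])
  then have "nrm (y - 1) < 1" using ne by linarith
  then obtain w where w: "w \<in> T s" "(1 + (y - 1)) * w = 1"
    using geometric_inverse[OF T_diff[OF y(1) T_1]] by blast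
  obtain a where a: "a \<noteq> 0" "a ^ q = c * a" using root_qm1[OF ch(1)] by blast
  show thesis
  proof (rule that)
    show "const a * y \<in> T s" "const (inverse a) * w \<in> T s" by (intro T_mult T_const y w)+
    have "(const a * y) * (const (inverse a) * w) = (const a * const (inverse a)) * (y * w)" by (simp add: mult_ac)
    then show "(const a * y) * (const (inverse a) * w) = 1" using const_inverse[OF a(1)] w(2) by simp
    show "tau (const a * y) = k * (const a * y)"
      using a(2) ch(4) by (simp add: tau_mult tau_const ty const_mult mult_ac)
  qed
qed

end

section \<open>Frobenius descent\<close>

context cinf
begin

text \<open>A closed linear subspace of c_0(I) over the valued field. Closedness keeps limits of
  Frobenius iterates and infinite combinations of fixed vectors inside.\<close>

definition csub :: "('i \<Rightarrow> 'a) set \<Rightarrow> bool" where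
  "csub N \<longleftrightarrow> N \<subseteq> C0 \<and> (\<lambda>_. 0) \<in> N \<and> (\<forall>x\<in>N. \<forall>y\<in>N. (\<lambda>k. x k + y k) \<in> N)
     \<and> (\<forall>c. \<forall>x\<in>N. (\<lambda>k. c * x k) \<in> N)
     \<and> (\<forall>L\<in>C0. (\<forall>\<epsilon>>0. \<exists>x\<in>N. \<forall>k. av (x k - L k) < \<epsilon>) \<longrightarrow> L \<in> N)"

lemma csubD:
  assumes "csub N"
  shows "x \<in> N \<Longrightarrow> x \<in> C0" "(\<lambda>_. 0) \<in> N" "x \<in> N \<Longrightarrow> y \<in> N \<Longrightarrow> (\<lambda>k. x k + y k) \<in> N"
    "x \<in> N \<Longrightarrow> (\<lambda>k. c * x k) \<in> N"
    "L \<in> C0 \<Longrightarrow> (\<And>\<epsilon>. \<epsilon> > 0 \<Longrightarrow> \<exists>x\<in>N. \<forall>k. av (x k - L k) < \<epsilon>) \<Longrightarrow> L \<in> N"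
  using assms unfolding csub_def by blast+

lemma csub_diff: "csub N \<Longrightarrow> x \<in> N \<Longrightarrow> y \<in> N \<Longrightarrow> (\<lambda>k. x k - y k) \<in> N"
  using csubD(3)[of N x "\<lambda>k. (-1) * y k"] csubD(4)[of N y "-1"] by simp

lemma csub_sum: "csub N \<Longrightarrow> (\<And>j. j \<in> J \<Longrightarrow> x j \<in> N) \<Longrightarrow> (\<lambda>k. \<Sum>j\<in>J. c j * x j k) \<in> N"
proof (induction J rule: infinite_finite_induct)
  case (insert j J)
  then show ?case using csubD(3)[OF insert(4) csubD(4)[OF insert(4), of "x j" "c j"], of "\<lambda>k. \<Sum>j\<in>J. c j * x j k"]
    by simp
qed (simp_all add: csubD(2))

lemma frobn_diff_K: "(x - y :: 'a) ^ (q ^ n) = x ^ (q ^ n) - y ^ (q ^ n)"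
proof (induction n)
  case (Suc n)
  then show ?case by (simp only: power_Suc2 power_mult frob_diff_K)
qed simp

text \<open>The restriction to \<epsilon> at most 1 lets the caller bound the q-th power of a small
  quantity by the quantity itself.\<close>

lemma eq_by_av: "(\<And>\<epsilon>. \<epsilon> > 0 \<Longrightarrow> \<epsilon> \<le> 1 \<Longrightarrow> av (x - y) < \<epsilon>) \<Longrightarrow> x = y"
proof (rule ccontr)
  assume h: "\<And>\<epsilon>. \<epsilon> > 0 \<Longrightarrow> \<epsilon> \<le> 1 \<Longrightarrow> av (x - y) < \<epsilon>" and "x \<noteq> y"
  then have "av (x - y) > 0" by (metis av_nonneg av_eq_0_iff less_eq_real_def right_minus_eq)
  then have "av (x - y) < min 1 (av (x - y))" by (intro h) auto
  then show False by simp
qed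

text \<open>A vector of the subspace with the fewest coordinates of maximal absolute value, scaled so that
  one of them is 1, is moved by Frobenius by less than 1; iterating Frobenius then converges.\<close>

lemma descent_nonzero:
  assumes N: "csub N" and st: "\<And>x. x \<in> N \<Longrightarrow> (\<lambda>k. x k ^ q) \<in> N" and x: "x \<in> N" "x \<noteq> (\<lambda>_. 0)"
  shows "\<exists>v\<in>N. v \<noteq> (\<lambda>_. 0) \<and> (\<forall>k. v k \<in> Fq q)"
proof -
  define S where "S w = {k. av (w k) = sup_norm w}" for w :: "'b \<Rightarrow> 'a"
  obtain w where w: "w \<in> N" "w \<noteq> (\<lambda>_. 0)" and min: "\<And>y. y \<in> N \<Longrightarrow> y \<noteq> (\<lambda>_. 0) \<Longrightarrow> card (S w) \<le> card (S y)"
    using ex_has_least_nat[of "\<lambda>w. w \<in> N \<and> w \<noteq> (\<lambda>_. 0)" x "\<lambda>w. card (S w)"] x by blast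
  have wC: "w \<in> C0" using csubD(1)[OF N w(1)] .
  obtain k' where "w k' \<noteq> 0" using w(2) by blast
  then obtain k0 where k0: "av (w k0) = sup_norm w" using sup_norm_attained[OF wC] by blast
  have nwp: "sup_norm w > 0" using w(2) sup_norm_nonneg[OF wC] sup_norm_eq_0_iff[OF wC] by fastforce
  have wk0: "w k0 \<noteq> 0" using k0 nwp by auto
  have finS: "finite (S w)"
    using C0_D[OF wC nwp] unfolding S_def by (rule rev_finite_subset) auto
  define u where "u k = inverse (w k0) * w k" for k
  have uN: "u \<in> N" unfolding u_def by (rule csubD(4)[OF N w(1)])
  have avu: "av (u k) = av (w k) / sup_norm w" for k
    unfolding u_def by (simp add: av_mult av_inverse k0 divide_inverse mult.commute)
  have u1: "av (u k) \<le> 1" for k using sup_norm_ge[OF wC, of k] nwp by (simp add: avu)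
  have uk0: "u k0 = 1" using wk0 by (simp add: u_def)
  define d where "d k = u k ^ q - u k" for k
  have dN: "d \<in> N" unfolding d_def by (rule csub_diff[OF N st[OF uN] uN])
  have dC: "d \<in> C0" using csubD(1)[OF N dN] .
  have upow: "av (u k ^ q) \<le> av (u k)" for k
    unfolding av_power using u1[of k] power_decreasing[of 1 q "av (u k)"] by (simp add: Suc_leI)
  have dle: "av (d k) \<le> av (u k)" for k unfolding d_def using upow[of k] by (intro av_diff_le) auto
  \<comment> \<open>If some coordinate of d had absolute value 1, then d would have norm 1, and its
    maximal coordinates would be maximal coordinates of u as well. They would omit k0, where u is 1
    and d vanishes; this contradicts the minimal number.\<close>
  have dlt: "av (d k) < 1" for k
  proof (rule ccontr)
    assume "\<not> av (d k) < 1"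
    then have dk: "av (d k) = 1" using dle[of k] u1[of k] by linarith
    have "sup_norm d \<le> 1" using dle u1 by (intro sup_norm_le) (meson order_trans)
    then have nnd: "sup_norm d = 1" using sup_norm_ge[OF dC, of k] dk by linarith
    have "d \<noteq> (\<lambda>_. 0)" using dk by (metis av_0 zero_neq_one)
    then have "card (S w) \<le> card (S d)" using min dN by blast
    moreover have "S d \<subset> S w"
    proof
      show "S d \<subseteq> S w"
      proof
        fix j assume "j \<in> S d"
        then have "av (u j) = 1" using nnd dle[of j] u1[of j] by (simp add: S_def)
        then show "j \<in> S w" using nwp by (simp add: S_def avu)
      qed
      have "k0 \<in> S w" by (simp add: S_def k0)
      moreover have "k0 \<notin> S d" using uk0 nnd by (simp add: S_def d_def)
      ultimately show "S d \<noteq> S w" by blast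
    qed
    ultimately show False using psubset_card_mono[OF finS, of "S d"] by linarith
  qed
  define \<delta> where "\<delta> = sup_norm d"
  have \<delta>: "0 \<le> \<delta>" "\<delta> < 1" unfolding \<delta>_def using sup_norm_nonneg[OF dC] sup_norm_less[OF dC _ dlt] by auto
  define X where "X n k = u k ^ (q ^ n)" for n k
  have XN: "X n \<in> N" for n
  proof (induction n)
    case 0 then show ?case using uN by (simp add: X_def[abs_def])
  next
    case (Suc n)
    have "X (Suc n) = (\<lambda>k. X n k ^ q)" unfolding X_def by (simp only: power_Suc2 power_mult)
    then show ?case using st[OF Suc] by simp
  qed
  \<comment> \<open>The difference of consecutive iterates is the n-th Frobenius iterate of d, so it
    decays like \<delta>^(q^n).\<close>
  have "av (X (Suc n) k - X n k) \<le> \<delta> ^ (q ^ n)" for n k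
  proof -
    have "X (Suc n) k - X n k = d k ^ (q ^ n)"
      unfolding X_def d_def frobn_diff_K by (simp add: power_mult[symmetric])
    then show ?thesis unfolding \<delta>_def using sup_norm_ge[OF dC, of k] by (simp add: av_power power_mono)
  qed
  note cau = telescoping_cauchy[of X, OF this power_q_tendsto_0[OF \<delta>]]
  obtain L where LC: "L \<in> C0" and L: "\<And>\<epsilon>. \<epsilon> > 0 \<Longrightarrow> \<exists>M. \<forall>n\<ge>M. \<forall>k. av (X n k - L k) < \<epsilon>"
    using C0_complete[of X, OF csubD(1)[OF N XN] cau] by blast
  have "L \<in> N"
  proof (rule csubD(5)[OF N LC])
    fix \<epsilon> :: real assume "\<epsilon> > 0"
    then obtain M where "\<forall>n\<ge>M. \<forall>k. av (X n k - L k) < \<epsilon>" using L by blast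
    then have "\<forall>k. av (X M k - L k) < \<epsilon>" by simp
    then show "\<exists>x\<in>N. \<forall>k. av (x k - L k) < \<epsilon>" using XN by blast
  qed
  moreover have "L k ^ q = L k" for k
  proof (rule eq_by_av)
    fix \<epsilon> :: real assume e: "\<epsilon> > 0" "\<epsilon> \<le> 1"
    obtain M where M: "\<And>n. n \<ge> M \<Longrightarrow> av (X n k - L k) < \<epsilon>" using L[OF e(1)] by blast
    have "av ((X M k - L k) ^ q) \<le> av (X M k - L k) ^ 1"
      unfolding av_power using M[of M] e by (intro power_decreasing) (auto simp: Suc_leI)
    then have 1: "av ((X M k - L k) ^ q) < \<epsilon>" using M[of M] by simp
    have "X (Suc M) k = X M k ^ q" unfolding X_def by (simp only: power_Suc2 power_mult)
    then have eq: "L k ^ q - L k = (X (Suc M) k - L k) - (X M k - L k) ^ q" by (simp add: frob_diff_K)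
    show "av (L k ^ q - L k) < \<epsilon>" unfolding eq by (rule av_diff_less[OF M 1]) simp
  qed
  \<comment> \<open>The coordinate k0 is 1 in every iterate, which keeps the fixed limit from being
    0.\<close>
  moreover have "L k0 = 1"
  proof (rule eq_by_av)
    fix \<epsilon> :: real assume e: "\<epsilon> > 0" "\<epsilon> \<le> 1"
    obtain M where M: "\<And>n. n \<ge> M \<Longrightarrow> av (X n k0 - L k0) < \<epsilon>" using L[OF e(1)] by blast
    then have "av (1 - L k0) < \<epsilon>" using M[of M] by (simp add: X_def uk0)
    then show "av (L k0 - 1) < \<epsilon>" by (simp add: av_diff_commute)
  qed
  then have "L \<noteq> (\<lambda>_. 0)" by (metis zero_neq_one)
  ultimately show ?thesis unfolding Fq_def by blast
qed

lemma Fq_finite_support: 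
  assumes "v \<in> C0" "\<And>k. v k \<in> Fq q" shows "finite {k. v k \<noteq> 0}"
proof -
  have "{k. v k \<noteq> 0} \<subseteq> {k. 1 \<le> av (v k)}" using av_Fq[OF assms(2)] by auto
  then show ?thesis using C0_D[OF assms(1), of 1] finite_subset by auto
qed

lemma inverse_Suc_tendsto_0: "(\<lambda>m. 1 / real (Suc m)) \<longlonglongrightarrow> 0"
  using LIMSEQ_inverse_real_of_nat by (simp add: inverse_eq_divide)

text \<open>A maximal set of coordinates on which no nonzero fixed vector is supported plays the role of a
  complement; modulo limits of combinations of fixed vectors, every vector is supported on it.\<close>

lemma frobenius_descent:
  fixes N Z :: "('i \<Rightarrow> 'a) set"
  assumes N: "csub N" and st: "\<And>x. x \<in> N \<Longrightarrow> (\<lambda>k. x k ^ q) \<in> N" and Z: "csub Z"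
    and fix_Z: "\<And>v. v \<in> N \<Longrightarrow> (\<And>k. v k \<in> Fq q) \<Longrightarrow> v \<in> Z"
  shows "N \<subseteq> Z"
proof
  fix w assume w: "w \<in> N"
  define V0 where "V0 = {v\<in>N. \<forall>k. v k \<in> Fq q}"
  define \<S> where "\<S> = {S. \<forall>v\<in>V0. (\<forall>k. k \<notin> S \<longrightarrow> v k = 0) \<longrightarrow> v = (\<lambda>_. 0)}"
  have "{} \<in> \<S>" unfolding \<S>_def by auto
  have "\<exists>M\<in>\<S>. \<forall>X\<in>\<S>. M \<subseteq> X \<longrightarrow> X = M"
  proof (rule subset_Zorn_nonempty)
    show "\<S> \<noteq> {}" using \<open>{} \<in> \<S>\<close> by blast
    fix \<C> assume C: "\<C> \<noteq> {}" "subset.chain \<S> \<C>"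
    show "\<Union>\<C> \<in> \<S>"
      unfolding \<S>_def
    proof (intro CollectI ballI impI)
      fix v assume v: "v \<in> V0" "\<forall>k. k \<notin> \<Union>\<C> \<longrightarrow> v k = 0"
      \<comment> \<open>A fixed vector has finite support by discreteness of F_q, so its support
        already lies in a single member of the chain. This makes Zorn's lemma applicable.\<close>
      have "finite {k. v k \<noteq> 0}" using v(1) csubD(1)[OF N] by (intro Fq_finite_support) (auto simp: V0_def)
      moreover have "{k. v k \<noteq> 0} \<subseteq> \<Union>\<C>" using v(2) by blast
      ultimately obtain B where B: "B \<in> \<C>" "{k. v k \<noteq> 0} \<subseteq> B"
        using finite_subset_Union_chain C by metis
      have "B \<in> \<S>" using B(1) C(2) unfolding subset.chain_def by blast
      then show "v = (\<lambda>_. 0)" using B(2) v(1) unfolding \<S>_def by blast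
    qed
  qed
  then obtain S where S: "S \<in> \<S>" "\<And>X. X \<in> \<S> \<Longrightarrow> S \<subseteq> X \<Longrightarrow> X = S" by blast
  have "\<exists>f. f \<in> N \<and> f \<in> Z \<and> f n = 1 \<and> (\<forall>k. k \<notin> insert n S \<longrightarrow> f k = 0) \<and> (\<forall>k. av (f k) \<le> 1)" if n: "n \<notin> S" for n
  proof -
    \<comment> \<open>By maximality of S there is a nonzero fixed vector supported on S together
      with n. It cannot vanish at n, and scaling makes its n-th coordinate 1; its other nonzero
      coordinates lie in S.\<close>
    have "insert n S \<notin> \<S>" using S(2)[of "insert n S"] n by blast
    then obtain v where v: "v \<in> V0" "\<And>k. k \<notin> insert n S \<Longrightarrow> v k = 0" "v \<noteq> (\<lambda>_. 0)"
      unfolding \<S>_def by blast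
    have vn: "v n \<noteq> 0"
    proof
      assume "v n = 0"
      then have "\<forall>k. k \<notin> S \<longrightarrow> v k = 0" using v(2) by (metis insert_iff)
      then show False using S(1) v(1,3) unfolding \<S>_def by blast
    qed
    define f where "f k = inverse (v n) * v k" for k
    have vv: "v \<in> N" "v \<in> Z" "\<And>k. v k \<in> Fq q" using v(1) fix_Z unfolding V0_def by auto
    have "f \<in> N" "f \<in> Z" unfolding f_def using csubD(4)[OF N vv(1)] csubD(4)[OF Z vv(2)] by auto
    moreover have "av (f k) \<le> 1" for k
      unfolding f_def using av_Fq[OF vv(3) vn] av_Fq[OF vv(3), of k]
      by (cases "v k = 0") (auto simp: av_mult av_inverse)
    ultimately show ?thesis using vn v(2) by (intro exI[of _ f]) (auto simp: f_def)
  qed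
  then obtain f where f: "\<And>n. n \<notin> S \<Longrightarrow> f n \<in> N" "\<And>n. n \<notin> S \<Longrightarrow> f n \<in> Z" "\<And>n. n \<notin> S \<Longrightarrow> f n n = 1"
    "\<And>n k. n \<notin> S \<Longrightarrow> k \<notin> insert n S \<Longrightarrow> f n k = 0" "\<And>n k. n \<notin> S \<Longrightarrow> av (f n k) \<le> 1" by metis
  have wC: "w \<in> C0" using csubD(1)[OF N w] .
  \<comment> \<open>These finite sets exhaust the coordinates outside S where w is nonzero. The sums
    \<open>P m\<close> of the terms \<open>w j * f j\<close> over them converge to an element L of
    both N and Z that agrees with w outside S, since f j is 1 at j and 0 at all other places outside
    S.\<close>
  define F where "F m = {k. 1 / real (Suc m) \<le> av (w k)} - S" for m
  have finF: "finite (F m)" for m unfolding F_def using C0_D[OF wC, of "1 / real (Suc m)"] by simp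
  have Fmono: "F m \<subseteq> F (Suc m)" for m
  proof -
    have "1 / real (Suc (Suc m)) \<le> 1 / real (Suc m)" by (simp add: frac_le)
    then show ?thesis unfolding F_def by fastforce
  qed
  define P where "P m k = (\<Sum>j\<in>F m. w j * f j k)" for m k
  have PN: "P m \<in> N" "P m \<in> Z" for m
    unfolding P_def using f(1,2) by (auto intro!: csub_sum[OF N] csub_sum[OF Z] simp: F_def)
  have step: "av (P (Suc m) k - P m k) \<le> 1 / real (Suc m)" for m k
  proof -
    have "P (Suc m) k - P m k = (\<Sum>j\<in>F (Suc m) - F m. w j * f j k)"
      unfolding P_def using sum.subset_diff[OF Fmono finF] by (metis add_diff_cancel_right')
    moreover have "av (\<Sum>j\<in>F (Suc m) - F m. w j * f j k) \<le> 1 / real (Suc m)"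
    proof (rule av_sum_le)
      fix j assume j: "j \<in> F (Suc m) - F m"
      then have 1: "av (w j) \<le> 1 / real (Suc m)" and 2: "av (f j k) \<le> 1" using f(5) by (auto simp: F_def)
      have "av (w j) * av (f j k) \<le> 1 / real (Suc m) * 1" using 1 2 by (intro mult_mono) auto
      then show "av (w j * f j k) \<le> 1 / real (Suc m)" by (simp add: av_mult)
    qed simp
    ultimately show ?thesis by simp
  qed
  obtain L where LC: "L \<in> C0" and L: "\<And>\<epsilon>. \<epsilon> > 0 \<Longrightarrow> \<exists>M. \<forall>n\<ge>M. \<forall>k. av (P n k - L k) < \<epsilon>"
    using C0_complete[of P, OF csubD(1)[OF N PN(1)] telescoping_cauchy[of P, OF step inverse_Suc_tendsto_0]] by blast
  have app: "\<exists>M. \<forall>k. av (P M k - L k) < \<epsilon>" if "\<epsilon> > 0" for \<epsilon>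
    using L[OF that] by blast
  have LN: "L \<in> N" by (rule csubD(5)[OF N LC]) (use app PN(1) in blast)
  have LZ: "L \<in> Z" by (rule csubD(5)[OF Z LC]) (use app PN(2) in blast)
  have off: "L k = w k" if k: "k \<notin> S" for k
  proof (rule eq_by_av)
    fix \<epsilon> :: real assume e: "\<epsilon> > 0" "\<epsilon> \<le> 1"
    obtain M where M: "\<And>n. n \<ge> M \<Longrightarrow> av (P n k - L k) < \<epsilon>" using L[OF e(1)] by blast
    obtain n0 where n0: "1 / real (Suc n0) < \<epsilon>" using e(1) nat_approx_posE by metis
    define n where "n = max M n0"
    have "1 / real (Suc n) \<le> 1 / real (Suc n0)" unfolding n_def by (intro frac_le) auto
    then have n: "1 / real (Suc n) < \<epsilon>" "n \<ge> M" using n0 unfolding n_def by linarith+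
    have "P n k = (\<Sum>j\<in>F n. if j = k then w k else 0)"
      unfolding P_def using f(3,4) k by (intro sum.cong) (auto simp: F_def)
    then have "P n k = (if k \<in> F n then w k else 0)" using finF by simp
    then have "av (P n k - w k) < \<epsilon>" using n(1) k e by (auto simp: F_def)
    then have "av ((P n k - w k) - (P n k - L k)) < \<epsilon>" using M[OF n(2)] by (rule av_diff_less)
    then show "av (L k - w k) < \<epsilon>" by simp
  qed
  define w' where "w' k = w k - L k" for k
  have w'N: "w' \<in> N" unfolding w'_def by (rule csub_diff[OF N w LN])
  \<comment> \<open>The remainder w - L lies in this closed Frobenius-stable subspace. By the choice
    of S it has no nonzero fixed vector, so \<open>descent_nonzero\<close> leaves only 0.\<close>
  define N' where "N' = {x\<in>N. \<forall>k. k \<notin> S \<longrightarrow> x k = 0}"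
  have "csub N'"
    unfolding csub_def
  proof (intro conjI ballI allI impI)
    show "N' \<subseteq> C0" using csubD(1)[OF N] by (auto simp: N'_def)
    show "(\<lambda>_. 0) \<in> N'" using csubD(2)[OF N] by (simp add: N'_def)
    show "(\<lambda>k. x k + y k) \<in> N'" if "x \<in> N'" "y \<in> N'" for x y using csubD(3)[OF N] that by (simp add: N'_def)
    show "(\<lambda>k. c * x k) \<in> N'" if "x \<in> N'" for c x using csubD(4)[OF N] that by (simp add: N'_def)
    fix M assume M: "M \<in> C0" "\<forall>\<epsilon>>0. \<exists>x\<in>N'. \<forall>k. av (x k - M k) < \<epsilon>"
    have "M \<in> N" by (rule csubD(5)[OF N M(1)]) (use M(2) in \<open>unfold N'_def, blast\<close>)
    moreover have "M k = 0" if k: "k \<notin> S" for k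
    proof (rule eq_by_av)
      fix \<epsilon> :: real assume "\<epsilon> > 0"
      then obtain x where "x \<in> N'" "av (x k - M k) < \<epsilon>" using M(2) by blast
      then show "av (M k - 0) < \<epsilon>" using k by (simp add: N'_def)
    qed
    ultimately show "M \<in> N'" by (simp add: N'_def)
  qed
  moreover have "(\<lambda>k. x k ^ q) \<in> N'" if "x \<in> N'" for x using st that by (simp add: N'_def power_0_left)
  moreover have "w' \<in> N'" using w'N off by (simp add: N'_def w'_def)
  ultimately have "w' = (\<lambda>_. 0)"
    using descent_nonzero[of N' w'] S(1) unfolding \<S>_def V0_def N'_def by blast
  then have "w = L" by (auto simp: w'_def fun_eq_iff)
  then show "w \<in> Z" using LZ by simp
qed

section \<open>Descent for vectors over a Tate algebra\<close>

definition vecs :: "nat \<Rightarrow> nat \<Rightarrow> (nat \<Rightarrow> 'a mps) set" where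
  "vecs n s = {w. (\<forall>i. w i \<in> T s) \<and> (\<forall>i\<ge>n. w i = 0)}"

text \<open>Only linearity over the ground field is demanded, not over the Tate algebra, because
  descent takes place in c_0.\<close>

definition vsub :: "nat \<Rightarrow> nat \<Rightarrow> (nat \<Rightarrow> 'a mps) set \<Rightarrow> bool" where
  "vsub n s N \<longleftrightarrow> N \<subseteq> vecs n s \<and> (\<lambda>_. 0) \<in> N \<and> (\<forall>v\<in>N. \<forall>w\<in>N. (\<lambda>i. v i + w i) \<in> N)
     \<and> (\<forall>c. \<forall>w\<in>N. (\<lambda>i. const c * w i) \<in> N)
     \<and> (\<forall>L\<in>vecs n s. (\<forall>\<epsilon>>0. \<exists>w\<in>N. \<forall>i. nrm (w i - L i) < \<epsilon>) \<longrightarrow> L \<in> N)"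

text \<open>A family indexed by pairs, read as a vector of power series. In this picture Frobenius
  on the vector is the q-th power in every coordinate.\<close>

definition unflat :: "(nat \<times> midx \<Rightarrow> 'a) \<Rightarrow> nat \<Rightarrow> 'a mps" where
  "unflat x i = Mps (\<lambda>\<nu>. x (i, \<nu>))"

lemma cf_unflat [simp]: "cf (unflat x i) \<nu> = x (i, \<nu>)"
  by (simp add: unflat_def)

lemma unflat_C0: "x \<in> C0 \<Longrightarrow> unflat x i \<in> CC"
  unfolding CC_def
proof (intro CollectI C0_I)
  fix \<epsilon> :: real assume "x \<in> C0" "\<epsilon> > 0"
  then have "finite (snd ` {k. \<epsilon> \<le> av (x k)})" using C0_D by blast
  moreover have "{\<nu>. \<epsilon> \<le> av (cf (unflat x i) \<nu>)} \<subseteq> snd ` {k. \<epsilon> \<le> av (x k)}" by force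
  ultimately show "finite {\<nu>. \<epsilon> \<le> av (cf (unflat x i) \<nu>)}" using finite_subset by blast
qed

lemma flat_C0:
  assumes w: "w \<in> vecs n s" shows "(\<lambda>(i, \<nu>). cf (w i) \<nu>) \<in> C0"
proof (rule C0_I)
  fix \<epsilon> :: real assume e: "\<epsilon> > 0"
  have "cf (w i) \<in> C0" for i using w by (auto simp: vecs_def T_def CC_def)
  then have "finite (\<Union>i\<in>{..<n}. Pair i ` {\<nu>. \<epsilon> \<le> av (cf (w i) \<nu>)})" using e by (auto intro: C0_D)
  moreover have "{k. \<epsilon> \<le> av (case k of (i, \<nu>) \<Rightarrow> cf (w i) \<nu>)} \<subseteq> (\<Union>i\<in>{..<n}. Pair i ` {\<nu>. \<epsilon> \<le> av (cf (w i) \<nu>)})"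
  proof clarify
    fix i \<nu> assume a: "\<epsilon> \<le> av (cf (w i) \<nu>)"
    have "i < n"
    proof (rule ccontr)
      assume "\<not> i < n"
      then have "w i = 0" using w by (simp add: vecs_def)
      then show False using a e by simp
    qed
    then show "(i, \<nu>) \<in> (\<Union>i\<in>{..<n}. Pair i ` {\<nu>. \<epsilon> \<le> av (cf (w i) \<nu>)})" using a by blast
  qed
  ultimately show "finite {k. \<epsilon> \<le> av (case k of (i, \<nu>) \<Rightarrow> cf (w i) \<nu>)}" by (rule rev_finite_subset)
qed

lemma csub_unflat:
  assumes N: "vsub n s N"
  shows "csub {x \<in> C0. unflat x \<in> N}"
  unfolding csub_def
proof (intro conjI ballI allI impI)
  have u0: "unflat (\<lambda>_. 0) = (\<lambda>_. 0)" by (auto simp: unflat_def zero_mps_def)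
  show "(\<lambda>_. 0) \<in> {x \<in> C0. unflat x \<in> N}" using N u0 by (auto simp: vsub_def intro: C0_finite_support)
  fix x assume x: "x \<in> {x \<in> C0. unflat x \<in> N}"
  show "(\<lambda>k. c * x k) \<in> {x \<in> C0. unflat x \<in> N}" for c
  proof -
    have "unflat (\<lambda>k. c * x k) = (\<lambda>i. const c * unflat x i)" by (auto intro!: ext mps_eqI)
    then show ?thesis using x N by (auto simp: vsub_def intro: C0_scale)
  qed
  fix y assume y: "y \<in> {x \<in> C0. unflat x \<in> N}"
  have "unflat (\<lambda>k. x k + y k) = (\<lambda>i. unflat x i + unflat y i)" by (auto intro!: ext mps_eqI)
  then show "(\<lambda>k. x k + y k) \<in> {x \<in> C0. unflat x \<in> N}" using x y N by (auto simp: vsub_def intro: C0_add)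
next
  fix L assume L: "L \<in> C0" "\<forall>\<epsilon>>0. \<exists>x\<in>{x \<in> C0. unflat x \<in> N}. \<forall>k. av (x k - L k) < \<epsilon>"
  have z: "L (i, \<nu>) = 0" if "i \<ge> n \<or> \<not> valid_idx s (lookup \<nu>)" for i \<nu>
  proof (rule eq_by_av)
    fix \<epsilon> :: real assume "\<epsilon> > 0"
    then obtain x where x: "x \<in> C0" "unflat x \<in> N" "av (x (i, \<nu>) - L (i, \<nu>)) < \<epsilon>" using L(2) by blast
    have "unflat x \<in> vecs n s" using x(2) N by (auto simp: vsub_def)
    then have "cf (unflat x i) \<nu> = 0" using that unfolding vecs_def T_def V_def by (metis (mono_tags, lifting) Int_iff cf_zero mem_Collect_eq)
    then show "av (L (i, \<nu>) - 0) < \<epsilon>" using x(3) by simp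
  qed
  have Lv: "unflat L \<in> vecs n s"
    unfolding vecs_def T_def V_def using unflat_C0[OF L(1)] z by (auto intro!: mps_eqI)
  have "\<exists>w\<in>N. \<forall>i. nrm (w i - unflat L i) < \<epsilon>" if e: "\<epsilon> > 0" for \<epsilon>
  proof -
    obtain x where x: "x \<in> C0" "unflat x \<in> N" "\<And>k. av (x k - L k) < \<epsilon>" using L(2) e by blast
    have "nrm (unflat x i - unflat L i) < \<epsilon>" for i
      using x(3) e by (intro nrm_less CC_diff unflat_C0 x(1) L(1)) auto
    then show ?thesis using x(2) by blast
  qed
  then show "L \<in> {x \<in> C0. unflat x \<in> N}" using N Lv L(1) unfolding vsub_def by blast
qed auto

lemma frobenius_descent_vec:
  assumes N: "vsub n s N" and st: "\<And>w. w \<in> N \<Longrightarrow> (\<lambda>i. tau (w i)) \<in> N" and Z: "vsub n s Z"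
    and fix_Z: "\<And>w. w \<in> N \<Longrightarrow> (\<And>i. tau (w i) = w i) \<Longrightarrow> w \<in> Z"
    and w: "w \<in> N"
  shows "w \<in> Z"
proof -
  have "{x \<in> C0. unflat x \<in> N} \<subseteq> {x \<in> C0. unflat x \<in> Z}"
  proof (rule frobenius_descent[OF csub_unflat[OF N] _ csub_unflat[OF Z]])
    fix x assume x: "x \<in> {x \<in> C0. unflat x \<in> N}"
    have "unflat (\<lambda>k. x k ^ q) = (\<lambda>i. tau (unflat x i))" by (auto intro!: ext mps_eqI)
    then show "(\<lambda>k. x k ^ q) \<in> {x \<in> C0. unflat x \<in> N}"
      using x st C0_power[of x q] q_ge_2 by auto
    assume "\<And>k. x k \<in> Fq q"
    then have "tau (unflat x i) = unflat x i" for i by (intro mps_eqI) (simp add: Fq_def)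
    then show "x \<in> {x \<in> C0. unflat x \<in> Z}" using x fix_Z by blast
  qed
  moreover have "w \<in> vecs n s" using N w by (auto simp: vsub_def)
  moreover have "unflat (\<lambda>(i, \<nu>). cf (w i) \<nu>) = w" by (auto intro!: ext mps_eqI)
  ultimately show ?thesis using flat_C0 w by force
qed

end

section \<open>Moore determinants\<close>

context cinf
begin

text \<open>Multiplication by a nonzero e scales the norm by \<open>nrm e\<close>. Approximate
  quotients therefore form a Cauchy sequence, whose limit is an exact quotient.\<close>

lemma T_ideal_closed:
  assumes e: "e \<in> T S" and x: "x \<in> T S" and app: "\<And>\<delta>. \<delta> > 0 \<Longrightarrow> \<exists>y\<in>T S. nrm (e * y - x) < \<delta>"
  shows "\<exists>y\<in>T S. x = e * y"
proof (cases "e = 0")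
  case True
  then have "nrm x < \<delta>" if "\<delta> > 0" for \<delta> using app[OF that] by auto
  then have "nrm x = 0" using nrm_nonneg[OF T_CC[OF x]] by (metis less_eq_real_def less_irrefl)
  then show ?thesis using nrm_eq_0_iff[OF T_CC[OF x]] by (intro bexI[of _ 0]) auto
next
  case False
  have ne: "nrm e > 0" using nrm_pos[OF T_CC[OF e] False] .
  have "\<exists>y\<in>T S. nrm (e * y - x) < 1 / real (Suc n)" for n by (rule app) simp
  then obtain y where y: "\<And>n. y n \<in> T S" "\<And>n. nrm (e * y n - x) < 1 / real (Suc n)" by metis
  have ey: "e * y n - x \<in> CC" for n using e x y by (intro CC_diff CC_mult T_CC)
  have "nrm (y (Suc n) - y n) \<le> (1 / real (Suc n)) / nrm e" for n
  proof -
    have "nrm e * nrm (y (Suc n) - y n) = nrm ((e * y (Suc n) - x) - (e * y n - x))"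
      using nrm_mult[OF T_CC[OF e] CC_diff[OF T_CC[OF y(1)] T_CC[OF y(1)]], of "Suc n" n] by (simp add: algebra_simps)
    also have "\<dots> \<le> 1 / real (Suc n)"
    proof (rule nrm_diff_le[OF ey ey])
      have "1 / real (Suc (Suc n)) \<le> 1 / real (Suc n)" by (simp add: frac_le)
      then show "nrm (e * y (Suc n) - x) \<le> 1 / real (Suc n)" using y(2)[of "Suc n"] by linarith
      show "nrm (e * y n - x) \<le> 1 / real (Suc n)" using y(2)[of n] by linarith
    qed
    finally show ?thesis using ne by (simp add: pos_le_divide_eq mult_ac)
  qed
  then have "(\<lambda>n. nrm (y (Suc n) - y n)) \<longlonglongrightarrow> 0"
    by (rule tendsto_0_le[OF nrm_nonneg[OF CC_diff[OF T_CC[OF y(1)] T_CC[OF y(1)]]] _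
          tendsto_divide_zero[OF inverse_Suc_tendsto_0]])
  then obtain z where z: "z \<in> T S" "nlim y z" using T_complete[of y S, OF y(1)] by blast
  have "nlim (\<lambda>n. e * y n) (e * z)" by (intro nlim_mult T_CC[OF y(1)] T_CC[OF z(1)] T_CC[OF e] z(2))
  moreover have "nlim (\<lambda>n. e * y n) x"
    unfolding nlim_def
    by (rule tendsto_0_le[OF nrm_nonneg[OF ey] _ inverse_Suc_tendsto_0]) (use y(2) in \<open>auto intro: less_imp_le\<close>)
  ultimately have "e * z = x"
    by (intro nlim_unique[of "\<lambda>n. e * y n"] CC_mult T_CC[OF e] T_CC[OF y(1)] T_CC[OF z(1)] T_CC[OF x])
  then show ?thesis using z(1) by blast
qed

text \<open>One form serves two purposes: with e = 0 it gives common kernels of linear forms, with e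
  nonzero the vectors on which the forms take values divisible by e. Closedness comes from
  \<open>T_ideal_closed\<close>.\<close>

lemma vsub_linear:
  assumes e: "e \<in> T S" and a: "\<And>j i. a j i \<in> T S"
  shows "vsub n S {v \<in> vecs n S. \<forall>j\<in>J. \<exists>y\<in>T S. (\<Sum>i<n. v i * a j i) = e * y}" (is "vsub n S ?N")
  unfolding vsub_def
proof (intro conjI ballI allI impI)
  show "(\<lambda>_. 0) \<in> ?N" by (auto simp: vecs_def intro!: bexI[of _ 0])
  show "(\<lambda>i. v i + w i) \<in> ?N" if v: "v \<in> ?N" and w: "w \<in> ?N" for v w
  proof -
    have "\<exists>y\<in>T S. (\<Sum>i<n. (v i + w i) * a j i) = e * y" if j: "j \<in> J" for j
    proof -
      obtain y z where "y \<in> T S" "z \<in> T S" "(\<Sum>i<n. v i * a j i) = e * y" "(\<Sum>i<n. w i * a j i) = e * z"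
        using v w j by blast
      then show ?thesis by (intro bexI[of _ "y + z"]) (auto simp: distrib_right distrib_left sum.distrib T_add)
    qed
    then show ?thesis using v w by (auto simp: vecs_def T_add)
  qed
  show "(\<lambda>i. const c * w i) \<in> ?N" if w: "w \<in> ?N" for c w
  proof -
    have "\<exists>y\<in>T S. (\<Sum>i<n. const c * w i * a j i) = e * y" if j: "j \<in> J" for j
    proof -
      obtain z where z: "z \<in> T S" "(\<Sum>i<n. w i * a j i) = e * z" using w j by blast
      have "(\<Sum>i<n. const c * w i * a j i) = e * (const c * z)"
        using arg_cong[OF z(2), of "\<lambda>z. const c * z"] by (simp add: sum_distrib_left mult_ac)
      then show ?thesis using z(1) T_mult T_const by blast
    qed
    then show ?thesis using w by (auto simp: vecs_def T_mult)
  qed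
  fix L assume L: "L \<in> vecs n S" "\<forall>\<epsilon>>0. \<exists>w\<in>?N. \<forall>i. nrm (w i - L i) < \<epsilon>"
  have LT: "L i \<in> T S" for i using L(1) by (auto simp: vecs_def)
  have "\<exists>y\<in>T S. (\<Sum>i<n. L i * a j i) = e * y" if j: "j \<in> J" for j
  proof (rule T_ideal_closed[OF e])
    show "(\<Sum>i<n. L i * a j i) \<in> T S" by (intro T_sum T_mult LT a)
    fix \<delta> :: real assume d: "\<delta> > 0"
    \<comment> \<open>A positive bound for all coefficients of the form. A vector within
      \<open>\<delta> / (2 * B)\<close> of L changes the value by at most \<delta>/2, which leaves a
      strict inequality.\<close>
    define B where "B = (\<Sum>i<n. nrm (a j i)) + 1"
    have sup_norm: "0 \<le> nrm (a j i)" for i by (rule nrm_nonneg[OF T_CC[OF a]])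
    have B: "B > 0" "\<And>i. i < n \<Longrightarrow> nrm (a j i) \<le> B"
    proof -
      show "B > 0" unfolding B_def using sum_nonneg[of "{..<n}" "\<lambda>i. nrm (a j i)"] sup_norm by (auto intro: add_nonneg_pos)
      show "nrm (a j i) \<le> B" if "i < n" for i
        unfolding B_def using member_le_sum[of i "{..<n}" "\<lambda>i. nrm (a j i)"] sup_norm that by auto
    qed
    obtain w where w: "w \<in> ?N" "\<And>i. nrm (w i - L i) < \<delta> / (2 * B)" 
    proof -
      have "\<delta> / (2 * B) > 0" using d B(1) by simp
      then show ?thesis using L(2) that by blast
    qed
    have wT: "w i \<in> T S" for i using w(1) by (auto simp: vecs_def)
    obtain y where y: "y \<in> T S" "(\<Sum>i<n. w i * a j i) = e * y" using w(1) j by blast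
    have "nrm (\<Sum>i<n. (w i - L i) * a j i) \<le> \<delta> / 2"
    proof (rule nrm_sum_le)
      fix i assume i: "i \<in> {..<n}"
      show "(w i - L i) * a j i \<in> CC" by (intro CC_mult CC_diff T_CC[OF wT] T_CC[OF LT] T_CC[OF a])
      have "nrm (w i - L i) * nrm (a j i) \<le> \<delta> / (2 * B) * B"
        using w(2)[of i] B i sup_norm[of i] d by (intro mult_mono) auto
      then show "nrm ((w i - L i) * a j i) \<le> \<delta> / 2"
        using B(1) by (simp add: nrm_mult[OF CC_diff[OF T_CC[OF wT] T_CC[OF LT]] T_CC[OF a]])
    qed (use d in simp)
    moreover have "(\<Sum>i<n. (w i - L i) * a j i) = e * y - (\<Sum>i<n. L i * a j i)"
      unfolding y(2)[symmetric] by (simp add: left_diff_distrib sum_subtractf)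
    ultimately show "\<exists>y\<in>T S. nrm (e * y - (\<Sum>i<n. L i * a j i)) < \<delta>" using y(1) d by (intro bexI[of _ y]) auto
  qed
  then show "L \<in> ?N" using L(1) by blast
qed blast

lemma T_nonempty: "\<exists>y. y \<in> T S"
  using T_0 by blast

definition indep :: "nat \<Rightarrow> nat \<Rightarrow> (nat \<Rightarrow> 'a mps) \<Rightarrow> bool" where
  "indep S n g \<longleftrightarrow> (\<forall>c. (\<forall>i<n. c i \<in> T S \<and> tau (c i) = c i) \<longrightarrow> (\<Sum>i<n. c i * g i) = 0 \<longrightarrow> (\<forall>i<n. c i = 0))"

lemma indepD: "indep S n g \<Longrightarrow> (\<And>i. i < n \<Longrightarrow> c i \<in> T S) \<Longrightarrow> (\<And>i. i < n \<Longrightarrow> tau (c i) = c i) \<Longrightarrow> (\<Sum>i<n. c i * g i) = 0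
    \<Longrightarrow> i < n \<Longrightarrow> c i = 0"
  unfolding indep_def by blast

lemma indep_Suc:
  assumes "indep S (Suc n) g" shows "indep S n g"
  unfolding indep_def
proof (intro allI impI)
  fix c i assume c: "\<forall>i<n. c i \<in> T S \<and> tau (c i) = c i" "(\<Sum>i<n. c i * g i) = 0" and i: "i < n"
  define c' where "c' i = (if i < n then c i else 0)" for i
  have "c' i = 0" 
  proof (rule indepD[OF assms])
    show "(\<Sum>i<Suc n. c' i * g i) = 0" using c(2) by (simp add: c'_def)
  qed (use c i in \<open>auto simp: c'_def\<close>)
  then show "c i = 0" using i by (simp add: c'_def)
qed

lemma indep_tau:
  assumes "indep S n g" shows "indep S n (\<lambda>i. tau (g i))"
  unfolding indep_def
proof (intro allI impI)
  fix c i assume c: "\<forall>i<n. c i \<in> T S \<and> tau (c i) = c i" "(\<Sum>i<n. c i * tau (g i)) = 0" and i: "i < n"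
  have "tau (\<Sum>i<n. c i * g i) = (\<Sum>i<n. c i * tau (g i))" using c(1) by (simp add: tau_sum tau_mult)
  then have "(\<Sum>i<n. c i * g i) = 0" using c(2) tau_inj by simp
  then show "c i = 0" using indepD[OF assms, of c i] c(1) i by blast
qed

text \<open>Over a field one would divide a kernel vector w by its last entry and find a
  Frobenius-fixed relation. Here division is replaced by descent: the induction hypothesis makes tau
  w proportional to w, so the vectors proportional to w form a Frobenius-stable space; a fixed
  vector in it is a relation among the g i with fixed coefficients and vanishes by independence;
  hence the space, and w with it, is 0.\<close>

lemma moore_kernel:
  assumes "\<And>i. i < n \<Longrightarrow> g i \<in> T S" "indep S n g" "\<And>i. i < n \<Longrightarrow> w i \<in> T S"
    and "\<And>j. j < n \<Longrightarrow> (\<Sum>i<n. w i * (tau ^^ j) (g i)) = 0" and "i < n"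
  shows "w i = 0"
  using assms
proof (induction n arbitrary: g w i)
  case (Suc n)
  note g = Suc(2) and ind = Suc(3) and w = Suc(4) and ker = Suc(5)
  show ?case
  proof (cases "w n = 0")
    case True
    have "w i = 0" if "i < n" for i
    proof (rule Suc.IH[of g])
      show "(\<Sum>i<n. w i * (tau ^^ j) (g i)) = 0" if "j < n" for j using ker[of j] True that by simp
    qed (use g w that indep_Suc[OF ind] in auto)
    then show ?thesis using True Suc(6) by (metis less_SucE)
  next
    case False
    \<comment> \<open>The last entry cancels, and u is a kernel vector for the twisted functions:
      tau carries the relation with index j to a relation for tau w with index j + 1.\<close>
    define u where "u i = w n * tau (w i) - tau (w n) * w i" for i
    have uT: "u i \<in> T S" if "i < Suc n" for i unfolding u_def using w that by (intro T_diff T_mult T_tau) auto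
    have un: "u n = 0" by (simp add: u_def)
    have "u i = 0" if "i < n" for i
    proof (rule Suc.IH[of "\<lambda>i. tau (g i)"])
      show "(\<Sum>i<n. u i * (tau ^^ j) (tau (g i))) = 0" if j: "j < n" for j
      proof -
        have s1: "(\<Sum>i<Suc n. tau (w i) * (tau ^^ Suc j) (g i)) = 0"
          using arg_cong[OF ker[of j], of tau] j by (simp add: tau_sum tau_mult tau_add)
        have s2: "(\<Sum>i<Suc n. w i * (tau ^^ Suc j) (g i)) = 0" by (rule ker) (use j in simp)
        have "(\<Sum>i<n. u i * (tau ^^ j) (tau (g i))) = (\<Sum>i<Suc n. u i * (tau ^^ Suc j) (g i))"
          by (simp add: un funpow_swap1)
        also have "\<dots> = w n * (\<Sum>i<Suc n. tau (w i) * (tau ^^ Suc j) (g i)) - tau (w n) * (\<Sum>i<Suc n. w i * (tau ^^ Suc j) (g i))"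
          unfolding u_def left_diff_distrib sum_subtractf sum_distrib_left mult.assoc ..
        finally show ?thesis unfolding s1 s2 by simp
      qed
      show "indep S n (\<lambda>i. tau (g i))" by (rule indep_tau[OF indep_Suc[OF ind]])
    qed (use g uT that in \<open>auto intro: T_tau\<close>)
    then have u0: "w n * tau (w i) = tau (w n) * w i" if "i < Suc n" for i
      using that un by (cases "i = n") (auto simp: u_def)
    \<comment> \<open>Chosen so that pairing with v gives v j * w n - v n * w j, which states
      proportionality as a linear condition. The value 0 for j beyond n is set below because
      \<open>vsub_linear\<close> asks for coefficients in the Tate algebra at all indices.\<close>
    define e where "e j i = (if i = j then w n else 0) - (if i = n then w j else 0)" for i j
    define N where "N = {v \<in> vecs (Suc n) S. \<forall>j\<in>{..n}. \<exists>y\<in>T S. (\<Sum>i<Suc n. v i * (if j \<le> n then e j i else 0)) = 0 * y}"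
    define Z where "Z = {v \<in> vecs (Suc n) S. \<forall>j\<in>{..n}. \<exists>y\<in>T S. (\<Sum>i<Suc n. v i * (if i = j then 1 else 0)) = 0 * y}"
    have esum: "(\<Sum>i<Suc n. v i * (if j \<le> n then e j i else 0)) = v j * w n - v n * w j" if "j \<le> n" for v j
    proof -
      have "(\<Sum>i<Suc n. v i * (if j \<le> n then e j i else 0))
          = (\<Sum>i<Suc n. if i = j then v i * w n else 0) - (\<Sum>i<Suc n. if i = n then v i * w j else 0)"
        unfolding sum_subtractf[symmetric] e_def using that by (intro sum.cong) (auto simp: right_diff_distrib)
      also have "\<dots> = v j * w n - v n * w j" using that by (simp add: less_Suc_eq_le del: sum.lessThan_Suc)
      finally show ?thesis .
    qed
    have dsum: "(\<Sum>i<Suc n. v i * (if i = j then 1 else 0)) = v j" if "j \<le> n" for v :: "nat \<Rightarrow> 'a mps" and j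
    proof -
      have "(\<Sum>i<Suc n. v i * (if i = j then 1 else 0)) = (\<Sum>i<Suc n. if i = j then v i else 0)" 
        by (intro sum.cong) auto
      then show ?thesis using that by (simp add: less_Suc_eq_le del: sum.lessThan_Suc)
    qed
    have Nmem: "v \<in> N \<longleftrightarrow> v \<in> vecs (Suc n) S \<and> (\<forall>j\<le>n. v j * w n = v n * w j)" for v
      unfolding N_def using esum[of _ v] T_nonempty by (auto simp del: sum.lessThan_Suc)
    have Zmem: "v \<in> Z \<longleftrightarrow> v \<in> vecs (Suc n) S \<and> (\<forall>j\<le>n. v j = 0)" for v
      unfolding Z_def using dsum[of _ v] T_nonempty by (auto simp del: sum.lessThan_Suc)
    define w' where "w' i = (if i < Suc n then w i else 0)" for i
    have w'v: "w' \<in> vecs (Suc n) S" using w by (auto simp: vecs_def w'_def)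
    have wnT: "w n \<in> T S" using w by simp
    have "w' \<in> Z"
    proof (rule frobenius_descent_vec)
      show "vsub (Suc n) S N" unfolding N_def
        by (rule vsub_linear) (use w wnT in \<open>auto simp: e_def intro!: T_diff T_uminus\<close>)
      show "vsub (Suc n) S Z" unfolding Z_def by (rule vsub_linear) auto
      show "w' \<in> N" unfolding Nmem using w'v by (simp add: w'_def mult.commute)
      show "(\<lambda>i. tau (v i)) \<in> N" if v: "v \<in> N" for v
      proof -
        have vT: "v i \<in> T S" for i using v by (auto simp: N_def vecs_def)
        \<comment> \<open>Twisting the proportionality of v gives one with tau w; \<open>u0\<close>
          turns it back into one with w after the nonzero factor tau (w n) is cancelled.\<close>
        have "tau (v j) * w n = tau (v n) * w j" if j: "j \<le> n" for j
        proof (rule CC_mult_cancel[of "tau (w n)"])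
          have "v j * w n = v n * w j" using v j unfolding Nmem by blast
          then have "tau (v j) * tau (w n) = tau (v n) * tau (w j)" by (metis tau_mult)
          then have "tau (w n) * (tau (v j) * w n) = tau (v n) * (w n * tau (w j))" by (simp add: mult_ac)
          also have "\<dots> = tau (w n) * (tau (v n) * w j)" using u0[of j] j by (simp add: mult_ac)
          finally show "tau (w n) * (tau (v j) * w n) = tau (w n) * (tau (v n) * w j)" .
          show "tau (w n) \<noteq> 0" using False tau_inj by blast
        qed (use vT w j in \<open>auto intro!: T_CC[of _ S] T_mult T_tau\<close>)
        moreover have "(\<lambda>i. tau (v i)) \<in> vecs (Suc n) S" using v by (auto simp: N_def vecs_def T_tau)
        ultimately show ?thesis unfolding Nmem by blast
      qed
      fix v assume v: "v \<in> N" "\<And>i. tau (v i) = v i"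
      have vT: "v i \<in> T S" for i using v by (auto simp: N_def vecs_def)
      have "w n * (\<Sum>i<Suc n. v i * g i) = (\<Sum>i<Suc n. (v i * w n) * g i)"
        by (simp add: sum_distrib_left mult_ac distrib_left)
      also have "\<dots> = (\<Sum>i<Suc n. (v n * w i) * g i)" using v(1) unfolding Nmem by (intro sum.cong) auto
      also have "\<dots> = v n * (\<Sum>i<Suc n. w i * (tau ^^ 0) (g i))" by (simp add: sum_distrib_left mult_ac distrib_left)
      also have "\<dots> = 0" using ker[of 0] by simp
      finally have "w n * (\<Sum>i<Suc n. v i * g i) = 0" .
      moreover have "(\<Sum>i<Suc n. v i * g i) \<in> T S" using vT g by (intro T_sum T_mult) auto
      ultimately have "(\<Sum>i<Suc n. v i * g i) = 0" using CC_mult_eq_0[of "w n"] False wnT T_CC by blast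
      then have "v i = 0" if "i < Suc n" for i using indepD[OF ind, of v i] vT v(2) that by blast
      then show "v \<in> Z" unfolding Zmem using v(1) by (auto simp: N_def)
    qed
    then have "w n = 0" unfolding Zmem by (auto simp: w'_def)
    then show ?thesis using False by blast
  qed
qed simp

section \<open>Determinant and inverse of the Moore matrix\<close>

lemma T_det:
  assumes "A \<in> carrier_mat n n" "\<And>i j. i < n \<Longrightarrow> j < n \<Longrightarrow> A $$ (i, j) \<in> T S"
  shows "det A \<in> T S"
proof -
  have "signof p \<in> T S" for p :: "nat \<Rightarrow> nat"
    by (cases "sign p = 1") (auto simp: sign_def T_uminus)
  moreover have "p i < n" if "p permutes {0..<n}" "i < n" for p i
    using permutes_in_image[OF that(1), of i] that(2) by simp
  ultimately show ?thesis unfolding det_def'[OF assms(1)] using assms(2)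
    by (intro T_sum T_mult T_prod) auto
qed

definition moore :: "nat \<Rightarrow> (nat \<Rightarrow> 'a mps) \<Rightarrow> 'a mps mat" where
  "moore n g = mat n n (\<lambda>(j, i). (tau ^^ j) (g i))"

lemma moore_carrier: "moore n g \<in> carrier_mat n n"
  by (simp add: moore_def)

lemma adj_mat_T:
  assumes A: "A \<in> carrier_mat n n" "\<And>i j. i < n \<Longrightarrow> j < n \<Longrightarrow> A $$ (i, j) \<in> T S" and ij: "i < n" "j < n"
  shows "adj_mat A $$ (i, j) \<in> T S"
proof -
  have "det (mat_delete A j i) \<in> T S"
  proof (rule T_det)
    show "mat_delete A j i \<in> carrier_mat (n - 1) (n - 1)" using mat_delete_carrier[OF A(1)] .
    fix k l assume kl: "k < n - 1" "l < n - 1"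
    then show "mat_delete A j i $$ (k, l) \<in> T S"
      using A by (auto simp: mat_delete_def intro!: A(2))
  qed
  moreover have "(- 1) ^ (j + i) \<in> T S" by (intro T_power T_uminus T_1)
  ultimately show ?thesis using A(1) ij by (simp add: adj_mat_def cofactor_def T_mult)
qed

lemma adj_mat_sums:
  assumes A: "A \<in> carrier_mat n n" and jk: "j < n" "k < n"
  shows "(\<Sum>i<n. A $$ (j, i) * adj_mat A $$ (i, k)) = (if j = k then det A else 0)"
    "(\<Sum>i<n. adj_mat A $$ (j, i) * A $$ (i, k)) = (if j = k then det A else 0)"
proof -
  have c: "adj_mat A \<in> carrier_mat n n" using adj_mat(1)[OF A] .
  have "(A * adj_mat A) $$ (j, k) = (\<Sum>i<n. A $$ (j, i) * adj_mat A $$ (i, k))"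
    using A c jk by (auto simp: times_mat_def scalar_prod_def lessThan_atLeast0)
  moreover have "(A * adj_mat A) $$ (j, k) = (if j = k then det A else 0)"
    unfolding adj_mat(2)[OF A] using jk by auto
  ultimately show "(\<Sum>i<n. A $$ (j, i) * adj_mat A $$ (i, k)) = (if j = k then det A else 0)"
    by simp
  have "(adj_mat A * A) $$ (j, k) = (\<Sum>i<n. adj_mat A $$ (j, i) * A $$ (i, k))"
    using A c jk by (auto simp: times_mat_def scalar_prod_def lessThan_atLeast0)
  moreover have "(adj_mat A * A) $$ (j, k) = (if j = k then det A else 0)"
    unfolding adj_mat(3)[OF A] using jk by auto
  ultimately show "(\<Sum>i<n. adj_mat A $$ (j, i) * A $$ (i, k)) = (if j = k then det A else 0)"
    by simp
qed

text \<open>If the determinant vanished, the last column of the adjugate would lie in the kernel.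
  Its last entry is the Moore determinant of one size less, nonzero by induction, against
  \<open>moore_kernel\<close>.\<close>

lemma moore_det_nonzero:
  assumes "\<And>i. i < n \<Longrightarrow> g i \<in> T S" "indep S n g"
  shows "det (moore n g) \<noteq> 0"
  using assms
proof (induction n)
  case 0
  then show ?case by (simp add: moore_def)
next
  case (Suc n)
  let ?A = "moore (Suc n) g"
  have AT: "i < Suc n \<Longrightarrow> j < Suc n \<Longrightarrow> ?A $$ (i, j) \<in> T S" for i j
    using Suc(2) by (simp add: moore_def T_taun)
  show ?case
  proof
    assume d: "det ?A = 0"
    define w where "w i = adj_mat ?A $$ (i, n)" for i
    have "w n = 0"
    proof (rule moore_kernel[OF Suc(2,3)])
      show "w i \<in> T S" if "i < Suc n" for i unfolding w_def using adj_mat_T[OF moore_carrier AT] that by blast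
      show "(\<Sum>i<Suc n. w i * (tau ^^ j) (g i)) = 0" if j: "j < Suc n" for j
      proof -
        have "(\<Sum>i<Suc n. w i * (tau ^^ j) (g i)) = (\<Sum>i<Suc n. ?A $$ (j, i) * adj_mat ?A $$ (i, n))"
          using j by (intro sum.cong) (auto simp: w_def moore_def)
        also have "\<dots> = 0" using adj_mat_sums(1)[OF moore_carrier j, of n g] d by simp
        finally show ?thesis .
      qed
    qed auto
    moreover have "mat_delete ?A n n = moore n g"
      unfolding mat_delete_def moore_def by (intro eq_matI) auto
    then have "w n = det (moore n g)"
      using moore_carrier[of "Suc n" g] by (simp add: w_def adj_mat_def cofactor_def)
    moreover have "det (moore n g) \<noteq> 0" using Suc.IH Suc(2) indep_Suc[OF Suc(3)] by simp
    ultimately show False by simp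
  qed
qed

sublocale tau: comm_ring_hom tau
  by unfold_locales (simp_all add: tau_add tau_mult)

text \<open>The matrix that turns the difference equation of order r into a system of first order:
  the Moore matrix M of solutions satisfies tau M = \<Theta> M. The parameter b takes the place of
  the coefficient with index 0.\<close>

definition companion :: "nat \<Rightarrow> 'a mps \<Rightarrow> (nat \<Rightarrow> 'a mps) \<Rightarrow> 'a mps mat" where
  "companion r b a = mat r r (\<lambda>(j, l). if Suc j < r then (if l = Suc j then 1 else 0) else if l = 0 then b else a l)"

lemma det_companion:
  assumes r: "r \<ge> 1" shows "det (companion r b a) = (- 1) ^ (r - 1) * b"
proof -
  have c: "companion r b a \<in> carrier_mat r r" by (simp add: companion_def)
  have "det (companion r b a) = (\<Sum>i<r. companion r b a $$ (i, 0) * cofactor (companion r b a) i 0)"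
    by (rule laplace_expansion_column[OF c]) (use r in simp)
  also have "\<dots> = (\<Sum>i<r. if i = r - 1 then b * cofactor (companion r b a) (r - 1) 0 else 0)"
    using r by (intro sum.cong) (auto simp: companion_def)
  also have "\<dots> = b * cofactor (companion r b a) (r - 1) 0" using r by simp
  also have "mat_delete (companion r b a) (r - 1) 0 = 1\<^sub>m (r - 1)"
    unfolding mat_delete_def companion_def by (intro eq_matI) auto
  then have "cofactor (companion r b a) (r - 1) 0 = (- 1) ^ (r - 1)" by (simp add: cofactor_def)
  finally show ?thesis by (simp add: mult.commute)
qed

lemma neg_one_power_unit: "((- 1) ^ n :: 'a mps) * (- 1) ^ n = 1"
  by (simp add: power_mult_distrib[symmetric])

text \<open>The Moore determinant is a unit times a Frobenius-fixed element e. Vectors that the Moore matrix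
  maps into the ideal of e form a Frobenius-stable space, whose fixed points are divisible by e because
  the given solutions form a basis; so the adjugate is divisible by e and the matrix is invertible.\<close>

lemma moore_invertible:
  assumes r: "r \<ge> 1" and A: "\<And>k. A k \<in> T S" and Ar: "Ar' \<in> T S" "A r * Ar' = 1"
    and x: "x \<in> T S" "x' \<in> T S" "x * x' = 1"
    and g: "\<And>i. i < r \<Longrightarrow> g i \<in> T S" and ind: "indep S r g"
    and eq: "\<And>i. i < r \<Longrightarrow> (\<Sum>k=1..r. A k * (tau ^^ k) (g i)) = x * g i"
    and gen: "\<And>h. h \<in> T S \<Longrightarrow> (\<Sum>k=1..r. A k * (tau ^^ k) h) = x * h \<Longrightarrow>
      \<exists>d. (\<forall>i<r. d i \<in> T S \<and> tau (d i) = d i) \<and> h = (\<Sum>i<r. d i * g i)"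
  shows "\<exists>B. (\<forall>i j. B i j \<in> T S)
    \<and> (\<forall>j<r. \<forall>k<r. (\<Sum>i<r. (tau ^^ j) (g i) * B i k) = (if j = k then 1 else 0))
    \<and> (\<forall>j<r. \<forall>k<r. (\<Sum>i<r. B j i * (tau ^^ i) (g k)) = (if j = k then 1 else 0))"
proof -
  let ?M = "moore r g"
  define \<psi> where "\<psi> = det ?M"
  have MT: "i < r \<Longrightarrow> j < r \<Longrightarrow> ?M $$ (i, j) \<in> T S" for i j using g by (simp add: moore_def T_taun)
  have psiT: "\<psi> \<in> T S" unfolding \<psi>_def using T_det[OF moore_carrier MT] .
  have psi0: "\<psi> \<noteq> 0" unfolding \<psi>_def by (rule moore_det_nonzero[OF g ind])
  define \<Theta> where "\<Theta> = companion r (Ar' * x) (\<lambda>l. - (Ar' * A l))"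
  define \<kappa> where "\<kappa> = (- 1) ^ (r - 1) * (Ar' * x)"
  define \<kappa>' where "\<kappa>' = (- 1) ^ (r - 1) * (A r * x')"
  have kT: "\<kappa> \<in> T S" "\<kappa>' \<in> T S" unfolding \<kappa>_def \<kappa>'_def by (intro T_mult T_power T_uminus T_1 Ar x A)+
  have kk: "\<kappa> * \<kappa>' = 1"
  proof -
    have "\<kappa> * \<kappa>' = ((- 1) ^ (r - 1) * (- 1) ^ (r - 1)) * ((A r * Ar') * (x * x'))"
      unfolding \<kappa>_def \<kappa>'_def by (simp only: mult_ac)
    then show ?thesis using neg_one_power_unit Ar x by simp
  qed
  have top: "(tau ^^ r) (g i) = Ar' * x * g i + (\<Sum>l=1..<r. - (Ar' * A l) * (tau ^^ l) (g i))" if i: "i < r" for i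
  proof -
    have "{1..r} = insert r {1..<r}" using r by auto
    then have "A r * (tau ^^ r) (g i) = x * g i - (\<Sum>l=1..<r. A l * (tau ^^ l) (g i))"
      using eq[OF i] by (simp add: algebra_simps)
    then have "Ar' * (A r * (tau ^^ r) (g i)) = Ar' * (x * g i - (\<Sum>l=1..<r. A l * (tau ^^ l) (g i)))" by simp
    then have "(A r * Ar') * (tau ^^ r) (g i) = Ar' * x * g i - (\<Sum>l=1..<r. (Ar' * A l) * (tau ^^ l) (g i))"
      by (simp add: right_diff_distrib sum_distrib_left mult_ac)
    then show ?thesis using Ar by (simp add: sum_negf)
  qed
  have "map_mat tau ?M = \<Theta> * ?M"
  proof (rule eq_matI)
    fix j i assume "j < dim_row (\<Theta> * ?M)" "i < dim_col (\<Theta> * ?M)"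
    then have ji: "j < r" "i < r" by (auto simp: \<Theta>_def companion_def moore_def)
    have "(\<Theta> * ?M) $$ (j, i) = (\<Sum>l<r. \<Theta> $$ (j, l) * (tau ^^ l) (g i))"
      using ji by (auto simp: \<Theta>_def companion_def moore_def times_mat_def scalar_prod_def lessThan_atLeast0 intro!: sum.cong)
    also have "\<dots> = (tau ^^ Suc j) (g i)"
    proof (cases "Suc j < r")
      case True
      have "(\<Sum>l<r. \<Theta> $$ (j, l) * (tau ^^ l) (g i)) = (\<Sum>l<r. if l = Suc j then (tau ^^ Suc j) (g i) else 0)"
        using ji True by (intro sum.cong) (auto simp: \<Theta>_def companion_def)
      then show ?thesis using True by simp
    next
      case False
      then have j: "Suc j = r" using ji by simp
      have "{..<r} = insert 0 {1..<r}" using r by auto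
      then have "(\<Sum>l<r. \<Theta> $$ (j, l) * (tau ^^ l) (g i)) = \<Theta> $$ (j, 0) * g i + (\<Sum>l=1..<r. \<Theta> $$ (j, l) * (tau ^^ l) (g i))"
        by simp
      also have "\<dots> = Ar' * x * g i + (\<Sum>l=1..<r. - (Ar' * A l) * (tau ^^ l) (g i))"
        using ji False by (auto simp: \<Theta>_def companion_def intro!: sum.cong)
      finally show ?thesis using top[OF ji(2)] j by simp
    qed
    finally show "map_mat tau ?M $$ (j, i) = (\<Theta> * ?M) $$ (j, i)" using ji by (simp add: moore_def)
  qed (auto simp: \<Theta>_def companion_def moore_def)
  then have "tau \<psi> = det (\<Theta> * ?M)" unfolding \<psi>_def by (simp add: tau.hom_det[symmetric])
  also have "\<dots> = det \<Theta> * \<psi>" unfolding \<psi>_def by (rule det_mult[of _ r]) (auto simp: \<Theta>_def companion_def moore_def)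
  finally have tpsi: "tau \<psi> = \<kappa> * \<psi>" unfolding \<Theta>_def \<kappa>_def det_companion[OF r] .
  obtain y y' where y: "y \<in> T S" "y' \<in> T S" "y * y' = 1" "tau y = \<kappa> * y" using unit_frobenius_equation[OF kT kk] by blast
  \<comment> \<open>Both \<psi> and the unit y solve tau z = \<kappa> z, so their quotient is fixed
    by Frobenius.\<close>
  define e where "e = \<psi> * y'"
  have eT: "e \<in> T S" unfolding e_def by (intro T_mult psiT y)
  have psi_e: "\<psi> = e * y" unfolding e_def using y(3) by (simp add: mult.assoc mult.commute[of y'])
  have e0: "e \<noteq> 0" using psi0 psi_e by auto
  have te: "tau e = e"
  proof -
    have 1: "\<kappa> * y * tau y' = 1" using arg_cong[OF y(3), of tau] by (simp add: tau_mult y(4))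
    have "tau e = (\<kappa> * \<psi>) * tau y' * (y * y')" unfolding e_def by (simp add: tau_mult tpsi y(3))
    also have "\<dots> = \<psi> * y' * (\<kappa> * y * tau y')" by (simp only: mult_ac)
    finally show ?thesis using 1 by (simp add: e_def)
  qed
  have ten: "(tau ^^ k) e = e" for k by (rule taun_fixed[OF te])
  have canc: "a = b" if "e * a = e * b" "a \<in> T S" "b \<in> T S" for a b
    using CC_mult_cancel[OF T_CC[OF eT] T_CC[OF that(2)] T_CC[OF that(3)] e0 that(1)] .
  define N where "N = {v \<in> vecs r S. \<forall>j\<in>{..<r}. \<exists>h\<in>T S. (\<Sum>i<r. v i * (if i < r then (tau ^^ j) (g i) else 0)) = e * h}"
  define Z where "Z = {v \<in> vecs r S. \<forall>j\<in>{..<r}. \<exists>h\<in>T S. (\<Sum>i<r. v i * (if i = j then 1 else 0)) = e * h}"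
  have Nmem: "v \<in> N \<longleftrightarrow> v \<in> vecs r S \<and> (\<forall>j<r. \<exists>h\<in>T S. (\<Sum>i<r. v i * (tau ^^ j) (g i)) = e * h)" for v
    unfolding N_def by auto
  have Zmem: "v \<in> Z \<longleftrightarrow> v \<in> vecs r S \<and> (\<forall>j<r. \<exists>h\<in>T S. v j = e * h)" for v
  proof -
    have "(\<Sum>i<r. v i * (if i = j then 1 else 0)) = v j" if "j < r" for j
    proof -
      have "(\<Sum>i<r. v i * (if i = j then 1 else 0)) = (\<Sum>i<r. if i = j then v i else 0)" by (intro sum.cong) auto
      then show ?thesis using that by simp
    qed
    then show ?thesis unfolding Z_def by auto
  qed
  have NZ: "v \<in> Z" if "v \<in> N" for v
  proof (rule frobenius_descent_vec[OF _ _ _ _ that])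
    show "vsub r S N" unfolding N_def by (rule vsub_linear[OF eT]) (use g in \<open>auto intro: T_taun\<close>)
    show "vsub r S Z" unfolding Z_def by (rule vsub_linear[OF eT]) auto
  next
    fix v assume v: "v \<in> N"
    have vv: "v \<in> vecs r S" using v Nmem by blast
    have "\<exists>h\<in>T S. (\<Sum>i<r. tau (v i) * (tau ^^ k) (g i)) = e * h" if k: "1 \<le> k" "k \<le> r" for k
    proof -
      obtain j where j: "k = Suc j" "j < r" using k by (cases k) auto
      obtain h where h: "h \<in> T S" "(\<Sum>i<r. v i * (tau ^^ j) (g i)) = e * h" using v j(2) unfolding Nmem by blast
      have "(\<Sum>i<r. tau (v i) * (tau ^^ k) (g i)) = tau (\<Sum>i<r. v i * (tau ^^ j) (g i))"
        unfolding j(1) by (simp add: tau_sum tau_mult)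
      also have "\<dots> = e * tau h" unfolding h(2) tau_mult te ..
      finally show ?thesis using T_tau[OF h(1)] by blast
    qed
    then have "\<forall>k\<in>{1..r}. \<exists>h. h \<in> T S \<and> (\<Sum>i<r. tau (v i) * (tau ^^ k) (g i)) = e * h"
      by (metis atLeastAtMost_iff)
    then obtain H where HH: "\<forall>k\<in>{1..r}. H k \<in> T S \<and> (\<Sum>i<r. tau (v i) * (tau ^^ k) (g i)) = e * H k"
      using bchoice by meson
    then have H: "\<And>k. 1 \<le> k \<Longrightarrow> k \<le> r \<Longrightarrow> H k \<in> T S"
      "\<And>k. 1 \<le> k \<Longrightarrow> k \<le> r \<Longrightarrow> (\<Sum>i<r. tau (v i) * (tau ^^ k) (g i)) = e * H k"
      by auto
    \<comment> \<open>Twisting shifts the row conditions for v to the rows 1, ..., r of tau v. The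
      missing row 0 is recovered from the difference equation, after division by the unit x.\<close>
    have "x' * (\<Sum>i<r. tau (v i) * (x * g i)) = (x * x') * (\<Sum>i<r. tau (v i) * g i)"
      by (simp add: sum_distrib_left mult_ac)
    then have "(\<Sum>i<r. tau (v i) * g i) = x' * (\<Sum>i<r. tau (v i) * (x * g i))"
      using x(3) by simp
    also have "(\<Sum>i<r. tau (v i) * (x * g i)) = (\<Sum>i<r. \<Sum>k=1..r. A k * (tau (v i) * (tau ^^ k) (g i)))"
      by (intro sum.cong refl) (simp add: eq[symmetric] sum_distrib_left mult_ac)
    also have "\<dots> = (\<Sum>k=1..r. A k * (\<Sum>i<r. tau (v i) * (tau ^^ k) (g i)))"
      by (subst sum.swap) (simp add: sum_distrib_left)
    also have "\<dots> = (\<Sum>k=1..r. A k * (e * H k))"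
      by (intro sum.cong refl) (simp add: H(2))
    also have "\<dots> = e * (\<Sum>k=1..r. A k * H k)"
      by (simp add: sum_distrib_left mult_ac)
    finally have "(\<Sum>i<r. tau (v i) * g i) = e * (x' * (\<Sum>k=1..r. A k * H k))" by (simp add: mult_ac)
    moreover have "x' * (\<Sum>k=1..r. A k * H k) \<in> T S" using H(1) by (intro T_mult x T_sum A) auto
    ultimately have z: "\<exists>h\<in>T S. (\<Sum>i<r. tau (v i) * (tau ^^ 0) (g i)) = e * h" by auto
    have "\<exists>h\<in>T S. (\<Sum>i<r. tau (v i) * (tau ^^ j) (g i)) = e * h" if "j < r" for j
    proof (cases "j = 0")
      case True then show ?thesis using z by simp
    next
      case False then show ?thesis using H[of j] that by auto
    qed
    moreover have "(\<lambda>i. tau (v i)) \<in> vecs r S" using vv by (auto simp: vecs_def T_tau)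
    ultimately show "(\<lambda>i. tau (v i)) \<in> N" unfolding Nmem by blast
  next
    fix v assume v: "v \<in> N" "\<And>i. tau (v i) = v i"
    have vT: "v i \<in> T S" for i using v(1) by (auto simp: Nmem vecs_def)
    obtain h where h: "h \<in> T S" "(\<Sum>i<r. v i * (tau ^^ 0) (g i)) = e * h" using v(1) r unfolding Nmem by fastforce
    then have h2: "(\<Sum>i<r. v i * g i) = e * h" by simp
    \<comment> \<open>Since e and the v i are fixed, the quotient h of the combination of the g i by
      e solves the equation again. It is then a combination of the g i with fixed coefficients d i,
      and independence gives v i = e * d i.\<close>
    have "(\<Sum>k=1..r. A k * (tau ^^ k) h) = x * h"
    proof (rule canc)
      have "e * (\<Sum>k=1..r. A k * (tau ^^ k) h) = (\<Sum>k=1..r. A k * (tau ^^ k) (e * h))"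
        by (simp add: taun_mult ten sum_distrib_left mult_ac)
      also have "\<dots> = (\<Sum>k=1..r. \<Sum>i<r. v i * (A k * (tau ^^ k) (g i)))"
        unfolding h2[symmetric] by (simp add: taun_sum taun_mult taun_fixed[OF v(2)] sum_distrib_left mult_ac)
      also have "\<dots> = (\<Sum>i<r. v i * (\<Sum>k=1..r. A k * (tau ^^ k) (g i)))"
        by (subst sum.swap) (simp add: sum_distrib_left)
      also have "\<dots> = (\<Sum>i<r. v i * (x * g i))" using eq by simp
      also have "\<dots> = x * (\<Sum>i<r. v i * g i)" by (simp add: sum_distrib_left mult_ac)
      finally show "e * (\<Sum>k=1..r. A k * (tau ^^ k) h) = e * (x * h)" unfolding h2 by (simp add: mult_ac)
    qed (intro T_sum T_mult A T_taun h x)+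
    then obtain d where d: "\<And>i. i < r \<Longrightarrow> d i \<in> T S" "\<And>i. i < r \<Longrightarrow> tau (d i) = d i" "h = (\<Sum>i<r. d i * g i)"
      using gen[OF h(1)] by blast
    have "v i - e * d i = 0" if "i < r" for i
    proof (rule indepD[OF ind _ _ _ that])
      have "(\<Sum>i<r. e * d i * g i) = e * h" unfolding d(3) by (simp add: sum_distrib_left mult_ac)
      then show "(\<Sum>i<r. (v i - e * d i) * g i) = 0" using h2 by (simp add: left_diff_distrib sum_subtractf)
    qed (use vT d eT te v(2) in \<open>auto intro!: T_diff T_mult simp: tau_diff tau_mult\<close>)
    then show "v \<in> Z" unfolding Zmem using d v(1) unfolding Nmem by auto
  qed
  have adjT: "i < r \<Longrightarrow> k < r \<Longrightarrow> adj_mat ?M $$ (i, k) \<in> T S" for i k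
    using adj_mat_T[OF moore_carrier MT] .
  have "\<exists>b\<in>T S. adj_mat ?M $$ (i, k) = e * b" if ik: "i < r" "k < r" for i k
  proof -
    \<comment> \<open>A column of the adjugate. The Moore matrix maps it to \<psi> = e * y times a
      standard basis vector, hence into the ideal of e.\<close>
    define v where "v i = (if i < r then adj_mat ?M $$ (i, k) else 0)" for i
    have "v \<in> N"
      unfolding Nmem
    proof (intro conjI allI impI)
      show "v \<in> vecs r S" using adjT ik by (auto simp: vecs_def v_def)
      fix j assume j: "j < r"
      have "(\<Sum>i<r. v i * (tau ^^ j) (g i)) = (\<Sum>i<r. ?M $$ (j, i) * adj_mat ?M $$ (i, k))"
        using j by (intro sum.cong) (auto simp: v_def moore_def)
      also have "\<dots> = (if j = k then det ?M else 0)" by (rule adj_mat_sums(1)[OF moore_carrier j ik(2)])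
      also have "\<dots> = e * (if j = k then y else 0)" using psi_e unfolding \<psi>_def by simp
      finally show "\<exists>h\<in>T S. (\<Sum>i<r. v i * (tau ^^ j) (g i)) = e * h"
        using y(1) by (intro bexI[of _ "if j = k then y else 0"]) auto
    qed
    then have "v \<in> Z" by (rule NZ)
    then show ?thesis unfolding Zmem using ik by (auto simp: v_def)
  qed
  then obtain b where b: "\<And>i k. i < r \<Longrightarrow> k < r \<Longrightarrow> b i k \<in> T S" "\<And>i k. i < r \<Longrightarrow> k < r \<Longrightarrow> adj_mat ?M $$ (i, k) = e * b i k"
    by metis
  \<comment> \<open>The adjugate divided by \<psi>: the factor e has been split off in b, the factor
    y is inverted by y'.\<close>
  define B where "B i k = (if i < r \<and> k < r then y' * b i k else 0)" for i k
  have "B i k \<in> T S" for i k using b(1) y(2) by (auto simp: B_def T_mult)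
  moreover have "(\<Sum>i<r. (tau ^^ j) (g i) * B i k) = (if j = k then 1 else 0)" if jk: "j < r" "k < r" for j k
  proof -
    have "(\<Sum>i<r. (tau ^^ j) (g i) * b i k) = (if j = k then y else 0)"
    proof (rule canc)
      have "e * (\<Sum>i<r. (tau ^^ j) (g i) * b i k) = (\<Sum>i<r. ?M $$ (j, i) * adj_mat ?M $$ (i, k))"
        unfolding sum_distrib_left using jk b(2) by (intro sum.cong) (auto simp: moore_def mult_ac)
      then show "e * (\<Sum>i<r. (tau ^^ j) (g i) * b i k) = e * (if j = k then y else 0)"
        using adj_mat_sums(1)[OF moore_carrier jk, of g] psi_e unfolding \<psi>_def by simp
    qed (use b jk y g in \<open>auto intro!: T_sum T_mult T_taun\<close>)
    then have "y' * (\<Sum>i<r. (tau ^^ j) (g i) * b i k) = (if j = k then 1 else 0)"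
      using y(3) by (simp add: mult.commute)
    moreover have "(\<Sum>i<r. (tau ^^ j) (g i) * B i k) = y' * (\<Sum>i<r. (tau ^^ j) (g i) * b i k)"
      unfolding sum_distrib_left using jk by (intro sum.cong) (auto simp: B_def mult_ac)
    ultimately show ?thesis by simp
  qed
  moreover have "(\<Sum>i<r. B j i * (tau ^^ i) (g k)) = (if j = k then 1 else 0)" if jk: "j < r" "k < r" for j k
  proof -
    have "(\<Sum>i<r. b j i * (tau ^^ i) (g k)) = (if j = k then y else 0)"
    proof (rule canc)
      have "e * (\<Sum>i<r. b j i * (tau ^^ i) (g k)) = (\<Sum>i<r. adj_mat ?M $$ (j, i) * ?M $$ (i, k))"
        unfolding sum_distrib_left using jk b(2) by (intro sum.cong) (auto simp: moore_def mult_ac)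
      then show "e * (\<Sum>i<r. b j i * (tau ^^ i) (g k)) = e * (if j = k then y else 0)"
        using adj_mat_sums(2)[OF moore_carrier jk, of g] psi_e unfolding \<psi>_def by simp
    qed (use b jk y g in \<open>auto intro!: T_sum T_mult T_taun\<close>)
    then have "y' * (\<Sum>i<r. b j i * (tau ^^ i) (g k)) = (if j = k then 1 else 0)"
      using y(3) by (simp add: mult.commute)
    moreover have "(\<Sum>i<r. B j i * (tau ^^ i) (g k)) = y' * (\<Sum>i<r. b j i * (tau ^^ i) (g k))"
      unfolding sum_distrib_left using jk by (intro sum.cong) (auto simp: B_def mult_ac)
    ultimately show ?thesis by simp
  qed
  ultimately show ?thesis by blast
qed

end

section \<open>Twisted power series and entire operators\<close>

context cinf
begin

definition tm :: "(nat \<Rightarrow> 'a mps) \<Rightarrow> (nat \<Rightarrow> 'a mps) \<Rightarrow> nat \<Rightarrow> 'a mps" where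
  "tm a b = (\<lambda>k. \<Sum>i\<le>k. a i * (tau ^^ i) (b (k - i)))"

definition sc :: "'a mps \<Rightarrow> nat \<Rightarrow> 'a mps" where
  "sc c = (\<lambda>n. if n = 0 then c else 0)"

lemma tm_sc_left: "tm (sc c) b k = c * b k"
proof -
  have "tm (sc c) b k = (\<Sum>i\<le>k. if i = 0 then c * b k else 0)"
    unfolding tm_def by (intro sum.cong) (auto simp: sc_def)
  then show ?thesis by simp
qed

lemma tm_sc_right: "tm a (sc c) k = a k * (tau ^^ k) c"
proof -
  have "tm a (sc c) k = (\<Sum>i\<le>k. if i = k then a k * (tau ^^ k) c else 0)"
    unfolding tm_def by (intro sum.cong) (auto simp: sc_def)
  then show ?thesis by simp
qed

lemma tm_add_left: "tm (a + b) c = tm a c + tm b c"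
  and tm_add_right: "tm a (b + c) = tm a b + tm a c"
  and tm_diff_left: "tm (a - b) c = tm a c - tm b c"
  and tm_diff_right: "tm a (b - c) = tm a b - tm a c"
  and tm_0_left [simp]: "tm 0 a = 0" and tm_0_right [simp]: "tm a 0 = 0"
  by (auto simp: tm_def fun_eq_iff distrib_right distrib_left left_diff_distrib right_diff_distrib
      sum.distrib sum_subtractf taun_add taun_diff)

lemma tm_assoc: "tm (tm a b) c = tm a (tm b c)"
proof
  fix k
  let ?f = "\<lambda>i j n. a i * (tau ^^ i) (b j) * (tau ^^ (i + j)) (c n)"
  have "tm (tm a b) c k = (\<Sum>j=0..k. \<Sum>i=0..j. ?f i (j - i) (k - j))"
    unfolding tm_def by (simp add: sum_distrib_right atLeast0AtMost)
  also have "\<dots> = (\<Sum>j=0..k. \<Sum>i=0..k - j. ?f j i (k - j - i))"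
    by (rule fps_mult_assoc_lemma)
  also have "\<dots> = tm a (tm b c) k"
    unfolding tm_def by (simp add: sum_distrib_left atLeast0AtMost taun_sum taun_mult taun_taun mult.assoc)
  finally show "tm (tm a b) c k = tm a (tm b c) k" .
qed

text \<open>A nonzero difference has a lowest coefficient, and this survives multiplication on the
  right by a series with constant term 1.\<close>

lemma tm_cancel_right:
  assumes E: "E 0 = 1" and eq: "tm X E = tm Y E"
  shows "X = Y"
proof
  fix n
  define Z where "Z = X - Y"
  have Z: "tm Z E = 0" using eq by (simp add: Z_def tm_diff_left)
  have "Z n = 0"
  proof (induction n rule: less_induct)
    case (less n)
    have "0 = (\<Sum>i\<le>n. Z i * (tau ^^ i) (E (n - i)))" using fun_cong[OF Z, of n] by (simp add: tm_def)
    also have "\<dots> = (\<Sum>i\<le>n. if i = n then Z n else 0)"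
      using less E by (intro sum.cong) auto
    finally show ?case by simp
  qed
  then show "X n = Y n" by (simp add: Z_def)
qed

lemma tm_T: "(\<And>n. a n \<in> T s) \<Longrightarrow> (\<And>n. b n \<in> T s) \<Longrightarrow> tm a b n \<in> T s"
  unfolding tm_def by (intro T_sum T_mult T_taun)

section \<open>Twisted polynomials and everywhere convergent operators\<close>

definition tpoly :: "nat \<Rightarrow> (nat \<Rightarrow> 'a mps) \<Rightarrow> bool" where
  "tpoly s m \<longleftrightarrow> (\<forall>n. m n \<in> T s) \<and> (\<exists>d. \<forall>n\<ge>d. m n = 0)"

lemma tpoly_T: "tpoly s m \<Longrightarrow> m n \<in> T s"
  by (simp add: tpoly_def)

lemma tpoly_sc: "c \<in> T s \<Longrightarrow> tpoly s (sc c)"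
  by (auto simp: tpoly_def sc_def intro!: exI[of _ 1])

lemma tpoly_add: "tpoly s a \<Longrightarrow> tpoly s b \<Longrightarrow> tpoly s (a + b)"
  unfolding tpoly_def
proof safe
  fix d d' assume "\<forall>n\<ge>d. a n = 0" "\<forall>n\<ge>d'. b n = 0"
  then show "\<exists>d. \<forall>n\<ge>d. (a + b) n = 0" by (intro exI[of _ "max d d'"]) auto
qed (auto intro: T_add)

lemma tpoly_diff: "tpoly s a \<Longrightarrow> tpoly s b \<Longrightarrow> tpoly s (a - b)"
  unfolding tpoly_def
proof safe
  fix d d' assume "\<forall>n\<ge>d. a n = 0" "\<forall>n\<ge>d'. b n = 0"
  then show "\<exists>d. \<forall>n\<ge>d. (a - b) n = 0" by (intro exI[of _ "max d d'"]) auto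
qed (auto intro: T_diff)

lemma tpoly_tm: "tpoly s a \<Longrightarrow> tpoly s b \<Longrightarrow> tpoly s (tm a b)"
  unfolding tpoly_def
proof safe
  fix d d' assume d: "\<forall>n\<ge>d. a n = 0" "\<forall>n\<ge>d'. b n = 0"
  have "tm a b n = 0" if "n \<ge> d + d'" for n
    unfolding tm_def
  proof (intro sum.neutral ballI)
    fix i assume "i \<in> {..n}"
    then have "i \<ge> d \<or> n - i \<ge> d'" using that by auto
    then show "a i * (tau ^^ i) (b (n - i)) = 0" using d by auto
  qed
  then show "\<exists>d. \<forall>n\<ge>d. tm a b n = 0" by blast
qed (auto intro: tm_T)

text \<open>Growth condition for operators that converge on the whole Tate algebra. Boundedness is
  enough, since it is required for every \<rho>: a larger radius turns it into decay.\<close>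

definition entire :: "nat \<Rightarrow> (nat \<Rightarrow> 'a mps) \<Rightarrow> bool" where
  "entire s a \<longleftrightarrow> (\<forall>n. a n \<in> T s) \<and> (\<forall>\<rho>\<ge>1. \<exists>D. \<forall>n. nrm (a n) * \<rho> ^ (q ^ n) \<le> D)"

lemma entire_T: "entire s a \<Longrightarrow> a n \<in> T s"
  by (simp add: entire_def)

lemma entire_bound:
  assumes "entire s a" "\<rho> \<ge> 1" obtains D where "D \<ge> 1" "\<And>n. nrm (a n) * \<rho> ^ (q ^ n) \<le> D"
proof -
  obtain D where "\<And>n. nrm (a n) * \<rho> ^ (q ^ n) \<le> D" using assms unfolding entire_def by blast
  then have "\<And>n. nrm (a n) * \<rho> ^ (q ^ n) \<le> max 1 D" by (simp add: le_max_iff_disj)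
  then show thesis using that[of "max 1 D"] by simp
qed

lemma entire_le:
  assumes a: "entire s a" and b: "\<And>n. b n \<in> T s" "\<And>n. nrm (b n) \<le> nrm (a n)"
  shows "entire s b"
  unfolding entire_def
proof (intro conjI allI impI)
  fix \<rho> :: real assume r: "\<rho> \<ge> 1"
  obtain D where D: "\<And>n. nrm (a n) * \<rho> ^ (q ^ n) \<le> D" using entire_bound[OF a r] by blast
  have "nrm (b n) * \<rho> ^ (q ^ n) \<le> D" for n
  proof -
    have "nrm (b n) * \<rho> ^ (q ^ n) \<le> nrm (a n) * \<rho> ^ (q ^ n)" by (intro mult_right_mono b(2)) (use r in simp)
    then show ?thesis using D[of n] by linarith
  qed
  then show "\<exists>D. \<forall>n. nrm (b n) * \<rho> ^ (q ^ n) \<le> D" by blast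
qed (rule b(1))

lemma entire_add: 
  assumes a: "entire s a" and b: "entire s b" shows "entire s (a + b)"
  unfolding entire_def
proof (intro conjI allI impI)
  fix \<rho> :: real assume r: "\<rho> \<ge> 1"
  obtain D where D: "\<And>n. nrm (a n) * \<rho> ^ (q ^ n) \<le> D" using entire_bound[OF a r] by blast
  obtain D' where D': "\<And>n. nrm (b n) * \<rho> ^ (q ^ n) \<le> D'" using entire_bound[OF b r] by blast
  have "nrm ((a + b) n) * \<rho> ^ (q ^ n) \<le> max D D'" for n
  proof -
    have "nrm (a n + b n) \<le> max (nrm (a n)) (nrm (b n))" by (intro nrm_add T_CC[of _ s] entire_T a b)
    then have "nrm (a n + b n) \<le> nrm (a n) \<or> nrm (a n + b n) \<le> nrm (b n)" by linarith
    then have "nrm (a n + b n) * \<rho> ^ (q ^ n) \<le> nrm (a n) * \<rho> ^ (q ^ n) \<or> nrm (a n + b n) * \<rho> ^ (q ^ n) \<le> nrm (b n) * \<rho> ^ (q ^ n)"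
      using r by (auto intro: mult_right_mono)
    then show ?thesis using D[of n] D'[of n] by auto
  qed
  then show "\<exists>D. \<forall>n. nrm ((a + b) n) * \<rho> ^ (q ^ n) \<le> D" by blast
qed (auto intro: T_add entire_T a b)

text \<open>For the term with index i, the factor \<rho>^(q^n) is the q^i-th power of
  \<rho>^(q^(n-i)), so the bound for a is raised to the power q^i. Only finitely many i occur, and D
  >= 1 makes the largest exponent serve for all.\<close>

lemma entire_tm:
  assumes m: "tpoly s m" and a: "entire s a"
  shows "entire s (tm m a)"
  unfolding entire_def
proof (intro conjI allI impI)
  show "tm m a n \<in> T s" for n by (intro tm_T tpoly_T[OF m] entire_T[OF a])
  fix \<rho> :: real assume r: "\<rho> \<ge> 1"
  obtain D where D: "D \<ge> 1" "\<And>n. nrm (a n) * \<rho> ^ (q ^ n) \<le> D" using entire_bound[OF a r] by blast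
  obtain d where d: "\<And>n. n \<ge> d \<Longrightarrow> m n = 0" using m unfolding tpoly_def by blast
  define M where "M = (\<Sum>i<d. nrm (m i))"
  have nnm: "0 \<le> nrm (m i)" for i by (rule nrm_nonneg[OF T_CC[OF tpoly_T[OF m]]])
  have M: "0 \<le> M" "\<And>i. i < d \<Longrightarrow> nrm (m i) \<le> M"
    unfolding M_def using nnm by (auto intro!: sum_nonneg member_le_sum)
  have "nrm (tm m a n) * \<rho> ^ (q ^ n) \<le> M * D ^ (q ^ d)" for n
  proof -
    have rp: "\<rho> ^ (q ^ n) > 0" using r by simp
    have "nrm (tm m a n) \<le> M * D ^ (q ^ d) / \<rho> ^ (q ^ n)"
      unfolding tm_def
    proof (rule nrm_sum_le)
      fix i assume i: "i \<in> {..n}"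
      show "m i * (tau ^^ i) (a (n - i)) \<in> CC" by (intro CC_mult CC_taun T_CC[OF tpoly_T[OF m]] T_CC[OF entire_T[OF a]])
      show "nrm (m i * (tau ^^ i) (a (n - i))) \<le> M * D ^ (q ^ d) / \<rho> ^ (q ^ n)"
      proof (cases "i < d")
        case True
        have "q ^ n = q ^ (n - i) * q ^ i" using i by (simp add: power_add[symmetric])
        then have rho: "\<rho> ^ (q ^ n) = (\<rho> ^ (q ^ (n - i))) ^ (q ^ i)" by (simp add: power_mult)
        have "nrm (m i * (tau ^^ i) (a (n - i))) * \<rho> ^ (q ^ n) = nrm (m i) * (nrm (a (n - i)) * \<rho> ^ (q ^ (n - i))) ^ (q ^ i)"
          unfolding rho nrm_mult[OF T_CC[OF tpoly_T[OF m]] CC_taun[OF T_CC[OF entire_T[OF a]]]] nrm_taun[OF T_CC[OF entire_T[OF a]]]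
          by (simp add: power_mult_distrib)
        also have "\<dots> \<le> M * D ^ (q ^ i)"
          using M True D nnm[of i] nrm_nonneg[OF T_CC[OF entire_T[OF a]], of "n - i"] r
          by (intro mult_mono power_mono) auto
        also have "\<dots> \<le> M * D ^ (q ^ d)"
          using M(1) D(1) True q_ge_2 by (intro mult_left_mono power_increasing) auto
        finally show ?thesis using rp by (simp add: pos_le_divide_eq)
      next
        case False
        then show ?thesis using d[of i] M(1) D(1) r by simp
      qed
    qed (use M(1) D(1) r in simp)
    then show ?thesis using rp by (simp add: pos_le_divide_eq)
  qed
  then show "\<exists>D. \<forall>n. nrm (tm m a n) * \<rho> ^ (q ^ n) \<le> D" by blast
qed

definition psum :: "(nat \<Rightarrow> 'a mps) \<Rightarrow> 'a mps \<Rightarrow> nat \<Rightarrow> 'a mps" where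
  "psum a x N = (\<Sum>n<N. a n * (tau ^^ n) x)"

definition app :: "(nat \<Rightarrow> 'a mps) \<Rightarrow> 'a mps \<Rightarrow> 'a mps" where
  "app a x = (THE L. L \<in> CC \<and> nlim (psum a x) L)"

lemma psum_T: "entire s a \<Longrightarrow> x \<in> T s \<Longrightarrow> psum a x N \<in> T s"
  unfolding psum_def using entire_T[of s a] by (intro T_sum T_mult T_taun) auto

lemma app_eqI:
  assumes "entire s a" "x \<in> T s" "L \<in> CC" "nlim (psum a x) L"
  shows "app a x = L"
  unfolding app_def
proof (rule the_equality)
  fix L' assume "L' \<in> CC \<and> nlim (psum a x) L'"
  then show "L' = L" using nlim_unique[of "psum a x" L' L] assms T_CC[OF psum_T] by blast
qed (use assms in auto)

lemma entire_terms_tendsto_0: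
  assumes a: "entire s a" and x: "x \<in> T s"
  shows "(\<lambda>n. nrm (a n * (tau ^^ n) x)) \<longlonglongrightarrow> 0"
proof -
  define R where "R = max 1 (nrm x)"
  have R: "R \<ge> 1" "nrm x \<le> R" by (auto simp: R_def)
  \<comment> \<open>Doubling the radius gains the factor (1/2)^(q^n), which tends to 0.\<close>
  obtain D where D: "D \<ge> 1" "\<And>n. nrm (a n) * (2 * R) ^ (q ^ n) \<le> D" using entire_bound[OF a, of "2 * R"] R by auto
  have nx: "0 \<le> nrm x" by (rule nrm_nonneg[OF T_CC[OF x]])
  have na: "0 \<le> nrm (a n)" for n by (rule nrm_nonneg[OF T_CC[OF entire_T[OF a]]])
  have eq: "nrm (a n * (tau ^^ n) x) = nrm (a n) * nrm x ^ (q ^ n)" for n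
    using nrm_mult[OF T_CC[OF entire_T[OF a]] CC_taun[OF T_CC[OF x]]] nrm_taun[OF T_CC[OF x]] by simp
  show ?thesis
  proof (rule tendsto_0_le)
    show "0 \<le> nrm (a n * (tau ^^ n) x)" for n unfolding eq using na nx by simp
    show "nrm (a n * (tau ^^ n) x) \<le> D * (1 / 2) ^ (q ^ n)" for n
    proof -
      have "nrm (a n) * nrm x ^ (q ^ n) \<le> nrm (a n) * R ^ (q ^ n)"
        using na nx R by (intro mult_left_mono power_mono)
      also have "\<dots> = (nrm (a n) * (2 * R) ^ (q ^ n)) * (1 / 2) ^ (q ^ n)"
        by (simp add: power_mult_distrib power_one_over)
      also have "\<dots> \<le> D * (1 / 2) ^ (q ^ n)" using D(2) by (intro mult_right_mono) auto
      finally show ?thesis unfolding eq .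
    qed
    show "(\<lambda>n. D * (1 / 2) ^ (q ^ n)) \<longlonglongrightarrow> 0"
      using tendsto_mult_right_zero[OF power_q_tendsto_0[of "1/2"]] by simp
  qed
qed

lemma app:
  assumes a: "entire s a" and x: "x \<in> T s"
  shows app_T: "app a x \<in> T s" and app_lim: "nlim (psum a x) (app a x)"
proof -
  have "(\<lambda>n. nrm (psum a x (Suc n) - psum a x n)) \<longlonglongrightarrow> 0"
    using entire_terms_tendsto_0[OF a x] by (simp add: psum_def)
  then obtain L where L: "L \<in> T s" "nlim (psum a x) L"
    using T_complete[of "psum a x" s, OF psum_T[OF a x]] by blast
  then have "app a x = L" using app_eqI[OF a x T_CC] by blast
  then show "app a x \<in> T s" "nlim (psum a x) (app a x)" using L by auto
qed

lemma app_add_arg: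
  assumes a: "entire s a" and x: "x \<in> T s" "y \<in> T s"
  shows "app a (x + y) = app a x + app a y"
proof (rule app_eqI[OF a T_add[OF x]])
  have "psum a (x + y) = (\<lambda>n. psum a x n + psum a y n)"
    by (simp add: psum_def taun_add distrib_left sum.distrib fun_eq_iff)
  then show "nlim (psum a (x + y)) (app a x + app a y)"
    using nlim_add[OF T_CC[OF psum_T[OF a x(1)]] T_CC[OF psum_T[OF a x(2)]] T_CC[OF app_T[OF a x(1)]]
        T_CC[OF app_T[OF a x(2)]] app_lim[OF a x(1)] app_lim[OF a x(2)]] by simp
qed (intro CC_add T_CC[OF app_T[OF a]] x)

lemma app_add:
  assumes a: "entire s a" "entire s b" and x: "x \<in> T s"
  shows "app (a + b) x = app a x + app b x"
proof (rule app_eqI[OF entire_add[OF a] x])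
  have "psum (a + b) x = (\<lambda>n. psum a x n + psum b x n)"
    by (simp add: psum_def distrib_right sum.distrib fun_eq_iff)
  then show "nlim (psum (a + b) x) (app a x + app b x)"
    using nlim_add[OF T_CC[OF psum_T[OF a(1) x]] T_CC[OF psum_T[OF a(2) x]] T_CC[OF app_T[OF a(1) x]]
        T_CC[OF app_T[OF a(2) x]] app_lim[OF a(1) x] app_lim[OF a(2) x]] by simp
qed (intro CC_add T_CC[OF app_T[OF _ x]] a)

lemma app_0: "entire s a \<Longrightarrow> app a 0 = 0"
  by (rule app_eqI[of s]) (auto simp: psum_def nlim_def)

lemma app_fixed_mult:
  assumes a: "entire s a" and x: "x \<in> T s" and c: "c \<in> T s" "tau c = c"
  shows "app a (c * x) = c * app a x"
proof (rule app_eqI[OF a T_mult[OF c(1) x]])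
  have "psum a (c * x) = (\<lambda>n. c * psum a x n)"
    by (simp add: psum_def taun_mult taun_fixed[OF c(2)] sum_distrib_left fun_eq_iff mult_ac)
  then show "nlim (psum a (c * x)) (c * app a x)"
    using nlim_mult[OF T_CC[OF psum_T[OF a x]] T_CC[OF app_T[OF a x]] T_CC[OF c(1)] app_lim[OF a x]] by simp
qed (intro CC_mult T_CC[OF c(1)] T_CC[OF app_T[OF a x]])

lemma app_sum_arg: "entire s a \<Longrightarrow> (\<And>i. i \<in> I \<Longrightarrow> x i \<in> T s) \<Longrightarrow> app a (\<Sum>i\<in>I. x i) = (\<Sum>i\<in>I. app a (x i))"
  by (induction I rule: infinite_finite_induct) (auto simp: app_0 app_add_arg T_sum)

lemma app_tm_sc:
  assumes c: "c \<in> T s" and x: "x \<in> T s"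
  shows "app (tm a (sc c)) x = app a (c * x)"
proof -
  have "psum (tm a (sc c)) x = psum a (c * x)"
    by (simp add: psum_def fun_eq_iff tm_sc_right taun_mult mult.assoc)
  then show ?thesis by (simp add: app_def)
qed

lemma psum_tm:
  assumes d: "\<And>n. n \<ge> d \<Longrightarrow> m n = 0"
  shows "psum (tm m a) x N = (\<Sum>i<d. m i * (tau ^^ i) (psum a x (N - i)))"
proof -
  let ?f = "\<lambda>i j. m i * (tau ^^ i) (a j) * (tau ^^ (i + j)) x"
  have "psum (tm m a) x N = (\<Sum>k<N. \<Sum>i\<le>k. ?f i (k - i))"
    unfolding psum_def tm_def by (simp add: sum_distrib_right)
  also have "\<dots> = (\<Sum>(i, j)\<in>{(i, j). i + j < N}. ?f i j)"
    by (rule sum.triangle_reindex[symmetric])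
  also have "{(i, j). i + j < N} = Sigma {..<N} (\<lambda>i. {..<N - i})" by auto
  also have "(\<Sum>(i, j)\<in>Sigma {..<N} (\<lambda>i. {..<N - i}). ?f i j) = (\<Sum>i<N. \<Sum>j<N - i. ?f i j)"
    by (subst sum.Sigma) auto
  also have "\<dots> = (\<Sum>i<N. m i * (tau ^^ i) (psum a x (N - i)))"
    unfolding psum_def by (simp add: taun_sum taun_mult taun_taun sum_distrib_left mult.assoc)
  \<comment> \<open>For i beyond N the truncated difference is 0 and the partial sum empty, so the
    range may be enlarged and then cut down to the support of m.\<close>
  also have "\<dots> = (\<Sum>i<max N d. m i * (tau ^^ i) (psum a x (N - i)))"
    by (rule sum.mono_neutral_left) (auto simp: psum_def)
  also have "\<dots> = (\<Sum>i<d. m i * (tau ^^ i) (psum a x (N - i)))"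
    by (rule sum.mono_neutral_right) (auto simp: d)
  finally show ?thesis .
qed

lemma app_tm:
  assumes m: "tpoly s m" and d: "\<And>n. n \<ge> d \<Longrightarrow> m n = 0" and a: "entire s a" and x: "x \<in> T s"
  shows "app (tm m a) x = (\<Sum>i<d. m i * (tau ^^ i) (app a x))"
proof (rule app_eqI[OF entire_tm[OF m a] x])
  have mC: "m i \<in> CC" for i by (rule T_CC[OF tpoly_T[OF m]])
  have pC: "psum a x N \<in> CC" for N by (rule T_CC[OF psum_T[OF a x]])
  have aC: "app a x \<in> CC" by (rule T_CC[OF app_T[OF a x]])
  show "(\<Sum>i<d. m i * (tau ^^ i) (app a x)) \<in> CC" by (intro CC_sum CC_mult CC_taun mC aC)
  have "nlim (\<lambda>N. psum a x (N - i)) (app a x)" for i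
    using app_lim[OF a x] LIMSEQ_offset[of "\<lambda>N. nrm (psum a x (N - i) - app a x)" i 0] by (simp add: nlim_def)
  then have "nlim (\<lambda>N. \<Sum>i<d. m i * (tau ^^ i) (psum a x (N - i))) (\<Sum>i<d. m i * (tau ^^ i) (app a x))"
    by (intro nlim_sum nlim_mult nlim_taun CC_mult CC_taun mC pC aC)
  then show "nlim (psum (tm m a) x) (\<Sum>i<d. m i * (tau ^^ i) (app a x))"
    using psum_tm[OF d] by (simp add: nlim_def)
qed

text \<open>Without the constant term all exponents q^n are at least 2, and on the unit ball the
  square dominates the higher powers.\<close>

lemma app_quadratic_bound:
  assumes a: "entire s a" and a0: "a 0 = 0"
  obtains D where "D \<ge> 1" "\<And>x. x \<in> T s \<Longrightarrow> nrm x \<le> 1 \<Longrightarrow> nrm (app a x) \<le> D * nrm x ^ 2"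
proof -
  obtain D where D: "D \<ge> 1" "\<And>n. nrm (a n) * 1 ^ (q ^ n) \<le> D" using entire_bound[OF a, of 1] by auto
  have "nrm (app a x) \<le> D * nrm x ^ 2" if x: "x \<in> T s" "nrm x \<le> 1" for x
  proof (rule nlim_le[OF T_CC[OF psum_T[OF a x(1)]] T_CC[OF app_T[OF a x(1)]] app_lim[OF a x(1)]])
    fix N
    have nx: "0 \<le> nrm x" by (rule nrm_nonneg[OF T_CC[OF x(1)]])
    show "nrm (psum a x N) \<le> D * nrm x ^ 2"
      unfolding psum_def
    proof (rule nrm_sum_le)
      fix n
      show "a n * (tau ^^ n) x \<in> CC" by (intro CC_mult CC_taun T_CC[OF entire_T[OF a]] T_CC[OF x(1)])
      show "nrm (a n * (tau ^^ n) x) \<le> D * nrm x ^ 2"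
      proof (cases "n = 0")
        case True then show ?thesis using a0 D(1) by simp
      next
        case False
        have "nrm x ^ (q ^ n) \<le> nrm x ^ 2" using x(2) nx qpow_ge[of n] False by (intro power_decreasing) auto
        then have "nrm (a n) * nrm x ^ (q ^ n) \<le> D * nrm x ^ 2"
          using D(1) D(2)[of n] nx by (intro mult_mono) auto
        then show ?thesis
          using nrm_mult[OF T_CC[OF entire_T[OF a]] CC_taun[OF T_CC[OF x(1)]]] nrm_taun[OF T_CC[OF x(1)]] by simp
      qed
    qed (use D(1) in simp)
  qed
  then show thesis using that D(1) by blast
qed

section \<open>Coefficients and growth of the exponential\<close>

lemma theta_power_diff_nz: "n \<ge> 1 \<Longrightarrow> \<theta> ^ (q ^ n) - \<theta> \<noteq> 0"
proof -
  assume n: "n \<ge> 1"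
  have "real q ^ (q ^ n) > 0" by simp
  then have "av (\<theta> ^ (q ^ n) - \<theta>) \<noteq> 0" using av_theta_power_diff[OF n] by linarith
  then show ?thesis by auto
qed

text \<open>The recursion comes from comparing the coefficients of tau^n in exp theta = phi_theta
  exp. The term of index 0 of phi_theta, which is theta, has been moved to the left and produces the
  denominator.\<close>

function Ex :: "(nat \<Rightarrow> 'a mps) \<Rightarrow> nat \<Rightarrow> 'a mps" where
  "Ex A n = (if n = 0 then 1 else
     const (inverse (\<theta> ^ (q ^ n) - \<theta>)) * (\<Sum>i\<in>{1..n}. A i * (tau ^^ i) (Ex A (n - i))))"
  by pat_completeness auto
termination by (relation "measure snd") auto

declare Ex.simps [simp del]

lemma Ex_0 [simp]: "Ex A 0 = 1"
  by (simp add: Ex.simps)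

lemma Ex_rec: "n \<ge> 1 \<Longrightarrow> const (\<theta> ^ (q ^ n) - \<theta>) * Ex A n = (\<Sum>i\<in>{1..n}. A i * (tau ^^ i) (Ex A (n - i)))"
  unfolding Ex.simps[of A n] using const_inverse[OF theta_power_diff_nz[of n]] by (simp add: mult.assoc[symmetric])

lemma atMost_eq_insert_0: "{..n} = insert 0 {1..n::nat}"
  by auto

lemma Ex_eq:
  assumes A0: "A 0 = const \<theta>"
  shows "tm (Ex A) (sc (const \<theta>)) = tm A (Ex A)"
proof
  fix n
  show "tm (Ex A) (sc (const \<theta>)) n = tm A (Ex A) n"
  proof (cases "n = 0")
    case True then show ?thesis by (simp add: tm_def sc_def A0)
  next
    case False
    have "tm A (Ex A) n = const \<theta> * Ex A n + (\<Sum>i\<in>{1..n}. A i * (tau ^^ i) (Ex A (n - i)))"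
      unfolding tm_def atMost_eq_insert_0 by (simp add: A0)
    also have "\<dots> = const (\<theta> ^ (q ^ n)) * Ex A n"
      using Ex_rec[of n A] False by (simp add: const_diff algebra_simps)
    finally show ?thesis by (simp add: tm_sc_right taun_const mult.commute)
  qed
qed

lemma Ex_unique:
  assumes A0: "A 0 = const \<theta>" and e: "e 0 = 1" "tm e (sc (const \<theta>)) = tm A e"
  shows "e = Ex A"
proof
  fix n
  show "e n = Ex A n"
  proof (induction n rule: less_induct)
    case (less n)
    show ?case
    proof (cases "n = 0")
      case True then show ?thesis using e by simp
    next
      case False
      have "e n * const (\<theta> ^ (q ^ n)) = const \<theta> * e n + (\<Sum>i\<in>{1..n}. A i * (tau ^^ i) (e (n - i)))"
      proof -
        have "tm e (sc (const \<theta>)) n = e n * const (\<theta> ^ (q ^ n))" by (simp add: tm_sc_right taun_const)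
        moreover have "tm A e n = const \<theta> * e n + (\<Sum>i\<in>{1..n}. A i * (tau ^^ i) (e (n - i)))"
          unfolding tm_def atMost_eq_insert_0 by (simp add: A0)
        ultimately show ?thesis using fun_cong[OF e(2), of n] by simp
      qed
      then have "const (\<theta> ^ (q ^ n) - \<theta>) * e n = (\<Sum>i\<in>{1..n}. A i * (tau ^^ i) (e (n - i)))"
        by (simp add: const_diff algebra_simps)
      also have "\<dots> = (\<Sum>i\<in>{1..n}. A i * (tau ^^ i) (Ex A (n - i)))" by (intro sum.cong) (auto simp: less)
      also have "\<dots> = const (\<theta> ^ (q ^ n) - \<theta>) * Ex A n" using False by (simp add: Ex_rec)
      finally have "const (inverse (\<theta> ^ (q ^ n) - \<theta>)) * (const (\<theta> ^ (q ^ n) - \<theta>) * e n)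
        = const (inverse (\<theta> ^ (q ^ n) - \<theta>)) * (const (\<theta> ^ (q ^ n) - \<theta>) * Ex A n)" by simp
      then show ?thesis using const_inverse[OF theta_power_diff_nz[of n]] False
        by (simp add: mult.assoc[symmetric] mult.commute[of "const (inverse _)"])
    qed
  qed
qed

lemma Ex_T: "(\<And>n. A n \<in> T s) \<Longrightarrow> Ex A n \<in> T s"
proof (induction n rule: less_induct)
  case (less n)
  then show ?case unfolding Ex.simps[of A n] by (auto intro!: T_mult T_sum T_taun)
qed

text \<open>The proof establishes the bound (B \<sigma>^n)^(q^n) for the n-th coefficient, with
  \<sigma> < 1. Each step of the recursion divides by q^(q^n), which outweighs both the norms of the
  coefficients A i and the loss from going back at most r places.\<close>

lemma Ex_entire:
  assumes A: "\<And>n. A n \<in> T s" and r: "r \<ge> 1" "\<And>n. n > r \<Longrightarrow> A n = 0"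
  shows "entire s (Ex A)"
proof -
  let ?e = "\<lambda>n. nrm (Ex A n)"
  have EC: "Ex A n \<in> CC" for n using T_CC[OF Ex_T[of A s]] A by blast
  have AC: "A n \<in> CC" for n using T_CC[OF A] .
  have e0: "0 \<le> ?e n" for n by (rule nrm_nonneg[OF EC])
  define W where "W = 1 + (\<Sum>i\<le>r. nrm (A i))"
  have nA: "0 \<le> nrm (A i)" for i by (rule nrm_nonneg[OF AC])
  have W: "W \<ge> 1" "\<And>i. nrm (A i) \<le> W"
  proof -
    show "W \<ge> 1" unfolding W_def using nA by (simp add: sum_nonneg)
    show "nrm (A i) \<le> W" for i
    proof (cases "i \<le> r")
      case True
      then show ?thesis unfolding W_def using member_le_sum[of i "{..r}" "\<lambda>i. nrm (A i)"] nA by simp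
    next
      case False then show ?thesis using r(2)[of i] \<open>W \<ge> 1\<close> by simp
    qed
  qed
  \<comment> \<open>With \<sigma>^r = 3/4, going back at most r places costs a factor of at most 4/3
    in the base. Division by q >= 2 leaves at most 2/3, whose q^n-th power absorbs W for large
    n.\<close>
  define \<sigma> where "\<sigma> = root r (3 / 4)"
  have sr: "\<sigma> ^ r = 3 / 4" unfolding \<sigma>_def using r(1) by (intro real_root_pow_pos2) auto
  have s01: "0 < \<sigma>" "\<sigma> < 1" unfolding \<sigma>_def using r(1) by auto
  have "(\<lambda>n. W * (2 / 3) ^ (q ^ n)) \<longlonglongrightarrow> 0"
    using tendsto_mult_right_zero[OF power_q_tendsto_0[of "2/3"]] by simp
  then have "\<forall>\<^sub>F n in sequentially. W * (2 / 3) ^ (q ^ n) < 1" by (rule order_tendstoD) simp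
  then obtain n0 where n0: "\<And>n. n \<ge> n0 \<Longrightarrow> W * (2 / 3) ^ (q ^ n) < 1" by (auto simp: eventually_sequentially)
  \<comment> \<open>Chosen to make the bound true for the finitely many n up to n0, where W is not
    yet absorbed.\<close>
  define B where "B = 1 + (\<Sum>n\<le>n0. ?e n / \<sigma> ^ (n * q ^ n))"
  have B1: "B \<ge> 1" unfolding B_def using e0 s01 by (simp add: sum_nonneg)
  have bound: "?e n \<le> (B * \<sigma> ^ n) ^ (q ^ n)" for n
  proof (induction n rule: less_induct)
    case (less n)
    show ?case
    proof (cases "n \<le> n0")
      case True
      have "?e n / \<sigma> ^ (n * q ^ n) \<le> B"
        unfolding B_def using member_le_sum[of n "{..n0}" "\<lambda>n. ?e n / \<sigma> ^ (n * q ^ n)"] True e0 s01 by auto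
      also have "B = B ^ 1" by simp
      also have "\<dots> \<le> B ^ (q ^ n)" using B1 by (intro power_increasing) (auto simp: Suc_leI)
      finally have "?e n \<le> B ^ (q ^ n) * \<sigma> ^ (n * q ^ n)" using s01 by (simp add: pos_divide_le_eq)
      then show ?thesis by (simp add: power_mult_distrib power_mult)
    next
      case False
      then have n: "n \<ge> 1" "n \<ge> n0" by auto
      let ?c = "W * (4 / 3 * (B * \<sigma> ^ n)) ^ (q ^ n)"
      have c0: "0 \<le> ?c" using W(1) B1 s01 by simp
      have Qp: "0 < real q ^ (q ^ n)" by simp
      have "nrm (\<Sum>i\<in>{1..n}. A i * (tau ^^ i) (Ex A (n - i))) \<le> ?c"
      proof (rule nrm_sum_le[OF _ _ c0])
        fix i assume i: "i \<in> {1..n}"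
        show "A i * (tau ^^ i) (Ex A (n - i)) \<in> CC" by (intro CC_mult AC CC_taun EC)
        show "nrm (A i * (tau ^^ i) (Ex A (n - i))) \<le> ?c"
        proof (cases "i \<le> r")
          case False then show ?thesis using r(2)[of i] c0 by simp
        next
          case True
          have "\<sigma> ^ r \<le> \<sigma> ^ i" using True s01 by (intro power_decreasing) auto
          then have "\<sigma> ^ (n - i) * (3 / 4) \<le> \<sigma> ^ (n - i) * \<sigma> ^ i" using s01 sr by (intro mult_left_mono) auto
          also have "\<dots> = \<sigma> ^ n" using i by (simp add: power_add[symmetric])
          finally have sig: "\<sigma> ^ (n - i) \<le> 4 / 3 * \<sigma> ^ n" by simp
          have qq: "q ^ n = q ^ (n - i) * q ^ i" using i by (simp add: power_add[symmetric])
          have "nrm (A i * (tau ^^ i) (Ex A (n - i))) = nrm (A i) * ?e (n - i) ^ (q ^ i)"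
            using nrm_mult[OF AC CC_taun[OF EC]] nrm_taun[OF EC] by simp
          also have "\<dots> \<le> W * ((B * \<sigma> ^ (n - i)) ^ (q ^ (n - i))) ^ (q ^ i)"
            using W nA e0 less[of "n - i"] i by (intro mult_mono power_mono) auto
          also have "\<dots> = W * (B * \<sigma> ^ (n - i)) ^ (q ^ n)" unfolding qq by (simp add: power_mult)
          also have "\<dots> \<le> ?c"
          proof (intro mult_left_mono power_mono)
            have "B * \<sigma> ^ (n - i) \<le> B * (4 / 3 * \<sigma> ^ n)" using sig B1 by (intro mult_left_mono) auto
            then show "B * \<sigma> ^ (n - i) \<le> 4 / 3 * (B * \<sigma> ^ n)" by simp
          qed (use W(1) B1 s01 in auto)
          finally show ?thesis .
        qed
      qed
      moreover have "real q ^ (q ^ n) * ?e n = nrm (\<Sum>i\<in>{1..n}. A i * (tau ^^ i) (Ex A (n - i)))"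
        unfolding Ex_rec[OF n(1), symmetric] by (simp add: nrm_mult EC av_theta_power_diff[OF n(1)])
      ultimately have "?e n \<le> ?c / real q ^ (q ^ n)" using Qp by (simp add: pos_le_divide_eq mult.commute)
      also have "\<dots> = (W * (4 / (3 * real q)) ^ (q ^ n)) * (B * \<sigma> ^ n) ^ (q ^ n)"
        by (simp add: power_mult_distrib power_divide)
      also have "\<dots> \<le> (W * (2 / 3) ^ (q ^ n)) * (B * \<sigma> ^ n) ^ (q ^ n)"
      proof (intro mult_right_mono mult_left_mono power_mono)
        show "4 / (3 * real q) \<le> 2 / 3" using q_ge_2 by (simp add: field_simps)
      qed (use W(1) B1 s01 in auto)
      also have "\<dots> \<le> 1 * (B * \<sigma> ^ n) ^ (q ^ n)"
        using n0[OF n(2)] B1 s01 by (intro mult_right_mono) auto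
      finally show ?thesis by simp
    qed
  qed
  show ?thesis
    unfolding entire_def
  proof (intro conjI allI impI)
    show "Ex A n \<in> T s" for n using Ex_T A by blast
    fix \<rho> :: real assume \<rho>: "\<rho> \<ge> 1"
    have "(\<lambda>n. \<rho> * B * \<sigma> ^ n) \<longlonglongrightarrow> 0"
      using tendsto_mult_right_zero[OF LIMSEQ_realpow_zero[of \<sigma>]] s01 by simp
    then have "\<forall>\<^sub>F n in sequentially. \<rho> * B * \<sigma> ^ n < 1" by (rule order_tendstoD) simp
    then obtain n1 where n1: "\<And>n. n \<ge> n1 \<Longrightarrow> \<rho> * B * \<sigma> ^ n < 1" by (auto simp: eventually_sequentially)
    have "?e n * \<rho> ^ (q ^ n) \<le> 1 + (\<Sum>n\<le>n1. ?e n * \<rho> ^ (q ^ n))" for n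
    proof (cases "n \<le> n1")
      case True
      then show ?thesis using member_le_sum[of n "{..n1}" "\<lambda>n. ?e n * \<rho> ^ (q ^ n)"] e0 \<rho> by auto
    next
      case False
      have "?e n * \<rho> ^ (q ^ n) \<le> (B * \<sigma> ^ n) ^ (q ^ n) * \<rho> ^ (q ^ n)"
        using bound[of n] \<rho> by (intro mult_right_mono) auto
      also have "\<dots> = (\<rho> * B * \<sigma> ^ n) ^ (q ^ n)" by (simp add: power_mult_distrib mult_ac)
      also have "\<dots> \<le> 1" using n1[of n] False \<rho> B1 s01 by (intro power_le_one) auto
      finally show ?thesis using sum_nonneg[of "{..n1}" "\<lambda>n. ?e n * \<rho> ^ (q ^ n)"] e0 \<rho> by auto
    qed
    then show "\<exists>D. \<forall>n. ?e n * \<rho> ^ (q ^ n) \<le> D" by blast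
  qed
qed

text \<open>Coefficientwise inverse of the commutator with theta (on series without constant term).\<close>

definition dvt :: "(nat \<Rightarrow> 'a mps) \<Rightarrow> nat \<Rightarrow> 'a mps" where
  "dvt a n = (if n = 0 then 0 else const (inverse (\<theta> ^ (q ^ n) - \<theta>)) * a n)"

lemma dvt_0 [simp]: "dvt a 0 = 0"
  by (simp add: dvt_def)

lemma dvt_add: "dvt (a + b) = dvt a + dvt b" and dvt_diff: "dvt (a - b) = dvt a - dvt b"
  by (auto simp: dvt_def fun_eq_iff distrib_left right_diff_distrib)

lemma dvt_scale: "dvt (\<lambda>n. c * a n) = (\<lambda>n. c * dvt a n)"
  by (auto simp: dvt_def fun_eq_iff mult_ac)

lemma dvt_entire:
  assumes a: "entire s a" shows "entire s (dvt a)"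
proof (rule entire_le[OF a])
  show "dvt a n \<in> T s" for n unfolding dvt_def using entire_T[OF a] by (auto intro: T_mult)
  show "nrm (dvt a n) \<le> nrm (a n)" for n
  proof (cases "n = 0")
    case True then show ?thesis using nrm_nonneg[OF T_CC[OF entire_T[OF a]]] by simp
  next
    case False
    have "real q ^ (q ^ n) \<ge> 1" using q_ge_2 by (intro one_le_power) auto
    then have i: "inverse (real q ^ (q ^ n)) \<le> 1" by (simp add: inverse_le_1_iff)
    have "nrm (dvt a n) = inverse (real q ^ (q ^ n)) * nrm (a n)"
      using False by (simp add: dvt_def nrm_mult T_CC[OF entire_T[OF a]] av_inverse av_theta_power_diff)
    then show ?thesis using mult_right_mono[OF i nrm_nonneg[OF T_CC[OF entire_T[OF a]]], of n] by simp
  qed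
qed

text \<open>The commutator with theta multiplies the n-th coefficient by theta^(q^n) - theta. This
  factor is 0 only at n = 0, where the normalisation F 0 = 0 takes over; existence and uniqueness of
  quasi-periodic operators follow together.\<close>

lemma dvt_eq_iff:
  assumes a0: "a 0 = 0"
  shows "(F 0 = 0 \<and> tm F (sc (const \<theta>)) - tm (sc (const \<theta>)) F = a) \<longleftrightarrow> F = dvt a"
proof -
  have eq: "(tm F (sc (const \<theta>)) - tm (sc (const \<theta>)) F) n = const (\<theta> ^ (q ^ n) - \<theta>) * F n" for F n
    by (simp add: tm_sc_left tm_sc_right taun_const const_diff algebra_simps)
  have inv: "n \<ge> 1 \<Longrightarrow> const (inverse (\<theta> ^ (q ^ n) - \<theta>)) * (const (\<theta> ^ (q ^ n) - \<theta>) * x) = x" for n x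
    using const_inverse[OF theta_power_diff_nz[of n]] by (simp add: mult.assoc[symmetric] mult.commute[of "const (inverse _)"])
  show ?thesis
  proof
    assume h: "F 0 = 0 \<and> tm F (sc (const \<theta>)) - tm (sc (const \<theta>)) F = a"
    show "F = dvt a"
    proof
      fix n
      have "a n = const (\<theta> ^ (q ^ n) - \<theta>) * F n" using h eq[of F n] by simp
      then show "F n = dvt a n" using h inv[of n "F n"] by (cases "n = 0") (auto simp: dvt_def)
    qed
  next
    assume F: "F = dvt a"
    have "const (\<theta> ^ (q ^ n) - \<theta>) * F n = a n" for n
    proof (cases "n = 0")
      case False
      then show ?thesis using inv[of n "a n"] by (simp add: F dvt_def mult.left_commute)
    qed (simp add: F a0)
    then show "F 0 = 0 \<and> tm F (sc (const \<theta>)) - tm (sc (const \<theta>)) F = a"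
      unfolding fun_eq_iff eq by (simp add: F)
  qed
qed

end

section \<open>Coefficients with respect to an additional variable\<close>

lemma midx_split: "(\<nu> :: midx) = (\<nu> - Poly_Mapping.single s (lookup \<nu> s)) + Poly_Mapping.single s (lookup \<nu> s)"
  by (rule poly_mapping_eqI) (auto simp: lookup_add lookup_minus lookup_single when_def)

lemma midx_add_diff [simp]: "(\<nu> + \<mu> :: midx) - \<mu> = \<nu>"
  by (rule poly_mapping_eqI) (auto simp: lookup_add lookup_minus)

text \<open>The power series in the variables below s that multiplies the m-th power of the variable s.\<close>

definition slice :: "nat \<Rightarrow> nat \<Rightarrow> 'a::comm_ring_1 mps \<Rightarrow> 'a mps" where
  "slice s m g = Mps (\<lambda>\<nu>. if lookup \<nu> s = 0 then cf g (\<nu> + Poly_Mapping.single s m) else 0)"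

text \<open>Inverse to taking slices: k is read as the sequence of coefficients with respect to the
  variable s.\<close>

definition assemble :: "nat \<Rightarrow> (nat \<Rightarrow> 'a::comm_ring_1 mps) \<Rightarrow> 'a mps" where
  "assemble s k = Mps (\<lambda>\<nu>. cf (k (lookup \<nu> s)) (\<nu> - Poly_Mapping.single s (lookup \<nu> s)))"

definition tvar :: "nat \<Rightarrow> 'a::comm_ring_1 mps" where
  "tvar s = monom_mps (Poly_Mapping.single s 1) 1"

lemma cf_slice: "cf (slice s m g) \<nu> = (if lookup \<nu> s = 0 then cf g (\<nu> + Poly_Mapping.single s m) else 0)"
  by (simp add: slice_def)

lemma cf_assemble: "cf (assemble s k) \<nu> = cf (k (lookup \<nu> s)) (\<nu> - Poly_Mapping.single s (lookup \<nu> s))"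
  by (simp add: assemble_def)

lemma slice_0 [simp]: "slice s m 0 = 0" and slice_add: "slice s m (f + g) = slice s m f + slice s m g"
  and slice_diff: "slice s m (f - g) = slice s m f - slice s m g"
  by (rule mps_eqI; simp add: cf_slice)+

lemma slice_sum: "slice s m (\<Sum>i\<in>I. f i) = (\<Sum>i\<in>I. slice s m (f i))"
  by (induction I rule: infinite_finite_induct) (auto simp: slice_add)

lemma cf_via_slice: "cf g \<nu> = cf (slice s (lookup \<nu> s) g) (\<nu> - Poly_Mapping.single s (lookup \<nu> s))"
  unfolding cf_slice midx_split[of \<nu> s, symmetric] by (simp add: lookup_minus)

lemma slice_eqI: "(\<And>m. slice s m g = slice s m h) \<Longrightarrow> g = h"
proof (rule mps_eqI)
  fix \<nu> assume "\<And>m. slice s m g = slice s m h"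
  then show "cf g \<nu> = cf h \<nu>" unfolding cf_via_slice[of g \<nu> s] cf_via_slice[of h \<nu> s] by simp
qed

lemma slice_tvar: "slice s m (tvar s * g) = (if m = 0 then 0 else slice s (m - 1) g)"
proof (rule mps_eqI)
  fix \<nu> :: midx
  show "cf (slice s m (tvar s * g)) \<nu> = cf (if m = 0 then 0 else slice s (m - 1) g) \<nu>"
  proof (cases "lookup \<nu> s = 0")
    case True
    show ?thesis
    proof (cases m)
      case 0
      have "\<nu> \<noteq> Poly_Mapping.single s 1 + \<kappa>" for \<kappa>
        using True by (metis add_is_0 lookup_add lookup_single_eq zero_neq_one)
      then show ?thesis using 0 True cf_monom_mult_eq_0[of \<nu> "Poly_Mapping.single s 1" 1 g]
        by (simp add: cf_slice tvar_def)
    next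
      case (Suc m')
      have eq: "\<nu> + Poly_Mapping.single s m = Poly_Mapping.single s 1 + (\<nu> + Poly_Mapping.single s m')"
        unfolding Suc by (rule poly_mapping_eqI) (auto simp: lookup_add lookup_single when_def)
      show ?thesis using True Suc by (simp add: cf_slice tvar_def eq[unfolded Suc] del: add_Suc_right)
    qed
  qed (simp add: cf_slice)
qed

context cinf
begin

lemma V_s_zero: "f \<in> V s \<Longrightarrow> lookup a s \<noteq> 0 \<Longrightarrow> cf f a = 0"
  by (auto simp: V_def valid_idx_def)

lemma slice_mult:
  assumes f: "f \<in> V s" shows "slice s m (f * g) = f * slice s m g"
proof (rule mps_eqI)
  fix \<nu> :: midx
  let ?e = "Poly_Mapping.single s m :: midx"
  show "cf (slice s m (f * g)) \<nu> = cf (f * slice s m g) \<nu>"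
  proof (cases "lookup \<nu> s = 0")
    case True
    let ?h = "\<lambda>x :: midx \<times> midx. (fst x, snd x + ?e)"
    have inj: "inj_on ?h (splits \<nu>)" by (rule inj_onI) (metis add_right_cancel fst_conv snd_conv prod_eq_iff)
    have "cf (f * slice s m g) \<nu> = (\<Sum>x\<in>splits \<nu>. cf f (fst x) * cf g (snd x + ?e))"
      unfolding cf_mult case_prod_unfold
    proof (rule sum.cong)
      fix x assume "x \<in> splits \<nu>"
      then have "lookup (fst x) s + lookup (snd x) s = lookup \<nu> s" by (cases x) (auto simp: lookup_add)
      then show "cf f (fst x) * cf (slice s m g) (snd x) = cf f (fst x) * cf g (snd x + ?e)" using True by (simp add: cf_slice)
    qed simp
    also have "\<dots> = (\<Sum>x\<in>?h ` splits \<nu>. cf f (fst x) * cf g (snd x))"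
      by (subst sum.reindex[OF inj]) simp
    also have "\<dots> = (\<Sum>x\<in>splits (\<nu> + ?e). cf f (fst x) * cf g (snd x))"
    proof (rule sum.mono_neutral_left)
      show "?h ` splits \<nu> \<subseteq> splits (\<nu> + ?e)" by (auto simp: add.assoc)
      show "\<forall>x\<in>splits (\<nu> + ?e) - ?h ` splits \<nu>. cf f (fst x) * cf g (snd x) = 0"
      proof
        \<comment> \<open>A splitting outside the image gives part of the variable s to the first
          factor, where f has no coefficients.\<close>
        fix x assume x: "x \<in> splits (\<nu> + ?e) - ?h ` splits \<nu>"
        obtain a b where ab: "x = (a, b)" by (cases x)
        have eq: "a + b = \<nu> + ?e" using x ab by simp
        have "lookup a s \<noteq> 0"
        proof
          assume a0: "lookup a s = 0"
          have bs: "lookup b s = m" using arg_cong[OF eq, of "\<lambda>z. lookup z s"] a0 True by (simp add: lookup_add)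
          have b: "b = (b - ?e) + ?e" using midx_split[of b s] unfolding bs .
          then have "a + (b - ?e) = \<nu>" using eq by (metis add.assoc add_right_cancel)
          then have "x \<in> ?h ` splits \<nu>" using b ab by (intro image_eqI[of _ _ "(a, b - ?e)"]) auto
          then show False using x by blast
        qed
        then show "cf f (fst x) * cf g (snd x) = 0" using V_s_zero[OF f] ab by simp
      qed
    qed simp
    finally show ?thesis using True by (simp add: cf_slice cf_mult case_prod_unfold)
  next
    case False
    have "cf (f * slice s m g) \<nu> = 0"
      unfolding cf_mult
    proof (intro sum.neutral ballI)
      fix x assume "x \<in> splits \<nu>"
      then obtain a b where ab: "x = (a, b)" "a + b = \<nu>" by (cases x) auto
      then have "lookup a s \<noteq> 0 \<or> lookup b s \<noteq> 0" using False by (auto simp: lookup_add)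
      then show "(case x of (a, b) \<Rightarrow> cf f a * cf (slice s m g) b) = 0"
        using V_s_zero[OF f] ab by (auto simp: cf_slice)
    qed
    then show ?thesis using False by (simp add: cf_slice)
  qed
qed

lemma T_V: "f \<in> T s \<Longrightarrow> f \<in> V s"
  by (simp add: T_def)

lemma slice_const: "f \<in> V s \<Longrightarrow> slice s m f = (if m = 0 then f else 0)"
proof (rule mps_eqI)
  fix \<nu> assume f: "f \<in> V s"
  show "cf (slice s m f) \<nu> = cf (if m = 0 then f else 0) \<nu>"
    using V_s_zero[OF f, of \<nu>] V_s_zero[OF f, of "\<nu> + Poly_Mapping.single s m"]
    by (auto simp: cf_slice lookup_add)
qed

lemma slice_tau: "slice s m (tau g) = tau (slice s m g)"
  by (rule mps_eqI) (simp add: cf_slice power_0_left)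

lemma slice_taun: "slice s m ((tau ^^ n) g) = (tau ^^ n) (slice s m g)"
  by (induction n) (auto simp: slice_tau)

lemma slice_T:
  assumes g: "g \<in> T (Suc s)" shows "slice s m g \<in> T s"
proof -
  let ?h = "\<lambda>\<nu> :: midx. \<nu> + Poly_Mapping.single s m"
  have "cf (slice s m g) \<in> C0"
  proof (rule C0_I)
    fix \<epsilon> :: real assume e: "\<epsilon> > 0"
    have "finite (?h -` {\<nu>. \<epsilon> \<le> av (cf g \<nu>)})"
      using g e by (intro finite_vimageI C0_D) (auto simp: T_def CC_def inj_def)
    then show "finite {\<nu>. \<epsilon> \<le> av (cf (slice s m g) \<nu>)}"
      by (rule rev_finite_subset) (use e in \<open>auto simp: cf_slice split: if_splits\<close>)
  qed
  moreover have "cf (slice s m g) \<nu> = 0" if nv: "\<not> valid_idx s (lookup \<nu>)" for \<nu>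
  proof (cases "lookup \<nu> s = 0")
    case True
    have "\<not> valid_idx (Suc s) (lookup \<nu>)"
    proof
      assume v: "valid_idx (Suc s) (lookup \<nu>)"
      have "lookup \<nu> i = 0" if "i \<ge> s" for i
      proof (cases "i = s")
        case False then show ?thesis using v that by (simp add: valid_idx_def)
      qed (use True in simp)
      then show False using nv by (simp add: valid_idx_def)
    qed
    then have "\<not> valid_idx (Suc s) (lookup (\<nu> + Poly_Mapping.single s m))" by (simp add: valid_idx_add)
    then show ?thesis using g True by (simp add: cf_slice T_def V_def)
  qed (simp add: cf_slice)
  ultimately show ?thesis by (simp add: T_def V_def CC_def)
qed

lemma slice_tendsto_0:
  assumes g: "g \<in> T (Suc s)" shows "(\<lambda>m. nrm (slice s m g)) \<longlonglongrightarrow> 0"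
proof (rule LIMSEQ_I)
  fix r :: real assume r: "0 < r"
  have fin: "finite ((\<lambda>\<nu>. lookup \<nu> s) ` {\<nu>. r \<le> av (cf g \<nu>)})"
    using g r by (intro finite_imageI C0_D) (auto simp: T_def CC_def)
  then obtain M where M: "\<And>\<nu>. r \<le> av (cf g \<nu>) \<Longrightarrow> lookup \<nu> s < M"
    using finite_nat_set_iff_bounded[of "(\<lambda>\<nu>. lookup \<nu> s) ` {\<nu>. r \<le> av (cf g \<nu>)}"] by auto
  have "norm (nrm (slice s m g) - 0) < r" if "m \<ge> M" for m
  proof -
    have c: "slice s m g \<in> CC" by (rule T_CC[OF slice_T[OF g]])
    have "nrm (slice s m g) < r"
    proof (rule nrm_less[OF c r])
      fix \<nu>
      have "av (cf g (\<nu> + Poly_Mapping.single s m)) < r"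
      proof (rule ccontr)
        assume "\<not> ?thesis"
        then have "lookup (\<nu> + Poly_Mapping.single s m) s < M" by (intro M) simp
        then show False using that by (simp add: lookup_add)
      qed
      then show "av (cf (slice s m g) \<nu>) < r" using r by (simp add: cf_slice)
    qed
    then show ?thesis using nrm_nonneg[OF c] by simp
  qed
  then show "\<exists>no. \<forall>n\<ge>no. norm (nrm (slice s n g) - 0) < r" by blast
qed

lemma slice_assemble: "(\<And>m. k m \<in> V s) \<Longrightarrow> slice s m (assemble s k) = k m"
proof (rule mps_eqI)
  fix \<nu> assume k: "\<And>m. k m \<in> V s"
  show "cf (slice s m (assemble s k)) \<nu> = cf (k m) \<nu>"
    using V_s_zero[OF k, of \<nu> m] by (auto simp: cf_slice cf_assemble lookup_add)
qed

lemma assemble_T: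
  assumes k: "\<And>m. k m \<in> T s" and lim: "(\<lambda>m. nrm (k m)) \<longlonglongrightarrow> 0"
  shows "assemble s k \<in> T (Suc s)"
proof -
  have "cf (assemble s k) \<in> C0"
  proof (rule C0_I)
    fix \<epsilon> :: real assume e: "\<epsilon> > 0"
    have "\<forall>\<^sub>F m in sequentially. nrm (k m) < \<epsilon>" using lim e by (rule order_tendstoD)
    then obtain M where M: "\<And>m. m \<ge> M \<Longrightarrow> nrm (k m) < \<epsilon>" by (auto simp: eventually_sequentially)
    have "finite (\<Union>m<M. (\<lambda>\<mu>. \<mu> + Poly_Mapping.single s m) ` {\<mu>. \<epsilon> \<le> av (cf (k m) \<mu>)})"
      using k e by (intro finite_UN_I finite_imageI C0_D) (auto simp: T_def CC_def)
    then show "finite {\<nu>. \<epsilon> \<le> av (cf (assemble s k) \<nu>)}"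
    proof (rule rev_finite_subset, intro subsetI)
      fix \<nu> assume "\<nu> \<in> {\<nu>. \<epsilon> \<le> av (cf (assemble s k) \<nu>)}"
      then have a: "\<epsilon> \<le> av (cf (k (lookup \<nu> s)) (\<nu> - Poly_Mapping.single s (lookup \<nu> s)))" by (simp add: cf_assemble)
      have "lookup \<nu> s < M"
        using M[of "lookup \<nu> s"] nrm_ge[OF T_CC[OF k], of "lookup \<nu> s" "\<nu> - Poly_Mapping.single s (lookup \<nu> s)"] a
        by (meson le_less_trans not_le)
      then show "\<nu> \<in> (\<Union>m<M. (\<lambda>\<mu>. \<mu> + Poly_Mapping.single s m) ` {\<mu>. \<epsilon> \<le> av (cf (k m) \<mu>)})"
        using a midx_split[of \<nu> s] by blast
    qed
  qed
  moreover have "cf (assemble s k) \<nu> = 0" if nv: "\<not> valid_idx (Suc s) (lookup \<nu>)" for \<nu>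
  proof -
    obtain i where i: "i \<ge> Suc s" "lookup \<nu> i \<noteq> 0" using nv by (auto simp: valid_idx_def)
    have "lookup (\<nu> - Poly_Mapping.single s (lookup \<nu> s)) i \<noteq> 0"
      using i by (simp add: lookup_minus lookup_single when_def)
    then have "\<not> valid_idx s (lookup (\<nu> - Poly_Mapping.single s (lookup \<nu> s)))"
      using i(1) unfolding valid_idx_def by (metis Suc_leD)
    then show ?thesis using k by (simp add: cf_assemble T_def V_def)
  qed
  ultimately show ?thesis by (simp add: T_def V_def CC_def)
qed

lemma tvar_T: "tvar s \<in> T (Suc s)"
  by (auto simp: T_def tvar_def V_def cf_monom valid_idx_def lookup_single when_def)

lemma tau_tvar: "tau (tvar s) = tvar s"
  by (rule mps_eqI) (simp add: tvar_def cf_monom power_0_left)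

section \<open>Evaluation at t = theta\<close>

lemma T_Suc: "f \<in> T s \<Longrightarrow> f \<in> T (Suc s)"
  by (rule T_mono) auto

text \<open>The substitution of theta t for t. It may leave the Tate algebra and is therefore
  defined on all power series; evaluation at t = theta becomes evaluation at t = 1.\<close>

definition scl :: "nat \<Rightarrow> 'a mps \<Rightarrow> 'a mps" where
  "scl s g = Mps (\<lambda>\<nu>. \<theta> ^ lookup \<nu> s * cf g \<nu>)"

lemma cf_scl: "cf (scl s g) \<nu> = \<theta> ^ lookup \<nu> s * cf g \<nu>"
  by (simp add: scl_def)

lemma scl_add: "scl s (f + g) = scl s f + scl s g"
  by (rule mps_eqI) (simp add: cf_scl distrib_left)

lemma scl_mult: "scl s (f * g) = scl s f * scl s g"
proof (rule mps_eqI)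
  fix \<nu>
  show "cf (scl s (f * g)) \<nu> = cf (scl s f * scl s g) \<nu>"
    unfolding cf_scl cf_mult sum_distrib_left
    by (intro sum.cong) (auto simp: lookup_add power_add cf_scl mult_ac)
qed

lemma scl_V: "f \<in> V s \<Longrightarrow> scl s f = f"
  by (rule mps_eqI) (metis V_s_zero cf_scl mult_1 mult_zero_right power_0)

lemma slice_scl: "slice s m (scl s g) = const (\<theta> ^ m) * slice s m g"
  by (rule mps_eqI) (simp add: cf_slice cf_scl lookup_add)

text \<open>Evaluation at t = theta, where t is the variable s: the series converges at theta only after t has
  been rescaled, and there the value h is singled out by divisibility of the difference by t - 1.\<close>

definition eval_at :: "nat \<Rightarrow> 'a mps \<Rightarrow> 'a mps \<Rightarrow> bool" where
  "eval_at s g h \<longleftrightarrow> h \<in> T s \<and> (\<exists>k\<in>T (Suc s). scl s g = h + (tvar s - 1) * k)"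

lemma slice_tvar_1: "slice s m ((tvar s - 1) * k) = (if m = 0 then 0 else slice s (m - 1) k) - slice s m k"
  by (simp add: left_diff_distrib slice_diff slice_tvar)

text \<open>Two values differ by (t - 1) d with d in the Tate algebra. The difference is free of t,
  so all slices of d are equal; they tend to 0, hence vanish, and so does the difference.\<close>

lemma eval_at_unique:
  assumes "eval_at s g h" "eval_at s g h'" shows "h = h'"
proof -
  obtain k k' where k: "h \<in> T s" "h' \<in> T s" "k \<in> T (Suc s)" "k' \<in> T (Suc s)"
    "scl s g = h + (tvar s - 1) * k" "scl s g = h' + (tvar s - 1) * k'"
    using assms unfolding eval_at_def by blast
  define d where "d = k' - k"
  have dT: "d \<in> T (Suc s)" unfolding d_def using k by (intro T_diff)
  have "h - h' = (tvar s - 1) * d" using k(5,6) by (simp add: d_def algebra_simps)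
  then have eq: "slice s m (h - h') = slice s m ((tvar s - 1) * d)" for m by simp
  have hV: "h - h' \<in> V s" using T_V[OF T_diff[OF k(1,2)]] .
  have step: "slice s (Suc m) d = slice s m d" for m
    using eq[of "Suc m"] unfolding slice_const[OF hV] slice_tvar_1 by simp
  have "slice s m d = slice s 0 d" for m by (induction m) (auto simp: step)
  then have "(\<lambda>m. nrm (slice s m d)) = (\<lambda>m. nrm (slice s 0 d))" by (intro ext arg_cong[where f = nrm])
  then have "(\<lambda>m::nat. nrm (slice s 0 d)) \<longlonglongrightarrow> 0" using slice_tendsto_0[OF dT] by simp
  then have "nrm (slice s 0 d) = 0" by (simp add: LIMSEQ_const_iff)
  then have "slice s 0 d = 0" using nrm_eq_0_iff[OF T_CC[OF slice_T[OF dT]]] by blast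
  then show ?thesis using eq[of 0] unfolding slice_const[OF hV] slice_tvar_1 by simp
qed

lemma eval_at_const: "h \<in> T s \<Longrightarrow> eval_at s h h"
  unfolding eval_at_def using scl_V[OF T_V] by (auto intro!: bexI[of _ 0])

lemma eval_at_add: "eval_at s g h \<Longrightarrow> eval_at s g' h' \<Longrightarrow> eval_at s (g + g') (h + h')"
  unfolding eval_at_def
proof safe
  fix k k' assume k: "k \<in> T (Suc s)" "k' \<in> T (Suc s)" "scl s g = h + (tvar s - 1) * k" "scl s g' = h' + (tvar s - 1) * k'"
  have "scl s (g + g') = h + h' + (tvar s - 1) * (k + k')"
    unfolding scl_add k(3,4) by (simp add: algebra_simps)
  then show "\<exists>k\<in>T (Suc s). scl s (g + g') = h + h' + (tvar s - 1) * k"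
    using T_add[OF k(1,2)] by blast
qed (rule T_add)

lemma eval_at_sum: "(\<And>i. i \<in> I \<Longrightarrow> eval_at s (g i) (h i)) \<Longrightarrow> eval_at s (\<Sum>i\<in>I. g i) (\<Sum>i\<in>I. h i)"
  by (induction I rule: infinite_finite_induct) (auto intro: eval_at_add eval_at_const)

lemma eval_at_mult: "eval_at s g h \<Longrightarrow> eval_at s g' h' \<Longrightarrow> eval_at s (g * g') (h * h')"
  unfolding eval_at_def
proof safe
  fix k k' assume k: "h \<in> T s" "h' \<in> T s" "k \<in> T (Suc s)" "k' \<in> T (Suc s)" "scl s g = h + (tvar s - 1) * k" "scl s g' = h' + (tvar s - 1) * k'"
  have "h * k' + k * h' + (tvar s - 1) * k * k' \<in> T (Suc s)"
    by (intro T_add T_mult T_diff tvar_T T_1 k(3,4) T_Suc[OF k(1)] T_Suc[OF k(2)])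
  moreover have "scl s (g * g') = h * h' + (tvar s - 1) * (h * k' + k * h' + (tvar s - 1) * k * k')"
    unfolding scl_mult k(5,6) by (simp add: algebra_simps)
  ultimately show "\<exists>k\<in>T (Suc s). scl s (g * g') = h * h' + (tvar s - 1) * k" by blast
qed (rule T_mult)

text \<open>The sequence p consists of the tails of the series at theta: it tends to 0 and its
  differences are the terms, so \<open>p 0\<close> is the sum. The shifted tails are the slices of
  the quotient by t - 1.\<close>

lemma eval_at_asmI:
  assumes p: "\<And>m. p m \<in> T s" and lim: "(\<lambda>m. nrm (p m)) \<longlonglongrightarrow> 0"
    and eq: "\<And>m. const (\<theta> ^ m) * slice s m g = p m - p (Suc m)"
  shows "eval_at s g (p 0)"
proof -
  have k: "assemble s (\<lambda>m. p (Suc m)) \<in> T (Suc s)" by (rule assemble_T[OF p LIMSEQ_Suc[OF lim]])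
  have "scl s g = p 0 + (tvar s - 1) * assemble s (\<lambda>m. p (Suc m))"
  proof (rule slice_eqI[of s])
    fix m
    show "slice s m (scl s g) = slice s m (p 0 + (tvar s - 1) * assemble s (\<lambda>m. p (Suc m)))"
      unfolding slice_scl eq slice_add slice_tvar_1 slice_const[OF T_V[OF p]] slice_assemble[OF T_V[OF p]]
      by (cases m) auto
  qed
  then show ?thesis unfolding eval_at_def using p k by blast
qed

lemma eval_at_exists:
  assumes g: "\<And>m. slice s m g \<in> T s" and lim: "(\<lambda>m. nrm (slice s m g) * real q ^ m) \<longlonglongrightarrow> 0"
  shows "\<exists>h. eval_at s g h"
proof -
  define G where "G m = const (\<theta> ^ m) * slice s m g" for m
  have GT: "G m \<in> T s" for m unfolding G_def by (intro T_mult T_const g)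
  have nG: "nrm (G m) = nrm (slice s m g) * real q ^ m" for m
    unfolding G_def by (simp add: nrm_mult T_CC[OF g] av_power av_theta mult.commute)
  define P where "P n = (\<Sum>m<n. G m)" for n
  have PT: "P n \<in> T s" for n unfolding P_def by (intro T_sum GT)
  have "(\<lambda>n. nrm (P (Suc n) - P n)) \<longlonglongrightarrow> 0" using lim by (simp add: P_def nG)
  then obtain h where h: "h \<in> T s" "nlim P h" using T_complete[of P s] PT by blast
  have "eval_at s g (h - P 0)"
  proof (rule eval_at_asmI[where p = "\<lambda>m. h - P m"])
    show "h - P m \<in> T s" for m by (intro T_diff h PT)
    show "(\<lambda>m. nrm (h - P m)) \<longlonglongrightarrow> 0" using h(2) unfolding nlim_def by (simp add: nrm_diff_commute)
    show "const (\<theta> ^ m) * slice s m g = (h - P m) - (h - P (Suc m))" for m by (simp add: P_def G_def)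
  qed
  then show ?thesis by blast
qed

text \<open>A nonzero top term has absolute value q^d, strictly above all lower terms, so it cannot
  cancel.\<close>

lemma Fq_theta_independent:
  assumes c: "\<And>m. m < d \<Longrightarrow> x m \<in> Fq q" and z: "(\<Sum>m<d. x m * \<theta> ^ m) = 0" and m: "m < d"
  shows "x m = (0::'a)"
  using c z m
proof (induction d)
  case (Suc d)
  have "av (\<Sum>m<d. x m * \<theta> ^ m) < real q ^ d"
  proof (rule av_sum_less)
    fix m assume m: "m \<in> {..<d}"
    have "av (x m) \<le> 1" using av_Fq[of "x m"] Suc(2)[of m] m by (cases "x m = 0") auto
    then have "av (x m * \<theta> ^ m) \<le> 1 * real q ^ m"
      unfolding av_mult av_power av_theta by (intro mult_right_mono) auto
    also have "\<dots> < real q ^ d" using m q_ge_2 by (simp add: power_strict_increasing)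
    finally show "av (x m * \<theta> ^ m) < real q ^ d" .
  qed simp
  moreover have "(\<Sum>m<d. x m * \<theta> ^ m) = - (x d * \<theta> ^ d)" using Suc(3) by (simp add: eq_neg_iff_add_eq_0)
  ultimately have "av (x d) * real q ^ d < real q ^ d" by (simp add: av_mult av_power av_theta)
  then have "x d = 0" using av_Fq[of "x d"] Suc(2)[of d] by auto
  then show ?case using Suc by (cases "m = d") auto
qed simp

end

text \<open>Once the terms are small, the maximum cannot be the power of the new term itself, so the
  new term is bounded by W times the q-th power of the previous one. This yields at least geometric
  decay with ratio 1/(2q), enough to beat the factor q^m.\<close>

lemma superexponential_decay:
  fixes \<beta> :: "nat \<Rightarrow> real"
  assumes b0: "\<And>m. 0 \<le> \<beta> m" and lim: "\<beta> \<longlonglongrightarrow> 0" and W: "W \<ge> 1" and q: "q \<ge> (2::nat)"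
    and rec: "\<And>m. \<beta> (Suc m) \<le> W * max (\<beta> (Suc m) ^ q) (\<beta> m ^ q)"
  shows "(\<lambda>m. \<beta> m ^ q * real q ^ m) \<longlonglongrightarrow> 0"
proof -
  \<comment> \<open>Below this threshold W times the q-th power of a term is at most the term
    divided by 2q.\<close>
  have "0 < 1 / (2 * real q * W)" using W q by simp
  then have "\<forall>\<^sub>F m in sequentially. \<beta> m < 1 / (2 * real q * W)" using lim by (intro order_tendstoD)
  then obtain M where M: "\<And>m. m \<ge> M \<Longrightarrow> \<beta> m < 1 / (2 * real q * W)" by (auto simp: eventually_sequentially)
  have "1 * 1 \<le> (2 * real q) * W" using W q by (intro mult_mono) auto
  then have W2: "1 \<le> 2 * real q * W" by simp
  then have le1: "1 / (2 * real q * W) \<le> 1" by (intro divide_le_eq_1_pos[THEN iffD2]) linarith+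
  have pw: "\<beta> m ^ q \<le> \<beta> m ^ 2" if "m \<ge> M" for m
    using M[OF that] le1 b0[of m] q by (intro power_decreasing) auto
  have small: "W * \<beta> m ^ q \<le> \<beta> m / (2 * real q)" if m: "m \<ge> M" for m
  proof -
    have "W * \<beta> m ^ q \<le> W * (\<beta> m * \<beta> m)" using pw[OF m] W by (simp add: power2_eq_square)
    also have "\<dots> \<le> W * (\<beta> m * (1 / (2 * real q * W)))"
      using M[OF m] W b0[of m] by (intro mult_left_mono) auto
    also have "\<dots> = \<beta> m / (2 * real q)" using W by simp
    finally show ?thesis .
  qed
  have step: "\<beta> (Suc m) \<le> \<beta> m / (2 * real q)" if m: "m \<ge> M" for m
  proof (cases "\<beta> (Suc m) = 0")
    case True then show ?thesis using b0[of m] by simp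
  next
    case False
    then have pos: "\<beta> (Suc m) > 0" using b0[of "Suc m"] by simp
    \<comment> \<open>If the maximum were attained by the new term, that term would be strictly
      smaller than itself.\<close>
    have "W * \<beta> (Suc m) ^ q \<le> \<beta> (Suc m) / (2 * real q)" using small[of "Suc m"] m by simp
    also have "\<dots> < \<beta> (Suc m)" using pos q by (simp add: divide_less_eq)
    finally have "W * \<beta> (Suc m) ^ q < \<beta> (Suc m)" .
    then have "\<beta> (Suc m) \<le> W * \<beta> m ^ q" using rec[of m] by (auto simp: max_def split: if_splits)
    then show ?thesis using small[OF m] by simp
  qed
  have geo: "\<beta> (M + k) \<le> \<beta> M / (2 * real q) ^ k" for k
  proof (induction k)
    case (Suc k)
    have "\<beta> (M + Suc k) \<le> \<beta> (M + k) / (2 * real q)" using step[of "M + k"] by simp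
    also have "\<dots> \<le> (\<beta> M / (2 * real q) ^ k) / (2 * real q)" using Suc q by (intro divide_right_mono) auto
    finally show ?case by (simp add: mult_ac)
  qed simp
  have "(\<lambda>k. \<beta> (k + M) ^ q * real q ^ (k + M)) \<longlonglongrightarrow> 0"
  proof (rule tendsto_sandwich[of "\<lambda>_. 0" _ _ "\<lambda>k. (\<beta> M * real q ^ M) / 2 ^ k"])
    have "\<beta> (k + M) ^ q * real q ^ (k + M) \<le> (\<beta> M * real q ^ M) / 2 ^ k" for k
    proof -
      have "\<beta> (k + M) ^ q \<le> \<beta> (k + M) ^ 1" using M[of "k + M"] le1 b0[of "k + M"] q by (intro power_decreasing) auto
      then have "\<beta> (k + M) ^ q * real q ^ (k + M) \<le> (\<beta> M / (2 * real q) ^ k) * real q ^ (k + M)"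
        using geo[of k] by (intro mult_right_mono) (auto simp: add.commute)
      also have "\<dots> = (\<beta> M * real q ^ M) / 2 ^ k" using q by (simp add: power_mult_distrib power_add)
      finally show ?thesis .
    qed
    then show "\<forall>\<^sub>F k in sequentially. \<beta> (k + M) ^ q * real q ^ (k + M) \<le> (\<beta> M * real q ^ M) / 2 ^ k" by simp
    show "\<forall>\<^sub>F k in sequentially. 0 \<le> \<beta> (k + M) ^ q * real q ^ (k + M)" using b0 by simp
    show "(\<lambda>k. (\<beta> M * real q ^ M) / 2 ^ k) \<longlonglongrightarrow> 0" by (rule LIMSEQ_divide_realpow_zero) simp
  qed simp
  then show ?thesis by (rule LIMSEQ_offset)
qed

section \<open>Anderson generating functions\<close>

locale drinfeld_operator = cinf +
  fixes s r :: nat and A :: "nat \<Rightarrow> 'a mps" and Ar' :: "'a mps"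
  assumes A0: "A 0 = const \<theta>" and AT: "A n \<in> T s" and A_gt: "n > r \<Longrightarrow> A n = 0" and r: "r \<ge> 1"
    and Ar': "Ar' \<in> T s" "A r * Ar' = 1"
begin

abbreviation "E \<equiv> Ex A"

lemma entE: "entire s E"
  by (rule Ex_entire[OF AT r A_gt])

lemma tpolyA: "tpoly s A"
  unfolding tpoly_def using AT A_gt by (auto intro!: exI[of _ "Suc r"])

definition phi :: "'a mps \<Rightarrow> 'a mps" where
  "phi x = (\<Sum>k<Suc r. A k * (tau ^^ k) x)"

lemma phi_eq: "phi x = const \<theta> * x + (\<Sum>k=1..r. A k * (tau ^^ k) x)"
proof -
  have "{..<Suc r} = insert 0 {1..r}" by auto
  then show ?thesis by (simp add: phi_def A0)
qed

lemma phi_T: "x \<in> T s \<Longrightarrow> phi x \<in> T s"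
  unfolding phi_def by (intro T_sum T_mult AT T_taun)

lemma phi_diff: "phi (x - y) = phi x - phi y"
  by (simp add: phi_def taun_diff right_diff_distrib sum_subtractf)

lemma phi_0 [simp]: "phi 0 = 0"
  by (simp add: phi_def)

lemma phi_E: "x \<in> T s \<Longrightarrow> app E (const \<theta> * x) = phi (app E x)"
  using app_tm_sc[of "const \<theta>" s x E] app_tm[OF tpolyA _ entE, of "Suc r" x] A_gt
  unfolding Ex_eq[of A, OF A0] phi_def by auto

definition Lamm :: "'a mps set" where
  "Lamm = {x \<in> T s. app E x = 0}"

lemma Lamm_T: "x \<in> Lamm \<Longrightarrow> x \<in> T s"
  by (simp add: Lamm_def)

lemma Lamm_add: "x \<in> Lamm \<Longrightarrow> y \<in> Lamm \<Longrightarrow> x + y \<in> Lamm"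
  by (simp add: Lamm_def T_add app_add_arg[OF entE])

lemma Lamm_fixed: "x \<in> Lamm \<Longrightarrow> c \<in> T s \<Longrightarrow> tau c = c \<Longrightarrow> c * x \<in> Lamm"
  by (simp add: Lamm_def T_mult app_fixed_mult[OF entE])

lemma Lamm_theta: "x \<in> Lamm \<Longrightarrow> const \<theta> * x \<in> Lamm"
  by (simp add: Lamm_def T_mult phi_E)

lemma Lamm_theta_power: "x \<in> Lamm \<Longrightarrow> const (\<theta> ^ n) * x \<in> Lamm"
proof (induction n)
  case (Suc n)
  then have "const \<theta> * (const (\<theta> ^ n) * x) \<in> Lamm" by (intro Lamm_theta) simp
  then show ?case by (simp add: const_mult mult.assoc)
qed simp

lemma Lamm_0: "0 \<in> Lamm"
  by (simp add: Lamm_def app_0[OF entE])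

lemma Lamm_sum: "(\<And>i. i \<in> I \<Longrightarrow> x i \<in> Lamm) \<Longrightarrow> (\<Sum>i\<in>I. x i) \<in> Lamm"
  by (induction I rule: infinite_finite_induct) (auto intro: Lamm_add Lamm_0)

text \<open>The exponential minus the identity, to which the quadratic bound applies.\<close>

definition E1 :: "nat \<Rightarrow> 'a mps" where
  "E1 n = (if n = 0 then 0 else E n)"

lemma entE1: "entire s E1"
  by (rule entire_le[OF entE]) (auto simp: E1_def entire_T[OF entE] nrm_nonneg T_CC[OF entire_T[OF entE]])

lemma app_E: "x \<in> T s \<Longrightarrow> app E x = x + app E1 x"
proof -
  assume x: "x \<in> T s"
  have "E = sc 1 + E1" by (auto simp: E1_def sc_def fun_eq_iff)
  moreover have sc1: "entire s (sc 1)"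
    by (rule entire_le[OF entE]) (auto simp: sc_def nrm_nonneg T_CC[OF entire_T[OF entE]])
  moreover have "app (sc 1) x = x"
  proof (rule app_eqI[OF sc1 x T_CC[OF x]])
    have "psum (sc 1) x (Suc n) = x" for n
    proof -
      have "psum (sc 1) x (Suc n) = (\<Sum>k<Suc n. if k = 0 then x else 0)"
        unfolding psum_def by (intro sum.cong) (auto simp: sc_def)
      then show ?thesis by (simp del: sum.lessThan_Suc)
    qed
    then have "(\<lambda>n. nrm (psum (sc 1) x (Suc n) - x)) \<longlonglongrightarrow> 0" by simp
    then show "nlim (psum (sc 1) x) x" unfolding nlim_def by (rule LIMSEQ_imp_Suc)
  qed
  ultimately show ?thesis using app_add[OF sc1 entE1 x] by simp
qed

lemma app_E_diff_CC: "x \<in> T s \<Longrightarrow> app E x - x \<in> CC"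
  by (intro CC_diff T_CC[OF app_T[OF entE]] T_CC[of _ s])

lemma exp_bound:
  obtains D where "D \<ge> 1" "\<And>x. x \<in> T s \<Longrightarrow> nrm x \<le> 1 \<Longrightarrow> nrm (app E x - x) \<le> D * nrm x ^ 2"
  using app_quadratic_bound[OF entE1] app_E by (metis E1_def add_diff_cancel_left')

definition pw :: "nat \<Rightarrow> 'a mps" where
  "pw m = const (inverse (\<theta> ^ m))"

lemma pw_T: "pw m \<in> T s'"
  by (simp add: pw_def)

lemma theta_pw: "const \<theta> * pw (Suc m) = pw m"
proof -
  have "\<theta> * inverse (\<theta> ^ Suc m) = inverse (\<theta> ^ m)" by simp
  then show ?thesis unfolding pw_def const_mult[symmetric] by (rule arg_cong)
qed

lemma power_pw: "const (\<theta> ^ m) * pw m = 1"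
  by (simp add: pw_def const_inverse)

lemma nrm_pw: "x \<in> CC \<Longrightarrow> nrm (pw m * x) = nrm x / real q ^ m"
  by (simp add: pw_def nrm_mult av_inverse av_power av_theta divide_inverse mult.commute)

lemma tends_div_q: "(\<lambda>m. c / real q ^ m) \<longlonglongrightarrow> 0"
  by (rule LIMSEQ_divide_realpow_zero) (use q_ge_2 in simp)

text \<open>At theta^(-m) x the quadratic bound contributes q^(-2m), which leaves q^(-m) after
  multiplication by q^m. Applied to exp minus the identity it says that theta^m exp(theta^(-m) x)
  tends to x.\<close>

lemma quad_decay:
  assumes a: "entire s a" and x: "x \<in> T s" 
    and bd: "\<And>x. x \<in> T s \<Longrightarrow> nrm x \<le> 1 \<Longrightarrow> nrm (f x) \<le> D * nrm x ^ 2" and fC: "\<And>x. x \<in> T s \<Longrightarrow> f x \<in> CC"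
  shows "(\<lambda>m. real q ^ m * nrm (f (pw m * x))) \<longlonglongrightarrow> 0"
proof (rule tendsto_sandwich[of "\<lambda>_. 0" _ _ "\<lambda>m. (D * nrm x ^ 2) / real q ^ m"])
  have "\<forall>\<^sub>F m in sequentially. nrm x / real q ^ m < 1" using tends_div_q by (rule order_tendstoD) simp
  then show "\<forall>\<^sub>F m in sequentially. real q ^ m * nrm (f (pw m * x)) \<le> (D * nrm x ^ 2) / real q ^ m"
  proof (rule eventually_mono)
    fix m assume m: "nrm x / real q ^ m < 1"
    have "nrm (f (pw m * x)) \<le> D * (nrm x / real q ^ m) ^ 2"
      using bd[of "pw m * x"] m x by (simp add: nrm_pw T_CC T_mult pw_T)
    then have "real q ^ m * nrm (f (pw m * x)) \<le> real q ^ m * (D * (nrm x / real q ^ m) ^ 2)"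
      by (intro mult_left_mono) auto
    also have "\<dots> = (D * nrm x ^ 2) / real q ^ m" by (simp add: power2_eq_square)
    finally show "real q ^ m * nrm (f (pw m * x)) \<le> (D * nrm x ^ 2) / real q ^ m" .
  qed
  show "\<forall>\<^sub>F m in sequentially. 0 \<le> real q ^ m * nrm (f (pw m * x))"
    using x by (auto intro!: always_eventually mult_nonneg_nonneg nrm_nonneg fC T_mult pw_T)
qed (use tends_div_q in auto)

text \<open>The Anderson generating function, the sum of exp(theta^(-m-1) x) t^m, where t is the
  variable with index s.\<close>

definition anderson :: "'a mps \<Rightarrow> 'a mps" where
  "anderson x = assemble s (\<lambda>m. app E (pw (Suc m) * x))"

lemma app_E_pw_T: "x \<in> T s \<Longrightarrow> app E (pw m * x) \<in> T s"
  by (intro app_T[OF entE] T_mult pw_T)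

lemma app_E_pw_tendsto_0: "x \<in> T s \<Longrightarrow> (\<lambda>m. nrm (app E (pw m * x))) \<longlonglongrightarrow> 0"
proof -
  assume x: "x \<in> T s"
  obtain D where D: "D \<ge> 1" "\<And>x. x \<in> T s \<Longrightarrow> nrm x \<le> 1 \<Longrightarrow> nrm (app E x - x) \<le> D * nrm x ^ 2"
    using exp_bound by blast
  have 1: "(\<lambda>m. real q ^ m * nrm (app E (pw m * x) - pw m * x)) \<longlonglongrightarrow> 0"
    by (rule quad_decay[OF entE x D(2)]) (auto intro: app_E_diff_CC)
  have yC: "app E (pw m * x) - pw m * x \<in> CC" for m
    using x by (intro CC_diff T_CC[OF app_E_pw_T[OF x]] T_CC[of _ s] T_mult pw_T)
  show ?thesis
  proof (rule tendsto_0_le)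
    show "0 \<le> nrm (app E (pw m * x))" for m by (rule nrm_nonneg[OF T_CC[OF app_E_pw_T[OF x]]])
    show "nrm (app E (pw m * x)) \<le> real q ^ m * nrm (app E (pw m * x) - pw m * x) + nrm x / real q ^ m" for m
    proof -
      have sup_norm: "0 \<le> nrm (app E (pw m * x) - pw m * x)" by (rule nrm_nonneg[OF yC])
      have "nrm (app E (pw m * x)) = nrm ((app E (pw m * x) - pw m * x) + pw m * x)" by simp
      also have "\<dots> \<le> max (nrm (app E (pw m * x) - pw m * x)) (nrm (pw m * x))"
        using x by (intro nrm_add yC T_CC[of _ s] T_mult pw_T)
      also have "\<dots> \<le> nrm (app E (pw m * x) - pw m * x) + nrm x / real q ^ m"
        using sup_norm nrm_nonneg[OF T_CC[OF x]] by (simp add: nrm_pw T_CC[OF x])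
      also have "nrm (app E (pw m * x) - pw m * x) \<le> real q ^ m * nrm (app E (pw m * x) - pw m * x)"
        using sup_norm mult_right_mono[OF one_le_power[of "real q" m] sup_norm] q_ge_2 by simp
      finally show ?thesis by simp
    qed
    show "(\<lambda>m. real q ^ m * nrm (app E (pw m * x) - pw m * x) + nrm x / real q ^ m) \<longlonglongrightarrow> 0"
      using tendsto_add[OF 1 tends_div_q] by simp
  qed
qed

lemma anderson_T: "x \<in> T s \<Longrightarrow> anderson x \<in> T (Suc s)"
  unfolding anderson_def by (rule assemble_T[OF app_E_pw_T LIMSEQ_Suc[OF app_E_pw_tendsto_0]])

lemma slice_anderson: "x \<in> T s \<Longrightarrow> slice s m (anderson x) = app E (pw (Suc m) * x)"
  unfolding anderson_def by (rule slice_assemble[OF T_V[OF app_E_pw_T]])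

lemma anderson_add: "x \<in> T s \<Longrightarrow> y \<in> T s \<Longrightarrow> anderson (x + y) = anderson x + anderson y"
  by (rule slice_eqI[of s]) (simp add: slice_anderson slice_add T_add distrib_left app_add_arg[OF entE] T_mult pw_T)

lemma anderson_0 [simp]: "anderson 0 = 0"
  by (rule slice_eqI[of s]) (simp add: slice_anderson app_0[OF entE])

lemma anderson_sum: "(\<And>i. i \<in> I \<Longrightarrow> x i \<in> T s) \<Longrightarrow> anderson (\<Sum>i\<in>I. x i) = (\<Sum>i\<in>I. anderson (x i))"
  by (induction I rule: infinite_finite_induct) (auto simp: anderson_add T_sum)

lemma anderson_fixed: 
  assumes "x \<in> T s" "c \<in> T s" "tau c = c" shows "anderson (c * x) = c * anderson x"
proof (rule slice_eqI[of s])
  fix m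
  have "pw (Suc m) * (c * x) = c * (pw (Suc m) * x)" by (simp add: mult_ac)
  then have "app E (pw (Suc m) * (c * x)) = app E (c * (pw (Suc m) * x))" by (rule arg_cong)
  also have "\<dots> = c * app E (pw (Suc m) * x)" by (rule app_fixed_mult[OF entE T_mult[OF pw_T assms(1)] assms(2,3)])
  finally show "slice s m (anderson (c * x)) = slice s m (c * anderson x)"
    using assms by (simp add: slice_anderson slice_mult[OF T_V] T_mult)
qed

text \<open>Multiplying x by theta shifts the sequence of coefficients. The coefficient that enters
  at m = 0 is exp(x), which vanishes because x is a period.\<close>

lemma anderson_theta: "x \<in> Lamm \<Longrightarrow> anderson (const \<theta> * x) = tvar s * anderson x"
proof (rule slice_eqI[of s])
  fix m assume x: "x \<in> Lamm"
  have "pw (Suc m) * (const \<theta> * x) = (const \<theta> * pw (Suc m)) * x" by (simp only: mult_ac)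
  then have "pw (Suc m) * (const \<theta> * x) = pw m * x" unfolding theta_pw .
  moreover have "pw 0 * x = x" by (simp add: pw_def)
  ultimately show "slice s m (anderson (const \<theta> * x)) = slice s m (tvar s * anderson x)"
    using x by (cases m) (auto simp: slice_tvar slice_anderson T_mult Lamm_def)
qed

lemma anderson_theta_power: "x \<in> Lamm \<Longrightarrow> anderson (const (\<theta> ^ n) * x) = tvar s ^ n * anderson x"
proof (induction n)
  case (Suc n)
  have "anderson (const (\<theta> ^ Suc n) * x) = anderson (const \<theta> * (const (\<theta> ^ n) * x))" by (simp add: const_mult mult.assoc)
  also have "\<dots> = tvar s * (tvar s ^ n * anderson x)" using Suc Lamm_theta_power[of x n] by (simp add: anderson_theta)
  finally show ?case by (simp add: mult.assoc)
qed simp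

lemma anderson_polynomial:
  assumes x: "x \<in> Lamm" and c: "\<And>m. c m \<in> T s" "\<And>m. tau (c m) = c m"
  shows "anderson ((\<Sum>m<d. c m * const (\<theta> ^ m)) * x) = (\<Sum>m<d. c m * tvar s ^ m) * anderson x"
proof -
  have xm: "const (\<theta> ^ m) * x \<in> T s" for m using Lamm_theta_power[OF x] Lamm_T by blast
  have "anderson ((\<Sum>m<d. c m * const (\<theta> ^ m)) * x) = anderson (\<Sum>m<d. c m * (const (\<theta> ^ m) * x))"
    by (simp add: sum_distrib_right mult.assoc)
  also have "\<dots> = (\<Sum>m<d. c m * anderson (const (\<theta> ^ m) * x))"
    using c xm by (simp add: anderson_sum T_mult anderson_fixed)
  also have "\<dots> = (\<Sum>m<d. c m * tvar s ^ m) * anderson x"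
    by (simp add: anderson_theta_power[OF x] sum_distrib_right mult.assoc)
  finally show ?thesis .
qed

text \<open>The functional equation of the exponential maps the coefficient with index m to the one
  with index m - 1, and the coefficient with index 0 to exp(x) = 0. So phi_theta acts on the
  generating function as multiplication by t.\<close>

lemma anderson_eq: 
  assumes x: "x \<in> Lamm"
  shows "(\<Sum>k=1..r. A k * (tau ^^ k) (anderson x)) = (tvar s - const \<theta>) * anderson x"
proof -
  have xT: "x \<in> T s" using Lamm_T[OF x] .
  have "const \<theta> * anderson x + (\<Sum>k=1..r. A k * (tau ^^ k) (anderson x)) = tvar s * anderson x"
  proof (rule slice_eqI[of s])
    fix m
    have "slice s m (const \<theta> * anderson x + (\<Sum>k=1..r. A k * (tau ^^ k) (anderson x))) = phi (app E (pw (Suc m) * x))"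
      by (simp add: phi_eq slice_add slice_sum slice_mult T_V AT slice_taun slice_anderson xT)
    also have "\<dots> = app E (const \<theta> * (pw (Suc m) * x))" using phi_E[of "pw (Suc m) * x"] xT by (simp add: T_mult pw_T)
    also have "const \<theta> * (pw (Suc m) * x) = pw m * x" by (simp only: mult.assoc[symmetric] theta_pw)
    also have "app E (pw m * x) = slice s m (tvar s * anderson x)"
    proof (cases m)
      case 0 then show ?thesis using x by (simp add: slice_tvar pw_def Lamm_def)
    next
      case (Suc m') then show ?thesis by (simp add: slice_tvar slice_anderson xT)
    qed
    finally show "slice s m (const \<theta> * anderson x + (\<Sum>k=1..r. A k * (tau ^^ k) (anderson x))) = slice s m (tvar s * anderson x)" .
  qed
  then show ?thesis by (simp add: left_diff_distrib algebra_simps)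
qed

section \<open>Solutions of the difference equation\<close>

lemma phi_bound:
  obtains W where "W \<ge> 1" "\<And>x. x \<in> T s \<Longrightarrow> nrm x \<le> 1 \<Longrightarrow> nrm (phi x - const \<theta> * x) \<le> W * nrm x ^ 2"
proof -
  define A1 where "A1 k = (if k = 0 then 0 else A k)" for k
  define W where "W = 1 + (\<Sum>k=1..r. nrm (A k))"
  have nA: "0 \<le> nrm (A k)" for k by (rule nrm_nonneg[OF T_CC[OF AT]])
  have W1: "W \<ge> 1" unfolding W_def using nA by (simp add: sum_nonneg)
  have "nrm (phi x - const \<theta> * x) \<le> W * nrm x ^ 2" if x: "x \<in> T s" "nrm x \<le> 1" for x
  proof -
    have nx: "0 \<le> nrm x" by (rule nrm_nonneg[OF T_CC[OF x(1)]])
    have "nrm (\<Sum>k=1..r. A k * (tau ^^ k) x) \<le> W * nrm x ^ 2"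
    proof (rule nrm_sum_le)
      fix k assume k: "k \<in> {1..r}"
      show "A k * (tau ^^ k) x \<in> CC" by (intro CC_mult CC_taun T_CC[OF AT] T_CC[OF x(1)])
      have "nrm (A k) \<le> W" unfolding W_def using member_le_sum[of k "{1..r}" "\<lambda>k. nrm (A k)"] k nA by simp
      moreover have "nrm x ^ (q ^ k) \<le> nrm x ^ 2" using qpow_ge[of k] k x nx by (intro power_decreasing) auto
      ultimately have "nrm (A k) * nrm x ^ (q ^ k) \<le> W * nrm x ^ 2" using W1 nx by (intro mult_mono) auto
      then show "nrm (A k * (tau ^^ k) x) \<le> W * nrm x ^ 2"
        using nrm_mult[OF T_CC[OF AT] CC_taun[OF T_CC[OF x(1)]]] nrm_taun[OF T_CC[OF x(1)]] by simp
    qed (use W1 in simp)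
    then show ?thesis by (simp add: phi_eq)
  qed
  then show thesis using that W1 by blast
qed

text \<open>On small elements the linear term theta x dominates the remaining terms, which are
  quadratic, so norms are multiplied by exactly q.\<close>

lemma phi_isometry:
  obtains \<delta> where "0 < \<delta>" "\<delta> \<le> 1" "\<And>x. x \<in> T s \<Longrightarrow> nrm x < \<delta> \<Longrightarrow> nrm (phi x) = real q * nrm x"
proof -
  obtain W where W: "W \<ge> 1" "\<And>x. x \<in> T s \<Longrightarrow> nrm x \<le> 1 \<Longrightarrow> nrm (phi x - const \<theta> * x) \<le> W * nrm x ^ 2"
    using phi_bound by blast
  have "nrm (phi x) = real q * nrm x" if x: "x \<in> T s" "nrm x < 1 / W" for x
  proof (cases "x = 0")
    case False
    have pos: "nrm x > 0" using nrm_pos[OF T_CC[OF x(1)] False] .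
    have "1 / W \<le> 1" using W(1) by simp
    then have x1: "nrm x \<le> 1" using x(2) by linarith
    have "W * nrm x ^ 2 < nrm x" using x(2) W(1) pos by (simp add: power2_eq_square field_simps)
    then have "nrm (phi x - const \<theta> * x) < nrm x" using W(2)[OF x(1) x1] by linarith
    moreover have "1 * nrm x \<le> real q * nrm x" using q_ge_2 pos by (intro mult_right_mono) auto
    ultimately have d: "nrm (phi x - const \<theta> * x) < nrm (const \<theta> * x)"
      using x(1) by (simp add: nrm_mult T_CC av_theta)
    have cs: "phi x \<in> CC" "const \<theta> * x \<in> CC" "phi x - const \<theta> * x \<in> CC"
      using T_CC[OF phi_T[OF x(1)]] T_CC[OF x(1)] by (auto intro!: CC_diff CC_mult)
    have "nrm (phi x) \<le> nrm (const \<theta> * x)" using nrm_add[OF cs(3,2)] d by simp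
    moreover have "nrm (const \<theta> * x) \<le> nrm (phi x)" using nrm_diff[OF cs(1,3)] d by simp
    ultimately show ?thesis using x(1) by (simp add: nrm_mult T_CC av_theta)
  qed simp
  then show thesis using that[of "1 / W"] W(1) by simp
qed

text \<open>The coefficients g m of a solution of the difference equation form a phi-compatible sequence
  tending to 0, and x is the limit of the rescaled sequence.\<close>

lemma solution_is_anderson:
  assumes h: "h \<in> T (Suc s)" and eq: "(\<Sum>k=1..r. A k * (tau ^^ k) h) = (tvar s - const \<theta>) * h"
  shows "\<exists>x\<in>Lamm. h = anderson x"
proof -
  define g where "g m = slice s m h" for m
  have gT: "g m \<in> T s" for m unfolding g_def by (rule slice_T[OF h])
  have glim: "(\<lambda>m. nrm (g m)) \<longlonglongrightarrow> 0" unfolding g_def by (rule slice_tendsto_0[OF h])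
  have "const \<theta> * h + (\<Sum>k=1..r. A k * (tau ^^ k) h) = tvar s * h" unfolding eq by (simp add: algebra_simps)
  then have "slice s m (const \<theta> * h + (\<Sum>k=1..r. A k * (tau ^^ k) h)) = slice s m (tvar s * h)" for m by simp
  \<comment> \<open>The operator acts on each slice separately, whereas multiplication by t shifts
    the slices and brings in 0 at m = 0.\<close>
  then have phg: "phi (g m) = (if m = 0 then 0 else g (m - 1))" for m
    by (simp add: phi_eq slice_add slice_sum slice_mult T_V AT slice_taun slice_tvar g_def)
  obtain \<delta> where d: "0 < \<delta>" "\<delta> \<le> 1" "\<And>x. x \<in> T s \<Longrightarrow> nrm x < \<delta> \<Longrightarrow> nrm (phi x) = real q * nrm x"
    using phi_isometry by blast
  obtain W where W: "W \<ge> 1" "\<And>x. x \<in> T s \<Longrightarrow> nrm x \<le> 1 \<Longrightarrow> nrm (phi x - const \<theta> * x) \<le> W * nrm x ^ 2"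
    using phi_bound by blast
  obtain D where D: "D \<ge> 1" "\<And>x. x \<in> T s \<Longrightarrow> nrm x \<le> 1 \<Longrightarrow> nrm (app E x - x) \<le> D * nrm x ^ 2"
    using exp_bound by blast
  have "\<forall>\<^sub>F m in sequentially. nrm (g m) < \<delta>" using glim d(1) by (rule order_tendstoD)
  then obtain M where M: "\<And>m. m \<ge> M \<Longrightarrow> nrm (g m) < \<delta>" by (auto simp: eventually_sequentially)
  have qpos: "real q > 0" by simp
  have gM: "nrm (g (M + k)) = nrm (g M) / real q ^ k" for k
  proof (induction k)
    case (Suc k)
    have "nrm (g (M + k)) = real q * nrm (g (M + Suc k))"
      using d(3)[OF gT M, of "M + Suc k"] phg[of "M + Suc k"] by simp
    then show ?case using Suc qpos by (simp add: field_simps)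
  qed simp
  \<comment> \<open>If g m is to be exp(theta^(-m-1) x), then theta^(m+1) g m must approximate x.
    The offset M starts the sequence where phi is exact on norms.\<close>
  define X where "X k = const (\<theta> ^ (M + k + 1)) * g (M + k)" for k
  have XT: "X k \<in> T s" for k unfolding X_def by (intro T_mult T_const gT)
  have "(\<lambda>k. nrm (X (Suc k) - X k)) \<longlonglongrightarrow> 0"
  proof (rule tendsto_0_le)
    show "0 \<le> nrm (X (Suc k) - X k)" for k by (intro nrm_nonneg CC_diff T_CC[OF XT])
    show "nrm (X (Suc k) - X k) \<le> (real q ^ M * W * nrm (g M) ^ 2) / real q ^ Suc k" for k
    proof -
      let ?y = "g (M + Suc k)"
      have "X (Suc k) - X k = - (const (\<theta> ^ (M + k + 1)) * (phi ?y - const \<theta> * ?y))"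
        using phg[of "M + Suc k"] by (simp add: X_def const_mult algebra_simps)
      then have "nrm (X (Suc k) - X k) = real q ^ (M + k + 1) * nrm (phi ?y - const \<theta> * ?y)"
        using nrm_mult[OF CC_const CC_diff[OF T_CC[OF phi_T[OF gT]] CC_mult[OF CC_const T_CC[OF gT]]]]
        by (simp only: nrm_uminus nrm_const av_power av_theta)
      also have "\<dots> \<le> real q ^ (M + k + 1) * (W * nrm ?y ^ 2)"
        using W(2)[OF gT, of "M + Suc k"] M[of "M + Suc k"] d(2) by (intro mult_left_mono) auto
      also have "\<dots> = (real q ^ M * W * nrm (g M) ^ 2) / real q ^ Suc k"
        unfolding gM[of "Suc k"] using qpos by (simp add: power2_eq_square power_add field_simps)
      finally show ?thesis .
    qed
    show "(\<lambda>k. (real q ^ M * W * nrm (g M) ^ 2) / real q ^ Suc k) \<longlonglongrightarrow> 0" by (rule LIMSEQ_Suc[OF tends_div_q])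
  qed
  then obtain x where x: "x \<in> T s" "nlim X x" using T_complete[of X s] XT by blast
  \<comment> \<open>The error between the expected coefficient and g k. It is again compatible with
    phi, and \<open>lime2\<close> shows that q^k times its norm tends to 0.\<close>
  define e where "e k = app E (pw (Suc k) * x) - g k" for k
  have eT: "e k \<in> T s" for k unfolding e_def by (intro T_diff app_E_pw_T x gT)
  have phe: "phi (e (Suc k)) = e k" for k
  proof -
    have "phi (app E (pw (Suc (Suc k)) * x)) = app E (const \<theta> * (pw (Suc (Suc k)) * x))"
      using phi_E[of "pw (Suc (Suc k)) * x"] x(1) by (simp add: T_mult pw_T)
    also have "const \<theta> * (pw (Suc (Suc k)) * x) = pw (Suc k) * x" by (simp only: mult.assoc[symmetric] theta_pw)
    finally show ?thesis using phg[of "Suc k"] by (simp add: e_def phi_diff)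
  qed
  let ?f = "\<lambda>x. app E x - x"
  have l1: "(\<lambda>m. real q ^ m * nrm (?f (pw m * x))) \<longlonglongrightarrow> 0"
    by (rule quad_decay[OF entE x(1) D(2)]) (auto intro: app_E_diff_CC)
  have lime: "(\<lambda>k. real q ^ (k + M + 1) * nrm (e (k + M))) \<longlonglongrightarrow> 0"
  proof (rule tendsto_0_le)
    show "0 \<le> real q ^ (k + M + 1) * nrm (e (k + M))" for k using nrm_nonneg[OF T_CC[OF eT]] by simp
    show "real q ^ (k + M + 1) * nrm (e (k + M)) \<le> real q ^ (k + M + 1) * nrm (?f (pw (k + M + 1) * x)) + nrm (X k - x)" for k
    proof -
      let ?m = "k + M + 1"
      have fC: "?f (pw ?m * x) \<in> CC" using x(1) by (intro CC_diff T_CC[OF app_E_pw_T[OF x(1)]] CC_mult T_CC[OF pw_T] T_CC[OF x(1)])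
      have xC: "x - X k \<in> CC" by (intro CC_diff T_CC[OF x(1)] T_CC[OF XT])
      have "pw ?m * X k = g (k + M)"
      proof -
        have "pw ?m * X k = (const (\<theta> ^ ?m) * pw ?m) * g (k + M)" by (simp add: X_def add_ac mult_ac)
        then show ?thesis by (simp only: power_pw mult_1)
      qed
      then have "e (k + M) = ?f (pw ?m * x) + pw ?m * (x - X k)" by (simp add: e_def right_diff_distrib)
      then have "nrm (e (k + M)) \<le> max (nrm (?f (pw ?m * x))) (nrm (pw ?m * (x - X k)))"
        using nrm_add[OF fC CC_mult[OF T_CC[OF pw_T] xC]] by simp
      also have "nrm (pw ?m * (x - X k)) = nrm (x - X k) / real q ^ ?m" by (rule nrm_pw[OF xC])
      also have "max (nrm (?f (pw ?m * x))) (nrm (x - X k) / real q ^ ?m) \<le> nrm (?f (pw ?m * x)) + nrm (x - X k) / real q ^ ?m"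
        using nrm_nonneg[OF fC] nrm_nonneg[OF xC] by simp
      finally have "real q ^ ?m * nrm (e (k + M)) \<le> real q ^ ?m * (nrm (?f (pw ?m * x)) + nrm (x - X k) / real q ^ ?m)"
        by (intro mult_left_mono) auto
      also have "\<dots> = real q ^ ?m * nrm (?f (pw ?m * x)) + nrm (X k - x)"
        using qpos by (simp add: distrib_left nrm_diff_commute)
      finally show ?thesis .
    qed
    have "(\<lambda>k. real q ^ (k + (M + 1)) * nrm (?f (pw (k + (M + 1)) * x))) \<longlonglongrightarrow> 0"
      by (rule LIMSEQ_ignore_initial_segment[OF l1])
    then show "(\<lambda>k. real q ^ (k + M + 1) * nrm (?f (pw (k + M + 1) * x)) + nrm (X k - x)) \<longlonglongrightarrow> 0"
      using tendsto_add[OF _ x(2)[unfolded nlim_def]] by (fastforce simp: add.assoc)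
  qed
  have lime2: "(\<lambda>k. real q ^ k * nrm (e k)) \<longlonglongrightarrow> 0"
  proof (rule LIMSEQ_offset[of _ M])
    show "(\<lambda>k. real q ^ (k + M) * nrm (e (k + M))) \<longlonglongrightarrow> 0"
      using tendsto_divide_zero[OF lime, of "real q"] qpos by simp
  qed
  have "\<forall>\<^sub>F k in sequentially. real q ^ k * nrm (e k) < \<delta>" using lime2 d(1) by (rule order_tendstoD)
  then obtain J where J: "\<And>k. k \<ge> J \<Longrightarrow> real q ^ k * nrm (e k) < \<delta>" by (auto simp: eventually_sequentially)
  have small: "nrm (e k) < \<delta>" if "k \<ge> J" for k
  proof -
    have "1 * nrm (e k) \<le> real q ^ k * nrm (e k)"
      using q_ge_2 nrm_nonneg[OF T_CC[OF eT]] by (intro mult_right_mono one_le_power) auto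
    then show ?thesis using J[OF that] by simp
  qed
  \<comment> \<open>For large k the map phi is exact on norms, so this product is constant; as it
    also tends to 0, the errors vanish from J on.\<close>
  have const_e: "real q ^ (J + k) * nrm (e (J + k)) = real q ^ J * nrm (e J)" for k
  proof (induction k)
    case (Suc k)
    have "nrm (e (J + k)) = real q * nrm (e (J + Suc k))"
      using d(3)[OF eT small, of "J + Suc k"] phe[of "J + k"] by simp
    then show ?case using Suc by (simp add: mult_ac)
  qed simp
  have ez: "e k = 0" if k: "k \<ge> J" for k
  proof -
    have "(\<lambda>k. real q ^ (k + J) * nrm (e (k + J))) \<longlonglongrightarrow> 0" by (rule LIMSEQ_ignore_initial_segment[OF lime2])
    moreover have "(\<lambda>k. real q ^ (k + J) * nrm (e (k + J))) = (\<lambda>k. real q ^ J * nrm (e J))"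
      using const_e by (simp add: add.commute)
    ultimately have "real q ^ J * nrm (e J) = 0" by (simp add: LIMSEQ_const_iff)
    then have "real q ^ k * nrm (e k) = 0" using const_e[of "k - J"] k by simp
    then have "nrm (e k) = 0" using qpos by simp
    then show ?thesis using nrm_eq_0_iff[OF T_CC[OF eT]] by blast
  qed
  have "e k = 0" for k
  proof (cases "k \<ge> J")
    case False
    \<comment> \<open>The vanishing is carried down to smaller indices, each error being the image
      under phi of the next one.\<close>
    have "e (J - j) = 0" for j
    proof (induction j)
      case (Suc j)
      show ?case
      proof (cases "J - j = 0")
        case True then show ?thesis using Suc by simp
      next
        case F: False
        then have "e (J - Suc j) = phi (e (J - j))" using phe[of "J - Suc j"] by (simp add: Suc_diff_Suc)
        then show ?thesis using Suc by simp
      qed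
    qed (simp add: ez)
    from this[of "J - k"] show ?thesis using False by simp
  qed (rule ez)
  then have ge: "app E (pw (Suc m) * x) = g m" for m by (simp add: e_def)
  have "const \<theta> * (pw 1 * x) = x" using theta_pw[of 0] by (simp add: mult.assoc[symmetric] pw_def)
  then have "app E x = phi (g 0)" using phi_E[of "pw 1 * x"] ge[of 0] x(1) by (simp add: T_mult pw_T)
  then have "x \<in> Lamm" using x(1) phg[of 0] by (simp add: Lamm_def)
  moreover have "h = anderson x" by (rule slice_eqI[of s]) (simp add: slice_anderson x(1) ge g_def)
  ultimately show ?thesis by blast
qed

text \<open>The period is recovered as the limit of theta^m exp(theta^(-m) x), whose terms are all 0
  if the generating function is 0.\<close>

lemma anderson_inj: 
  assumes x: "x \<in> T s" and f: "anderson x = 0" shows "x = 0"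
proof (rule ccontr)
  assume nz: "x \<noteq> 0"
  obtain D where D: "D \<ge> 1" "\<And>x. x \<in> T s \<Longrightarrow> nrm x \<le> 1 \<Longrightarrow> nrm (app E x - x) \<le> D * nrm x ^ 2"
    using exp_bound by blast
  have "app E (pw (Suc m) * x) = 0" for m using slice_anderson[OF x, of m] f by simp
  moreover have "(\<lambda>m. real q ^ m * nrm (app E (pw m * x) - pw m * x)) \<longlonglongrightarrow> 0"
    by (rule quad_decay[OF entE x D(2)]) (auto intro: app_E_diff_CC)
  then have "(\<lambda>m. real q ^ Suc m * nrm (app E (pw (Suc m) * x) - pw (Suc m) * x)) \<longlonglongrightarrow> 0"
    by (rule LIMSEQ_Suc)
  ultimately have "(\<lambda>m::nat. nrm x) \<longlonglongrightarrow> 0"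
    using nrm_pw[OF T_CC[OF x]] by simp
  then have "nrm x = 0" by (simp add: LIMSEQ_const_iff)
  then show False using nrm_pos[OF T_CC[OF x] nz] by simp
qed

text \<open>The quasi-periodic operator of the biderivation whose value at theta is m.\<close>

definition qper_op :: "(nat \<Rightarrow> 'a mps) \<Rightarrow> nat \<Rightarrow> 'a mps" where
  "qper_op m = dvt (tm m E)"

lemma qper_op_entire: "tpoly s m \<Longrightarrow> entire s (qper_op m)"
  unfolding qper_op_def by (intro dvt_entire entire_tm entE)

lemma qper_op_relation:
  assumes m: "tpoly s m" "m 0 = 0" "\<And>n. n \<ge> d \<Longrightarrow> m n = 0" and x: "x \<in> T s"
  shows "app (qper_op m) (const \<theta> * x) = const \<theta> * app (qper_op m) x + (\<Sum>i<d. m i * (tau ^^ i) (app E x))"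
proof -
  have t0: "tm m E 0 = 0" using m(2) by (simp add: tm_def)
  have "tm (qper_op m) (sc (const \<theta>)) - tm (sc (const \<theta>)) (qper_op m) = tm m E"
    using dvt_eq_iff[of "tm m E" "qper_op m", OF t0] unfolding qper_op_def by blast
  then have "tm (qper_op m) (sc (const \<theta>)) = tm (sc (const \<theta>)) (qper_op m) + tm m E" by (metis diff_add_cancel add.commute)
  then have "app (qper_op m) (const \<theta> * x) = app (tm (sc (const \<theta>)) (qper_op m) + tm m E) x"
    using app_tm_sc[of "const \<theta>" s x "qper_op m"] x by simp
  also have "\<dots> = app (tm (sc (const \<theta>)) (qper_op m)) x + app (tm m E) x"
    by (intro app_add[of s] entire_tm tpoly_sc qper_op_entire m(1) entE x T_const)
  also have "app (tm (sc (const \<theta>)) (qper_op m)) x = const \<theta> * app (qper_op m) x"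
    using app_tm[OF tpoly_sc[OF T_const] _ qper_op_entire[OF m(1)] x, of 1 \<theta>] by (simp add: sc_def)
  also have "app (tm m E) x = (\<Sum>i<d. m i * (tau ^^ i) (app E x))"
    by (rule app_tm[OF m(1,3) entE x])
  finally show ?thesis .
qed

definition tj :: "nat \<Rightarrow> nat \<Rightarrow> 'a mps" where
  "tj j = (\<lambda>n. if n = j then 1 else 0)"

lemma tpoly_tj: "tpoly s (tj j)"
  by (auto simp: tpoly_def tj_def intro!: exI[of _ "Suc j"])

lemma qper_op_tj_relation:
  assumes j: "j \<ge> 1" and x: "x \<in> T s"
  shows "app (qper_op (tj j)) (const \<theta> * x) = const \<theta> * app (qper_op (tj j)) x + (tau ^^ j) (app E x)"
proof -
  have "(\<Sum>i<Suc j. tj j i * (tau ^^ i) (app E x)) = (\<Sum>i<Suc j. if i = j then (tau ^^ j) (app E x) else 0)"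
    by (intro sum.cong) (auto simp: tj_def)
  also have "\<dots> = (tau ^^ j) (app E x)" by simp
  finally show ?thesis
    using qper_op_relation[OF tpoly_tj[of j] _ _ x, of "Suc j"] j by (simp add: tj_def)
qed

text \<open>The relation F theta = theta F + tau^j exp, taken at theta^(-m-1) x and multiplied by
  theta^m, writes the m-th term of the series at theta as a difference of consecutive values theta^m
  F(theta^(-m) x). These tend to 0 by \<open>quad_decay\<close>, so the series telescopes to
  F(x).\<close>

lemma eval_at_anderson:
  assumes j: "j \<ge> 1" and x: "x \<in> T s"
  shows "eval_at s ((tau ^^ j) (anderson x)) (app (qper_op (tj j)) x)"
proof -
  let ?F = "qper_op (tj j)"
  have eF: "entire s ?F" by (rule qper_op_entire[OF tpoly_tj])
  define p where "p m = const (\<theta> ^ m) * app ?F (pw m * x)" for m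
  have pT: "app ?F (pw m * x) \<in> T s" for m by (intro app_T[OF eF] T_mult pw_T x)
  obtain D where D: "D \<ge> 1" "\<And>x. x \<in> T s \<Longrightarrow> nrm x \<le> 1 \<Longrightarrow> nrm (app ?F x) \<le> D * nrm x ^ 2"
    using app_quadratic_bound[OF eF] by (auto simp: qper_op_def)
  have "eval_at s ((tau ^^ j) (anderson x)) (p 0)"
  proof (rule eval_at_asmI)
    show "p m \<in> T s" for m unfolding p_def by (intro T_mult T_const pT)
    have "(\<lambda>m. real q ^ m * nrm (app ?F (pw m * x))) \<longlonglongrightarrow> 0"
      by (rule quad_decay[OF eF x D(2)]) (auto intro!: T_CC app_T[OF eF])
    then show "(\<lambda>m. nrm (p m)) \<longlonglongrightarrow> 0"
      by (simp add: p_def nrm_mult T_CC[OF pT] av_power av_theta)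
    fix m
    have "app ?F (const \<theta> * (pw (Suc m) * x)) = const \<theta> * app ?F (pw (Suc m) * x) + (tau ^^ j) (app E (pw (Suc m) * x))"
      by (rule qper_op_tj_relation[OF j T_mult[OF pw_T x]])
    moreover have "const \<theta> * (pw (Suc m) * x) = pw m * x" by (simp only: mult.assoc[symmetric] theta_pw)
    ultimately show "const (\<theta> ^ m) * slice s m ((tau ^^ j) (anderson x)) = p m - p (Suc m)"
      by (simp add: slice_taun slice_anderson[OF x] p_def const_mult algebra_simps)
  qed
  then show ?thesis by (simp add: p_def pw_def)
qed

text \<open>The ring A[t_1, ..., t_s] inside the Tate algebra, presented as polynomials in theta
  with Frobenius-fixed coefficients. In this form theta can be exchanged for the new variable
  t.\<close>

definition AR :: "'a mps set" where
  "AR = {a. \<exists>c d. (\<forall>m. c m \<in> T s \<and> tau (c m) = c m) \<and> a = (\<Sum>m<d. c m * const (\<theta> ^ m))}"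

lemma AR_T: "a \<in> AR \<Longrightarrow> a \<in> T s"
  unfolding AR_def by (auto intro!: T_sum T_mult)

lemma cf_mult_const: "cf (f * const a) \<nu> = cf f \<nu> * a"
proof -
  have "cf (const a * f) \<nu> = a * cf f \<nu>" by simp
  then show ?thesis by (simp only: mult.commute)
qed

lemma AR_sum_zero:
  assumes c: "\<And>m. tau (c m) = c m" and z: "(\<Sum>m<d. c m * const (\<theta> ^ m)) = 0" and m: "m < d"
  shows "c m = 0"
proof (rule mps_eqI)
  fix \<nu>
  have "cf (c m) \<nu> = 0"
  proof (rule Fq_theta_independent[of d "\<lambda>m. cf (c m) \<nu>", OF _ _ m])
    show "cf (c m) \<nu> \<in> Fq q" for m using arg_cong[OF c[of m], of "\<lambda>f. cf f \<nu>"] by (simp add: Fq_def)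
    have "(\<Sum>m<d. cf (c m) \<nu> * \<theta> ^ m) = cf (\<Sum>m<d. c m * const (\<theta> ^ m)) \<nu>"
      by (simp add: cf_sum cf_mult_const)
    then show "(\<Sum>m<d. cf (c m) \<nu> * \<theta> ^ m) = 0" using z by simp
  qed
  then show "cf (c m) \<nu> = cf 0 \<nu>" by simp
qed

text \<open>The slices of a fixed element are fixed and tend to 0, so by discreteness of F_q they
  vanish from some index on. The fixed elements are thus polynomials in t.\<close>

lemma fixed_point_polynomial:
  assumes c: "c \<in> T (Suc s)" "tau c = c"
  obtains d where "c = (\<Sum>m<d. slice s m c * tvar s ^ m)" "\<And>m. m \<ge> d \<Longrightarrow> slice s m c = 0"
proof -
  have slf: "tau (slice s m c) = slice s m c" for m using slice_tau[of s m c] c(2) by simp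
  have "\<forall>\<^sub>F m in sequentially. nrm (slice s m c) < 1" using slice_tendsto_0[OF c(1)] by (rule order_tendstoD) simp
  then obtain d where d: "\<And>m. m \<ge> d \<Longrightarrow> nrm (slice s m c) < 1" by (auto simp: eventually_sequentially)
  have z: "slice s m c = 0" if m: "m \<ge> d" for m
  proof (rule mps_eqI)
    fix \<nu>
    have "cf (slice s m c) \<nu> \<in> Fq q" using arg_cong[OF slf[of m], of "\<lambda>f. cf f \<nu>"] by (simp add: Fq_def)
    moreover have "av (cf (slice s m c) \<nu>) < 1" using nrm_ge[OF T_CC[OF slice_T[OF c(1)]], of m \<nu>] d[OF m] by simp
    ultimately show "cf (slice s m c) \<nu> = cf 0 \<nu>" using av_Fq by fastforce
  qed
  have slpow: "slice s n (tvar s ^ m :: 'a mps) = (if n = m then 1 else 0)" for n m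
  proof (induction m arbitrary: n)
    case 0 show ?case unfolding power_0 by (rule slice_const[OF T_V[OF T_1]])
  next
    case (Suc m) then show ?case by (cases n) (auto simp: slice_tvar)
  qed
  have "c = (\<Sum>m<d. slice s m c * tvar s ^ m)"
  proof (rule slice_eqI[of s])
    fix n
    have "slice s n (\<Sum>m<d. slice s m c * tvar s ^ m) = (\<Sum>m<d. if m = n then slice s n c else 0)"
      unfolding slice_sum by (intro sum.cong) (auto simp: slice_mult[OF T_V[OF slice_T[OF c(1)]]] slpow)
    then show "slice s n c = slice s n (\<Sum>m<d. slice s m c * tvar s ^ m)" using z[of n] by auto
  qed
  then show thesis using that z by blast
qed

text \<open>Since theta has absolute value q > 1, the element is -theta times 1 minus a series of
  norm less than 1.\<close>

lemma tvar_minus_theta_unit: obtains x' where "x' \<in> T (Suc s)" "(tvar s - const \<theta>) * x' = 1"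
proof -
  let ?h = "- (const (inverse \<theta>) * tvar s)"
  have hT: "?h \<in> T (Suc s)" by (intro T_uminus T_mult T_const tvar_T)
  have "nrm (tvar s) \<le> 1" by (rule nrm_le) (simp add: tvar_def cf_monom)
  then have "nrm ?h \<le> inverse (real q) * 1"
    unfolding nrm_uminus nrm_mult[OF CC_const T_CC[OF tvar_T]] nrm_const av_inverse av_theta
    by (intro mult_left_mono) auto
  also have "\<dots> < 1" using q_ge_2 by (simp add: inverse_less_1_iff)
  finally obtain g where g: "g \<in> T (Suc s)" "(1 + ?h) * g = 1" using geometric_inverse[OF hT] by blast
  have "tvar s - const \<theta> = - (const \<theta>) * (1 + ?h)"
    using const_inverse[OF theta_nz] by (simp add: algebra_simps)
  then have "(tvar s - const \<theta>) * (- (const (inverse \<theta>)) * g) = (const \<theta> * const (inverse \<theta>)) * ((1 + ?h) * g)"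
    by (simp only: mult_ac minus_mult_minus mult_minus_left mult_minus_right minus_minus)
  then have "(tvar s - const \<theta>) * (- (const (inverse \<theta>)) * g) = 1" using g(2) const_inverse[OF theta_nz] by simp
  then show thesis using that g(1) by (meson T_const T_mult T_uminus)
qed

end

section \<open>The period matrix\<close>

context drinfeld_operator
begin

lemma polynomial_T_fixed:
  assumes "\<And>m. c m \<in> T s \<and> tau (c m) = c m"
  shows "(\<Sum>m<d. c m * tvar s ^ m) \<in> T (Suc s)" "tau (\<Sum>m<d. c m * tvar s ^ m) = (\<Sum>m<d. c m * tvar s ^ m)"
proof -
  show "(\<Sum>m<d. c m * tvar s ^ m) \<in> T (Suc s)" using assms T_Suc by (intro T_sum T_mult T_power tvar_T) blast
  have "tau (tvar s ^ m) = tvar s ^ m" for m by (induction m) (auto simp: tau_mult tau_tvar)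
  then show "tau (\<Sum>m<d. c m * tvar s ^ m) = (\<Sum>m<d. c m * tvar s ^ m)" using assms by (simp add: tau_sum tau_mult)
qed

definition is_basis :: "(nat \<Rightarrow> 'a mps) \<Rightarrow> bool" where
  "is_basis b \<longleftrightarrow> (\<forall>i<r. b i \<in> Lamm) \<and> (\<forall>x\<in>Lamm. \<exists>c. (\<forall>i<r. c i \<in> AR) \<and> x = (\<Sum>i<r. c i * b i))
     \<and> (\<forall>c. (\<forall>i<r. c i \<in> AR) \<longrightarrow> (\<Sum>i<r. c i * b i) = 0 \<longrightarrow> (\<forall>i<r. c i = 0))"

lemma is_basis_indepD:
  "is_basis b \<Longrightarrow> (\<And>i. i < r \<Longrightarrow> c i \<in> AR) \<Longrightarrow> (\<Sum>i<r. c i * b i) = 0 \<Longrightarrow> i < r \<Longrightarrow> c i = 0"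
  by (simp add: is_basis_def)

lemma AR_times_anderson:
  assumes x: "x \<in> Lamm" and a: "a \<in> AR"
  shows "\<exists>d\<in>T (Suc s). tau d = d \<and> anderson (a * x) = d * anderson x"
proof -
  obtain c n where c: "\<And>m. c m \<in> T s \<and> tau (c m) = c m" "a = (\<Sum>m<n. c m * const (\<theta> ^ m))"
    using a unfolding AR_def by blast
  then have "anderson (a * x) = (\<Sum>m<n. c m * tvar s ^ m) * anderson x" using anderson_polynomial[OF x, of c n] by simp
  moreover note polynomial_T_fixed[of c n, OF c(1)]
  ultimately show ?thesis by (intro bexI[of _ "\<Sum>m<n. c m * tvar s ^ m"] conjI)
qed

text \<open>Replacing t by theta in the fixed coefficients c i gives elements a i of
  A[t_1, ..., t_s], and the combination of generating functions becomes that of the period formed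
  from a i and b i. Injectivity makes this period 0, the basis makes each a i zero, and independence
  of the powers of theta over the fixed coefficients returns c i = 0.\<close>

lemma basis_anderson_indep:
  assumes b: "is_basis b"
  shows "indep (Suc s) r (\<lambda>i. anderson (b i))"
  unfolding indep_def
proof (intro allI impI)
  fix c i assume c: "\<forall>i<r. c i \<in> T (Suc s) \<and> tau (c i) = c i" and z: "(\<Sum>i<r. c i * anderson (b i)) = 0" and i: "i < r"
  have bL: "b i \<in> Lamm" if "i < r" for i using b that by (simp add: is_basis_def)
  have "\<exists>d. c i = (\<Sum>m<d. slice s m (c i) * tvar s ^ m) \<and> (\<forall>m\<ge>d. slice s m (c i) = 0)" if "i < r" for i
    using fixed_point_polynomial[of "c i"] c that by metis
  then obtain d where d: "\<And>i. i < r \<Longrightarrow> c i = (\<Sum>m<d i. slice s m (c i) * tvar s ^ m)"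
    "\<And>i m. i < r \<Longrightarrow> m \<ge> d i \<Longrightarrow> slice s m (c i) = 0" by metis
  \<comment> \<open>The value of the polynomial c i at t = theta.\<close>
  define a where "a i = (\<Sum>m<d i. slice s m (c i) * const (\<theta> ^ m))" for i
  have slc: "slice s m (c i) \<in> T s \<and> tau (slice s m (c i)) = slice s m (c i)" if "i < r" for i m
    using c that slice_T[of "c i" s m] slice_tau[of s m "c i"] by simp
  have aAR: "a i \<in> AR" if "i < r" for i unfolding AR_def a_def
    by (rule CollectI, rule exI[of _ "\<lambda>m. slice s m (c i)"], rule exI[of _ "d i"]) (use slc[OF that] in auto)
  have "anderson (a i * b i) = c i * anderson (b i)" if "i < r" for i
    unfolding a_def using anderson_polynomial[OF bL[OF that], of "\<lambda>m. slice s m (c i)" "d i"] slc[OF that] d(1)[OF that] by simp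
  moreover have abT: "a i * b i \<in> T s" if "i < r" for i by (intro T_mult AR_T[OF aAR[OF that]] Lamm_T[OF bL[OF that]])
  ultimately have "anderson (\<Sum>i<r. a i * b i) = (\<Sum>i<r. c i * anderson (b i))"
    by (subst anderson_sum) (auto intro!: sum.cong)
  then have "anderson (\<Sum>i<r. a i * b i) = 0" using z by simp
  then have "(\<Sum>i<r. a i * b i) = 0" 
    by (rule anderson_inj[rotated]) (use abT in \<open>auto intro: T_sum\<close>)
  then have "a i = 0" using is_basis_indepD[OF b, of a i] aAR i by blast
  then have "slice s m (c i) = 0" for m
    using AR_sum_zero[of "\<lambda>m. slice s m (c i)" "d i" m] slc[OF i] d(2)[OF i, of m] unfolding a_def
    by (cases "m < d i") auto
  then show "c i = 0" by (rule slice_eqI[of s, OF trans[OF _ slice_0[symmetric]]])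
qed

text \<open>Every solution belongs to a period; expanding it in the basis and exchanging theta for t
  in the coordinates gives the combination.\<close>

lemma basis_anderson_generates:
  assumes b: "is_basis b" and h: "h \<in> T (Suc s)" "(\<Sum>k=1..r. A k * (tau ^^ k) h) = (tvar s - const \<theta>) * h"
  shows "\<exists>d. (\<forall>i<r. d i \<in> T (Suc s) \<and> tau (d i) = d i) \<and> h = (\<Sum>i<r. d i * anderson (b i))"
proof -
  obtain x where x: "x \<in> Lamm" "h = anderson x" using solution_is_anderson[OF h] by blast
  obtain c where c: "\<And>i. i < r \<Longrightarrow> c i \<in> AR" "x = (\<Sum>i<r. c i * b i)" using b x(1) unfolding is_basis_def by blast
  have bL: "b i \<in> Lamm" if "i < r" for i using b that by (simp add: is_basis_def)
  have "\<exists>d. d \<in> T (Suc s) \<and> tau d = d \<and> anderson (c i * b i) = d * anderson (b i)" if "i < r" for i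
    using AR_times_anderson[OF bL[OF that] c(1)[OF that]] by blast
  then obtain d where d: "\<And>i. i < r \<Longrightarrow> d i \<in> T (Suc s)" "\<And>i. i < r \<Longrightarrow> tau (d i) = d i"
    "\<And>i. i < r \<Longrightarrow> anderson (c i * b i) = d i * anderson (b i)" by metis
  have "h = (\<Sum>i<r. anderson (c i * b i))"
    unfolding x(2) c(2) using c(1) bL by (intro anderson_sum T_mult AR_T Lamm_T) auto
  also have "\<dots> = (\<Sum>i<r. d i * anderson (b i))" using d(3) by simp
  finally show ?thesis using d(1,2) by blast
qed

text \<open>An inverse B of the Moore matrix satisfies a difference equation of its own, which forces its
  coefficients to decay fast enough for its Frobenius twist to be evaluated at t = theta.\<close>

lemma inverse_recursion:
  assumes B: "\<And>j k. j < r \<Longrightarrow> k < r \<Longrightarrow> (\<Sum>i<r. (tau ^^ j) (g i) * B i k) = (if j = k then 1 else 0)"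
    and B': "\<And>j k. j < r \<Longrightarrow> k < r \<Longrightarrow> (\<Sum>i<r. B j i * (tau ^^ i) (g k)) = (if j = k then 1 else 0)"
    and eq: "\<And>i. i < r \<Longrightarrow> (\<Sum>k=1..r. A k * (tau ^^ k) (g i)) = x * g i"
    and i: "i < r" and l: "l < r"
  shows "B i l = (if l = 0 then Ar' * tau (B i (r - 1)) * x else tau (B i (l - 1)) - Ar' * A l * tau (B i (r - 1)))"
proof -
  let ?b = "tau (B i (r - 1))"
  \<comment> \<open>The row of tau(B) times the companion matrix. From tau(M) = \<Theta> M it is to
    be expected that B = tau(B) \<Theta>.\<close>
  define c where "c l = (if l = 0 then Ar' * ?b * x else tau (B i (l - 1)) - Ar' * A l * ?b)" for l
  have sum_c: "(\<Sum>l<r. c l * (tau ^^ l) (g k)) = (if i = k then 1 else 0)" if k: "k < r" for k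
  proof -
    have r1: "{..<r} = insert 0 {1..<r}" and r2: "{1..r} = insert r {1..<r}" using r by auto
    have "A r * (tau ^^ r) (g k) = x * g k - (\<Sum>l=1..<r. A l * (tau ^^ l) (g k))"
      using eq[OF k] unfolding r2 by (simp add: algebra_simps)
    then have "Ar' * (A r * (tau ^^ r) (g k)) = Ar' * (x * g k - (\<Sum>l=1..<r. A l * (tau ^^ l) (g k)))" by simp
    moreover have "Ar' * (A r * (tau ^^ r) (g k)) = (A r * Ar') * (tau ^^ r) (g k)" by (simp only: mult_ac)
    ultimately have top: "(tau ^^ r) (g k) = Ar' * (x * g k - (\<Sum>l=1..<r. A l * (tau ^^ l) (g k)))" using Ar' by simp
    have "(\<Sum>l<r. c l * (tau ^^ l) (g k)) = Ar' * ?b * x * g k + (\<Sum>l=1..<r. (tau (B i (l - 1)) - Ar' * A l * ?b) * (tau ^^ l) (g k))"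
      unfolding r1 by (simp add: c_def)
    also have "\<dots> = ?b * (Ar' * (x * g k - (\<Sum>l=1..<r. A l * (tau ^^ l) (g k)))) + (\<Sum>l=1..<r. tau (B i (l - 1)) * (tau ^^ l) (g k))"
      by (simp add: left_diff_distrib right_diff_distrib sum_subtractf sum_distrib_left mult_ac)
    also have "\<dots> = ?b * (tau ^^ r) (g k) + (\<Sum>l=1..<r. tau (B i (l - 1)) * (tau ^^ l) (g k))" unfolding top ..
    also have "\<dots> = (\<Sum>l=1..r. tau (B i (l - 1)) * (tau ^^ l) (g k))" unfolding r2 by simp
    also have "\<dots> = (\<Sum>l<r. tau (B i l) * (tau ^^ Suc l) (g k))"
      by (rule sum.reindex_bij_witness[of _ Suc "\<lambda>l. l - 1"]) auto
    also have "\<dots> = tau (\<Sum>l<r. B i l * (tau ^^ l) (g k))" by (simp add: tau_sum tau_mult)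
    finally show ?thesis unfolding B'[OF i k] by simp
  qed
  \<comment> \<open>The row c multiplies the Moore matrix to a unit row, and B is also a right
    inverse; multiplying by it identifies c with the row of B.\<close>
  have "c l = (\<Sum>j<r. if j = l then c j else 0)" using l by simp
  also have "\<dots> = (\<Sum>j<r. c j * (\<Sum>k<r. (tau ^^ j) (g k) * B k l))"
    using B l by (intro sum.cong) auto
  also have "\<dots> = (\<Sum>k<r. (\<Sum>j<r. c j * (tau ^^ j) (g k)) * B k l)"
    unfolding sum_distrib_left sum_distrib_right by (subst sum.swap) (simp add: mult.assoc)
  also have "\<dots> = (\<Sum>k<r. if k = i then B k l else 0)" using sum_c by (intro sum.cong) auto
  also have "\<dots> = B i l" using i by simp
  finally show ?thesis by (simp add: c_def)
qed

text \<open>The factor t - theta links slice m + 1 of B to slices m and m + 1 of tau(B), and the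
  other coefficients are free of t. The largest norm among the slices of index m therefore satisfies
  the recursion of \<open>superexponential_decay\<close>.\<close>

lemma inverse_decay:
  assumes BT: "\<And>l. B l \<in> T (Suc s)"
    and rec: "\<And>l. l < r \<Longrightarrow> B l = (if l = 0 then Ar' * tau (B (r - 1)) * (tvar s - const \<theta>)
      else tau (B (l - 1)) - Ar' * A l * tau (B (r - 1)))" and l: "l < r"
  shows "(\<lambda>m. nrm (slice s m (tau (B l))) * real q ^ m) \<longlonglongrightarrow> 0"
proof -
  define Q where "Q l m = nrm (slice s m (B l))" for l m
  define \<beta> where "\<beta> m = Max ((\<lambda>l. Q l m) ` {..<r})" for m
  have slT: "slice s m (B l) \<in> T s" for l m by (rule slice_T[OF BT])
  have Q0: "0 \<le> Q l m" for l m unfolding Q_def by (rule nrm_nonneg[OF T_CC[OF slT]])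
  have Qb: "Q l m \<le> \<beta> m" if "l < r" for l m unfolding \<beta>_def using that by (intro Max_ge) auto
  have b0: "0 \<le> \<beta> m" for m using Q0[of 0 m] Qb[of 0 m] r by simp
  have bmem: "\<exists>l<r. \<beta> m = Q l m" for m
  proof -
    have "\<beta> m \<in> (\<lambda>l. Q l m) ` {..<r}" unfolding \<beta>_def using r by (intro Max_in) (auto simp: lessThan_empty_iff)
    then show ?thesis by auto
  qed
  have blim: "\<beta> \<longlonglongrightarrow> 0"
  proof (rule tendsto_0_le[OF b0])
    show "\<beta> m \<le> (\<Sum>l<r. Q l m)" for m
    proof -
      obtain l where "l < r" "\<beta> m = Q l m" using bmem by blast
      then show ?thesis using member_le_sum[of l "{..<r}" "\<lambda>l. Q l m"] Q0 by simp
    qed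
    show "(\<lambda>m. \<Sum>l<r. Q l m) \<longlonglongrightarrow> 0"
      unfolding Q_def using tendsto_sum[of "{..<r}" "\<lambda>l m. nrm (slice s m (B l))" "\<lambda>_. 0"] slice_tendsto_0[OF BT] by simp
  qed
  \<comment> \<open>Dominates every coefficient of the recursion: 1 for the bare twist, the second
    term for theta times the inverse of A r, the sum for the products with A l.\<close>
  define W where "W = 1 + real q * nrm Ar' + (\<Sum>l<r. nrm Ar' * nrm (A l))"
  have nA: "0 \<le> nrm Ar'" "0 \<le> nrm (A l)" for l using nrm_nonneg[OF T_CC[OF Ar'(1)]] nrm_nonneg[OF T_CC[OF AT]] by auto
  have S0: "0 \<le> (\<Sum>l<r. nrm Ar' * nrm (A l))" using nA by (intro sum_nonneg) auto
  have qA: "0 \<le> real q * nrm Ar'" using nA by simp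
  have W1: "W \<ge> 1" "real q * nrm Ar' \<le> W" "nrm Ar' \<le> W" "\<And>l. l < r \<Longrightarrow> nrm Ar' * nrm (A l) \<le> W"
  proof -
    show "W \<ge> 1" "real q * nrm Ar' \<le> W" unfolding W_def using S0 qA by auto
    have "1 * nrm Ar' \<le> real q * nrm Ar'" using q_ge_2 nA by (intro mult_right_mono) auto
    then show "nrm Ar' \<le> W" unfolding W_def using S0 by simp
    show "nrm Ar' * nrm (A l) \<le> W" if "l < r" for l
    proof -
      have "nrm Ar' * nrm (A l) \<le> (\<Sum>l<r. nrm Ar' * nrm (A l))"
        by (rule member_le_sum[where f = "\<lambda>l. nrm Ar' * nrm (A l)"]) (use that nA in auto)
      then show ?thesis unfolding W_def using qA by linarith
    qed
  qed
  have tslC: "tau (slice s m (B l)) \<in> CC" for l m by (rule CC_tau[OF T_CC[OF slT]])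
  have ntau: "nrm (tau (slice s m (B l))) = Q l m ^ q" for l m unfolding Q_def by (rule nrm_tau[OF T_CC[OF slT]])
  have Qq: "Q l m ^ q \<le> \<beta> m ^ q" if "l < r" for l m using Qb[OF that] Q0 by (intro power_mono)
  have bq0: "0 \<le> \<beta> m ^ q" for m using b0 by simp
  have AV: "Ar' \<in> V s" "A l \<in> V s" "const c \<in> V s" for l c using T_V Ar'(1) AT T_const by blast+
  have recb: "\<beta> (Suc m) \<le> W * max (\<beta> (Suc m) ^ q) (\<beta> m ^ q)" for m
  proof -
    let ?M = "max (\<beta> (Suc m) ^ q) (\<beta> m ^ q)"
    have M0: "0 \<le> ?M" using bq0 by (simp add: le_max_iff_disj)
    obtain l where l: "l < r" "\<beta> (Suc m) = Q l (Suc m)" using bmem by blast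
    have r1: "r - 1 < r" using r by simp
    have "Q l (Suc m) \<le> W * ?M"
    proof (cases "l = 0")
      case True
      define G where "G = Ar' * tau (B (r - 1))"
      have slG: "slice s m G = Ar' * tau (slice s m (B (r - 1)))" for m
        unfolding G_def by (simp add: slice_mult AV slice_tau)
      have nG: "nrm (slice s m G) = nrm Ar' * Q (r - 1) m ^ q" for m
        unfolding slG by (simp add: nrm_mult T_CC[OF Ar'(1)] tslC ntau)
      have GC: "slice s m G \<in> CC" for m unfolding slG by (intro CC_mult T_CC[OF Ar'(1)] tslC)
      have "B l = tvar s * G - const \<theta> * G" using rec[OF l(1)] True by (simp add: G_def algebra_simps)
      then have "slice s (Suc m) (B l) = slice s m G - const \<theta> * slice s (Suc m) G"
        by (simp add: slice_diff slice_tvar slice_mult AV)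
      then have "Q l (Suc m) = nrm (slice s m G - const \<theta> * slice s (Suc m) G)" by (simp add: Q_def)
      also have "\<dots> \<le> W * ?M"
      proof (rule nrm_diff_le)
        show "slice s m G \<in> CC" "const \<theta> * slice s (Suc m) G \<in> CC" by (intro CC_mult CC_const GC)+
        have "nrm Ar' * Q (r - 1) m ^ q \<le> W * ?M"
          using W1 Qq[OF r1, of m] M0 Q0 by (intro mult_mono) (auto simp: le_max_iff_disj)
        then show "nrm (slice s m G) \<le> W * ?M" unfolding nG .
        have "(real q * nrm Ar') * Q (r - 1) (Suc m) ^ q \<le> W * ?M"
          using W1 Qq[OF r1, of "Suc m"] M0 Q0 by (intro mult_mono) (auto simp: le_max_iff_disj)
        then show "nrm (const \<theta> * slice s (Suc m) G) \<le> W * ?M"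
          by (simp add: nrm_mult GC nG av_theta mult.assoc)
      qed
      finally show ?thesis .
    next
      case False
      then have l1: "l - 1 < r" using l(1) by simp
      have "B l = tau (B (l - 1)) - (Ar' * A l) * tau (B (r - 1))" using rec[OF l(1)] False by simp
      moreover have "Ar' * A l \<in> V s" by (intro V_mult AV)
      ultimately have "slice s (Suc m) (B l) = tau (slice s (Suc m) (B (l - 1))) - (Ar' * A l) * tau (slice s (Suc m) (B (r - 1)))"
        by (simp add: slice_diff slice_mult slice_tau)
      then have "Q l (Suc m) = nrm (tau (slice s (Suc m) (B (l - 1))) - (Ar' * A l) * tau (slice s (Suc m) (B (r - 1))))" by (simp add: Q_def)
      also have "\<dots> \<le> W * ?M"
      proof (rule nrm_diff_le)
        show "tau (slice s (Suc m) (B (l - 1))) \<in> CC" by (rule tslC)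
        show "(Ar' * A l) * tau (slice s (Suc m) (B (r - 1))) \<in> CC" by (intro CC_mult T_CC[OF Ar'(1)] T_CC[OF AT] tslC)
        have "1 * Q (l - 1) (Suc m) ^ q \<le> W * ?M"
          using W1(1) Qq[OF l1, of "Suc m"] M0 Q0 by (intro mult_mono) (auto simp: le_max_iff_disj)
        then show "nrm (tau (slice s (Suc m) (B (l - 1)))) \<le> W * ?M" by (simp add: ntau)
        have "(nrm Ar' * nrm (A l)) * Q (r - 1) (Suc m) ^ q \<le> W * ?M"
          using W1(1) W1(4)[OF l(1)] Qq[OF r1, of "Suc m"] M0 Q0 by (intro mult_mono) (auto simp: le_max_iff_disj)
        then show "nrm ((Ar' * A l) * tau (slice s (Suc m) (B (r - 1)))) \<le> W * ?M"
          by (simp add: nrm_mult CC_mult T_CC[OF Ar'(1)] T_CC[OF AT] tslC ntau)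
      qed
      finally show ?thesis .
    qed
    then show ?thesis using l(2) by simp
  qed
  have lim: "(\<lambda>m. \<beta> m ^ q * real q ^ m) \<longlonglongrightarrow> 0"
    by (rule superexponential_decay[OF b0 blim W1(1) q_ge_2 recb])
  show ?thesis
  proof (rule tendsto_0_le[OF _ _ lim])
    show "0 \<le> nrm (slice s m (tau (B l))) * real q ^ m" for m by (simp add: slice_tau nrm_nonneg[OF tslC])
    show "nrm (slice s m (tau (B l))) * real q ^ m \<le> \<beta> m ^ q * real q ^ m" for m
      unfolding slice_tau ntau using Qq[OF l] by (intro mult_right_mono) auto
  qed
qed

text \<open>Both inverse identities are twisted once and evaluated at t = theta; evaluation respects
  sums and products and is unique. Both sides are recorded because \<open>de_rham_injective\<close>
  uses the first identity and \<open>de_rham_surjective\<close> the second.\<close>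

lemma period_matrix_invertible:
  assumes b: "is_basis b"
  shows "\<exists>C. (\<forall>i j. C i j \<in> T s)
    \<and> (\<forall>j<r. \<forall>k<r. (\<Sum>i<r. app (qper_op (tj (Suc j))) (b i) * C i k) = (if j = k then 1 else 0))
    \<and> (\<forall>j<r. \<forall>k<r. (\<Sum>i<r. C j i * app (qper_op (tj (Suc i))) (b k)) = (if j = k then 1 else 0))"
proof -
  let ?g = "\<lambda>i. anderson (b i)"
  have bL: "b i \<in> Lamm" if "i < r" for i using b that by (simp add: is_basis_def)
  have bT: "b i \<in> T s" if "i < r" for i using Lamm_T[OF bL[OF that]] .
  obtain x' where x': "x' \<in> T (Suc s)" "(tvar s - const \<theta>) * x' = 1" using tvar_minus_theta_unit by blast
  have "\<exists>B. (\<forall>i j. B i j \<in> T (Suc s))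
    \<and> (\<forall>j<r. \<forall>k<r. (\<Sum>i<r. (tau ^^ j) (?g i) * B i k) = (if j = k then 1 else 0))
    \<and> (\<forall>j<r. \<forall>k<r. (\<Sum>i<r. B j i * (tau ^^ i) (?g k)) = (if j = k then 1 else 0))"
  proof (rule moore_invertible[where r = r and A = A and S = "Suc s" and Ar' = Ar' and x = "tvar s - const \<theta>"
        and x' = x' and g = "\<lambda>i. anderson (b i)", OF r T_Suc[OF AT] T_Suc[OF Ar'(1)] Ar'(2) _ x'])
    show "tvar s - const \<theta> \<in> T (Suc s)" by (intro T_diff tvar_T T_const)
    show "?g i \<in> T (Suc s)" if "i < r" for i by (rule anderson_T[OF bT[OF that]])
    show "indep (Suc s) r ?g" by (rule basis_anderson_indep[OF b])
    show "(\<Sum>k=1..r. A k * (tau ^^ k) (?g i)) = (tvar s - const \<theta>) * ?g i" if "i < r" for i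
      by (rule anderson_eq[OF bL[OF that]])
    show "\<exists>d. (\<forall>i<r. d i \<in> T (Suc s) \<and> tau (d i) = d i) \<and> h = (\<Sum>i<r. d i * ?g i)"
      if "h \<in> T (Suc s)" "(\<Sum>k=1..r. A k * (tau ^^ k) h) = (tvar s - const \<theta>) * h" for h
      by (rule basis_anderson_generates[OF b that])
  qed
  then obtain B where BT: "\<And>i j. B i j \<in> T (Suc s)"
    and B: "\<And>j k. j < r \<Longrightarrow> k < r \<Longrightarrow> (\<Sum>i<r. (tau ^^ j) (?g i) * B i k) = (if j = k then 1 else 0)"
    and B': "\<And>j k. j < r \<Longrightarrow> k < r \<Longrightarrow> (\<Sum>i<r. B j i * (tau ^^ i) (?g k)) = (if j = k then 1 else 0)" by blast
  have "\<exists>h. eval_at s (tau (B i l)) h" if i: "i < r" and l: "l < r" for i l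
  proof (rule eval_at_exists)
    show "slice s m (tau (B i l)) \<in> T s" for m by (intro slice_T T_tau BT)
    show "(\<lambda>m. nrm (slice s m (tau (B i l))) * real q ^ m) \<longlonglongrightarrow> 0"
      by (rule inverse_decay[where B = "B i", OF BT _ l]) (rule inverse_recursion[OF B B' anderson_eq[OF bL] i])
  qed
  then obtain C0 where C0: "\<And>i l. i < r \<Longrightarrow> l < r \<Longrightarrow> eval_at s (tau (B i l)) (C0 i l)" by metis
  define C where "C i l = (if i < r \<and> l < r then C0 i l else 0)" for i l
  have C: "eval_at s (tau (B i l)) (C i l)" if "i < r" "l < r" for i l using C0 that by (simp add: C_def)
  have CT: "C i l \<in> T s" for i l using C0 by (auto simp: C_def eval_at_def)
  have evF: "eval_at s ((tau ^^ Suc j) (?g i)) (app (qper_op (tj (Suc j))) (b i))" if "i < r" for i j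
    by (rule eval_at_anderson[OF _ bT[OF that]]) simp
  have delta: "eval_at s (if j = k then 1 else 0) (if j = k then 1 else 0)" for j k :: nat by (rule eval_at_const) simp
  show ?thesis
  proof (intro exI[of _ C] conjI allI impI)
    show "C i j \<in> T s" for i j by (rule CT)
    fix j k assume jk: "j < r" "k < r"
    have "(\<Sum>i<r. (tau ^^ Suc j) (?g i) * tau (B i k)) = tau (if j = k then 1 else 0)"
      unfolding B[OF jk, symmetric] by (simp add: tau_sum tau_mult)
    then have e: "(\<Sum>i<r. (tau ^^ Suc j) (?g i) * tau (B i k)) = (if j = k then 1 else 0)" by (simp split: if_splits)
    have "eval_at s (\<Sum>i<r. (tau ^^ Suc j) (?g i) * tau (B i k)) (\<Sum>i<r. app (qper_op (tj (Suc j))) (b i) * C i k)"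
      using evF C jk by (intro eval_at_sum eval_at_mult) auto
    then show "(\<Sum>i<r. app (qper_op (tj (Suc j))) (b i) * C i k) = (if j = k then 1 else 0)"
      unfolding e using eval_at_unique delta by blast
    have "(\<Sum>i<r. tau (B j i) * (tau ^^ Suc i) (?g k)) = tau (if j = k then 1 else 0)"
      unfolding B'[OF jk, symmetric] by (simp add: tau_sum tau_mult)
    then have e': "(\<Sum>i<r. tau (B j i) * (tau ^^ Suc i) (?g k)) = (if j = k then 1 else 0)" by (simp split: if_splits)
    have "eval_at s (\<Sum>i<r. tau (B j i) * (tau ^^ Suc i) (?g k)) (\<Sum>i<r. C j i * app (qper_op (tj (Suc i))) (b k))"
      using evF C jk by (intro eval_at_sum eval_at_mult) auto
    then show "(\<Sum>i<r. C j i * app (qper_op (tj (Suc i))) (b k)) = (if j = k then 1 else 0)"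
      unfolding e' using eval_at_unique delta by blast
  qed
qed

section \<open>Reduction modulo inner biderivations\<close>

text \<open>The value at theta of the strictly inner biderivation given by n.\<close>

definition inner :: "(nat \<Rightarrow> 'a mps) \<Rightarrow> nat \<Rightarrow> 'a mps" where
  "inner n = tm n A - tm (sc (const \<theta>)) n"

lemma inner_add: "inner (n + n') = inner n + inner n'"
  by (simp add: inner_def tm_add_left tm_add_right)

definition low :: "(nat \<Rightarrow> 'a mps) \<Rightarrow> nat \<Rightarrow> 'a mps" where
  "low c k = (if 1 \<le> k \<and> k \<le> r then c (k - 1) else 0)"

text \<open>The inner biderivation of h tau^e has leading term h tau^e(A r) tau^(r+e). As A r is a
  unit, h can be chosen to cancel any top term; d measures the degree in excess of r.\<close>

lemma reduction_step:
  assumes m: "tpoly s m" "m 0 = 0" and d: "\<And>k. k > r + d \<Longrightarrow> m k = 0"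
  shows "\<exists>n c. tpoly s n \<and> n 0 = 0 \<and> (\<forall>j. c j \<in> T s) \<and> m = inner n + low c"
  using assms
proof (induction d arbitrary: m)
  case 0
  have "m = inner 0 + low (\<lambda>j. m (Suc j))"
  proof
    fix k show "m k = (inner 0 + low (\<lambda>j. m (Suc j))) k"
      using 0(2) 0(3)[of k] by (cases k) (auto simp: inner_def low_def)
  qed
  moreover have "tpoly s 0" "(0 :: nat \<Rightarrow> 'a mps) 0 = 0" by (auto simp: tpoly_def)
  moreover have "\<forall>j. m (Suc j) \<in> T s" using tpoly_T[OF 0(1)] by simp
  ultimately show ?case by (intro exI[of _ 0] exI[of _ "\<lambda>j. m (Suc j)"] conjI)
next
  case (Suc d)
  define e where "e = Suc d"
  have e0: "e \<noteq> 0" "\<And>k. k > r + e \<Longrightarrow> m k = 0" "\<And>k. k > r + d \<Longrightarrow> k \<noteq> r + e \<Longrightarrow> k > r + e" using Suc(4) by (auto simp: e_def)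
  \<comment> \<open>Twisting the inverse of A r by tau^e compensates the twist of A r in the product
    with tau^e.\<close>
  define h where "h = m (r + e) * (tau ^^ e) Ar'"
  define n1 where "n1 i = (if i = e then h else 0)" for i
  have hT: "h \<in> T s" unfolding h_def by (intro T_mult tpoly_T[OF Suc(2)] T_taun Ar')
  have n1T: "n1 i \<in> T s" for i using hT by (simp add: n1_def)
  have "n1 i = 0" if "i \<ge> Suc e" for i using that by (simp add: n1_def)
  then have n1: "tpoly s n1" "n1 0 = 0" using n1T e0(1) unfolding tpoly_def by (blast, simp add: n1_def)
  have t1: "tm n1 A k = (if e \<le> k then h * (tau ^^ e) (A (k - e)) else 0)" for k
  proof -
    have "tm n1 A k = (\<Sum>i\<le>k. if i = e then h * (tau ^^ e) (A (k - e)) else 0)"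
      unfolding tm_def n1_def by (intro sum.cong) auto
    then show ?thesis by simp
  qed
  have in1: "inner n1 k = tm n1 A k - const \<theta> * n1 k" for k by (simp add: inner_def tm_sc_left)
  define m' where "m' = m - inner n1"
  have "tpoly s (inner n1)" unfolding inner_def by (intro tpoly_diff tpoly_tm n1 tpolyA tpoly_sc T_const)
  then have m': "tpoly s m'" unfolding m'_def by (intro tpoly_diff Suc(2))
  have m'0: "m' 0 = 0" unfolding m'_def using Suc(3) n1(2) e0(1) by (simp add: in1 t1)
  have "m' k = 0" if k: "k > r + d" for k
  proof (cases "k = r + e")
    case True
    have "(tau ^^ e) Ar' * (tau ^^ e) (A r) = 1"
      using Ar'(2) by (metis mult.commute taun_1 taun_mult)
    then have "h * (tau ^^ e) (A r) = m k" unfolding h_def True by (simp add: mult.assoc)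
    then show ?thesis using True r by (simp add: m'_def in1 t1 n1_def)
  next
    case False
    then have ke: "k > r + e" using e0(3)[OF k] by simp
    moreover have "A (k - e) = 0" using ke by (intro A_gt) simp
    ultimately show ?thesis using e0(2)[of k] by (simp add: m'_def in1 t1 n1_def)
  qed
  then obtain n c where nc: "tpoly s n" "n 0 = 0" "\<forall>j. c j \<in> T s" "m' = inner n + low c"
    using Suc.IH[OF m' m'0] by blast
  have "m = inner (n1 + n) + low c" using nc(4) unfolding m'_def inner_add by (simp add: algebra_simps)
  moreover have "(n1 + n) 0 = 0" using n1(2) nc(2) by simp
  moreover note tpoly_add[OF n1(1) nc(1)] nc(3)
  ultimately show ?case by (intro exI[of _ "n1 + n"] exI[of _ c] conjI)
qed

lemma reduction:
  assumes m: "tpoly s m" "m 0 = 0"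
  shows "\<exists>n c. tpoly s n \<and> n 0 = 0 \<and> (\<forall>j. c j \<in> T s) \<and> m = inner n + low c"
proof -
  obtain d where "\<And>k. k \<ge> d \<Longrightarrow> m k = 0" using m(1) unfolding tpoly_def by blast
  then have "\<And>k. k > r + d \<Longrightarrow> m k = 0" by simp
  then show ?thesis by (rule reduction_step[OF m])
qed

section \<open>Linearity of quasi-periodic operators\<close>

lemma qper_op_add: "qper_op (m + m') = qper_op m + qper_op m'"
  by (simp add: qper_op_def tm_add_left dvt_add)

lemma qper_op_scale: "qper_op (\<lambda>k. c * m k) = (\<lambda>n. c * qper_op m n)"
proof -
  have "tm (\<lambda>k. c * m k) E = (\<lambda>n. c * tm m E n)" by (simp add: tm_def fun_eq_iff sum_distrib_left mult.assoc)
  then show ?thesis by (simp add: qper_op_def dvt_scale)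
qed

lemma app_scale:
  assumes a: "entire s a" and ca: "entire s (\<lambda>n. c * a n)" and c: "c \<in> T s" and x: "x \<in> T s"
  shows "app (\<lambda>n. c * a n) x = c * app a x"
proof (rule app_eqI[OF ca x])
  have "psum (\<lambda>n. c * a n) x = (\<lambda>N. c * psum a x N)" by (simp add: psum_def sum_distrib_left mult.assoc fun_eq_iff)
  then show "nlim (psum (\<lambda>n. c * a n) x) (c * app a x)"
    using nlim_mult[OF T_CC[OF psum_T[OF a x]] T_CC[OF app_T[OF a x]] T_CC[OF c] app_lim[OF a x]] by simp
qed (intro CC_mult T_CC[OF c] T_CC[OF app_T[OF a x]])

lemma tpoly_scale: "tpoly s m \<Longrightarrow> c \<in> T s \<Longrightarrow> tpoly s (\<lambda>k. c * m k)"
  unfolding tpoly_def by (metis T_mult mult_zero_right)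

lemma app_qper_op_add: "tpoly s m \<Longrightarrow> tpoly s m' \<Longrightarrow> x \<in> T s \<Longrightarrow> app (qper_op (m + m')) x = app (qper_op m) x + app (qper_op m') x"
  unfolding qper_op_add by (rule app_add[OF qper_op_entire qper_op_entire])

lemma app_qper_op_scale: "tpoly s m \<Longrightarrow> c \<in> T s \<Longrightarrow> x \<in> T s \<Longrightarrow> app (qper_op (\<lambda>k. c * m k)) x = c * app (qper_op m) x"
  using qper_op_entire[OF tpoly_scale[of m c]] unfolding qper_op_scale by (intro app_scale qper_op_entire)

lemma app_qper_op_diff: 
  assumes "tpoly s m" "tpoly s m'" "x \<in> T s" shows "app (qper_op (m - m')) x = app (qper_op m) x - app (qper_op m') x"
  using app_qper_op_add[OF tpoly_diff[OF assms(1,2)] assms(2,3)] by simp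

lemma tpoly_sum: "(\<And>i. i \<in> I \<Longrightarrow> tpoly s (m i)) \<Longrightarrow> tpoly s (\<lambda>k. \<Sum>i\<in>I. m i k)"
proof (induction I rule: infinite_finite_induct)
  case (insert i I)
  then show ?case using tpoly_add[of s "m i" "\<lambda>k. \<Sum>i\<in>I. m i k"] by (simp add: plus_fun_def)
qed (auto simp: tpoly_def)

lemma app_qper_op_0: "x \<in> T s \<Longrightarrow> app (qper_op (\<lambda>k. 0)) x = 0"
  using app_qper_op_scale[of "tj 0" 0 x] tpoly_tj by simp

lemma app_qper_op_sum: "(\<And>i. i \<in> I \<Longrightarrow> tpoly s (m i)) \<Longrightarrow> x \<in> T s \<Longrightarrow>
   app (qper_op (\<lambda>k. \<Sum>i\<in>I. m i k)) x = (\<Sum>i\<in>I. app (qper_op (m i)) x)"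
proof (induction I rule: infinite_finite_induct)
  case (insert i I)
  then show ?case using app_qper_op_add[of "m i" "\<lambda>k. \<Sum>i\<in>I. m i k" x] tpoly_sum[of I m] by (simp add: plus_fun_def)
qed (auto simp: app_qper_op_0)

lemma low_eq: "low c = (\<lambda>k. \<Sum>j<r. c j * tj (Suc j) k)"
proof
  fix k
  show "low c k = (\<Sum>j<r. c j * tj (Suc j) k)"
  proof (cases "1 \<le> k \<and> k \<le> r")
    case True
    then have "(\<Sum>j<r. c j * tj (Suc j) k) = (\<Sum>j<r. if j = k - 1 then c j else 0)"
      by (intro sum.cong) (auto simp: tj_def)
    then show ?thesis using True by (auto simp: low_def)
  next
    case False
    then have "(\<Sum>j<r. c j * tj (Suc j) k) = 0" by (intro sum.neutral) (auto simp: tj_def)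
    then show ?thesis using False by (auto simp: low_def)
  qed
qed

lemma tpoly_low: "(\<And>j. c j \<in> T s) \<Longrightarrow> tpoly s (low c)"
  unfolding low_eq by (intro tpoly_sum tpoly_scale tpoly_tj)

lemma app_qper_op_low: "(\<And>j. c j \<in> T s) \<Longrightarrow> x \<in> T s \<Longrightarrow> app (qper_op (low c)) x = (\<Sum>j<r. c j * app (qper_op (tj (Suc j))) x)"
  unfolding low_eq by (subst app_qper_op_sum) (auto intro: tpoly_scale tpoly_tj simp: app_qper_op_scale tpoly_tj)

lemma tpoly_inner: "tpoly s n \<Longrightarrow> tpoly s (inner n)"
  unfolding inner_def by (intro tpoly_diff tpoly_tm tpolyA tpoly_sc T_const)

lemma inner_0: "n 0 = 0 \<Longrightarrow> inner n 0 = 0"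
  by (simp add: inner_def tm_def)

text \<open>The commutator of n exp with theta is the inner value times exp, so the quasi-periodic
  operator of an inner biderivation is n exp. It vanishes wherever exp does.\<close>

lemma app_qper_op_inner:
  assumes n: "tpoly s n" "n 0 = 0" and x: "x \<in> Lamm"
  shows "app (qper_op (inner n)) x = 0"
proof -
  have z: "tm (inner n) E 0 = 0" using inner_0[of n, OF n(2)] by (simp add: tm_def)
  have "tm (tm n E) (sc (const \<theta>)) - tm (sc (const \<theta>)) (tm n E) = tm (inner n) E"
    unfolding inner_def tm_diff_left tm_assoc Ex_eq[of A, OF A0] ..
  moreover have "tm n E 0 = 0" using n(2) by (simp add: tm_def)
  ultimately have "qper_op (inner n) = tm n E" unfolding qper_op_def using dvt_eq_iff[of "tm (inner n) E" "tm n E", OF z] by simp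
  moreover obtain d where "\<And>k. k \<ge> d \<Longrightarrow> n k = 0" using n(1) unfolding tpoly_def by blast
  ultimately show ?thesis using app_tm[OF n(1) _ entE Lamm_T[OF x], of d] x by (simp add: Lamm_def)
qed

lemma app_qper_op_theta:
  assumes m: "tpoly s m" "m 0 = 0" and x: "x \<in> Lamm"
  shows "app (qper_op m) (const \<theta> * x) = const \<theta> * app (qper_op m) x"
proof -
  obtain d where "\<And>k. k \<ge> d \<Longrightarrow> m k = 0" using m(1) unfolding tpoly_def by blast
  then show ?thesis using qper_op_relation[OF m _ Lamm_T[OF x], of d] x by (simp add: Lamm_def)
qed

lemma app_qper_op_AR:
  assumes m: "tpoly s m" "m 0 = 0" and x: "x \<in> Lamm" and a: "a \<in> AR"
  shows "app (qper_op m) (a * x) = a * app (qper_op m) x"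
proof -
  obtain c d where c: "\<And>m. c m \<in> T s \<and> tau (c m) = c m" "a = (\<Sum>m<d. c m * const (\<theta> ^ m))"
    using a unfolding AR_def by blast
  have eF: "entire s (qper_op m)" by (rule qper_op_entire[OF m(1)])
  have pT: "const (\<theta> ^ n) * x \<in> T s" for n using Lamm_T[OF Lamm_theta_power[OF x]] .
  have p: "app (qper_op m) (const (\<theta> ^ n) * x) = const (\<theta> ^ n) * app (qper_op m) x" for n
  proof (induction n)
    case (Suc n)
    have "app (qper_op m) (const \<theta> * (const (\<theta> ^ n) * x)) = const \<theta> * app (qper_op m) (const (\<theta> ^ n) * x)"
      by (rule app_qper_op_theta[OF m Lamm_theta_power[OF x]])
    then show ?case using Suc by (simp add: const_mult mult.assoc)
  qed simp
  have "a * x = (\<Sum>n<d. c n * (const (\<theta> ^ n) * x))" unfolding c(2) by (simp add: sum_distrib_right mult.assoc)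
  then have "app (qper_op m) (a * x) = (\<Sum>n<d. app (qper_op m) (c n * (const (\<theta> ^ n) * x)))"
    using app_sum_arg[OF eF, of "{..<d}" "\<lambda>n. c n * (const (\<theta> ^ n) * x)"] c(1) pT by (simp add: T_mult)
  also have "\<dots> = (\<Sum>n<d. c n * (const (\<theta> ^ n) * app (qper_op m) x))"
    using app_fixed_mult[OF eF pT] c(1) p by simp
  also have "\<dots> = a * app (qper_op m) x" unfolding c(2) by (simp add: sum_distrib_right mult.assoc)
  finally show ?thesis .
qed

section \<open>Kernel and image on a basis of the period lattice\<close>

lemma de_rham_injective:
  assumes b: "is_basis b" and m: "tpoly s m" "m 0 = 0" and z: "\<And>i. i < r \<Longrightarrow> app (qper_op m) (b i) = 0"
  obtains n where "tpoly s n" "n 0 = 0" "m = inner n"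
proof -
  obtain C where C: "\<And>i j. C i j \<in> T s"
    "\<And>j k. j < r \<Longrightarrow> k < r \<Longrightarrow> (\<Sum>i<r. app (qper_op (tj (Suc j))) (b i) * C i k) = (if j = k then 1 else 0)"
    "\<And>j k. j < r \<Longrightarrow> k < r \<Longrightarrow> (\<Sum>i<r. C j i * app (qper_op (tj (Suc i))) (b k)) = (if j = k then 1 else 0)"
    using period_matrix_invertible[OF b] by blast
  obtain n c where nc: "tpoly s n" "n 0 = 0" "\<And>j. c j \<in> T s" "m = inner n + low c" using reduction[OF m] by blast
  have bL: "b i \<in> Lamm" if "i < r" for i using b that by (simp add: is_basis_def)
  have s0: "(\<Sum>j<r. c j * app (qper_op (tj (Suc j))) (b i)) = 0" if i: "i < r" for i
  proof -
    have "app (qper_op m) (b i) = app (qper_op (inner n)) (b i) + app (qper_op (low c)) (b i)"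
      unfolding nc(4) by (intro app_qper_op_add tpoly_inner nc tpoly_low Lamm_T[OF bL[OF i]])
    then show ?thesis using z[OF i] app_qper_op_inner[OF nc(1,2) bL[OF i]] app_qper_op_low[OF nc(3) Lamm_T[OF bL[OF i]]] by simp
  qed
  have "c k = 0" if k: "k < r" for k
  proof -
    have "c k = (\<Sum>j<r. if j = k then c j else 0)" using k by simp
    also have "\<dots> = (\<Sum>j<r. c j * (\<Sum>i<r. app (qper_op (tj (Suc j))) (b i) * C i k))"
      using C(2) k by (intro sum.cong) auto
    also have "\<dots> = (\<Sum>i<r. (\<Sum>j<r. c j * app (qper_op (tj (Suc j))) (b i)) * C i k)"
      unfolding sum_distrib_left sum_distrib_right by (subst sum.swap) (simp add: mult.assoc)
    also have "\<dots> = 0" using s0 by simp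
    finally show ?thesis .
  qed
  then have "low c = 0" by (auto simp: low_def fun_eq_iff)
  then show thesis using that nc by simp
qed

lemma de_rham_surjective:
  assumes b: "is_basis b" and h: "\<And>i. i < r \<Longrightarrow> h i \<in> T s"
  obtains m where "tpoly s m" "m 0 = 0" "\<And>i. i < r \<Longrightarrow> app (qper_op m) (b i) = h i"
proof -
  obtain C where C: "\<And>i j. C i j \<in> T s"
    "\<And>j k. j < r \<Longrightarrow> k < r \<Longrightarrow> (\<Sum>i<r. app (qper_op (tj (Suc j))) (b i) * C i k) = (if j = k then 1 else 0)"
    "\<And>j k. j < r \<Longrightarrow> k < r \<Longrightarrow> (\<Sum>i<r. C j i * app (qper_op (tj (Suc i))) (b k)) = (if j = k then 1 else 0)"
    using period_matrix_invertible[OF b] by blast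
  define c where "c j = (\<Sum>k<r. h k * C k j)" for j
  have cT: "c j \<in> T s" for j unfolding c_def using h C(1) by (intro T_sum T_mult) auto
  have bT: "b i \<in> T s" if "i < r" for i using b that Lamm_T by (simp add: is_basis_def)
  show thesis
  proof (rule that[OF tpoly_low[OF cT]])
    show "low c 0 = 0" by (simp add: low_def)
    fix i assume i: "i < r"
    have "app (qper_op (low c)) (b i) = (\<Sum>j<r. (\<Sum>k<r. h k * C k j) * app (qper_op (tj (Suc j))) (b i))"
      unfolding app_qper_op_low[OF cT bT[OF i]] c_def ..
    also have "\<dots> = (\<Sum>k<r. h k * (\<Sum>j<r. C k j * app (qper_op (tj (Suc j))) (b i)))"
      unfolding sum_distrib_left sum_distrib_right by (subst sum.swap) (simp add: mult.assoc)
    also have "\<dots> = (\<Sum>k<r. if k = i then h k else 0)" using C(3) i by (intro sum.cong) auto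
    also have "\<dots> = h i" using i by simp
    finally show "app (qper_op (low c)) (b i) = h i" .
  qed
qed

end

section \<open>Transfer to coefficient functions\<close>

definition cv :: "'a::comm_ring_1 tel \<Rightarrow> 'a mps" where
  "cv f = Mps (\<lambda>\<nu>. f (lookup \<nu>))"

text \<open>Coefficients at infinitely supported indices, which power series do not have, are set to
  0. On Tate elements this inverts \<open>cv\<close>, because such elements vanish at those
  indices.\<close>

definition vc :: "'a::comm_ring_1 mps \<Rightarrow> 'a tel" where
  "vc F = (\<lambda>\<nu>. if finite {i. \<nu> i \<noteq> 0} then cf F (Abs_poly_mapping \<nu>) else 0)"

lemma cf_cv [simp]: "cf (cv f) \<nu> = f (lookup \<nu>)"
  by (simp add: cv_def)

lemma cv_vc [simp]: "cv (vc F) = F"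
  by (rule mps_eqI) (simp add: vc_def)

lemma cv_tmul: "cv (tmul f g) = cv f * cv (g :: 'a::field tel)"
proof (rule mps_eqI)
  fix \<nu> :: midx
  have fin: "finite {i. \<mu> i \<noteq> 0}" if "\<forall>i. \<mu> i \<le> lookup \<nu> i" for \<mu> :: "nat \<Rightarrow> nat"
  proof (rule finite_subset)
    show "{i. \<mu> i \<noteq> 0} \<subseteq> {i. lookup \<nu> i \<noteq> 0}" 
    proof
      fix i assume "i \<in> {i. \<mu> i \<noteq> 0}"
      then show "i \<in> {i. lookup \<nu> i \<noteq> 0}" using that[rule_format, of i] by simp
    qed
  qed simp
  show "cf (cv (tmul f g)) \<nu> = cf (cv f * cv g) \<nu>"
    unfolding cf_cv tmul_def cf_mult
  proof (rule sum.reindex_bij_witness[of _ "\<lambda>(a, b). lookup a" "\<lambda>\<mu>. (Abs_poly_mapping \<mu>, \<nu> - Abs_poly_mapping \<mu>)"])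
    fix \<mu> :: "nat \<Rightarrow> nat" assume m: "\<mu> \<in> {\<mu>. \<forall>i. \<mu> i \<le> lookup \<nu> i}"
    then have l: "lookup (Abs_poly_mapping \<mu>) = \<mu>" using fin by simp
    show "(case (Abs_poly_mapping \<mu>, \<nu> - Abs_poly_mapping \<mu>) of (a, b) \<Rightarrow> lookup a) = \<mu>" using l by simp
    show "(Abs_poly_mapping \<mu>, \<nu> - Abs_poly_mapping \<mu>) \<in> splits \<nu>"
      unfolding splits_iff using m by (intro poly_mapping_eqI) (simp add: lookup_add lookup_minus l)
    have "lookup (\<nu> - Abs_poly_mapping \<mu>) = (\<lambda>i. lookup \<nu> i - \<mu> i)" by (rule ext) (simp add: lookup_minus l)
    then show "(case (Abs_poly_mapping \<mu>, \<nu> - Abs_poly_mapping \<mu>) of (a, b) \<Rightarrow> f (lookup a) * g (lookup b))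
      = f \<mu> * g (\<lambda>i. lookup \<nu> i - \<mu> i)" using l by simp
  next
    fix x assume x: "x \<in> splits \<nu>"
    obtain a b where ab: "x = (a, b)" "\<nu> = a + b" using x by (cases x) auto
    have "\<nu> - a = b" unfolding ab(2) by (metis add.commute midx_add_diff)
    then show "(Abs_poly_mapping (case x of (a, b) \<Rightarrow> lookup a), \<nu> - Abs_poly_mapping (case x of (a, b) \<Rightarrow> lookup a)) = x"
      using ab(1) by simp
    show "(case x of (a, b) \<Rightarrow> lookup a) \<in> {\<mu>. \<forall>i. \<mu> i \<le> lookup \<nu> i}" using ab by (simp add: lookup_add)
  qed
qed

lemma cv_tadd: "cv (tadd f g) = cv f + cv g" and cv_tsub: "cv (tsub f g) = cv f - cv g"
  and cv_tzero [simp]: "cv tzero = 0"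
  by (rule mps_eqI; simp add: tadd_def tsub_def tzero_def)+

lemma cv_tconst [simp]: "cv (tconst c) = const c"
proof (rule mps_eqI)
  fix \<nu> :: midx
  have "lookup \<nu> = (\<lambda>i. 0) \<longleftrightarrow> \<nu> = 0" by (metis lookup_inject lookup_zero ext)
  then show "cf (cv (tconst c)) \<nu> = cf (const c) \<nu>" by (simp add: tconst_def cf_const)
qed

lemma cv_tone [simp]: "cv tone = 1"
  by (simp add: tone_def)

lemma cv_sum: "cv (\<lambda>\<nu>. \<Sum>i\<in>I. F i \<nu>) = (\<Sum>i\<in>I. cv (F i))"
  by (rule mps_eqI) (simp add: cf_sum)

context cinf
begin

lemma cv_frob: "cv (frob q f) = tau (cv f)"
  by (rule mps_eqI) (simp add: frob_def)

lemma cv_frobn: "cv ((frob q ^^ n) f) = (tau ^^ n) (cv f)"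
  by (induction n) (auto simp: cv_frob)

lemma valid_idx_finite: "valid_idx s \<nu> \<Longrightarrow> finite {i. \<nu> i \<noteq> 0}"
proof (rule finite_subset[of _ "{..<s}"])
  assume v: "valid_idx s \<nu>"
  show "{i. \<nu> i \<noteq> 0} \<subseteq> {..<s}"
  proof
    fix i assume "i \<in> {i. \<nu> i \<noteq> 0}"
    then have "\<not> i \<ge> s" using v by (auto simp: valid_idx_def)
    then show "i \<in> {..<s}" by simp
  qed
qed simp

text \<open>The vanishing clause is stated on all index functions, since \<open>cv\<close> forgets
  the indices of infinite support.\<close>

lemma tate_iff: "f \<in> tate s av \<longleftrightarrow> (\<forall>\<nu>. \<not> valid_idx s \<nu> \<longrightarrow> f \<nu> = 0) \<and> cv f \<in> T s"
proof
  assume f: "f \<in> tate s av"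
  then have v: "\<forall>\<nu>. \<not> valid_idx s \<nu> \<longrightarrow> f \<nu> = 0" by (simp add: tate_def)
  have "finite (lookup -` {\<nu>. \<epsilon> \<le> av (f \<nu>)})" if "\<epsilon> > 0" for \<epsilon>
    using f that by (intro finite_vimageI) (auto simp: tate_def inj_def lookup_inject)
  then have "cf (cv f) \<in> C0" by (intro C0_I) (simp add: vimage_def)
  then show "(\<forall>\<nu>. \<not> valid_idx s \<nu> \<longrightarrow> f \<nu> = 0) \<and> cv f \<in> T s" using v by (simp add: T_def V_def CC_def)
next
  assume h: "(\<forall>\<nu>. \<not> valid_idx s \<nu> \<longrightarrow> f \<nu> = 0) \<and> cv f \<in> T s"
  have "finite {\<nu>. \<epsilon> \<le> av (f \<nu>)}" if e: "\<epsilon> > 0" for \<epsilon>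
  proof (rule finite_subset)
    show "finite (lookup ` {\<nu>. \<epsilon> \<le> av (cf (cv f) \<nu>)})"
      using h by (intro finite_imageI C0_D[OF _ e]) (simp add: T_def CC_def del: cf_cv)
    show "{\<nu>. \<epsilon> \<le> av (f \<nu>)} \<subseteq> lookup ` {\<nu>. \<epsilon> \<le> av (cf (cv f) \<nu>)}"
    proof
      fix \<nu> assume n: "\<nu> \<in> {\<nu>. \<epsilon> \<le> av (f \<nu>)}"
      then have "f \<nu> \<noteq> 0" using e by auto
      then have "valid_idx s \<nu>" using h by blast
      then have "lookup (Abs_poly_mapping \<nu>) = \<nu>" using valid_idx_finite by simp
      then show "\<nu> \<in> lookup ` {\<nu>. \<epsilon> \<le> av (cf (cv f) \<nu>)}"
        using n by (intro image_eqI[of _ _ "Abs_poly_mapping \<nu>"]) auto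
    qed
  qed
  then show "f \<in> tate s av" using h by (simp add: tate_def)
qed

lemma cv_T: "f \<in> tate s av \<Longrightarrow> cv f \<in> T s"
  by (simp add: tate_iff)

lemma vc_tate: "F \<in> T s \<Longrightarrow> vc F \<in> tate s av"
  unfolding tate_iff cv_vc by (auto simp: vc_def T_def V_def)

lemma tate_eqI: 
  assumes "f \<in> tate s av" "g \<in> tate s av" "cv f = cv g" shows "f = g"
proof
  fix \<nu>
  show "f \<nu> = g \<nu>"
  proof (cases "valid_idx s \<nu>")
    case True
    then have "lookup (Abs_poly_mapping \<nu>) = \<nu>" using valid_idx_finite by simp
    then show ?thesis using arg_cong[OF assms(3), of "\<lambda>F. cf F (Abs_poly_mapping \<nu>)"] by simp
  qed (use assms(1,2) in \<open>auto simp: tate_iff\<close>)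
qed

lemma vc_cv: "f \<in> tate s av \<Longrightarrow> vc (cv f) = f"
  by (rule tate_eqI[of _ s]) (auto intro: vc_tate cv_T)

lemma tate_tmul: "f \<in> tate s av \<Longrightarrow> g \<in> tate s av \<Longrightarrow> tmul f g \<in> tate s av"
  unfolding tate_iff cv_tmul
proof safe
  fix \<nu> assume f: "\<forall>\<nu>. \<not> valid_idx s \<nu> \<longrightarrow> f \<nu> = 0" and g: "\<forall>\<nu>. \<not> valid_idx s \<nu> \<longrightarrow> g \<nu> = 0" and v: "\<not> valid_idx s \<nu>"
  show "tmul f g \<nu> = 0"
    unfolding tmul_def
  proof (intro sum.neutral ballI)
    fix \<mu> assume "\<mu> \<in> {\<mu>. \<forall>i. \<mu> i \<le> \<nu> i}"
    then have le: "\<And>i. \<mu> i \<le> \<nu> i" by blast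
    obtain i where i: "i \<ge> s" "\<nu> i \<noteq> 0" using v by (auto simp: valid_idx_def)
    have "\<mu> i \<noteq> 0 \<or> \<nu> i - \<mu> i \<noteq> 0" using i(2) by auto
    then show "f \<mu> * g (\<lambda>i. \<nu> i - \<mu> i) = 0"
    proof
      assume "\<mu> i \<noteq> 0"
      then have "\<not> valid_idx s \<mu>" using i(1) by (auto simp: valid_idx_def)
      then show ?thesis using f by simp
    next
      assume "\<nu> i - \<mu> i \<noteq> 0"
      then have "\<not> valid_idx s (\<lambda>i. \<nu> i - \<mu> i)" using i(1) unfolding valid_idx_def by metis
      then show ?thesis using g by simp
    qed
  qed
qed (auto intro: T_mult)

lemma tate_simple: "tzero \<in> tate s av" "tconst c \<in> tate s av" "tone \<in> tate s av"
  "f \<in> tate s av \<Longrightarrow> g \<in> tate s av \<Longrightarrow> tadd f g \<in> tate s av"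
  "f \<in> tate s av \<Longrightarrow> g \<in> tate s av \<Longrightarrow> tsub f g \<in> tate s av"
proof -
  show "tzero \<in> tate s av" unfolding tate_iff cv_tzero by (simp add: tzero_def)
  show c: "tconst c \<in> tate s av" for c unfolding tate_iff cv_tconst by (auto simp: tconst_def valid_idx_def)
  show "tone \<in> tate s av" unfolding tone_def by (rule c)
  show "tadd f g \<in> tate s av" if "f \<in> tate s av" "g \<in> tate s av"
    using that unfolding tate_iff cv_tadd by (auto simp: tadd_def intro: T_add)
  show "tsub f g \<in> tate s av" if "f \<in> tate s av" "g \<in> tate s av"
    using that unfolding tate_iff cv_tsub by (auto simp: tsub_def intro: T_diff)
qed

lemma tate_frobn: "f \<in> tate s av \<Longrightarrow> (frob q ^^ n) f \<in> tate s av"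
proof (induction n)
  case (Suc n)
  then have g: "(frob q ^^ n) f \<in> tate s av" by blast
  have "frob q ((frob q ^^ n) f) \<in> tate s av"
    using g unfolding tate_iff cv_frob by (auto intro: T_tau simp: frob_def power_0_left)
  then show ?case by simp
qed simp

lemma tate_sum: "(\<And>i. i \<in> I \<Longrightarrow> F i \<in> tate s av) \<Longrightarrow> (\<lambda>\<nu>. \<Sum>i\<in>I. F i \<nu>) \<in> tate s av"
  unfolding tate_iff cv_sum by (auto intro: T_sum)

section \<open>Twisted series of coefficient functions\<close>

definition cvs :: "'a tser \<Rightarrow> nat \<Rightarrow> 'a mps" where
  "cvs a = (\<lambda>n. cv (a n))"

definition svc :: "(nat \<Rightarrow> 'a mps) \<Rightarrow> 'a tser" where
  "svc F = (\<lambda>n. vc (F n))"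

lemma cvs_svc [simp]: "cvs (svc F) = F"
  by (simp add: cvs_def svc_def)

lemma cvs_smul: "cvs (smul q a b) = tm (cvs a) (cvs b)"
  by (simp add: cvs_def smul_def tm_def cv_sum cv_tmul cv_frobn fun_eq_iff)

lemma cvs_sadd: "cvs (sadd a b) = cvs a + cvs b" and cvs_ssub: "cvs (ssub a b) = cvs a - cvs b"
  and cvs_sconst: "cvs (sconst c) = sc (cv c)"
  by (auto simp: cvs_def sadd_def ssub_def szero_def sconst_def sc_def cv_tadd cv_tsub fun_eq_iff)

lemma tser_eqI: "is_tser s av a \<Longrightarrow> is_tser s av b \<Longrightarrow> cvs a = cvs b \<Longrightarrow> a = b"
  unfolding is_tser_def cvs_def fun_eq_iff[of "\<lambda>n. cv (a n)"] by (intro ext tate_eqI[of _ s]) auto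

lemma tser_smul: "is_tser s av a \<Longrightarrow> is_tser s av b \<Longrightarrow> is_tser s av (smul q a b)"
  unfolding is_tser_def smul_def by (auto intro!: tate_sum tate_tmul tate_frobn)

lemma tser_simple: "is_tser s av a \<Longrightarrow> is_tser s av b \<Longrightarrow> is_tser s av (sadd a b)"
  "is_tser s av a \<Longrightarrow> is_tser s av b \<Longrightarrow> is_tser s av (ssub a b)"
  "is_tser s av szero" "c \<in> tate s av \<Longrightarrow> is_tser s av (sconst c)"
  by (auto simp: is_tser_def sadd_def ssub_def szero_def sconst_def tate_simple)

lemma tser_svc: "(\<And>n. F n \<in> T s) \<Longrightarrow> is_tser s av (svc F)"
  by (simp add: is_tser_def svc_def vc_tate)

lemma cvs_T: "is_tser s av a \<Longrightarrow> cvs a n \<in> T s"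
  by (simp add: is_tser_def cvs_def cv_T)

lemma svc_cvs: "is_tser s av a \<Longrightarrow> svc (cvs a) = a"
  unfolding is_tser_def svc_def cvs_def by (intro ext vc_cv) blast

lemma cvs_tpoly: "is_tpoly s av a \<Longrightarrow> tpoly s (cvs a)"
proof -
  assume a: "is_tpoly s av a"
  then obtain d where "\<And>n. a n \<noteq> tzero \<Longrightarrow> n < d"
    using finite_nat_set_iff_bounded[of "{n. a n \<noteq> tzero}"] by (auto simp: is_tpoly_def)
  then have "\<forall>n\<ge>d. cvs a n = 0" unfolding cvs_def by (metis cv_tzero not_le)
  then show ?thesis using cvs_T[of s a] a unfolding tpoly_def is_tpoly_def by blast
qed

lemma svc_tpoly: "tpoly s F \<Longrightarrow> is_tpoly s av (svc F)"
proof -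
  assume F: "tpoly s F"
  then obtain d where d: "\<And>n. n \<ge> d \<Longrightarrow> F n = 0" unfolding tpoly_def by blast
  have "vc 0 = tzero" by (auto simp: vc_def tzero_def)
  then have z: "svc F n = tzero" if "n \<ge> d" for n using d[OF that] by (simp add: svc_def)
  have "{n. svc F n \<noteq> tzero} \<subseteq> {..<d}"
  proof
    fix n assume "n \<in> {n. svc F n \<noteq> tzero}"
    then have "\<not> d \<le> n" using z[of n] by blast
    then show "n \<in> {..<d}" by simp
  qed
  then have "finite {n. svc F n \<noteq> tzero}" by (rule finite_subset) simp
  then show ?thesis using tser_svc[of F s, OF tpoly_T[OF F]] unfolding is_tpoly_def by blast
qed

lemma vc_0: "vc 0 = tzero"
  by (auto simp: vc_def tzero_def)

lemma gauss_eq: "f \<in> tate s av \<Longrightarrow> gauss av f = nrm (cv f)"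
proof (rule antisym)
  assume f: "f \<in> tate s av"
  have c: "cv f \<in> CC" by (rule T_CC[OF cv_T[OF f]])
  have le: "av (f \<nu>) \<le> nrm (cv f)" for \<nu>
  proof (cases "valid_idx s \<nu>")
    case True
    then have "lookup (Abs_poly_mapping \<nu>) = \<nu>" using valid_idx_finite by simp
    then show ?thesis using nrm_ge[OF c, of "Abs_poly_mapping \<nu>"] by simp
  next
    case False then show ?thesis using f nrm_nonneg[OF c] by (simp add: tate_iff)
  qed
  show "gauss av f \<le> nrm (cv f)" unfolding gauss_def by (rule cSUP_least) (auto intro: le)
  show "nrm (cv f) \<le> gauss av f"
  proof (rule nrm_le)
    fix \<nu>
    show "av (cf (cv f) \<nu>) \<le> gauss av f"
      unfolding gauss_def cf_cv using le by (intro cSUP_upper) (auto simp: bdd_above_def)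
  qed
qed

text \<open>The two notions of convergence correspond under \<open>cv\<close> because the Gauss
  norms agree; uniqueness of limits then identifies the two definite descriptions.\<close>

lemma sapp_eq:
  assumes a: "is_tser s av a" and e: "entire s (cvs a)" and x: "x \<in> tate s av"
  shows "sapp q s av a x = vc (app (cvs a) (cv x))"
proof -
  let ?S = "\<lambda>N. (\<lambda>\<nu>. \<Sum>n<N. tmul (a n) ((frob q ^^ n) x) \<nu>)"
  have ST: "?S N \<in> tate s av" for N using a x by (intro tate_sum tate_tmul tate_frobn) (auto simp: is_tser_def)
  have cS: "cv (?S N) = psum (cvs a) (cv x) N" for N
    by (simp add: cv_sum cv_tmul cv_frobn psum_def cvs_def)
  have conv: "tconv s av ?S L \<longleftrightarrow> L \<in> tate s av \<and> nlim (psum (cvs a) (cv x)) (cv L)" for L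
  proof -
    have eq: "(\<lambda>N. gauss av (tsub (?S N) L)) = (\<lambda>N. nrm (psum (cvs a) (cv x) N - cv L))" if "L \<in> tate s av"
      unfolding gauss_eq[OF tate_simple(5)[OF ST that]] cv_tsub cS ..
    show ?thesis
    proof (cases "L \<in> tate s av")
      case True
      show ?thesis unfolding tconv_def nlim_def eq[OF True] ..
    next
      case False
      then show ?thesis unfolding tconv_def by blast
    qed
  qed
  have xT: "cv x \<in> T s" by (rule cv_T[OF x])
  show ?thesis
    unfolding sapp_def conv
  proof (rule the_equality)
    show "vc (app (cvs a) (cv x)) \<in> tate s av \<and> nlim (psum (cvs a) (cv x)) (cv (vc (app (cvs a) (cv x))))"
      using app_T[OF e xT] app_lim[OF e xT] by (simp add: vc_tate)
    fix L assume L: "L \<in> tate s av \<and> nlim (psum (cvs a) (cv x)) (cv L)"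
    then have "app (cvs a) (cv x) = cv L" by (intro app_eqI[OF e xT T_CC[OF cv_T]]) auto
    then show "L = vc (app (cvs a) (cv x))" using vc_cv[of L s] L by simp
  qed
qed

lemma Fqt_cv: "c \<in> Fqt q s \<Longrightarrow> c \<in> tate s av \<and> tau (cv c) = cv c"
proof -
  assume c: "c \<in> Fqt q s"
  have "{\<nu>. \<epsilon> \<le> av (c \<nu>)} \<subseteq> {\<nu>. c \<nu> \<noteq> 0}" if "\<epsilon> > 0" for \<epsilon> using that by auto
  then have "c \<in> tate s av" using c unfolding tate_def Fqt_def by (auto intro: finite_subset)
  moreover have "tau (cv c) = cv c" using c by (intro mps_eqI) (auto simp: Fqt_def Fq_def)
  ultimately show ?thesis by blast
qed

text \<open>A fixed element has coefficients in F_q, and a null family of these has finite support,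
  so it is a polynomial.\<close>

lemma vc_Fqt: "c \<in> T s \<Longrightarrow> tau c = c \<Longrightarrow> vc c \<in> Fqt q s"
proof -
  assume c: "c \<in> T s" "tau c = c"
  have fq: "cf c \<nu> \<in> Fq q" for \<nu> using arg_cong[OF c(2), of "\<lambda>f. cf f \<nu>"] by (simp add: Fq_def)
  have "finite {\<nu>. cf c \<nu> \<noteq> 0}" using c(1) fq by (intro Fq_finite_support) (auto simp: T_def CC_def)
  moreover have "{\<nu>. vc c \<nu> \<noteq> 0} \<subseteq> lookup ` {\<nu>. cf c \<nu> \<noteq> 0}"
  proof
    fix \<nu> assume "\<nu> \<in> {\<nu>. vc c \<nu> \<noteq> 0}"
    then have n: "finite {i. \<nu> i \<noteq> 0}" "cf c (Abs_poly_mapping \<nu>) \<noteq> 0" by (auto simp: vc_def split: if_splits)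
    then show "\<nu> \<in> lookup ` {\<nu>. cf c \<nu> \<noteq> 0}" by (intro image_eqI[of _ _ "Abs_poly_mapping \<nu>"]) auto
  qed
  moreover have "vc c \<nu> \<in> Fq q" for \<nu> using fq by (auto simp: vc_def Fq_def power_0_left)
  ultimately show ?thesis using vc_tate[OF c(1)] unfolding Fqt_def tate_iff by (auto intro: finite_subset)
qed

end

context drinfeld_operator
begin

section \<open>The ring A[t_1, ..., t_s] and its two descriptions\<close>

lemma AR_add: "a \<in> AR \<Longrightarrow> b \<in> AR \<Longrightarrow> a + b \<in> AR"
proof -
  assume "a \<in> AR" "b \<in> AR"
  then obtain c d c' d' where c: "\<And>m. c m \<in> T s \<and> tau (c m) = c m" "a = (\<Sum>m<d. c m * const (\<theta> ^ m))"
    and c': "\<And>m. c' m \<in> T s \<and> tau (c' m) = c' m" "b = (\<Sum>m<d'. c' m * const (\<theta> ^ m))"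
    unfolding AR_def by blast
  define e where "e m = (if m < d then c m else 0) + (if m < d' then c' m else 0)" for m
  have "a = (\<Sum>m<max d d'. (if m < d then c m else 0) * const (\<theta> ^ m))"
    unfolding c(2) by (intro sum.mono_neutral_cong_left) auto
  moreover have "b = (\<Sum>m<max d d'. (if m < d' then c' m else 0) * const (\<theta> ^ m))"
    unfolding c'(2) by (intro sum.mono_neutral_cong_left) auto
  ultimately have "a + b = (\<Sum>m<max d d'. e m * const (\<theta> ^ m))"
    unfolding e_def by (simp add: distrib_right sum.distrib)
  moreover have "e m \<in> T s \<and> tau (e m) = e m" for m using c(1) c'(1) by (auto simp: e_def T_add tau_add)
  ultimately show ?thesis unfolding AR_def by (intro CollectI exI[of _ e] exI[of _ "max d d'"]) auto
qed

lemma AR_fixed_mult: "c \<in> T s \<Longrightarrow> tau c = c \<Longrightarrow> a \<in> AR \<Longrightarrow> c * a \<in> AR"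
proof -
  assume c0: "c \<in> T s" "tau c = c" "a \<in> AR"
  then obtain e d where e: "\<And>m. e m \<in> T s \<and> tau (e m) = e m" "a = (\<Sum>m<d. e m * const (\<theta> ^ m))"
    unfolding AR_def by blast
  have "c * a = (\<Sum>m<d. (c * e m) * const (\<theta> ^ m))" unfolding e(2) by (simp add: sum_distrib_left mult.assoc)
  moreover have "c * e m \<in> T s \<and> tau (c * e m) = c * e m" for m using e(1) c0 by (simp add: T_mult tau_mult)
  ultimately show ?thesis unfolding AR_def by (intro CollectI exI[of _ "\<lambda>m. c * e m"] exI[of _ d]) auto
qed

lemma AR_theta_mult: "a \<in> AR \<Longrightarrow> const \<theta> * a \<in> AR"
proof -
  assume "a \<in> AR"
  then obtain e d where e: "\<And>m. e m \<in> T s \<and> tau (e m) = e m" "a = (\<Sum>m<d. e m * const (\<theta> ^ m))"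
    unfolding AR_def by blast
  define e' where "e' m = (if m = 0 then 0 else e (m - 1))" for m
  have "(\<Sum>m<Suc d. e' m * const (\<theta> ^ m)) = (\<Sum>m<d. e m * const (\<theta> ^ Suc m))"
    unfolding sum.lessThan_Suc_shift by (simp add: e'_def)
  also have "\<dots> = const \<theta> * a" unfolding e(2) by (simp add: sum_distrib_left const_mult mult_ac)
  finally have "const \<theta> * a = (\<Sum>m<Suc d. e' m * const (\<theta> ^ m))" by simp
  moreover have "e' m \<in> T s \<and> tau (e' m) = e' m" for m using e(1) by (simp add: e'_def)
  ultimately show ?thesis unfolding AR_def by (intro CollectI exI[of _ e'] exI[of _ "Suc d"]) auto
qed

lemma fixed_AR: "c \<in> T s \<Longrightarrow> tau c = c \<Longrightarrow> c \<in> AR"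
  unfolding AR_def by (intro CollectI exI[of _ "\<lambda>m. c"] exI[of _ 1]) auto

lemma AR_sum: "(\<And>i. i \<in> I \<Longrightarrow> a i \<in> AR) \<Longrightarrow> (\<Sum>i\<in>I. a i) \<in> AR"
  by (induction I rule: infinite_finite_induct) (auto intro: AR_add fixed_AR)

lemma AR_theta_power: "a \<in> AR \<Longrightarrow> const (\<theta> ^ m) * a \<in> AR"
proof (induction m)
  case (Suc m)
  then have "const \<theta> * (const (\<theta> ^ m) * a) \<in> AR" by (intro AR_theta_mult)
  then show ?case by (simp add: const_mult mult.assoc)
qed simp

lemma AR_mult: "a \<in> AR \<Longrightarrow> b \<in> AR \<Longrightarrow> a * b \<in> AR"
proof -
  assume a: "a \<in> AR" and b: "b \<in> AR"
  obtain e d where e: "\<And>m. e m \<in> T s \<and> tau (e m) = e m" "a = (\<Sum>m<d. e m * const (\<theta> ^ m))"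
    using a unfolding AR_def by blast
  have "a * b = (\<Sum>m<d. e m * (const (\<theta> ^ m) * b))" unfolding e(2) by (simp add: sum_distrib_right mult.assoc)
  moreover have "e m * (const (\<theta> ^ m) * b) \<in> AR" for m using e(1) by (intro AR_fixed_mult AR_theta_power b) auto
  ultimately show ?thesis using AR_sum[of "{..<d}" "\<lambda>m. e m * (const (\<theta> ^ m) * b)"] by simp
qed

lemma theta_AR: "const \<theta> \<in> AR"
  using AR_theta_mult[OF fixed_AR[OF T_1 tau_1]] by simp

text \<open>The ring is generated by theta and the Frobenius-fixed elements. This carries statements
  known at theta to the whole ring.\<close>

lemma AR_induct:
  assumes a: "a \<in> AR" and fx: "\<And>c. c \<in> T s \<Longrightarrow> tau c = c \<Longrightarrow> Q c" and th: "Q (const \<theta>)"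
    and ad: "\<And>x y. x \<in> AR \<Longrightarrow> y \<in> AR \<Longrightarrow> Q x \<Longrightarrow> Q y \<Longrightarrow> Q (x + y)"
    and mu: "\<And>x y. x \<in> AR \<Longrightarrow> y \<in> AR \<Longrightarrow> Q x \<Longrightarrow> Q y \<Longrightarrow> Q (x * y)"
  shows "Q a"
proof -
  obtain e d where e: "\<And>m. e m \<in> T s \<and> tau (e m) = e m" "a = (\<Sum>m<d. e m * const (\<theta> ^ m))"
    using a unfolding AR_def by blast
  have pA: "const (\<theta> ^ m) \<in> AR" for m using AR_theta_power[OF fixed_AR[OF T_1 tau_1], of m] by simp
  have pQ: "Q (const (\<theta> ^ m))" for m
  proof (induction m)
    case 0 show ?case using fx[OF T_1 tau_1] by simp
  next
    case (Suc m) then show ?case using mu[OF theta_AR pA th] by (simp add: const_mult)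
  qed
  have eA: "e m \<in> AR" for m using e(1) fixed_AR by blast
  have tQ: "Q (e m * const (\<theta> ^ m))" for m using mu[OF eA pA _ pQ] fx e(1) by blast
  have "Q (\<Sum>m<k. e m * const (\<theta> ^ m))" for k
  proof (induction k)
    case 0 show ?case using fx[of 0] by simp
  next
    case (Suc k)
    have "(\<Sum>m<k. e m * const (\<theta> ^ m)) \<in> AR" by (intro AR_sum AR_mult eA pA)
    then show ?case using ad[OF _ AR_mult[OF eA pA] Suc tQ] by simp
  qed
  then show ?thesis unfolding e(2) .
qed

lemma Aset_tate: "a \<in> Aset q s \<theta> \<Longrightarrow> a \<in> tate s av"
proof -
  assume a: "a \<in> Aset q s \<theta>"
  have "{\<nu>. \<epsilon> \<le> av (a \<nu>)} \<subseteq> {\<nu>. a \<nu> \<noteq> 0}" if "\<epsilon> > 0" for \<epsilon> using that by auto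
  then show ?thesis using a unfolding tate_def Aset_def by (auto intro: finite_subset)
qed

lemma Aset_cv: 
  assumes a: "a \<in> Aset q s \<theta>" shows "cv a \<in> AR"
proof -
  \<comment> \<open>The zero polynomial is chosen where the coefficient of a vanishes. Only finitely
    many chosen polynomials are then nonzero, which bounds their degrees and makes each c m finitely
    supported.\<close>
  have "\<exists>P. (\<forall>i. coeff P i \<in> Fq q) \<and> a \<nu> = poly P \<theta> \<and> (a \<nu> = 0 \<longrightarrow> P = 0)" for \<nu>
  proof (cases "a \<nu> = 0")
    case True then show ?thesis by (intro exI[of _ 0]) (simp add: Fq_def power_0_left)
  next
    case False
    have "a \<nu> \<in> Atheta q \<theta>" using a by (simp add: Aset_def)
    then show ?thesis using False unfolding Atheta_def by blast
  qed
  then obtain P where P: "\<And>\<nu> i. coeff (P \<nu>) i \<in> Fq q" "\<And>\<nu>. a \<nu> = poly (P \<nu>) \<theta>" "\<And>\<nu>. a \<nu> = 0 \<Longrightarrow> P \<nu> = 0" by metis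
  have fin: "finite {\<nu>. a \<nu> \<noteq> 0}" using a by (simp add: Aset_def)
  define c where "c m = (Mps (\<lambda>\<nu>. coeff (P (lookup \<nu>)) m) :: 'a mps)" for m
  define d where "d = Suc (Max (insert 0 ((\<lambda>\<nu>. degree (P \<nu>)) ` {\<nu>. a \<nu> \<noteq> 0})))"
  have deg: "degree (P \<nu>) < d" for \<nu>
  proof (cases "a \<nu> = 0")
    case True then show ?thesis using P(3) by (simp add: d_def)
  next
    case False then show ?thesis unfolding d_def using fin by (intro le_imp_less_Suc Max_ge) auto
  qed
  have "c m \<in> T s" for m
  proof -
    have "finite (lookup -` {\<nu>. a \<nu> \<noteq> 0})" using fin by (rule finite_vimageI) (auto simp: inj_def lookup_inject)
    moreover have "{\<nu>. cf (c m) \<nu> \<noteq> 0} \<subseteq> lookup -` {\<nu>. a \<nu> \<noteq> 0}" using P(3) by (auto simp: c_def)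
    ultimately have "cf (c m) \<in> C0" by (intro C0_finite_support) (rule finite_subset)
    moreover have "cf (c m) \<nu> = 0" if "\<not> valid_idx s (lookup \<nu>)" for \<nu>
      using a that P(3)[of "lookup \<nu>"] by (simp add: c_def Aset_def)
    ultimately show ?thesis by (simp add: T_def CC_def V_def)
  qed
  moreover have "tau (c m) = c m" for m using P(1) by (intro mps_eqI) (simp add: c_def Fq_def)
  moreover have "cv a = (\<Sum>m<d. c m * const (\<theta> ^ m))"
  proof (rule mps_eqI)
    fix \<nu>
    have "cf (\<Sum>m<d. c m * const (\<theta> ^ m)) \<nu> = (\<Sum>m<d. coeff (P (lookup \<nu>)) m * \<theta> ^ m)"
      by (simp add: cf_sum cf_mult_const c_def)
    also have "\<dots> = (\<Sum>m\<le>degree (P (lookup \<nu>)). coeff (P (lookup \<nu>)) m * \<theta> ^ m)"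
      using deg[of "lookup \<nu>"] by (intro sum.mono_neutral_right) (auto simp: coeff_eq_0)
    finally show "cf (cv a) \<nu> = cf (\<Sum>m<d. c m * const (\<theta> ^ m)) \<nu>" by (simp add: P(2) poly_altdef)
  qed
  ultimately show ?thesis unfolding AR_def by (intro CollectI exI[of _ c] exI[of _ d]) auto
qed

lemma vc_Aset: 
  assumes a: "a \<in> AR" shows "vc a \<in> Aset q s \<theta>"
proof -
  obtain e d where e: "\<And>m. e m \<in> T s \<and> tau (e m) = e m" "a = (\<Sum>m<d. e m * const (\<theta> ^ m))"
    using a unfolding AR_def by blast
  have fq: "cf (e m) \<nu> \<in> Fq q" for m \<nu>
    using e(1)[of m] cf_tau[of "e m" \<nu>] by (simp add: Fq_def)
  have cfa: "cf a \<nu> = (\<Sum>m<d. cf (e m) \<nu> * \<theta> ^ m)" for \<nu> unfolding e(2) by (simp add: cf_sum cf_mult_const)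
  have "finite (\<Union>m<d. {\<nu>. cf (e m) \<nu> \<noteq> 0})"
    using e(1) fq by (intro finite_UN_I Fq_finite_support) (auto simp: T_def CC_def)
  then have fin: "finite (lookup ` (\<Union>m<d. {\<nu>. cf (e m) \<nu> \<noteq> 0}))" by (rule finite_imageI)
  have "{\<nu>. vc a \<nu> \<noteq> 0} \<subseteq> lookup ` (\<Union>m<d. {\<nu>. cf (e m) \<nu> \<noteq> 0})"
  proof
    fix \<nu> assume "\<nu> \<in> {\<nu>. vc a \<nu> \<noteq> 0}"
    then have n: "finite {i. \<nu> i \<noteq> 0}" "cf a (Abs_poly_mapping \<nu>) \<noteq> 0" by (auto simp: vc_def split: if_splits)
    have "\<exists>m<d. cf (e m) (Abs_poly_mapping \<nu>) \<noteq> 0"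
    proof (rule ccontr)
      assume "\<not> ?thesis"
      then show False using n(2) unfolding cfa by simp
    qed
    then show "\<nu> \<in> lookup ` (\<Union>m<d. {\<nu>. cf (e m) \<nu> \<noteq> 0})" using n(1) by (intro image_eqI[of _ _ "Abs_poly_mapping \<nu>"]) auto
  qed
  moreover have "vc a \<nu> \<in> Atheta q \<theta>" for \<nu>
  proof -
    define x where "x m = (if finite {i. \<nu> i \<noteq> 0} then cf (e m) (Abs_poly_mapping \<nu>) else 0)" for m
    have xF: "x m \<in> Fq q" for m using fq by (simp add: x_def Fq_def power_0_left)
    have "vc a \<nu> = (\<Sum>m<d. x m * \<theta> ^ m)" by (simp add: vc_def x_def cfa)
    also have "\<dots> = poly (\<Sum>m<d. Polynomial.monom (x m) m) \<theta>" by (simp add: poly_sum poly_monom)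
    finally have eq: "vc a \<nu> = poly (\<Sum>m<d. Polynomial.monom (x m) m) \<theta>" .
    have "coeff (\<Sum>m<d. Polynomial.monom (x m) m) i \<in> Fq q" for i
    proof -
      have "coeff (\<Sum>m<d. Polynomial.monom (x m) m) i = (if i < d then x i else 0)"
        by (simp add: coeff_sum coeff_monom)
      then show ?thesis using xF by (simp add: Fq_def power_0_left)
    qed
    then show ?thesis using eq unfolding Atheta_def by blast
  qed
  ultimately show ?thesis using vc_tate[OF AR_T[OF a]] fin unfolding Aset_def tate_iff by (auto intro: finite_subset)
qed

end

section \<open>Biderivations and the de Rham map\<close>

lemma ex1_unique_eq: "P x \<Longrightarrow> P y \<Longrightarrow> \<exists>!c. P c \<Longrightarrow> x = y"
  by blast

locale drinfeld_module = cinf +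
  fixes s r :: nat and \<phi> :: "'a tel \<Rightarrow> 'a tser" and g :: "'a tel"
  assumes D: "drinfeld q s av \<theta> \<phi> r" and g: "g \<in> tate s av" "tmul (\<phi> (tconst \<theta>) r) g = tone"
    and theta_Aset': "tconst \<theta> \<in> Aset q s \<theta>"
begin

definition \<Phi> :: "'a tel \<Rightarrow> nat \<Rightarrow> 'a mps" where
  "\<Phi> a = cvs (\<phi> a)"

sublocale drinfeld_operator q \<theta> av s r "\<Phi> (tconst \<theta>)" "cv g"
proof
  have poly: "is_tpoly s av (\<phi> (tconst \<theta>))" using D theta_Aset' unfolding drinfeld_def by blast
  show "\<Phi> (tconst \<theta>) 0 = const \<theta>" using D by (simp add: drinfeld_def \<Phi>_def cvs_def)
  show "\<Phi> (tconst \<theta>) n \<in> T s" for n using poly cvs_T[of s] unfolding \<Phi>_def is_tpoly_def by blast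
  show "\<Phi> (tconst \<theta>) n = 0" if "n > r" for n using D that by (simp add: drinfeld_def \<Phi>_def cvs_def)
  show "r \<ge> 1" using D by (simp add: drinfeld_def)
  show "cv g \<in> T s" by (rule cv_T[OF g(1)])
  show "\<Phi> (tconst \<theta>) r * cv g = 1" using arg_cong[OF g(2), of cv] by (simp add: \<Phi>_def cvs_def cv_tmul)
qed

abbreviation "AS \<equiv> Aset q s \<theta>"

lemma AS_add: "a \<in> AS \<Longrightarrow> b \<in> AS \<Longrightarrow> tadd a b \<in> AS"
proof -
  assume ab: "a \<in> AS" "b \<in> AS"
  have "vc (cv (tadd a b)) \<in> AS" unfolding cv_tadd by (intro vc_Aset AR_add Aset_cv ab)
  then show ?thesis using vc_cv[of "tadd a b" s] tate_simple(4) Aset_tate ab by simp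
qed

lemma AS_mul: "a \<in> AS \<Longrightarrow> b \<in> AS \<Longrightarrow> tmul a b \<in> AS"
proof -
  assume ab: "a \<in> AS" "b \<in> AS"
  have "vc (cv (tmul a b)) \<in> AS" unfolding cv_tmul by (intro vc_Aset AR_mult Aset_cv ab)
  then show ?thesis using vc_cv[of "tmul a b" s] tate_tmul Aset_tate ab by simp
qed

lemma Fqt_AS: "c \<in> Fqt q s \<Longrightarrow> c \<in> AS"
proof -
  assume c: "c \<in> Fqt q s"
  have "vc (cv c) \<in> AS" using Fqt_cv[OF c] by (intro vc_Aset fixed_AR cv_T) auto
  then show ?thesis using vc_cv[of c s] Fqt_cv[OF c] by simp
qed

lemma tone_Fqt: "(tone :: 'a tel) \<in> Fqt q s"
proof -
  have "vc (cv (tone :: 'a tel)) \<in> Fqt q s" unfolding cv_tone by (rule vc_Fqt[OF T_1 tau_1])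
  then show ?thesis unfolding vc_cv[OF tate_simple(3)] .
qed

lemma AS_induct:
  assumes a: "a \<in> AS" and fx: "\<And>c. c \<in> Fqt q s \<Longrightarrow> Q c" and th: "Q (tconst \<theta>)"
    and ad: "\<And>x y. x \<in> AS \<Longrightarrow> y \<in> AS \<Longrightarrow> Q x \<Longrightarrow> Q y \<Longrightarrow> Q (tadd x y)"
    and mu: "\<And>x y. x \<in> AS \<Longrightarrow> y \<in> AS \<Longrightarrow> Q x \<Longrightarrow> Q y \<Longrightarrow> Q (tmul x y)"
  shows "Q a"
proof -
  have "Q (vc (cv a))"
  proof (rule AR_induct[OF Aset_cv[OF a], of "\<lambda>F. Q (vc F)"])
    show "Q (vc c)" if "c \<in> T s" "tau c = c" for c by (rule fx[OF vc_Fqt[OF that]])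
    show "Q (vc (const \<theta>))" using th vc_cv[OF tate_simple(2), of \<theta>] by simp
    fix x y assume xy: "x \<in> AR" "y \<in> AR" "Q (vc x)" "Q (vc y)"
    have t: "vc x \<in> tate s av" "vc y \<in> tate s av" using xy vc_Aset Aset_tate by auto
    have "tadd (vc x) (vc y) = vc (x + y)"
      by (rule tate_eqI[OF tate_simple(4)[OF t] vc_tate]) (use xy AR_T in \<open>auto simp: cv_tadd intro: T_add\<close>)
    then show "Q (vc (x + y))" using ad[OF vc_Aset[OF xy(1)] vc_Aset[OF xy(2)] xy(3,4)] by simp
    have "tmul (vc x) (vc y) = vc (x * y)"
      by (rule tate_eqI[OF tate_tmul[OF t] vc_tate]) (use xy AR_T in \<open>auto simp: cv_tmul intro: T_mult\<close>)
    then show "Q (vc (x * y))" using mu[OF vc_Aset[OF xy(1)] vc_Aset[OF xy(2)] xy(3,4)] by simp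
  qed
  then show ?thesis using vc_cv[OF Aset_tate[OF a]] by simp
qed

lemma phi_tser: "a \<in> AS \<Longrightarrow> is_tser s av (\<phi> a)" and Phi_tpoly: "a \<in> AS \<Longrightarrow> tpoly s (\<Phi> a)"
  using D cvs_tpoly unfolding drinfeld_def is_tpoly_def \<Phi>_def by blast+

lemma Phi_add: "a \<in> AS \<Longrightarrow> b \<in> AS \<Longrightarrow> \<Phi> (tadd a b) = \<Phi> a + \<Phi> b"
  and Phi_mul: "a \<in> AS \<Longrightarrow> b \<in> AS \<Longrightarrow> \<Phi> (tmul a b) = tm (\<Phi> a) (\<Phi> b)"
  and Phi_Fqt: "c \<in> Fqt q s \<Longrightarrow> \<Phi> c = sc (cv c)"
  using D by (auto simp: drinfeld_def \<Phi>_def cvs_sadd cvs_smul cvs_sconst)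

lemma sc_add: "sc (x + y) = sc x + sc y" and sc_mult: "tm (sc x) (sc y) = sc (x * y)"
  by (auto simp: fun_eq_iff tm_sc_left) (auto simp: sc_def)

lemma tm_sc_fixed: "tau c = c \<Longrightarrow> tm a (sc c) = tm (sc c) a"
  by (auto simp: fun_eq_iff tm_sc_left tm_sc_right taun_fixed mult.commute)

text \<open>Fixed constants commute with tau, theta is the defining equation of the exponential, and
  the relation is preserved by sums and products.\<close>

lemma E_commutes: "a \<in> AS \<Longrightarrow> tm E (sc (cv a)) = tm (\<Phi> a) E"
proof (erule AS_induct)
  show "tm E (sc (cv c)) = tm (\<Phi> c) E" if "c \<in> Fqt q s" for c
    using Fqt_cv[OF that] tm_sc_fixed by (simp add: Phi_Fqt[OF that])
  show "tm E (sc (cv (tconst \<theta>))) = tm (\<Phi> (tconst \<theta>)) E" using Ex_eq[of "\<Phi> (tconst \<theta>)", OF A0] by simp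
  fix x y assume xy: "x \<in> AS" "y \<in> AS" "tm E (sc (cv x)) = tm (\<Phi> x) E" "tm E (sc (cv y)) = tm (\<Phi> y) E"
  show "tm E (sc (cv (tadd x y))) = tm (\<Phi> (tadd x y)) E"
    by (simp add: cv_tadd sc_add tm_add_right tm_add_left Phi_add xy)
  have "tm E (sc (cv (tmul x y))) = tm (tm E (sc (cv x))) (sc (cv y))" by (simp add: cv_tmul sc_mult[symmetric] tm_assoc)
  also have "\<dots> = tm (\<Phi> x) (tm E (sc (cv y)))" unfolding xy(3) tm_assoc ..
  also have "\<dots> = tm (\<Phi> (tmul x y)) E" unfolding xy(4) by (simp add: Phi_mul xy tm_assoc)
  finally show "tm E (sc (cv (tmul x y))) = tm (\<Phi> (tmul x y)) E" .
qed

text \<open>Existence needs the functional equation for all a, whereas uniqueness already follows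
  from a = theta by the recursion for the coefficients.\<close>

lemma expo_eq: "expo q s av \<theta> \<phi> = svc E"
  unfolding expo_def
proof (rule the_equality)
  have tE: "is_tser s av (svc E)" by (intro tser_svc entire_T[OF entE])
  show "svc E 0 = tone \<and> is_tser s av (svc E) \<and> (\<forall>a\<in>AS. smul q (svc E) (sconst a) = smul q (\<phi> a) (svc E))"
  proof (intro conjI ballI)
    show "svc E 0 = tone" using vc_cv[OF tate_simple(3)] by (simp add: svc_def)
    fix a assume a: "a \<in> AS"
    show "smul q (svc E) (sconst a) = smul q (\<phi> a) (svc E)"
    proof (rule tser_eqI[of s])
      show "cvs (smul q (svc E) (sconst a)) = cvs (smul q (\<phi> a) (svc E))"
        using E_commutes[OF a] by (simp add: cvs_smul cvs_sconst \<Phi>_def)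
    qed (intro tser_smul tE tser_simple(4) phi_tser a Aset_tate)+
  qed (rule tE)
  fix e assume e: "e 0 = tone \<and> is_tser s av e \<and> (\<forall>a\<in>AS. smul q e (sconst a) = smul q (\<phi> a) e)"
  then have "smul q e (sconst (tconst \<theta>)) = smul q (\<phi> (tconst \<theta>)) e" using theta_Aset' by blast
  then have "tm (cvs e) (sc (const \<theta>)) = tm (\<Phi> (tconst \<theta>)) (cvs e)"
    using cvs_smul[of e "sconst (tconst \<theta>)"] cvs_smul[of "\<phi> (tconst \<theta>)" e] by (simp add: cvs_sconst \<Phi>_def)
  moreover have "cvs e 0 = 1" using e by (simp add: cvs_def)
  ultimately have "cvs e = E" by (intro Ex_unique[of "\<Phi> (tconst \<theta>)", OF A0])
  then show "e = svc E" using svc_cvs[of s e] e by simp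
qed

lemma Lam_eq: "x \<in> Lam q s av \<theta> \<phi> \<longleftrightarrow> x \<in> tate s av \<and> cv x \<in> Lamm"
proof -
  have "sapp q s av (svc E) x = vc (app E (cv x))" if "x \<in> tate s av"
    using sapp_eq[of s "svc E" x, OF tser_svc[OF entire_T[OF entE]] _ that] entE by simp
  moreover have "vc F = tzero \<longleftrightarrow> F = 0" for F :: "'a mps" by (metis cv_tzero cv_vc vc_0)
  ultimately show ?thesis unfolding Lam_def Lamm_def expo_eq mem_Collect_eq using cv_T[of x s] by metis
qed

text \<open>Elements of \<open>Der\<close> are normalised to 0 outside the coefficient ring, so that
  equality of functions is equality of biderivations; this wrapper restores the
  normalisation.\<close>

definition mk :: "('a tel \<Rightarrow> nat \<Rightarrow> 'a mps) \<Rightarrow> 'a tel \<Rightarrow> 'a tser" where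
  "mk d = (\<lambda>a. if a \<in> AS then svc (d a) else szero)"

text \<open>Linearity over F_q[t_1, ..., t_s] is encoded as vanishing on that ring. Given the
  product rule the two are equivalent, and vanishing is easier to check.\<close>

definition bider :: "('a tel \<Rightarrow> nat \<Rightarrow> 'a mps) \<Rightarrow> bool" where
  "bider d \<longleftrightarrow> (\<forall>a\<in>AS. tpoly s (d a) \<and> d a 0 = 0)
    \<and> (\<forall>a\<in>AS. \<forall>b\<in>AS. d (tadd a b) = d a + d b)
    \<and> (\<forall>c\<in>Fqt q s. d c = 0)
    \<and> (\<forall>a\<in>AS. \<forall>b\<in>AS. d (tmul a b) = tm (sc (cv a)) (d b) + tm (d a) (\<Phi> b))"

lemma biderD:
  assumes "bider d"
  shows "a \<in> AS \<Longrightarrow> tpoly s (d a)" "a \<in> AS \<Longrightarrow> d a 0 = 0" "a \<in> AS \<Longrightarrow> b \<in> AS \<Longrightarrow> d (tadd a b) = d a + d b"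
    "c \<in> Fqt q s \<Longrightarrow> d c = 0"
    "a \<in> AS \<Longrightarrow> b \<in> AS \<Longrightarrow> d (tmul a b) = tm (sc (cv a)) (d b) + tm (d a) (\<Phi> b)"
  using assms unfolding bider_def by blast+

lemma cvs_mk: "a \<in> AS \<Longrightarrow> cvs (mk d a) = d a"
  by (simp add: mk_def)

lemma mk_tser: "bider d \<Longrightarrow> a \<in> AS \<Longrightarrow> is_tser s av (mk d a)"
  by (simp add: mk_def tser_svc tpoly_T biderD(1))

lemma mk_Der:
  assumes d: "bider d" shows "mk d \<in> Der q s av \<theta> \<phi>"
  unfolding Der_def
proof (intro CollectI conjI ballI allI impI)
  show "mk d a = szero" if "a \<notin> AS" for a using that by (simp add: mk_def)
  show "is_tau_tpoly s av (mk d a)" if a: "a \<in> AS" for a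
    using svc_tpoly[OF biderD(1)[OF d a]] biderD(2)[OF d a] a
    by (simp add: is_tau_tpoly_def mk_def svc_def vc_0)
  note ts = mk_tser[OF d]
  show "mk d (tadd a b) = sadd (mk d a) (mk d b)" if ab: "a \<in> AS" "b \<in> AS" for a b
    by (rule tser_eqI[of s]) (use ab AS_add in \<open>auto simp: cvs_sadd cvs_mk biderD(3)[OF d] intro: ts tser_simple\<close>)
  show "mk d (tmul c a) = smul q (sconst c) (mk d a)" if c: "c \<in> Fqt q s" and a: "a \<in> AS" for c a
  proof (rule tser_eqI[of s])
    have c': "c \<in> AS" by (rule Fqt_AS[OF c])
    show "is_tser s av (mk d (tmul c a))" by (intro ts AS_mul c' a)
    show "is_tser s av (smul q (sconst c) (mk d a))" by (intro tser_smul tser_simple(4) Aset_tate c' ts a)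
    show "cvs (mk d (tmul c a)) = cvs (smul q (sconst c) (mk d a))"
      using biderD(5)[OF d c' a] biderD(4)[OF d c] by (simp add: cvs_mk AS_mul c' a cvs_smul cvs_sconst)
  qed
  show "mk d (tmul a b) = sadd (smul q (sconst a) (mk d b)) (smul q (mk d a) (\<phi> b))" if ab: "a \<in> AS" "b \<in> AS" for a b
  proof (rule tser_eqI[of s])
    show "is_tser s av (mk d (tmul a b))" by (intro ts AS_mul ab)
    show "is_tser s av (sadd (smul q (sconst a) (mk d b)) (smul q (mk d a) (\<phi> b)))"
      by (intro tser_simple(1) tser_smul tser_simple(4) Aset_tate ts phi_tser ab)
    show "cvs (mk d (tmul a b)) = cvs (sadd (smul q (sconst a) (mk d b)) (smul q (mk d a) (\<phi> b)))"
      by (simp add: cvs_mk AS_mul ab cvs_sadd cvs_smul cvs_sconst biderD(5)[OF d] \<Phi>_def plus_fun_def)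
  qed
qed

lemma Der_bider:
  assumes e: "\<eta> \<in> Der q s av \<theta> \<phi>"
  shows "bider (\<lambda>a. cvs (\<eta> a))"
proof -
  have h: "a \<in> AS \<Longrightarrow> is_tau_tpoly s av (\<eta> a)"
    "a \<in> AS \<Longrightarrow> b \<in> AS \<Longrightarrow> \<eta> (tadd a b) = sadd (\<eta> a) (\<eta> b)"
    "c \<in> Fqt q s \<Longrightarrow> a \<in> AS \<Longrightarrow> \<eta> (tmul c a) = smul q (sconst c) (\<eta> a)"
    "a \<in> AS \<Longrightarrow> b \<in> AS \<Longrightarrow> \<eta> (tmul a b) = sadd (smul q (sconst a) (\<eta> b)) (smul q (\<eta> a) (\<phi> b))" for a b c
    using e unfolding Der_def by blast+
  have prod: "cvs (\<eta> (tmul a b)) = tm (sc (cv a)) (cvs (\<eta> b)) + tm (cvs (\<eta> a)) (\<Phi> b)" if "a \<in> AS" "b \<in> AS" for a b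
    unfolding h(4)[OF that] cvs_sadd cvs_smul cvs_sconst \<Phi>_def ..
  have one: "tone \<in> AS" by (rule Fqt_AS[OF tone_Fqt])
  have t1: "tmul c tone = c" if "c \<in> AS" for c
    by (rule tate_eqI[OF tate_tmul[OF Aset_tate[OF that] tate_simple(3)] Aset_tate[OF that]]) (simp add: cv_tmul)
  have sc1: "tm (sc 1) a = a" "tm a (sc 1) = a" for a by (auto simp: fun_eq_iff tm_sc_left tm_sc_right)
  \<comment> \<open>The product rule at 1 * 1 says that the value at 1 is twice itself, so it is 0;
    linearity then gives 0 on all of F_q[t_1, ..., t_s].\<close>
  have "cvs (\<eta> tone) = cvs (\<eta> tone) + cvs (\<eta> tone)"
    using prod[OF one one] by (simp add: t1[OF one] Phi_Fqt[OF tone_Fqt] sc1)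
  then have e1: "cvs (\<eta> tone) = 0" by simp
  have "cvs (\<eta> c) = 0" if c: "c \<in> Fqt q s" for c
    using h(3)[OF c one] by (simp add: t1[OF Fqt_AS[OF c]] cvs_smul e1)
  moreover have "cvs (\<eta> a) 0 = 0" if "a \<in> AS" for a using h(1)[OF that] by (simp add: is_tau_tpoly_def cvs_def)
  moreover have "tpoly s (cvs (\<eta> a))" if "a \<in> AS" for a using h(1)[OF that] cvs_tpoly unfolding is_tau_tpoly_def by blast
  ultimately show "bider (\<lambda>a. cvs (\<eta> a))" unfolding bider_def using h(2) prod by (simp add: cvs_sadd)
qed

lemma bider_determined:
  assumes d: "bider d" "bider d'" and eq: "d (tconst \<theta>) = d' (tconst \<theta>)" and a: "a \<in> AS"
  shows "d a = d' a"
  using a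
proof (rule AS_induct)
  show "d c = d' c" if "c \<in> Fqt q s" for c using biderD(4)[OF d(1) that] biderD(4)[OF d(2) that] by simp
  show "d (tconst \<theta>) = d' (tconst \<theta>)" by (rule eq)
  fix x y assume xy: "x \<in> AS" "y \<in> AS" "d x = d' x" "d y = d' y"
  show "d (tadd x y) = d' (tadd x y)" using biderD(3)[OF d(1) xy(1,2)] biderD(3)[OF d(2) xy(1,2)] xy(3,4) by simp
  show "d (tmul x y) = d' (tmul x y)" using biderD(5)[OF d(1) xy(1,2)] biderD(5)[OF d(2) xy(1,2)] xy(3,4) by simp
qed

lemma bider_add: "bider d \<Longrightarrow> bider d' \<Longrightarrow> bider (\<lambda>a. d a + d' a)"
  unfolding bider_def by (auto simp: tpoly_add tm_add_left tm_add_right add_ac)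

lemma bider_diff: "bider d \<Longrightarrow> bider d' \<Longrightarrow> bider (\<lambda>a. d a - d' a)"
  unfolding bider_def by (auto simp: tpoly_diff tm_diff_left tm_diff_right algebra_simps)

lemma tpoly_sc_tm: "tpoly s m \<Longrightarrow> c \<in> T s \<Longrightarrow> tpoly s (tm (sc c) m)"
  by (intro tpoly_tm tpoly_sc)

lemma sc_commute: "tm (sc x) (tm (sc y) a) = tm (sc y) (tm (sc x) a)"
  by (auto simp: fun_eq_iff tm_sc_left mult_ac)

lemma bider_scale: 
  assumes d: "bider d" and c: "c \<in> T s" shows "bider (\<lambda>a. tm (sc c) (d a))"
proof -
  have "tm (sc c) (d a) 0 = 0" if "a \<in> AS" for a using biderD(2)[OF d that] by (simp add: tm_sc_left)
  then show ?thesis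
    unfolding bider_def using biderD[OF d] c
    by (auto simp: tpoly_sc_tm tm_add_right sc_commute[of c] tm_assoc)
qed

lemma bider_inner:
  assumes n: "tpoly s n" "n 0 = 0"
  shows "bider (\<lambda>a. tm n (\<Phi> a) - tm (sc (cv a)) n)"
proof -
  have 0: "(tm n (\<Phi> a) - tm (sc (cv a)) n) 0 = 0" for a using n(2) by (simp add: tm_def)
  have p: "tpoly s (tm n (\<Phi> a) - tm (sc (cv a)) n)" if "a \<in> AS" for a
    by (intro tpoly_diff tpoly_tm n Phi_tpoly tpoly_sc cv_T Aset_tate that)
  have c: "tm n (\<Phi> c) - tm (sc (cv c)) n = 0" if "c \<in> Fqt q s" for c
    using tm_sc_fixed[of "cv c" n] Fqt_cv[OF that] by (simp add: Phi_Fqt[OF that])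
  have m: "tm n (\<Phi> (tmul a b)) - tm (sc (cv (tmul a b))) n
      = tm (sc (cv a)) (tm n (\<Phi> b) - tm (sc (cv b)) n) + tm (tm n (\<Phi> a) - tm (sc (cv a)) n) (\<Phi> b)"
    if ab: "a \<in> AS" "b \<in> AS" for a b
    by (simp add: Phi_mul[OF ab] cv_tmul sc_mult[symmetric] tm_diff_left tm_diff_right tm_assoc)
  show ?thesis unfolding bider_def using 0 p c m
    by (auto simp: Phi_add cv_tadd sc_add tm_add_left tm_add_right)
qed

text \<open>Right division by the exponential; applied to the commutator of an operator with a scalar it
  produces the biderivation with prescribed value at theta.\<close>

function rdiv :: "(nat \<Rightarrow> 'a mps) \<Rightarrow> nat \<Rightarrow> 'a mps" where
  "rdiv G n = G n - (\<Sum>i\<in>{..<n}. rdiv G i * (tau ^^ i) (E (n - i)))"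
  by pat_completeness auto
termination by (relation "measure snd") auto

declare rdiv.simps [simp del]

lemma rdiv_eq: "tm (rdiv G) E = G"
proof
  fix n
  have "tm (rdiv G) E n = (\<Sum>i\<in>{..<n}. rdiv G i * (tau ^^ i) (E (n - i))) + rdiv G n"
    unfolding tm_def lessThan_Suc_atMost[symmetric] by simp
  then show "tm (rdiv G) E n = G n" using rdiv.simps[of G n] by simp
qed

text \<open>The biderivation is determined by d_a exp = F a - a F, where F is the quasi-periodic
  operator of m. The product rule is the Leibniz rule for commutators combined with exp b = phi_b
  exp, and identities may be checked after multiplication by exp.\<close>

lemma bider_exists:
  assumes m: "tpoly s m" "m 0 = 0"
  obtains d where "bider d" "d (tconst \<theta>) = m"
proof -
  define F where "F = qper_op m"
  have F: "tm F (sc (const \<theta>)) - tm (sc (const \<theta>)) F = tm m E"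
    using dvt_eq_iff[of "tm m E" F] m(2) unfolding F_def qper_op_def by (simp add: tm_def)
  have F0: "F 0 = 0" by (simp add: F_def qper_op_def)
  define d where "d a = rdiv (tm F (sc (cv a)) - tm (sc (cv a)) F)" for a
  have dE: "tm (d a) E = tm F (sc (cv a)) - tm (sc (cv a)) F" for a unfolding d_def by (rule rdiv_eq)
  have canc: "X = Y" if "tm X E = tm Y E" for X Y using tm_cancel_right[of E X Y] that by simp
  have th: "d (tconst \<theta>) = m" by (rule canc) (simp add: dE F)
  have ad: "d (tadd a b) = d a + d b" for a b
    by (rule canc) (simp add: dE cv_tadd sc_add tm_add_left tm_add_right)
  have fx: "d c = 0" if "c \<in> Fqt q s" for c
    by (rule canc) (use tm_sc_fixed[of "cv c" F] Fqt_cv[OF that] in \<open>simp add: dE\<close>)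
  have mu: "d (tmul a b) = tm (sc (cv a)) (d b) + tm (d a) (\<Phi> b)" if ab: "a \<in> AS" "b \<in> AS" for a b
  proof (rule canc)
    have "tm (tm (d a) (\<Phi> b)) E = tm (tm (d a) E) (sc (cv b))" by (simp add: tm_assoc E_commutes[OF ab(2)])
    then show "tm (d (tmul a b)) E = tm (tm (sc (cv a)) (d b) + tm (d a) (\<Phi> b)) E"
      by (simp add: tm_add_left dE tm_assoc[of "sc (cv a)" "d b"] cv_tmul sc_mult[symmetric] tm_diff_left tm_diff_right)
        (simp add: tm_assoc)
  qed
  \<comment> \<open>Division by the exponential yields only power series. That the values are
    polynomials is carried from theta to all a by sums and the product rule.\<close>
  have "tpoly s (d a) \<and> d a 0 = 0" if "a \<in> AS" for a
    using that
  proof (rule AS_induct)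
    show "tpoly s (d c) \<and> d c 0 = 0" if "c \<in> Fqt q s" for c by (simp add: fx[OF that] tpoly_def)
    show "tpoly s (d (tconst \<theta>)) \<and> d (tconst \<theta>) 0 = 0" using m th by simp
    fix x y assume xy: "x \<in> AS" "y \<in> AS" "tpoly s (d x) \<and> d x 0 = 0" "tpoly s (d y) \<and> d y 0 = 0"
    show "tpoly s (d (tadd x y)) \<and> d (tadd x y) 0 = 0" using xy(3,4) tpoly_add[of s "d x" "d y"] by (simp add: ad)
    have "tpoly s (d (tmul x y))"
      unfolding mu[OF xy(1,2)] using xy(3,4) by (intro tpoly_add tpoly_tm tpoly_sc cv_T Aset_tate Phi_tpoly xy(1,2)) auto
    moreover have "d (tmul x y) 0 = 0" unfolding mu[OF xy(1,2)] using xy(3,4) by (simp add: tm_def)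
    ultimately show "tpoly s (d (tmul x y)) \<and> d (tmul x y) 0 = 0" by blast
  qed
  then have "bider d" unfolding bider_def using ad fx mu by blast
  then show thesis using that th by blast
qed

section \<open>The de Rham map on biderivations\<close>

abbreviation "DER \<equiv> Der q s av \<theta> \<phi>"
abbreviation "LAM \<equiv> Lam q s av \<theta> \<phi>"
abbreviation "DRm \<equiv> DR q s av \<theta> \<phi>"

definition val :: "('a tel \<Rightarrow> 'a tser) \<Rightarrow> nat \<Rightarrow> 'a mps" where
  "val \<eta> = cvs (\<eta> (tconst \<theta>))"

lemma Der_tser: "\<eta> \<in> DER \<Longrightarrow> a \<in> AS \<Longrightarrow> is_tser s av (\<eta> a)"
  unfolding Der_def is_tau_tpoly_def is_tpoly_def by blast

lemma Der_outside: "\<eta> \<in> DER \<Longrightarrow> a \<notin> AS \<Longrightarrow> \<eta> a = szero"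
  unfolding Der_def by blast

lemma val: "\<eta> \<in> DER \<Longrightarrow> tpoly s (val \<eta>)" "\<eta> \<in> DER \<Longrightarrow> val \<eta> 0 = 0"
  using biderD(1,2)[OF Der_bider theta_Aset'] by (simp_all add: val_def)

lemma qper_eq:
  assumes e: "\<eta> \<in> DER" shows "qper q s av \<theta> \<phi> \<eta> = svc (qper_op (val \<eta>))"
proof -
  have z: "tm (val \<eta>) E 0 = 0" using val(2)[OF e] by (simp add: tm_def)
  have tF: "is_tser s av (svc (qper_op (val \<eta>)))" by (intro tser_svc entire_T[OF qper_op_entire[OF val(1)[OF e]]])
  have th: "is_tser s av (sconst (tconst \<theta>))" by (intro tser_simple(4) tate_simple(2))
  have te: "is_tser s av (\<eta> (tconst \<theta>))" by (rule Der_tser[OF e theta_Aset'])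
  have tE: "is_tser s av (svc E)" by (intro tser_svc entire_T[OF entE])
  have char: "F 0 = tzero \<and> is_tser s av F \<and> ssub (smul q F (sconst (tconst \<theta>))) (smul q (sconst (tconst \<theta>)) F)
       = smul q (\<eta> (tconst \<theta>)) (svc E) \<longleftrightarrow> is_tser s av F \<and> cvs F = qper_op (val \<eta>)" (is "?L \<longleftrightarrow> ?R") for F
  proof (cases "is_tser s av F")
    case True
    have "ssub (smul q F (sconst (tconst \<theta>))) (smul q (sconst (tconst \<theta>)) F) = smul q (\<eta> (tconst \<theta>)) (svc E)
      \<longleftrightarrow> tm (cvs F) (sc (const \<theta>)) - tm (sc (const \<theta>)) (cvs F) = tm (val \<eta>) E" (is "?a = ?b \<longleftrightarrow> ?c = ?d")
    proof -
      have "cvs ?a = ?c" "cvs ?b = ?d" by (simp_all add: cvs_ssub cvs_smul cvs_sconst val_def)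
      moreover have "is_tser s av ?a" "is_tser s av ?b" by (intro tser_simple(2) tser_smul True th te tE)+
      ultimately show ?thesis using tser_eqI[of s ?a ?b] by auto
    qed
    moreover have "F 0 = tzero \<longleftrightarrow> cvs F 0 = 0"
    proof
      assume "cvs F 0 = 0"
      then show "F 0 = tzero" using True tate_eqI[of "F 0" s tzero] tate_simple(1) by (simp add: is_tser_def cvs_def)
    qed (simp add: cvs_def)
    ultimately show ?thesis using True dvt_eq_iff[of "tm (val \<eta>) E" "cvs F", OF z] unfolding qper_op_def by blast
  qed blast
  show ?thesis
    unfolding qper_def expo_eq char
  proof (rule the_equality)
    show "is_tser s av (svc (qper_op (val \<eta>))) \<and> cvs (svc (qper_op (val \<eta>))) = qper_op (val \<eta>)" using tF by simp
    show "F = svc (qper_op (val \<eta>))" if "is_tser s av F \<and> cvs F = qper_op (val \<eta>)" for F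
      using svc_cvs[of s F] that by simp
  qed
qed

lemma DR_eq: 
  assumes e: "\<eta> \<in> DER"
  shows "DRm \<eta> x = (if x \<in> LAM then vc (app (qper_op (val \<eta>)) (cv x)) else tzero)"
  unfolding DR_def qper_eq[OF e]
  using sapp_eq[of s "svc (qper_op (val \<eta>))" x, OF tser_svc[OF entire_T[OF qper_op_entire[OF val(1)[OF e]]]]] qper_op_entire[OF val(1)[OF e]]
  by (simp add: Lam_eq)

lemma cv_DR: "\<eta> \<in> DER \<Longrightarrow> x \<in> LAM \<Longrightarrow> cv (DRm \<eta> x) = app (qper_op (val \<eta>)) (cv x)"
  by (simp add: DR_eq)

lemma app_val_T: "\<eta> \<in> DER \<Longrightarrow> x \<in> LAM \<Longrightarrow> app (qper_op (val \<eta>)) (cv x) \<in> T s"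
  by (intro app_T qper_op_entire val) (auto simp: Lam_eq cv_T)

lemma DR_tate: "\<eta> \<in> DER \<Longrightarrow> x \<in> LAM \<Longrightarrow> DRm \<eta> x \<in> tate s av"
  by (simp add: DR_eq vc_tate app_val_T)

lemma LAM_add: "x \<in> LAM \<Longrightarrow> y \<in> LAM \<Longrightarrow> tadd x y \<in> LAM"
  by (simp add: Lam_eq tate_simple cv_tadd Lamm_add)

lemma AR_Lamm: "a \<in> AR \<Longrightarrow> x \<in> Lamm \<Longrightarrow> a * x \<in> Lamm"
proof -
  assume "a \<in> AR" and x: "x \<in> Lamm"
  then obtain c d where c: "\<And>m. c m \<in> T s \<and> tau (c m) = c m" "a = (\<Sum>m<d. c m * const (\<theta> ^ m))" unfolding AR_def by blast
  have "a * x = (\<Sum>m<d. c m * (const (\<theta> ^ m) * x))" unfolding c(2) by (simp add: sum_distrib_right mult.assoc)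
  moreover have "c m * (const (\<theta> ^ m) * x) \<in> Lamm" for m using c(1) by (intro Lamm_fixed Lamm_theta_power x) auto
  ultimately show ?thesis using Lamm_sum[of "{..<d}" "\<lambda>m. c m * (const (\<theta> ^ m) * x)"] by simp
qed

lemma LAM_mul: "a \<in> AS \<Longrightarrow> x \<in> LAM \<Longrightarrow> tmul a x \<in> LAM"
  by (simp add: Lam_eq tate_tmul Aset_tate cv_tmul AR_Lamm Aset_cv)

lemma DR_HomL: 
  assumes e: "\<eta> \<in> DER" shows "DRm \<eta> \<in> HomL q s av \<theta> \<phi>"
  unfolding HomL_def
proof (intro CollectI conjI ballI allI impI)
  show "DRm \<eta> x = tzero" if "x \<notin> LAM" for x using that by (simp add: DR_eq[OF e])
  show "DRm \<eta> x \<in> tate s av" if "x \<in> LAM" for x by (rule DR_tate[OF e that])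
  note eF = qper_op_entire[OF val(1)[OF e]]
  show "DRm \<eta> (tadd x y) = tadd (DRm \<eta> x) (DRm \<eta> y)" if xy: "x \<in> LAM" "y \<in> LAM" for x y
  proof (rule tate_eqI[of _ s])
    show "cv (DRm \<eta> (tadd x y)) = cv (tadd (DRm \<eta> x) (DRm \<eta> y))"
      using xy app_add_arg[OF eF, of "cv x" "cv y"]
      by (simp add: cv_DR[OF e] LAM_add cv_tadd) (simp add: Lam_eq cv_T)
  qed (intro DR_tate e LAM_add tate_simple(4) xy)+
  show "DRm \<eta> (tmul a x) = tmul a (DRm \<eta> x)" if ax: "a \<in> AS" "x \<in> LAM" for a x
  proof (rule tate_eqI[of _ s])
    show "cv (DRm \<eta> (tmul a x)) = cv (tmul a (DRm \<eta> x))"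
      using ax app_qper_op_AR[OF val(1)[OF e] val(2)[OF e], of "cv x" "cv a"] Aset_cv[OF ax(1)]
      by (simp add: cv_DR[OF e] LAM_mul cv_tmul) (simp add: Lam_eq)
  qed (intro DR_tate e LAM_mul tate_tmul Aset_tate ax)+
qed

lemma badd_eq: "\<eta> \<in> DER \<Longrightarrow> \<eta>' \<in> DER \<Longrightarrow> badd \<eta> \<eta>' = mk (\<lambda>a. cvs (\<eta> a) + cvs (\<eta>' a))"
proof
  fix a assume e: "\<eta> \<in> DER" "\<eta>' \<in> DER"
  show "badd \<eta> \<eta>' a = mk (\<lambda>a. cvs (\<eta> a) + cvs (\<eta>' a)) a"
  proof (cases "a \<in> AS")
    case True
    have ts: "is_tser s av (sadd (\<eta> a) (\<eta>' a))" by (intro tser_simple(1) Der_tser e True)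
    show ?thesis using svc_cvs[OF ts] True by (simp add: badd_def mk_def cvs_sadd)
  next
    case False
    then show ?thesis using Der_outside[OF e(1) False] Der_outside[OF e(2) False]
      by (simp add: badd_def mk_def szero_def sadd_def tadd_def tzero_def)
  qed
qed

lemma bsub_eq: "\<eta> \<in> DER \<Longrightarrow> \<eta>' \<in> DER \<Longrightarrow> bsub \<eta> \<eta>' = mk (\<lambda>a. cvs (\<eta> a) - cvs (\<eta>' a))"
proof
  fix a assume e: "\<eta> \<in> DER" "\<eta>' \<in> DER"
  show "bsub \<eta> \<eta>' a = mk (\<lambda>a. cvs (\<eta> a) - cvs (\<eta>' a)) a"
  proof (cases "a \<in> AS")
    case True
    have ts: "is_tser s av (ssub (\<eta> a) (\<eta>' a))" by (intro tser_simple(2) Der_tser e True)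
    show ?thesis using svc_cvs[OF ts] True by (simp add: bsub_def mk_def cvs_ssub)
  next
    case False
    then show ?thesis using Der_outside[OF e(1) False] Der_outside[OF e(2) False]
      by (simp add: bsub_def mk_def szero_def ssub_def tsub_def tzero_def)
  qed
qed

lemma bsmul_eq: "f \<in> tate s av \<Longrightarrow> \<eta> \<in> DER \<Longrightarrow> bsmul f \<eta> = mk (\<lambda>a. tm (sc (cv f)) (cvs (\<eta> a)))"
proof
  fix a assume f: "f \<in> tate s av" and e: "\<eta> \<in> DER"
  have c: "cvs (bsmul f \<eta> a) = tm (sc (cv f)) (cvs (\<eta> a))"
    by (simp add: fun_eq_iff cvs_def bsmul_def cv_tmul tm_sc_left)
  show "bsmul f \<eta> a = mk (\<lambda>a. tm (sc (cv f)) (cvs (\<eta> a))) a"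
  proof (cases "a \<in> AS")
    case True
    have "is_tser s av (\<eta> a)" by (rule Der_tser[OF e True])
    then have ts: "is_tser s av (bsmul f \<eta> a)" unfolding is_tser_def bsmul_def by (auto intro: tate_tmul f)
    show ?thesis using svc_cvs[OF ts] True c by (simp add: mk_def)
  next
    case False
    have "bsmul f \<eta> a = szero" unfolding bsmul_def Der_outside[OF e False] by (simp add: szero_def tmul_def tzero_def)
    then show ?thesis using False by (simp add: mk_def)
  qed
qed

lemma badd_DER: "\<eta> \<in> DER \<Longrightarrow> \<eta>' \<in> DER \<Longrightarrow> badd \<eta> \<eta>' \<in> DER"
  using badd_eq mk_Der[OF bider_add[OF Der_bider Der_bider]] by simp

lemma bsmul_DER: "f \<in> tate s av \<Longrightarrow> \<eta> \<in> DER \<Longrightarrow> bsmul f \<eta> \<in> DER"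
  using bsmul_eq mk_Der[OF bider_scale[OF Der_bider cv_T]] by simp

lemma val_badd: "\<eta> \<in> DER \<Longrightarrow> \<eta>' \<in> DER \<Longrightarrow> val (badd \<eta> \<eta>') = val \<eta> + val \<eta>'"
  unfolding val_def badd_eq cvs_mk[OF theta_Aset'] ..

lemma val_bsmul: "f \<in> tate s av \<Longrightarrow> \<eta> \<in> DER \<Longrightarrow> val (bsmul f \<eta>) = (\<lambda>k. cv f * val \<eta> k)"
  unfolding val_def bsmul_eq cvs_mk[OF theta_Aset'] by (auto simp: tm_sc_left)

lemma DR_badd: 
  assumes e: "\<eta> \<in> DER" "\<eta>' \<in> DER" shows "DRm (badd \<eta> \<eta>') = homadd (DRm \<eta>) (DRm \<eta>')"
proof
  fix x
  show "DRm (badd \<eta> \<eta>') x = homadd (DRm \<eta>) (DRm \<eta>') x"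
  proof (cases "x \<in> LAM")
    case True
    show ?thesis unfolding homadd_def
    proof (rule tate_eqI[of _ s])
      show "cv (DRm (badd \<eta> \<eta>') x) = cv (tadd (DRm \<eta> x) (DRm \<eta>' x))"
        unfolding cv_tadd cv_DR[OF badd_DER[OF e] True] cv_DR[OF e(1) True] cv_DR[OF e(2) True] val_badd[OF e]
        using True by (intro app_qper_op_add val e) (simp add: Lam_eq cv_T)
    qed (intro DR_tate badd_DER e True tate_simple(4))+
  next
    case False
    then show ?thesis using e badd_DER[OF e] by (simp add: homadd_def DR_eq tadd_def tzero_def)
  qed
qed

lemma DR_bsmul: 
  assumes f: "f \<in> tate s av" and e: "\<eta> \<in> DER" shows "DRm (bsmul f \<eta>) = homsmul f (DRm \<eta>)"
proof
  fix x
  show "DRm (bsmul f \<eta>) x = homsmul f (DRm \<eta>) x"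
  proof (cases "x \<in> LAM")
    case True
    show ?thesis unfolding homsmul_def
    proof (rule tate_eqI[of _ s])
      show "cv (DRm (bsmul f \<eta>) x) = cv (tmul f (DRm \<eta> x))"
        unfolding cv_tmul cv_DR[OF bsmul_DER[OF f e] True] cv_DR[OF e True] val_bsmul[OF f e]
        using True by (intro app_qper_op_scale val e cv_T f) (simp add: Lam_eq)
    qed (intro DR_tate bsmul_DER e f True tate_tmul)+
  next
    case False
    then show ?thesis using e bsmul_DER[OF f e] by (simp add: homsmul_def DR_eq tmul_def tzero_def)
  qed
qed

end

locale free_drinfeld_module = drinfeld_module +
  fixes b :: "nat \<Rightarrow> 'a tel"
  assumes bL: "\<And>i. i < r \<Longrightarrow> b i \<in> LAM"
    and coord: "\<And>x. x \<in> LAM \<Longrightarrow> \<exists>!c :: nat \<Rightarrow> 'a tel. (\<forall>i<r. c i \<in> AS) \<and> (\<forall>i\<ge>r. c i = tzero) \<and>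
                    x = (\<lambda>\<nu>. \<Sum>i<r. tmul (c i) (b i) \<nu>)"
begin

text \<open>Independence is uniqueness of the coordinates of the zero period. Coordinates from r on
  are set to \<open>tzero\<close> to match the form in which uniqueness is given.\<close>

lemma basis: "is_basis (\<lambda>i. cv (b i))"
  unfolding is_basis_def
proof (intro conjI allI impI ballI)
  show "cv (b i) \<in> Lamm" if "i < r" for i using bL[OF that] by (simp add: Lam_eq)
  show "\<exists>c. (\<forall>i<r. c i \<in> AR) \<and> x = (\<Sum>i<r. c i * cv (b i))" if x: "x \<in> Lamm" for x
  proof -
    have "vc x \<in> LAM" using x by (simp add: Lam_eq vc_tate Lamm_T)
    then obtain c where c: "\<forall>i<r. c i \<in> AS" "vc x = (\<lambda>\<nu>. \<Sum>i<r. tmul (c i) (b i) \<nu>)" using coord by blast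
    have "x = (\<Sum>i<r. cv (c i) * cv (b i))" using arg_cong[OF c(2), of cv] by (simp add: cv_sum cv_tmul)
    then show ?thesis using c(1) Aset_cv by (intro exI[of _ "\<lambda>i. cv (c i)"]) auto
  qed
  fix c i assume c: "\<forall>i<r. c i \<in> AR" "(\<Sum>i<r. c i * cv (b i)) = 0" and i: "i < r"
  define c' where "c' i = (if i < r then vc (c i) else tzero)" for i
  let ?P = "\<lambda>c. (\<forall>i<r. c i \<in> AS) \<and> (\<forall>i\<ge>r. c i = tzero) \<and> tzero = (\<lambda>\<nu>. \<Sum>i<r. tmul (c i) (b i) \<nu>)"
  have zL: "tzero \<in> LAM" by (simp add: Lam_eq tate_simple Lamm_0)
  have c'A: "\<forall>i<r. c' i \<in> AS" using c(1) vc_Aset by (simp add: c'_def)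
  have bT: "b i \<in> tate s av" if "i < r" for i using bL[OF that] by (simp add: Lam_eq)
  have "tzero = (\<lambda>\<nu>. \<Sum>i<r. tmul (c' i) (b i) \<nu>)"
  proof (rule tate_eqI[of _ s])
    have "(\<Sum>i<r. cv (c' i) * cv (b i)) = (\<Sum>i<r. c i * cv (b i))" by (intro sum.cong) (auto simp: c'_def)
    then show "cv tzero = cv (\<lambda>\<nu>. \<Sum>i<r. tmul (c' i) (b i) \<nu>)" by (simp add: cv_sum cv_tmul c(2))
    show "(\<lambda>\<nu>. \<Sum>i<r. tmul (c' i) (b i) \<nu>) \<in> tate s av" using c'A bT Aset_tate by (intro tate_sum tate_tmul) auto
  qed (rule tate_simple(1))
  then have "?P c'" using c'A by (simp add: c'_def)
  moreover have zA: "tzero \<in> AS" using vc_Aset[OF fixed_AR[OF T_0 tau_0]] by (simp add: vc_0)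
  have "tmul tzero f = tzero" for f :: "'a tel" by (auto simp: tmul_def tzero_def)
  then have "?P (\<lambda>i. tzero)" using zA by (simp add: tzero_def[symmetric]) (simp add: tzero_def)
  moreover have "\<exists>!c. ?P c" by (rule coord[OF zL])
  ultimately have "c' = (\<lambda>i. tzero)" by - (rule ex1_unique_eq[of ?P])
  then have "vc (c i) = tzero" using i by (metis c'_def)
  then show "c i = 0" by (metis cv_tzero cv_vc)
qed

end

context free_drinfeld_module
begin

section \<open>Passage to de Rham classes\<close>

lemma Dsi_eq: "X \<in> Dsi q s av \<theta> \<phi> \<longleftrightarrow>
  (\<exists>n. tpoly s n \<and> n 0 = 0 \<and> X = mk (\<lambda>a. tm n (\<Phi> a) - tm (sc (cv a)) n))"
proof -
  have eq: "(\<lambda>a. if a \<in> AS then ssub (smul q m (\<phi> a)) (smul q (sconst a) m) else szero)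
      = mk (\<lambda>a. tm (cvs m) (\<Phi> a) - tm (sc (cv a)) (cvs m))" if m: "is_tau_tpoly s av m" for m
  proof
    fix a
    show "(if a \<in> AS then ssub (smul q m (\<phi> a)) (smul q (sconst a) m) else szero)
      = mk (\<lambda>a. tm (cvs m) (\<Phi> a) - tm (sc (cv a)) (cvs m)) a"
    proof (cases "a \<in> AS")
      case True
      have "is_tser s av m" using m unfolding is_tau_tpoly_def is_tpoly_def by blast
      then have ts: "is_tser s av (ssub (smul q m (\<phi> a)) (smul q (sconst a) m))"
        by (intro tser_simple(2) tser_smul tser_simple(4) Aset_tate phi_tser True)
      show ?thesis using svc_cvs[OF ts] True by (simp add: mk_def cvs_ssub cvs_smul cvs_sconst \<Phi>_def)
    qed (simp add: mk_def)
  qed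
  show ?thesis
  proof
    assume "X \<in> Dsi q s av \<theta> \<phi>"
    then obtain m where m: "is_tau_tpoly s av m"
      "X = (\<lambda>a. if a \<in> AS then ssub (smul q m (\<phi> a)) (smul q (sconst a) m) else szero)" unfolding Dsi_def by blast
    have "tpoly s (cvs m)" "cvs m 0 = 0" using m(1) cvs_tpoly[of s m] by (auto simp: is_tau_tpoly_def cvs_def)
    then show "\<exists>n. tpoly s n \<and> n 0 = 0 \<and> X = mk (\<lambda>a. tm n (\<Phi> a) - tm (sc (cv a)) n)"
      using m(2) eq[OF m(1)] by (intro exI[of _ "cvs m"]) simp
  next
    assume "\<exists>n. tpoly s n \<and> n 0 = 0 \<and> X = mk (\<lambda>a. tm n (\<Phi> a) - tm (sc (cv a)) n)"
    then obtain n where n: "tpoly s n" "n 0 = 0" "X = mk (\<lambda>a. tm n (\<Phi> a) - tm (sc (cv a)) n)" by blast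
    have t: "is_tau_tpoly s av (svc n)"
      using svc_tpoly[OF n(1)] n(2) by (simp add: is_tau_tpoly_def svc_def vc_0)
    show "X \<in> Dsi q s av \<theta> \<phi>"
      unfolding Dsi_def using eq[OF t] n(3) t by (intro CollectI exI[of _ "svc n"]) simp
  qed
qed

text \<open>One direction makes the map well defined on classes, the other makes it injective. Both
  pass through the values at theta, which determine biderivations. Being the kernel relation of a
  map, \<open>DRrel\<close> needs no separate proof that it is an equivalence.\<close>

lemma DRrel_iff:
  assumes e: "\<eta> \<in> DER" "\<eta>' \<in> DER"
  shows "(\<eta>, \<eta>') \<in> DRrel q s av \<theta> \<phi> \<longleftrightarrow> DRm \<eta> = DRm \<eta>'"
proof -
  have tp: "tpoly s (val \<eta> - val \<eta>')" "(val \<eta> - val \<eta>') 0 = 0"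
    using val[OF e(1)] val[OF e(2)] by (auto intro: tpoly_diff)
  have app_diff: "app (qper_op (val \<eta> - val \<eta>')) x = app (qper_op (val \<eta>)) x - app (qper_op (val \<eta>')) x" if "x \<in> T s" for x
    by (rule app_qper_op_diff[OF val(1)[OF e(1)] val(1)[OF e(2)] that])
  have in_n: "tm n (\<Phi> (tconst \<theta>)) - tm (sc (cv (tconst \<theta>))) n = inner n" for n by (simp add: inner_def)
  have "bsub \<eta> \<eta>' \<in> Dsi q s av \<theta> \<phi> \<longleftrightarrow> (\<exists>n. tpoly s n \<and> n 0 = 0 \<and> val \<eta> - val \<eta>' = inner n)"
  proof
    assume "bsub \<eta> \<eta>' \<in> Dsi q s av \<theta> \<phi>"
    then obtain n where n: "tpoly s n" "n 0 = 0" "bsub \<eta> \<eta>' = mk (\<lambda>a. tm n (\<Phi> a) - tm (sc (cv a)) n)"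
      unfolding Dsi_eq by blast
    have "cvs (bsub \<eta> \<eta>' (tconst \<theta>)) = val \<eta> - val \<eta>'"
      unfolding bsub_eq[OF e] cvs_mk[OF theta_Aset'] val_def ..
    moreover have "cvs (bsub \<eta> \<eta>' (tconst \<theta>)) = inner n" unfolding n(3) cvs_mk[OF theta_Aset'] in_n ..
    ultimately show "\<exists>n. tpoly s n \<and> n 0 = 0 \<and> val \<eta> - val \<eta>' = inner n" using n(1,2) by (intro exI[of _ n]) simp
  next
    assume "\<exists>n. tpoly s n \<and> n 0 = 0 \<and> val \<eta> - val \<eta>' = inner n"
    then obtain n where n: "tpoly s n" "n 0 = 0" "val \<eta> - val \<eta>' = inner n" by blast
    have th: "cvs (\<eta> (tconst \<theta>)) - cvs (\<eta>' (tconst \<theta>)) = tm n (\<Phi> (tconst \<theta>)) - tm (sc (cv (tconst \<theta>))) n"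
      unfolding in_n n(3)[symmetric] val_def ..
    have "cvs (\<eta> a) - cvs (\<eta>' a) = tm n (\<Phi> a) - tm (sc (cv a)) n" if "a \<in> AS" for a
      by (rule bider_determined[OF bider_diff[OF Der_bider[OF e(1)] Der_bider[OF e(2)]] bider_inner[OF n(1,2)] th that])
    then have "bsub \<eta> \<eta>' = mk (\<lambda>a. tm n (\<Phi> a) - tm (sc (cv a)) n)"
      unfolding bsub_eq[OF e] mk_def by (intro ext if_cong refl arg_cong[of _ _ svc] arg_cong2[of _ _ _ _ svc]) simp
    then show "bsub \<eta> \<eta>' \<in> Dsi q s av \<theta> \<phi>" unfolding Dsi_eq using n(1,2) by (intro exI[of _ n]) simp
  qed
  also have "\<dots> \<longleftrightarrow> DRm \<eta> = DRm \<eta>'"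
  proof
    assume "\<exists>n. tpoly s n \<and> n 0 = 0 \<and> val \<eta> - val \<eta>' = inner n"
    then obtain n where n: "tpoly s n" "n 0 = 0" "val \<eta> - val \<eta>' = inner n" by blast
    have "app (qper_op (val \<eta>)) (cv x) = app (qper_op (val \<eta>')) (cv x)" if "x \<in> LAM" for x
      using app_diff[of "cv x"] app_qper_op_inner[OF n(1,2), of "cv x"] that by (simp add: n(3) Lam_eq cv_T)
    then show "DRm \<eta> = DRm \<eta>'" by (intro ext) (simp add: DR_eq[OF e(1)] DR_eq[OF e(2)])
  next
    assume eq: "DRm \<eta> = DRm \<eta>'"
    have "app (qper_op (val \<eta> - val \<eta>')) (cv (b i)) = 0" if i: "i < r" for i
    proof -
      have "app (qper_op (val \<eta>)) (cv (b i)) = app (qper_op (val \<eta>')) (cv (b i))"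
        unfolding cv_DR[OF e(1) bL[OF i], symmetric] cv_DR[OF e(2) bL[OF i], symmetric] eq ..
      then show ?thesis using app_diff[of "cv (b i)"] bL[OF i] by (simp add: Lam_eq cv_T)
    qed
    from de_rham_injective[OF basis tp this] obtain n where "tpoly s n" "n 0 = 0" "val \<eta> - val \<eta>' = inner n" by blast
    then show "\<exists>n. tpoly s n \<and> n 0 = 0 \<and> val \<eta> - val \<eta>' = inner n" by (intro exI[of _ n] conjI)
  qed
  finally show ?thesis using e by (simp add: DRrel_def)
qed

lemma HomL_coord:
  assumes W: "\<Omega> \<in> HomL q s av \<theta> \<phi>" and c: "\<And>i. i < r \<Longrightarrow> c i \<in> AS" and k: "k \<le> r"
  shows "cv (\<Omega> (\<lambda>\<nu>. \<Sum>i<k. tmul (c i) (b i) \<nu>)) = (\<Sum>i<k. cv (c i) * cv (\<Omega> (b i)))"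
proof -
  have W': "x \<in> LAM \<Longrightarrow> y \<in> LAM \<Longrightarrow> \<Omega> (tadd x y) = tadd (\<Omega> x) (\<Omega> y)"
    "a \<in> AS \<Longrightarrow> x \<in> LAM \<Longrightarrow> \<Omega> (tmul a x) = tmul a (\<Omega> x)" for a x y
    using W unfolding HomL_def by blast+
  have z: "tzero \<in> LAM" by (simp add: Lam_eq tate_simple Lamm_0)
  have za: "tadd tzero tzero = (tzero :: 'a tel)" by (simp add: tadd_def tzero_def)
  \<comment> \<open>Additivity at 0 + 0 forces the value 0, which starts the induction over partial
    sums.\<close>
  have "cv (\<Omega> tzero) = cv (\<Omega> tzero) + cv (\<Omega> tzero)" using arg_cong[OF W'(1)[OF z z], of cv] by (simp add: za cv_tadd)
  then have z0: "cv (\<Omega> tzero) = 0" by simp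
  have "(\<lambda>\<nu>. \<Sum>i<k. tmul (c i) (b i) \<nu>) \<in> LAM \<and>
    cv (\<Omega> (\<lambda>\<nu>. \<Sum>i<k. tmul (c i) (b i) \<nu>)) = (\<Sum>i<k. cv (c i) * cv (\<Omega> (b i)))"
    using k
  proof (induction k)
    case 0
    then show ?case using z z0 by (simp add: tzero_def)
  next
    case (Suc k)
    let ?x = "\<lambda>\<nu>. \<Sum>i<k. tmul (c i) (b i) \<nu>"
    have IH: "?x \<in> LAM" "cv (\<Omega> ?x) = (\<Sum>i<k. cv (c i) * cv (\<Omega> (b i)))" using Suc by auto
    have kr: "k < r" using Suc.prems by simp
    have cb: "tmul (c k) (b k) \<in> LAM" by (rule LAM_mul[OF c[OF kr] bL[OF kr]])
    have eq: "(\<lambda>\<nu>. \<Sum>i<Suc k. tmul (c i) (b i) \<nu>) = tadd ?x (tmul (c k) (b k))" by (simp add: tadd_def)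
    show ?case
      unfolding eq W'(1)[OF IH(1) cb] W'(2)[OF c[OF kr] bL[OF kr]] cv_tadd cv_tmul IH(2)
      using LAM_add[OF IH(1) cb] by simp
  qed
  then show ?thesis by blast
qed

lemma HomL_eqI:
  assumes W: "\<Omega> \<in> HomL q s av \<theta> \<phi>" "\<Omega>' \<in> HomL q s av \<theta> \<phi>"
    and eq: "\<And>i. i < r \<Longrightarrow> cv (\<Omega> (b i)) = cv (\<Omega>' (b i))"
  shows "\<Omega> = \<Omega>'"
proof
  fix x
  show "\<Omega> x = \<Omega>' x"
  proof (cases "x \<in> LAM")
    case True
    then obtain c where c: "\<forall>i<r. c i \<in> AS" "x = (\<lambda>\<nu>. \<Sum>i<r. tmul (c i) (b i) \<nu>)" using coord by blast
    have "cv (\<Omega> x) = (\<Sum>i<r. cv (c i) * cv (\<Omega> (b i)))"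
      unfolding c(2) by (rule HomL_coord[OF W(1)]) (use c(1) in auto)
    also have "\<dots> = (\<Sum>i<r. cv (c i) * cv (\<Omega>' (b i)))" using eq by simp
    also have "\<dots> = cv (\<Omega>' x)"
      unfolding c(2) by (rule HomL_coord[OF W(2), symmetric]) (use c(1) in auto)
    finally have "cv (\<Omega> x) = cv (\<Omega>' x)" .
    moreover have "\<Omega> x \<in> tate s av" "\<Omega>' x \<in> tate s av" using W True unfolding HomL_def by blast+
    ultimately show ?thesis by (intro tate_eqI[of _ s])
  next
    case False
    then show ?thesis using W unfolding HomL_def by simp
  qed
qed

lemma DR_surj:
  assumes W: "\<Omega> \<in> HomL q s av \<theta> \<phi>" shows "\<exists>\<eta>\<in>DER. DRm \<eta> = \<Omega>"
proof -
  have hT: "cv (\<Omega> (b i)) \<in> T s" if "i < r" for i using W bL[OF that] unfolding HomL_def by (intro cv_T) blast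
  from de_rham_surjective[OF basis, of "\<lambda>i. cv (\<Omega> (b i))", OF hT] obtain m where
    m: "tpoly s m" "m 0 = 0" "\<And>i. i < r \<Longrightarrow> app (qper_op m) (cv (b i)) = cv (\<Omega> (b i))" by blast
  obtain d where d: "bider d" "d (tconst \<theta>) = m" using bider_exists[OF m(1,2)] by blast
  have e: "mk d \<in> DER" by (rule mk_Der[OF d(1)])
  have v: "val (mk d) = m" unfolding val_def cvs_mk[OF theta_Aset'] d(2) ..
  have "DRm (mk d) = \<Omega>"
    by (rule HomL_eqI[OF DR_HomL[OF e] W]) (simp add: cv_DR[OF e bL] v m(3))
  then show ?thesis using e by blast
qed

text \<open>The representative picked by \<open>SOME\<close> lies in the class because the class
  contains \<eta>, and all members have the same image.\<close>

lemma DRbar_class: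
  assumes e: "\<eta> \<in> DER" shows "DRbar q s av \<theta> \<phi> (DRrel q s av \<theta> \<phi> `` {\<eta>}) = DRm \<eta>"
proof -
  let ?x = "SOME \<eta>'. \<eta>' \<in> DRrel q s av \<theta> \<phi> `` {\<eta>}"
  have "\<eta> \<in> DRrel q s av \<theta> \<phi> `` {\<eta>}" using DRrel_iff[OF e e] by simp
  then have "?x \<in> DRrel q s av \<theta> \<phi> `` {\<eta>}" by (rule someI[of "\<lambda>x. x \<in> DRrel q s av \<theta> \<phi> `` {\<eta>}"])
  then have x: "(\<eta>, ?x) \<in> DRrel q s av \<theta> \<phi>" by simp
  then have "?x \<in> DER" unfolding DRrel_def by blast
  then have "DRm \<eta> = DRm ?x" using DRrel_iff[OF e] x by blast
  then show ?thesis unfolding DRbar_def by simp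
qed

lemma DRbar_bij: "bij_betw (DRbar q s av \<theta> \<phi>) (HDR q s av \<theta> \<phi>) (HomL q s av \<theta> \<phi>)"
proof -
  have cls: "\<exists>\<eta>\<in>DER. X = DRrel q s av \<theta> \<phi> `` {\<eta>}" if "X \<in> HDR q s av \<theta> \<phi>" for X
    using that unfolding HDR_def by (auto elim: quotientE)
  have mem: "DRrel q s av \<theta> \<phi> `` {\<eta>} \<in> HDR q s av \<theta> \<phi>" if "\<eta> \<in> DER" for \<eta>
    unfolding HDR_def by (rule quotientI[OF that])
  have "inj_on (DRbar q s av \<theta> \<phi>) (HDR q s av \<theta> \<phi>)"
  proof (rule inj_onI)
    fix X Y assume XY: "X \<in> HDR q s av \<theta> \<phi>" "Y \<in> HDR q s av \<theta> \<phi>" "DRbar q s av \<theta> \<phi> X = DRbar q s av \<theta> \<phi> Y"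
    obtain \<eta> where e: "\<eta> \<in> DER" "X = DRrel q s av \<theta> \<phi> `` {\<eta>}" using cls[OF XY(1)] by blast
    obtain \<eta>' where e': "\<eta>' \<in> DER" "Y = DRrel q s av \<theta> \<phi> `` {\<eta>'}" using cls[OF XY(2)] by blast
    have eq: "DRm \<eta> = DRm \<eta>'" using XY(3) unfolding e(2) e'(2) DRbar_class[OF e(1)] DRbar_class[OF e'(1)] .
    have "(\<eta>, x) \<in> DRrel q s av \<theta> \<phi> \<longleftrightarrow> (\<eta>', x) \<in> DRrel q s av \<theta> \<phi>" for x
    proof (cases "x \<in> DER")
      case True
      show ?thesis unfolding DRrel_iff[OF e(1) True] DRrel_iff[OF e'(1) True] eq ..
    qed (simp add: DRrel_def)
    then show "X = Y" unfolding e(2) e'(2) by blast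
  qed
  moreover have "DRbar q s av \<theta> \<phi> ` HDR q s av \<theta> \<phi> = HomL q s av \<theta> \<phi>"
  proof (intro equalityI subsetI)
    fix \<Omega> assume "\<Omega> \<in> DRbar q s av \<theta> \<phi> ` HDR q s av \<theta> \<phi>"
    then obtain X where X: "X \<in> HDR q s av \<theta> \<phi>" "\<Omega> = DRbar q s av \<theta> \<phi> X" by blast
    obtain \<eta> where e: "\<eta> \<in> DER" "X = DRrel q s av \<theta> \<phi> `` {\<eta>}" using cls[OF X(1)] by blast
    show "\<Omega> \<in> HomL q s av \<theta> \<phi>" unfolding X(2) e(2) DRbar_class[OF e(1)] by (rule DR_HomL[OF e(1)])
  next
    fix \<Omega> assume "\<Omega> \<in> HomL q s av \<theta> \<phi>"
    then obtain \<eta> where e: "\<eta> \<in> DER" "DRm \<eta> = \<Omega>" using DR_surj by blast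
    show "\<Omega> \<in> DRbar q s av \<theta> \<phi> ` HDR q s av \<theta> \<phi>"
      by (rule image_eqI[OF _ mem[OF e(1)]]) (simp add: DRbar_class[OF e(1)] e(2))
  qed
  ultimately show ?thesis unfolding bij_betw_def by blast
qed

end

theorem theorem5p8:
  fixes q s r :: nat and \<theta> :: "'a::field" and av :: "'a \<Rightarrow> real"
    and \<phi> :: "'a tel \<Rightarrow> 'a tser"
  assumes C: "Cinf_field q \<theta> av"
    and s: "s \<ge> 1"
    and D: "drinfeld q s av \<theta> \<phi> r"
    and unit: "\<exists>g\<in>tate s av. tmul (\<phi> (tconst \<theta>) r) g = tone"
    and free: "\<exists>b :: nat \<Rightarrow> 'a tel. (\<forall>i<r. b i \<in> Lam q s av \<theta> \<phi>) \<and>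
                 (\<forall>x\<in>Lam q s av \<theta> \<phi>. \<exists>!c :: nat \<Rightarrow> 'a tel.
                    (\<forall>i<r. c i \<in> Aset q s \<theta>) \<and> (\<forall>i\<ge>r. c i = tzero) \<and>
                    x = (\<lambda>\<nu>. \<Sum>i<r. tmul (c i) (b i) \<nu>))"
  shows "bij_betw (DRbar q s av \<theta> \<phi>) (HDR q s av \<theta> \<phi>) (HomL q s av \<theta> \<phi>) \<and>
    (\<forall>\<eta>\<in>Der q s av \<theta> \<phi>. \<forall>\<eta>'\<in>Der q s av \<theta> \<phi>.
       DRbar q s av \<theta> \<phi> (DRrel q s av \<theta> \<phi> `` {badd \<eta> \<eta>'})
         = homadd (DRbar q s av \<theta> \<phi> (DRrel q s av \<theta> \<phi> `` {\<eta>}))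
                  (DRbar q s av \<theta> \<phi> (DRrel q s av \<theta> \<phi> `` {\<eta>'}))) \<and>
    (\<forall>f\<in>tate s av. \<forall>\<eta>\<in>Der q s av \<theta> \<phi>.
       DRbar q s av \<theta> \<phi> (DRrel q s av \<theta> \<phi> `` {bsmul f \<eta>})
         = homsmul f (DRbar q s av \<theta> \<phi> (DRrel q s av \<theta> \<phi> `` {\<eta>})))"
proof -
  obtain g where g: "g \<in> tate s av" "tmul (\<phi> (tconst \<theta>) r) g = tone" using unit by blast
  obtain b where b: "\<forall>i<r. b i \<in> Lam q s av \<theta> \<phi>"
    "\<forall>x\<in>Lam q s av \<theta> \<phi>. \<exists>!c :: nat \<Rightarrow> 'a tel. (\<forall>i<r. c i \<in> Aset q s \<theta>) \<and> (\<forall>i\<ge>r. c i = tzero) \<and>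
       x = (\<lambda>\<nu>. \<Sum>i<r. tmul (c i) (b i) \<nu>)" using free by (elim exE conjE)
  interpret cinf q \<theta> av by unfold_locales (rule C)
  have q0: "q > 0" by (rule q_pos)
  have poly_A: "poly P \<theta> \<in> Atheta q \<theta>" if "\<And>i. coeff P i \<in> Fq q" for P
    unfolding Atheta_def using that by blast
  \<comment> \<open>The variable polynomial puts theta into A, and the zero polynomial covers the
    remaining coefficients of \<open>tconst \<theta>\<close>.\<close>
  have "poly [:0, 1:] \<theta> \<in> Atheta q \<theta>"
    by (rule poly_A) (use q0 in \<open>auto simp: coeff_pCons Fq_def split: nat.split\<close>)
  moreover have "poly 0 \<theta> \<in> Atheta q \<theta>" by (rule poly_A) (use q0 in \<open>simp add: Fq_def\<close>)
  ultimately have "tconst \<theta> \<in> Aset q s \<theta>" 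
    unfolding Aset_def tconst_def by (auto simp: valid_idx_def split: if_splits intro: finite_subset[of _ "{\<lambda>i. 0}"])
  then interpret free_drinfeld_module q \<theta> av s r \<phi> g b
  proof unfold_locales
    show "\<exists>!c :: nat \<Rightarrow> 'a tel. (\<forall>i<r. c i \<in> Aset q s \<theta>) \<and> (\<forall>i\<ge>r. c i = tzero) \<and>
       x = (\<lambda>\<nu>. \<Sum>i<r. tmul (c i) (b i) \<nu>)" if "x \<in> Lam q s av \<theta> \<phi>" for x
      using b(2) that by (rule bspec)
  qed (use D g b(1) in simp_all)
  \<comment> \<open>On the class of a biderivation the induced map is \<open>DR\<close> itself, so
    both linearity clauses reduce to those for biderivations.\<close>
  show ?thesis
    using DRbar_bij by (intro conjI ballI) (simp_all only: DRbar_class badd_DER bsmul_DER DR_badd DR_bsmul)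
qed

end
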